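(* Let $Z$ be a $\mathbb{Z}$-group and $\mathcal Z\succ Z$ as in the context. Let $Y\subseteq\mathcal Z^k$ be a $Z$-definable set and let $(X_{\bar y})_{\bar y\in Y}$ and $(X'_{\bar y})_{\bar y\in Y}$ be two $Z$-definable families of sets such that $X_{\bar b}$ and $X'_{\bar b}$ are bounded for every $\bar b\in Y$. Then the following are equivalent: (1) For every $\bar b\in Y\cap Z^k$, there exists a definable bijection $X_{\bar b}\to X'_{\bar b}$. (2) For every $\bar b\in Y\cap Z^k$, $\#X_{\bar b}=\#X'_{\bar b}$. (3) For every $\bar b\in Y$, there exists a definable bijection $X_{\bar b}\to X'_{\bar b}$. (4) For every $\bar b\in Y$, $\#X_{\bar b}=\#X'_{\bar b}$. (5) There exists a definable family of bijections $f_{\bar y}\colon X_{\bar y}\to X'_{\bar y}$, $\bar y\in Y$ (i.e., the set of $(\bar y,\bar x,\bar x')$ with $\bar y\in Y$ and $f_{\bar y}(\bar x)=\bar x'$ is definable).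
   Context: $L=(0,+,-,<)$ is the language of ordered abelian groups; a $\mathbb Z$-group is an elementary extension of $(\mathbb Z,0,+,-,<)$. $\mathcal Z\succ Z$ is $\kappa^+$-saturated for some $\kappa\ge|Z|$. "Definable" means $L$-definable in $\mathcal Z$ with parameters; "$Z$-definable" means with parameters from $Z$. A family $(X_{\bar y})_{\bar y\in Y}$ is $Z$-definable if $\{(\bar y,\bar x):\bar y\in Y,\bar x\in X_{\bar y}\}$ is $Z$-definable. A definable set is bounded if it is contained in $[-a,a)^n=\{x: -a\le x<a\}^n$ for some $a\in\mathcal Z$, $a\ge0$. For a commutative monoid $G$ with monoid homomorphism $s\colon(\mathbb N,+)\to G$, $\mathrm{Sym}\,G$ is the commutative semiring generated by symbols $[g]$ ($g\in G$) modulo $[g]+[g']=[g+g']$, $[0]=0$, $[s(1)]=1$. Let $\mathcal Q=\mathcal Z\otimes_{\mathbb Z}\mathbb Q$ with $s$ the inclusion of $\mathbb N$; $\mathcal Z$ and $\mathbb Q$ embed into $\mathrm{Sym}\,\mathcal Q$ (a ring), and polynomials with rational coefficients are evaluated at tuples from $\mathcal Z$ inside $\mathrm{Sym}\,\mathcal Q$. Hyper-cardinality: for a bounded definable $X\subseteq\mathcal Z^n$, write $X=\varphi(\mathcal Z,\bar b)$ with $\varphi$ an $L$-formula and $\bar b\in\mathcal Z^k$. There exist an $\emptyset$-definable $Y_0\subseteq\mathcal Z^k$ containing $\bar b$ and $f\in\mathbb Q[y_1,\dots,y_k]$ such that $\#(\varphi(\mathcal Z,\bar b')\cap\mathbb Z^n)=f(\bar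 b')$ for all $\bar b'\in Y_0\cap\mathbb Z^k$; the element $\#X:=f(\bar b)\in\mathrm{Sym}\,\mathcal Q$ does not depend on the choices, and is called the hyper-cardinality of $X$ (it is the usual cardinality when $X$ is finite). *)

theory Defs
  imports Complex_Main "HOL-Library.Poly_Mapping"
begin

unbundle cardinal_syntax

section \<open>First-order logic of ordered abelian groups\<close>

datatype tm = Var nat | Zero | Plus tm tm | Minus tm

datatype fm = Eq tm tm | Less tm tm | Neg fm | Conj fm fm | Exists nat fm

primrec tm_vars :: "tm \<Rightarrow> nat set" where
  "tm_vars (Var i) = {i}"
| "tm_vars Zero = {}"
| "tm_vars (Plus s t) = tm_vars s \<union> tm_vars t"
| "tm_vars (Minus t) = tm_vars t"

primrec fv :: "fm \<Rightarrow> nat set" where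
  "fv (Eq s t) = tm_vars s \<union> tm_vars t"
| "fv (Less s t) = tm_vars s \<union> tm_vars t"
| "fv (Neg p) = fv p"
| "fv (Conj p q) = fv p \<union> fv q"
| "fv (Exists i p) = fv p - {i}"

context linordered_ab_group_add
begin

primrec tm_val :: "(nat \<Rightarrow> 'a) \<Rightarrow> tm \<Rightarrow> 'a" where
  "tm_val v (Var i) = v i"
| "tm_val v Zero = 0"
| "tm_val v (Plus s t) = tm_val v s + tm_val v t"
| "tm_val v (Minus t) = - tm_val v t"

text \<open>\<open>sat A v p\<close>: the structure with universe \<open>A\<close> (and the operations and order inherited
  from the type) satisfies \<open>p\<close> under the assignment \<open>v\<close>.\<close>

primrec sat :: "'a set \<Rightarrow> (nat \<Rightarrow> 'a) \<Rightarrow> fm \<Rightarrow> bool" where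
  "sat A v (Eq s t) \<longleftrightarrow> tm_val v s = tm_val v t"
| "sat A v (Less s t) \<longleftrightarrow> tm_val v s < tm_val v t"
| "sat A v (Neg p) \<longleftrightarrow> \<not> sat A v p"
| "sat A v (Conj p q) \<longleftrightarrow> sat A v p \<and> sat A v q"
| "sat A v (Exists i p) \<longleftrightarrow> (\<exists>a\<in>A. sat A (v(i := a)) p)"

definition substructure :: "'a set \<Rightarrow> bool" where
  "substructure A \<longleftrightarrow> 0 \<in> A \<and> (\<forall>a\<in>A. \<forall>b\<in>A. a + b \<in> A) \<and> (\<forall>a\<in>A. - a \<in> A)"

end

definition elementary_embedding ::
    "'a::linordered_ab_group_add set \<Rightarrow> 'b::linordered_ab_group_add set \<Rightarrow> ('a \<Rightarrow> 'b) \<Rightarrow> bool" where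
  "elementary_embedding A B h \<longleftrightarrow>
     substructure A \<and> substructure B \<and> h ` A \<subseteq> B \<and>
     (\<forall>p v. range v \<subseteq> A \<longrightarrow> (sat A v p \<longleftrightarrow> sat B (h \<circ> v) p))"

text \<open>A type of this class is an elementary extension of the ordered group of integers; \<open>of_Z\<close>
  is the inclusion of the integers. The language contains no symbol for \<open>1\<close>.\<close>

class zgroup = linordered_ab_group_add +
  fixes of_Z :: "int \<Rightarrow> 'a"
  assumes sat_of_Z: "sat (UNIV :: int set) v p \<longleftrightarrow> sat UNIV (of_Z \<circ> v) p"

lemma elementary_of_Z:
  "elementary_embedding (UNIV :: int set) (UNIV :: 'a::zgroup set) of_Z"
  by (simp add: elementary_embedding_def substructure_def sat_of_Z)


section \<open>Definable sets\<close>

text \<open>Elements of \<open>\<Z>\<^sup>n\<close> for an ordered group \<open>\<Z>\<close> are lists of length \<open>n\<close>. In \<open>p(x, b)\<close> the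
  variables \<open>0, \<dots>, n - 1\<close> stand for \<open>x\<close> and \<open>n, n + 1, \<dots>\<close> for the parameters \<open>b\<close>;
  the default value \<open>0\<close> is irrelevant for formulas with free variables in range.\<close>

definition assignment :: "'a::zero list \<Rightarrow> nat \<Rightarrow> 'a" where
  "assignment xs i = (if i < length xs then xs ! i else 0)"

definition solutions :: "nat \<Rightarrow> fm \<Rightarrow> 'a::linordered_ab_group_add list \<Rightarrow> 'a list set" where
  "solutions n p b = {x. length x = n \<and> sat UNIV (assignment (x @ b)) p}"

definition definable_over ::
    "'a::linordered_ab_group_add set \<Rightarrow> nat \<Rightarrow> 'a list set \<Rightarrow> bool" where
  "definable_over A n X \<longleftrightarrow>
     (\<exists>p b. set b \<subseteq> A \<and> fv p \<subseteq> {..<n + length b} \<and> X = solutions n p b)"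

definition definable_family_over ::
    "'a::linordered_ab_group_add set \<Rightarrow> nat \<Rightarrow> nat \<Rightarrow> 'a list set \<Rightarrow> ('a list \<Rightarrow> 'a list set) \<Rightarrow> bool" where
  "definable_family_over A k n Y X \<longleftrightarrow>
     (\<forall>y\<in>Y. \<forall>x\<in>X y. length x = n) \<and>
     definable_over A (k + n) {y @ x | y x. y \<in> Y \<and> x \<in> X y}"

definition bounded_tuples :: "'a::linordered_ab_group_add list set \<Rightarrow> bool" where
  "bounded_tuples X \<longleftrightarrow> (\<exists>a\<ge>0. \<forall>x\<in>X. \<forall>c\<in>set x. - a \<le> c \<and> c < a)"

definition definable_bijection_exists ::
    "nat \<Rightarrow> nat \<Rightarrow> 'a::linordered_ab_group_add list set \<Rightarrow> 'a list set \<Rightarrow> bool" where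
  "definable_bijection_exists n n' X X' \<longleftrightarrow>
     (\<exists>f. bij_betw f X X' \<and> definable_over UNIV (n + n') {x @ f x | x. x \<in> X})"

definition definable_bijection_family_exists ::
    "nat \<Rightarrow> nat \<Rightarrow> nat \<Rightarrow> 'a::linordered_ab_group_add list set \<Rightarrow>
     ('a list \<Rightarrow> 'a list set) \<Rightarrow> ('a list \<Rightarrow> 'a list set) \<Rightarrow> bool" where
  "definable_bijection_family_exists k n n' Y X X' \<longleftrightarrow>
     (\<exists>f. (\<forall>y\<in>Y. bij_betw (f y) (X y) (X' y)) \<and>
          definable_over UNIV (k + n + n') {y @ x @ f y x | y x. y \<in> Y \<and> x \<in> X y})"

text \<open>\<open>r\<close>-saturation of the structure with universe \<open>'a\<close>, for a cardinal \<open>r\<close>: every finitely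
  satisfiable set \<open>q\<close> of formulas in \<open>n\<close> variables, over fewer than \<open>r\<close> parameters, is realized.
  A formula with parameters is a pair \<open>(p, c)\<close>.\<close>

definition saturated :: "'a::linordered_ab_group_add itself \<Rightarrow> 'k rel \<Rightarrow> bool" where
  "saturated _ r \<longleftrightarrow>
     (\<forall>(A :: 'a set) n (q :: (fm \<times> 'a list) set).
        |A| <o r \<longrightarrow>
        (\<forall>(p, c)\<in>q. set c \<subseteq> A \<and> fv p \<subseteq> {..<n + length c}) \<longrightarrow>
        (\<forall>q0\<subseteq>q. finite q0 \<longrightarrow> (\<exists>x. length x = n \<and> (\<forall>(p, c)\<in>q0. x \<in> solutions n p c))) \<longrightarrow>
        (\<exists>x. length x = n \<and> (\<forall>(p, c)\<in>q. x \<in> solutions n p c)))"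


section \<open>Polynomials in several variables\<close>

type_synonym ('v, 'c) mpoly = "('v \<Rightarrow>\<^sub>0 nat) \<Rightarrow>\<^sub>0 'c"

definition mpoly_vars :: "('v, 'c::zero) mpoly \<Rightarrow> 'v set" where
  "mpoly_vars f = (\<Union>m\<in>Poly_Mapping.keys f. Poly_Mapping.keys m)"

text \<open>\<open>mpoly_eval h v f\<close> evaluates \<open>f\<close> at \<open>v\<close>, the coefficients being mapped by \<open>h\<close>.\<close>

definition mpoly_eval ::
    "('c::zero \<Rightarrow> 'r::{comm_semiring_0, comm_monoid_mult}) \<Rightarrow> ('v \<Rightarrow> 'r) \<Rightarrow> ('v, 'c) mpoly \<Rightarrow> 'r" where
  "mpoly_eval h v f =
     (\<Sum>m\<in>Poly_Mapping.keys f. h (Poly_Mapping.lookup f m) *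
        (\<Prod>i\<in>Poly_Mapping.keys m. v i ^ Poly_Mapping.lookup m i))"


section \<open>The semiring \<open>Sym G\<close>\<close>

class nat_monoid = comm_monoid_add +
  fixes nat_hom :: "nat \<Rightarrow> 'a"
  assumes nat_hom_0: "nat_hom 0 = 0"
    and nat_hom_add: "nat_hom (m + n) = nat_hom m + nat_hom n"

text \<open>The free commutative semiring on symbols \<open>g\<close> is the semiring of polynomials with coefficients
  in \<open>nat\<close> and variables \<open>g\<close>; we divide it by the least congruence containing the relations.\<close>

definition symbol :: "'g \<Rightarrow> ('g, nat) mpoly" where
  "symbol g = Poly_Mapping.single (Poly_Mapping.single g 1) 1"

inductive sym_cong :: "('g::nat_monoid, nat) mpoly \<Rightarrow> ('g, nat) mpoly \<Rightarrow> bool" where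
  refl: "sym_cong a a"
| sym: "sym_cong a b \<Longrightarrow> sym_cong b a"
| trans: "sym_cong a b \<Longrightarrow> sym_cong b c \<Longrightarrow> sym_cong a c"
| add: "sym_cong a b \<Longrightarrow> sym_cong c d \<Longrightarrow> sym_cong (a + c) (b + d)"
| mult: "sym_cong a b \<Longrightarrow> sym_cong c d \<Longrightarrow> sym_cong (a * c) (b * d)"
| symbol_add: "sym_cong (symbol g + symbol h) (symbol (g + h))"
| symbol_0: "sym_cong (symbol 0) 0"
| symbol_1: "sym_cong (symbol (nat_hom 1)) 1"

quotient_type (overloaded) 'g Sym = "('g::nat_monoid, nat) mpoly" / sym_cong
  by (rule equivpI; rule reflpI sympI transpI; blast intro: sym_cong.intros)

instantiation Sym :: (nat_monoid) "{comm_semiring_0, comm_monoid_mult}"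
begin

lift_definition zero_Sym :: "'a Sym" is 0 .
lift_definition one_Sym :: "'a Sym" is 1 .
lift_definition plus_Sym :: "'a Sym \<Rightarrow> 'a Sym \<Rightarrow> 'a Sym" is "(+)" by (rule sym_cong.add)
lift_definition times_Sym :: "'a Sym \<Rightarrow> 'a Sym \<Rightarrow> 'a Sym" is "(*)" by (rule sym_cong.mult)

instance
  by standard (transfer; simp add: algebra_simps sym_cong.refl)+

end

lift_definition Sym_of :: "'g::nat_monoid \<Rightarrow> 'g Sym" is symbol .


section \<open>The group \<open>\<Z> \<otimes> \<rat>\<close>\<close>

text \<open>The tensor product over the integers, as the free abelian group on pairs \<open>(a, q)\<close>
  divided by the subgroup generated by the bilinearity relations.\<close>

definition tensor_symbol :: "'a \<Rightarrow> rat \<Rightarrow> ('a \<times> rat) \<Rightarrow>\<^sub>0 int" where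
  "tensor_symbol a q = Poly_Mapping.single (a, q) 1"

inductive_set tensor_relations :: "(('a::ab_group_add \<times> rat) \<Rightarrow>\<^sub>0 int) set" where
  zero: "0 \<in> tensor_relations"
| diff: "s \<in> tensor_relations \<Longrightarrow> t \<in> tensor_relations \<Longrightarrow> s - t \<in> tensor_relations"
| add_left: "tensor_symbol (a + b) q - tensor_symbol a q - tensor_symbol b q \<in> tensor_relations"
| add_right: "tensor_symbol a (q + r) - tensor_symbol a q - tensor_symbol a r \<in> tensor_relations"

lemma tensor_relations_uminus: "s \<in> tensor_relations \<Longrightarrow> - s \<in> tensor_relations"
  using tensor_relations.diff[OF tensor_relations.zero] by simp

lemma tensor_relations_add:
  "s \<in> tensor_relations \<Longrightarrow> t \<in> tensor_relations \<Longrightarrow> s + t \<in> tensor_relations"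
  using tensor_relations.diff[OF _ tensor_relations_uminus] by fastforce

definition tensor_cong :: "('a::ab_group_add \<times> rat \<Rightarrow>\<^sub>0 int) \<Rightarrow> ('a \<times> rat \<Rightarrow>\<^sub>0 int) \<Rightarrow> bool" where
  "tensor_cong s t \<longleftrightarrow> s - t \<in> tensor_relations"

lemma tensor_cong_trans: "tensor_cong r s \<Longrightarrow> tensor_cong s t \<Longrightarrow> tensor_cong r t"
  using tensor_relations_add[of "r - s" "s - t"] by (simp add: tensor_cong_def)

lemma tensor_cong_diff:
  "tensor_cong s s' \<Longrightarrow> tensor_cong t t' \<Longrightarrow> tensor_cong (s - t) (s' - t')"
  using tensor_relations.diff[of "s - s'" "t - t'"] by (simp add: tensor_cong_def algebra_simps)

quotient_type (overloaded) 'a tensor_rat = "('a::ab_group_add \<times> rat) \<Rightarrow>\<^sub>0 int" / tensor_cong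
proof (rule equivpI)
  show "reflp tensor_cong"
    by (simp add: reflp_def tensor_cong_def tensor_relations.zero)
  show "symp tensor_cong"
    unfolding symp_def tensor_cong_def by (metis minus_diff_eq tensor_relations_uminus)
  show "transp tensor_cong"
    by (blast intro: transpI tensor_cong_trans)
qed

instantiation tensor_rat :: (ab_group_add) ab_group_add
begin

lift_definition zero_tensor_rat :: "'a tensor_rat" is 0 .
lift_definition plus_tensor_rat :: "'a tensor_rat \<Rightarrow> 'a tensor_rat \<Rightarrow> 'a tensor_rat" is "(+)"
  by (simp add: tensor_cong_def add_diff_add tensor_relations_add)
lift_definition uminus_tensor_rat :: "'a tensor_rat \<Rightarrow> 'a tensor_rat" is uminus
  by (metis minus_diff_minus tensor_cong_def tensor_relations_uminus)
lift_definition minus_tensor_rat :: "'a tensor_rat \<Rightarrow> 'a tensor_rat \<Rightarrow> 'a tensor_rat" is "(-)"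
  by (rule tensor_cong_diff)

instance
  by standard (transfer; simp add: tensor_cong_def tensor_relations.zero algebra_simps)+

end

lift_definition tensor :: "'a::ab_group_add \<Rightarrow> rat \<Rightarrow> 'a tensor_rat" is tensor_symbol .

lemma tensor_add_left: "tensor (a + b) q = tensor a q + tensor b q"
  by transfer (simp add: tensor_cong_def tensor_relations.add_left flip: diff_diff_eq)

lemma of_Z_add: "of_Z (i + j) = (of_Z i + of_Z j :: 'a::zgroup)"
proof -
  define v where "v = (\<lambda>_::nat. j)(0 := i + j, 1 := i)"
  have "sat UNIV v (Eq (Var 0) (Plus (Var 1) (Var 2)))"
    by (simp add: v_def)
  then have "sat UNIV ((of_Z :: int \<Rightarrow> 'a) \<circ> v) (Eq (Var 0) (Plus (Var 1) (Var 2)))"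
    using elementary_of_Z[where 'a = 'a] unfolding elementary_embedding_def by blast
  then show ?thesis
    by (simp add: v_def)
qed

instantiation tensor_rat :: (zgroup) nat_monoid
begin

definition nat_hom_tensor_rat :: "nat \<Rightarrow> 'a tensor_rat" where
  "nat_hom_tensor_rat m = tensor (of_Z (int m)) 1"

instance
proof
  show add: "nat_hom (m + n) = (nat_hom m + nat_hom n :: 'a tensor_rat)" for m n
    by (simp add: nat_hom_tensor_rat_def of_Z_add tensor_add_left)
  show "nat_hom 0 = (0 :: 'a tensor_rat)"
    using add[of 0 0] by simp
qed

end


section \<open>Hyper-cardinality\<close>

definition Sym_rat :: "rat \<Rightarrow> 'a::zgroup tensor_rat Sym" where
  "Sym_rat q = Sym_of (tensor (of_Z 1) q)"

definition Sym_elem :: "'a::zgroup \<Rightarrow> 'a tensor_rat Sym" where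
  "Sym_elem a = Sym_of (tensor a 1)"

text \<open>\<open>n\<close> is the dimension of the ambient space of \<open>X\<close>. Polynomial variables are numbered
  from \<open>0\<close>. That the number of points equals \<open>f(c)\<close> includes that it is finite
  (\<open>card\<close> is \<open>0\<close> on infinite sets).\<close>

definition is_hypercard :: "nat \<Rightarrow> 'a::zgroup list set \<Rightarrow> 'a tensor_rat Sym \<Rightarrow> bool" where
  "is_hypercard n X u \<longleftrightarrow>
     (\<exists>p b Y0 (f :: (nat, rat) mpoly).
        fv p \<subseteq> {..<n + length b} \<and> X = solutions n p b \<and>
        definable_over {} (length b) Y0 \<and> b \<in> Y0 \<and>
        mpoly_vars f \<subseteq> {..<length b} \<and>
        (\<forall>c. length c = length b \<and> map of_Z c \<in> Y0 \<longrightarrow>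
           finite (solutions n p (map of_Z c) \<inter> {x. set x \<subseteq> range (of_Z :: int \<Rightarrow> 'a)}) \<and>
           of_nat (card (solutions n p (map of_Z c) \<inter> {x. set x \<subseteq> range (of_Z :: int \<Rightarrow> 'a)})) =
             mpoly_eval id (\<lambda>i. of_int (c ! i)) f) \<and>
        u = mpoly_eval Sym_rat (\<lambda>i. Sym_elem (b ! i)) f)"

definition hypercard :: "nat \<Rightarrow> 'a::zgroup list set \<Rightarrow> 'a tensor_rat Sym" where
  "hypercard n X = (THE u. is_hypercard n X u)"

end

(* A definable set splits definably into finitely many products of simplices
  {0 <= x_1 < ... < x_d < e}: by induction on the dimension, from quantifier elimination for Z-groups.
  Two bounded sets defined over the same parameters b have such decompositions with sides e from one
  linearly independent positive tuple, and the hyper-cardinality of either set is the corresponding sum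
  of products of binomial coefficients of the e's. Independence lets us map Sym to the rationals with
  the e's sent to arbitrary natural numbers; hence equal hyper-cardinalities force the same simplices to
  occur with the same multiplicities, and matching them gives a definable bijection. Equality over
  points of Z passes to all points, because a polynomial function that vanishes at the Z-points of a
  Z-definable set vanishes on it. By saturation finitely many definable bijections, each valid on
  a Z-definable set of parameters, cover Y, and they are glued to a family. *)

theory Submission
 imports Defs "HOL-Computational_Algebra.Polynomial"
begin

section \<open>A calculus of definable predicates\<close>

text \<open>A simplex can be cut along a sum of nonnegative lengths, as in Vandermonde's identity,
  but not along a difference. So the basis must be independent, for the comparison, and must also
  have every side in its cone of nonnegative integer combinations; a Euclidean algorithm achieves
  both. The element 1 is kept in the basis because a homomorphism from Sym takes the value 1 there;
  simplices of side 1 are points or empty and are dropped. A product of two simplices of equal side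
  is broken up according to how their coordinates interleave, so that each basis element occurs
  once. In the induction on dimension the sides over a coordinate s are floors of linear functions
  of s: compactness makes these functions uniform, and on progressions whose step clears the
  denominators they become linear. Zeros of polynomials are handled without knowing that Sym is a
  domain: nonzero integers are invertible in it, and the zeros used differ by nonzero integers.
  Quantifier elimination appears only as invariance of truth under equality of finitely many
  residues and signs.\<close>

lemma finite_tm_vars: "finite (tm_vars t)"
 by (induction t) auto

lemma finite_fv: "finite (fv p)"
 by (induction p) (auto simp: finite_tm_vars)

lemma tm_val_cong: "(\<And>i. i \<in> tm_vars t ==> v i = w i) ==> tm_val v t = tm_val w t"
 by (induction t) auto

lemma sat_cong: "(\<And>i. i \<in> fv p ==> v i = w i) ==> sat A v p = sat A w p"
proof (induction p arbitrary: v w)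
 case (Eq s t)
 then have "tm_val v s = tm_val w s" "tm_val v t = tm_val w t"
  by (auto intro: tm_val_cong)
 then show ?case by simp
next
 case (Less s t)
 then have "tm_val v s = tm_val w s" "tm_val v t = tm_val w t"
  by (auto intro: tm_val_cong)
 then show ?case by simp
next
 case (Conj p q)
 have "sat A v p = sat A w p"
  by (rule Conj.IH(1)) (simp add: Conj.prems)
 moreover have "sat A v q = sat A w q"
  by (rule Conj.IH(2)) (simp add: Conj.prems)
 ultimately show ?case by simp
next
 case (Exists i p)
 have "sat A (v(i := a)) p = sat A (w(i := a)) p" for a
  by (rule Exists.IH) (use Exists.prems in auto)
 then show ?case by simp
next
 case (Neg p)
 have "sat A v p = sat A w p"
  by (rule Neg.IH) (simp add: Neg.prems)
 then show ?case by simp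
qed

primrec tm_ren :: "(nat => nat) => tm => tm" where
 "tm_ren r (Var i) = Var (r i)"
| "tm_ren r Zero = Zero"
| "tm_ren r (Plus s t) = Plus (tm_ren r s) (tm_ren r t)"
| "tm_ren r (Minus t) = Minus (tm_ren r t)"

primrec fm_ren :: "(nat => nat) => fm => fm" where
 "fm_ren r (Eq s t) = Eq (tm_ren r s) (tm_ren r t)"
| "fm_ren r (Less s t) = Less (tm_ren r s) (tm_ren r t)"
| "fm_ren r (Neg p) = Neg (fm_ren r p)"
| "fm_ren r (Conj p q) = Conj (fm_ren r p) (fm_ren r q)"
| "fm_ren r (Exists i p) = Exists (r i) (fm_ren r p)"

lemma tm_val_ren: "tm_val v (tm_ren r t) = tm_val (v \<circ> r) t"
 by (induction t) auto

lemma sat_ren: "inj r ==> sat A v (fm_ren r p) = sat A (v \<circ> r) p"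
proof (induction p arbitrary: v)
 case (Exists i p)
 have "v(r i := a) \<circ> r = (v \<circ> r)(i := a)" for a
  using Exists.prems by (auto simp: fun_eq_iff inj_def)
 then have "sat A (v(r i := a)) (fm_ren r p) = sat A ((v \<circ> r)(i := a)) p" for a
  using Exists.IH[OF Exists.prems, of "v(r i := a)"] by metis
 then show ?case by (simp del: o_apply)
qed (auto simp: tm_val_ren)

text \<open>A formula may mention variables beyond the range that \<open>definable_over\<close>
  permits. \<open>assignment\<close> gives them the value 0, so binding each of them by a quantifier
  that forces it to be 0 changes nothing.\<close>

lemma zero_out:
 assumes "finite F"
 shows "\<exists>q. fv q \<subseteq> fv p - F \<and>
  (\<forall>v::nat => 'a::linordered_ab_group_add. (\<forall>i\<in>F. v i = 0) --> sat UNIV v q = sat UNIV v p)"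
 using assms
proof (induction F)
 case empty
 then show ?case by auto
next
 case (insert i F)
 then obtain q where q: "fv q \<subseteq> fv p - F"
  "\<And>v::nat => 'a. (\<forall>i\<in>F. v i = 0) ==> sat UNIV v q = sat UNIV v p"
  by blast
 have "sat UNIV v (Exists i (Conj (Eq (Var i) Zero) q)) = sat UNIV v p"
  if "\<forall>j\<in>insert i F. v j = 0" for v :: "nat => 'a"
 proof -
  have "v(i := 0) = v" using that by auto
  then show ?thesis using q(2)[of v] that by auto
 qed
 moreover have "fv (Exists i (Conj (Eq (Var i) Zero) q)) \<subseteq> fv p - insert i F"
  using q(1) by auto
 ultimately show ?case by blast
qed

text \<open>Parameters come first here, unlike in \<open>solutions\<close>: the variables then form
  an infinite tail, and predicates in different numbers of variables can be combined without
  bookkeeping.\<close>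

definition pval :: "'a list => (nat => 'a) => nat => 'a" where
 "pval b v i = (if i < length b then b ! i else v (i - length b))"

text \<open>Definability of a HOL predicate on assignments. The closure rules below follow the shape
  of the HOL formula, so that definability is proved by \<open>intro\<close> and formulas need not
  be written down.\<close>

definition Def :: "'a::linordered_ab_group_add set => ((nat => 'a) => bool) => bool" where
 "Def A P \<longleftrightarrow> (\<exists>p b. set b \<subseteq> A \<and> (\<forall>v. P v \<longleftrightarrow> sat UNIV (pval b v) p))"

lemma Def_cong: "(\<And>v. P v = Q v) ==> Def A P = Def A Q"
 unfolding Def_def by simp

lemma Def_sat: "Def A (\<lambda>v. sat UNIV v p)"
proof -
 have "pval [] v = v" for v :: "nat => 'a"
  by (auto simp: pval_def)
 then show ?thesis unfolding Def_def by (intro exI[of _ p] exI[of _ "[]"]) simp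
qed

lemma Def_not: "Def A P ==> Def A (\<lambda>v. \<not> P v)"
proof -
 assume "Def A P"
 then obtain p b where p: "set b \<subseteq> A" "\<And>v. P v \<longleftrightarrow> sat UNIV (pval b v) p"
  unfolding Def_def by blast
 then have "(\<not> P v) = sat UNIV (pval b v) (Neg p)" for v
  by simp
 then show ?thesis unfolding Def_def using p(1) by blast
qed

lemma Def_conj:
 assumes "Def A P" "Def A Q"
 shows "Def A (\<lambda>v. P v \<and> Q v)"
proof -
 obtain p b where p: "set b \<subseteq> A" "\<And>v. P v \<longleftrightarrow> sat UNIV (pval b v) p"
  using assms(1) unfolding Def_def by blast
 obtain q c where q: "set c \<subseteq> A" "\<And>v. Q v \<longleftrightarrow> sat UNIV (pval c v) q"
  using assms(2) unfolding Def_def by blast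
 \<comment> \<open>Both formulas are renamed to read the joint list \<open>b @ c\<close>:
   \<open>r\<close> lets the variables jump over \<open>c\<close>, and \<open>s\<close> jumps over
   \<open>b\<close>.\<close>
 define r where "r = (\<lambda>i. if i < length b then i else i + length c)"
 define s where "s = (\<lambda>i. i + length b)"
 have inj: "inj r" "inj s" by (auto simp: r_def s_def inj_def)
 have "pval (b @ c) v \<circ> r = pval b v" for v
  by (auto simp: fun_eq_iff pval_def r_def nth_append)
 moreover have "pval (b @ c) v \<circ> s = pval c v" for v
  by (auto simp: fun_eq_iff pval_def s_def nth_append)
 ultimately have "(P v \<and> Q v) = sat UNIV (pval (b @ c) v) (Conj (fm_ren r p) (fm_ren s q))" for v
  by (simp add: sat_ren inj p q)
 moreover have "set (b @ c) \<subseteq> A" using p q by auto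
 ultimately show ?thesis unfolding Def_def by blast
qed

text \<open>The quantified element sits at index 0 of the enlarged assignment, in the manner of de
  Bruijn. In the formula it is moved to an index \<open>j\<close> above all free variables, where
  updating the assignment disturbs nothing else.\<close>

lemma Def_ex:
 assumes "Def A (\<lambda>w. Q (\<lambda>i. w (Suc i)) (w 0))"
 shows "Def A (\<lambda>v. \<exists>a. Q v a)"
proof -
 obtain p b where p: "set b \<subseteq> A" "\<And>w. Q (\<lambda>i. w (Suc i)) (w 0) \<longleftrightarrow> sat UNIV (pval b w) p"
  using assms unfolding Def_def by blast
 define m where "m = length b"
 obtain j where j: "\<forall>i\<in>fv p. i < j" "m < j"
 proof -
  have "finite (insert m (fv p))" using finite_fv by simp
  then obtain j where "\<forall>i\<in>insert m (fv p). i < j"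
   using finite_nat_set_iff_bounded by blast
  then show ?thesis using that by auto
 qed
 \<comment> \<open>A cyclic permutation of \<open>m, ..., j\<close>. It has to be injective on all
   of \<open>nat\<close>, because \<open>sat_ren\<close> renames bound variables as well.\<close>
 define r where "r = (\<lambda>i. if i < m then i else if i = m then j else if i \<le> j then i - 1 else i)"
 have inj: "inj r" using j(2) by (auto simp: r_def inj_def)
 have *: "Q v a \<longleftrightarrow> sat UNIV ((pval b v)(j := a)) (fm_ren r p)" for v a
 proof -
  have "Q v a \<longleftrightarrow> sat UNIV (pval b (case_nat a v)) p"
   using p(2)[of "case_nat a v"] by simp
  also have "\<dots> \<longleftrightarrow> sat UNIV (((pval b v)(j := a)) \<circ> r) p"
  proof (rule sat_cong)
   fix i assume "i \<in> fv p"
   then have "i < j" using j by auto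
   then show "pval b (case_nat a v) i = (((pval b v)(j := a)) \<circ> r) i"
    using j(2) by (auto simp: pval_def r_def m_def[symmetric] split: nat.split)
     (auto intro!: arg_cong[where f = v])
  qed
  finally show ?thesis using sat_ren[OF inj] by blast
 qed
 have "(\<exists>a. Q v a) \<longleftrightarrow> sat UNIV (pval b v) (Exists j (fm_ren r p))" for v
  unfolding * by simp
 then show ?thesis unfolding Def_def using p(1) by blast
qed

lemma Def_disj: "Def A P ==> Def A Q ==> Def A (\<lambda>v. P v \<or> Q v)"
proof -
 assume "Def A P" "Def A Q"
 then have "Def A (\<lambda>v. \<not> (\<not> P v \<and> \<not> Q v))" by (intro Def_not Def_conj)
 then show ?thesis by (rule Def_cong[THEN iffD1, rotated]) auto
qed

lemma Def_imp: "Def A P ==> Def A Q ==> Def A (\<lambda>v. P v --> Q v)"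
proof -
 assume "Def A P" "Def A Q"
 then have "Def A (\<lambda>v. \<not> P v \<or> Q v)" by (intro Def_not Def_disj)
 then show ?thesis by (rule Def_cong[THEN iffD1, rotated]) auto
qed

lemma Def_iff: "Def A P ==> Def A Q ==> Def A (\<lambda>v. P v \<longleftrightarrow> Q v)"
proof -
 assume "Def A P" "Def A Q"
 then have "Def A (\<lambda>v. (P v --> Q v) \<and> (Q v --> P v))" by (intro Def_imp Def_conj)
 then show ?thesis by (rule Def_cong[THEN iffD1, rotated]) auto
qed

lemma Def_all:
 assumes "Def A (\<lambda>w. Q (\<lambda>i. w (Suc i)) (w 0))"
 shows "Def A (\<lambda>v. \<forall>a. Q v a)"
proof -
 have "Def A (\<lambda>v. \<not> (\<exists>a. \<not> Q v a))"
  by (intro Def_not Def_ex assms)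
 then show ?thesis by simp
qed

lemma Def_const: "Def A (\<lambda>v. c)"
proof -
 have "Def A (\<lambda>v. sat UNIV v (if c then Eq Zero Zero else Neg (Eq Zero Zero)))"
  by (rule Def_sat)
 then show ?thesis by (cases c) simp_all
qed

lemma Def_Ball:
 assumes "finite I" "\<And>i. i \<in> I ==> Def A (P i)"
 shows "Def A (\<lambda>v. \<forall>i\<in>I. P i v)"
 using assms
proof (induction I)
 case (insert i I)
 have "Def A (\<lambda>v. P i v \<and> (\<forall>i\<in>I. P i v))"
  by (intro Def_conj insert.prems insert.IH) auto
 then show ?case by simp
qed (simp add: Def_const)

lemma Def_Bex:
 assumes "finite I" "\<And>i. i \<in> I ==> Def A (P i)"
 shows "Def A (\<lambda>v. \<exists>i\<in>I. P i v)"
proof -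
 have "Def A (\<lambda>v. \<not> (\<forall>i\<in>I. \<not> P i v))"
  by (intro Def_not Def_Ball assms)
 then show ?thesis by simp
qed

lemma Def_all_less:
 assumes "\<And>i. i < (m::nat) ==> Def A (P i)"
 shows "Def A (\<lambda>v. \<forall>i<m. P i v)"
 using Def_Ball[of "{..<m}" A P] assms by (simp add: Ball_def)

lemma Def_exl:
 assumes "Def A (\<lambda>w. Q (\<lambda>i. w (i + n)) (map w [0..<n]))"
 shows "Def A (\<lambda>v. \<exists>x. length x = n \<and> Q v x)"
 using assms
proof (induction n arbitrary: Q)
 case 0
 then show ?case by simp
next
 case (Suc n)
 have *: "(\<exists>x. length x = Suc n \<and> Q v x) \<longleftrightarrow> (\<exists>x. length x = n \<and> (\<exists>a. Q v (a # x)))" for v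
  by (metis length_Cons length_Suc_conv)
 have m: "map w [0..<Suc n] = w 0 # map (\<lambda>i. w (Suc i)) [0..<n]" for w :: "nat => 'a"
  by (simp del: upt_Suc add: upt_conv_Cons map_Suc_upt[symmetric])
 have "Def A (\<lambda>v. \<exists>x. length x = n \<and> (\<exists>a. Q v (a # x)))"
  by (rule Suc.IH, rule Def_ex) (use Suc.prems in "simp del: upt_Suc add: m")
 then show ?case by (simp add: *)
qed

lemma Def_alll:
 assumes "Def A (\<lambda>w. Q (\<lambda>i. w (i + n)) (map w [0..<n]))"
 shows "Def A (\<lambda>v. \<forall>x. length x = n --> Q v x)"
proof -
 have "Def A (\<lambda>v. \<not> (\<exists>x. length x = n \<and> \<not> Q v x))"
  by (intro Def_not Def_exl assms)
 then show ?thesis by simp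
qed

text \<open>A formula has finitely many variables. This lets the substitution lemmas work with a
  finite tuple although infinitely many values are substituted.\<close>

lemma Def_local:
 assumes "Def A P"
 obtains m where "\<And>v w. (\<And>i. i < m ==> v i = w i) ==> P v = P w"
proof -
 obtain p b where p: "\<And>v. P v \<longleftrightarrow> sat UNIV (pval b v) p"
  using assms unfolding Def_def by blast
 obtain m where m: "\<forall>i\<in>fv p. i < m"
  using finite_fv finite_nat_set_iff_bounded by blast
 show ?thesis
 proof
  fix v w :: "nat => 'a" assume vw: "\<And>i. i < m ==> v i = w i"
  show "P v = P w" unfolding p
   by (rule sat_cong) (use m vw in "auto simp: pval_def")
 qed
qed

section \<open>Definable functions, represented by their graphs, and substitution\<close>

definition Dfn :: "'a::linordered_ab_group_add set => ((nat => 'a) => 'a) => bool" where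
 "Dfn A t \<longleftrightarrow> Def A (\<lambda>w. w 0 = t (\<lambda>i. w (Suc i)))"

lemma Def_eq_var: "Def A (\<lambda>v. v i = v j)"
 using Def_sat[of A "Eq (Var i) (Var j)"] by simp

text \<open>\<open>sat_ren\<close> needs an injective renaming, whereas here variables may be
  identified. The values are copied into a fresh quantified tuple \<open>x\<close> that is tied to
  the old variables by equations.\<close>

lemma Def_reindex:
 assumes "Def A P"
 shows "Def A (\<lambda>w. P (\<lambda>j. w (r j)))"
proof -
 obtain m where m: "\<And>v w. (\<And>i. i < m ==> v i = w i) ==> P v = P w"
  using Def_local[OF assms] by blast
 have 1: "P (\<lambda>j. w (r j)) \<longleftrightarrow>
  (\<exists>x. length x = m \<and> ((\<forall>i<m. x ! i = w (r i)) \<and> P (\<lambda>i. if i < m then x ! i else 0)))" for w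
 proof
  assume "P (\<lambda>j. w (r j))"
  moreover have "P (\<lambda>i. if i < m then map (\<lambda>j. w (r j)) [0..<m] ! i else 0) = P (\<lambda>j. w (r j))"
   by (rule m) simp
  ultimately show "\<exists>x. length x = m \<and> ((\<forall>i<m. x ! i = w (r i)) \<and> P (\<lambda>i. if i < m then x ! i else 0))"
   by (intro exI[of _ "map (\<lambda>j. w (r j)) [0..<m]"]) auto
 next
  assume "\<exists>x. length x = m \<and> ((\<forall>i<m. x ! i = w (r i)) \<and> P (\<lambda>i. if i < m then x ! i else 0))"
  then obtain x where x: "\<forall>i<m. x ! i = w (r i)" "P (\<lambda>i. if i < m then x ! i else 0)" by blast
  have "P (\<lambda>i. if i < m then x ! i else 0) = P (\<lambda>j. w (r j))"
   by (rule m) (simp add: x)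
  then show "P (\<lambda>j. w (r j))" using x by simp
 qed
 have 2: "P (\<lambda>i. if i < m then map w [0..<m] ! i else 0) = P w" for w
  by (rule m) simp
 have "Def A (\<lambda>w. \<exists>x. length x = m \<and> ((\<forall>i<m. x ! i = w (r i)) \<and> P (\<lambda>i. if i < m then x ! i else 0)))"
 proof (rule Def_exl, rule Def_conj)
  show "Def A (\<lambda>w. \<forall>i<m. map w [0..<m] ! i = w (r i + m))"
   by (rule Def_all_less) (simp add: Def_eq_var)
  show "Def A (\<lambda>w. P (\<lambda>i. if i < m then map w [0..<m] ! i else 0))"
   using assms by (simp add: 2)
 qed
 then show ?thesis by (simp add: 1)
qed

lemma Dfn_reindex: "Dfn A t ==> Dfn A (\<lambda>w. t (\<lambda>j. w (r j)))"
 unfolding Dfn_def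
 using Def_reindex[of A "\<lambda>w. w 0 = t (\<lambda>i. w (Suc i))" "case_nat 0 (\<lambda>j. Suc (r j))"] by simp

text \<open>The same copying as in \<open>Def_reindex\<close>, with the graphs of the functions
  \<open>t j\<close> in place of equations between variables.\<close>

lemma Def_subst:
 assumes "Def A P" "\<And>i. Dfn A (t i)"
 shows "Def A (\<lambda>w. P (\<lambda>j. t j w))"
proof -
 obtain m where m: "\<And>v w. (\<And>i. i < m ==> v i = w i) ==> P v = P w"
  using Def_local[OF assms(1)] by blast
 have 1: "P (\<lambda>j. t j w) \<longleftrightarrow>
  (\<exists>x. length x = m \<and> ((\<forall>i<m. x ! i = t i w) \<and> P (\<lambda>i. if i < m then x ! i else 0)))" for w
 proof
  assume "P (\<lambda>j. t j w)"
  moreover have "P (\<lambda>i. if i < m then map (\<lambda>j. t j w) [0..<m] ! i else 0) = P (\<lambda>j. t j w)"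
   by (rule m) simp
  ultimately show "\<exists>x. length x = m \<and> ((\<forall>i<m. x ! i = t i w) \<and> P (\<lambda>i. if i < m then x ! i else 0))"
   by (intro exI[of _ "map (\<lambda>j. t j w) [0..<m]"]) auto
 next
  assume "\<exists>x. length x = m \<and> ((\<forall>i<m. x ! i = t i w) \<and> P (\<lambda>i. if i < m then x ! i else 0))"
  then obtain x where x: "\<forall>i<m. x ! i = t i w" "P (\<lambda>i. if i < m then x ! i else 0)" by blast
  have "P (\<lambda>i. if i < m then x ! i else 0) = P (\<lambda>j. t j w)"
   by (rule m) (simp add: x)
  then show "P (\<lambda>j. t j w)" using x by simp
 qed
 have 2: "P (\<lambda>i. if i < m then map w [0..<m] ! i else 0) = P w" for w
  by (rule m) simp
 have "Def A (\<lambda>w. \<exists>x. length x = m \<and> ((\<forall>i<m. x ! i = t i w) \<and> P (\<lambda>i. if i < m then x ! i else 0)))"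
 proof (rule Def_exl, rule Def_conj)
  show "Def A (\<lambda>w. \<forall>i<m. map w [0..<m] ! i = t i (\<lambda>j. w (j + m)))"
  proof (rule Def_all_less)
   fix i assume "i < m"
   have "Def A (\<lambda>w. w i = t i (\<lambda>j. w (j + m)))"
    using Def_reindex[OF assms(2)[of i, unfolded Dfn_def], of "case_nat i (\<lambda>j. j + m)"] by simp
   then show "Def A (\<lambda>w. map w [0..<m] ! i = t i (\<lambda>j. w (j + m)))" using \<open>i < m\<close> by simp
  qed
  show "Def A (\<lambda>w. P (\<lambda>i. if i < m then map w [0..<m] ! i else 0))"
   using assms by (simp add: 2)
 qed
 then show ?thesis by (simp add: 1)
qed

lemma Dfn_var: "Dfn A (\<lambda>v. v i)"
 unfolding Dfn_def by (rule Def_eq_var)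

lemma Dfn_subst:
 assumes "Dfn A F" "\<And>i. Dfn A (t i)"
 shows "Dfn A (\<lambda>w. F (\<lambda>j. t j w))"
proof -
 have "Dfn A (\<lambda>w. case i of 0 => w 0 | Suc j => t j (\<lambda>i. w (Suc i)))" for i
  using Dfn_reindex[OF assms(2), of _ Suc] Dfn_var by (cases i) auto
 from Def_subst[OF assms(1)[unfolded Dfn_def], of "\<lambda>i w. case_nat (w 0) (\<lambda>j. t j (\<lambda>i. w (Suc i))) i", OF this]
 show ?thesis unfolding Dfn_def by simp
qed

lemma Dfn_const: "a \<in> A ==> Dfn A (\<lambda>v. a)"
 unfolding Dfn_def Def_def
 by (intro exI[of _ "Eq (Var 1) (Var 0)"] exI[of _ "[a]"]) (auto simp: pval_def)

lemma Dfn_zero: "Dfn A (\<lambda>v. 0)"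
 unfolding Dfn_def using Def_sat[of A "Eq (Var 0) Zero"] by simp

lemma Dfn_plus:
 assumes "Dfn A s" "Dfn A t"
 shows "Dfn A (\<lambda>v. s v + t v)"
proof -
 have "Dfn A (\<lambda>v. v 0 + v 1)"
  unfolding Dfn_def using Def_sat[of A "Eq (Var 0) (Plus (Var 1) (Var 2))"] by (simp add: numeral_2_eq_2)
 from Dfn_subst[OF this, of "\<lambda>i. if i = 0 then s else t"] show ?thesis using assms by simp
qed

lemma Dfn_minus:
 assumes "Dfn A s"
 shows "Dfn A (\<lambda>v. - s v)"
proof -
 have "Dfn A (\<lambda>v. - v 0)"
  unfolding Dfn_def using Def_sat[of A "Eq (Var 0) (Minus (Var 1))"] by simp
 from Dfn_subst[OF this, of "\<lambda>i. s"] show ?thesis using assms by simp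
qed

lemma Dfn_diff: "Dfn A s ==> Dfn A t ==> Dfn A (\<lambda>v. s v - t v)"
 using Dfn_plus[of A s "\<lambda>v. - t v"] Dfn_minus[of A t] by simp

lemma Def_eq:
 assumes "Dfn A s" "Dfn A t"
 shows "Def A (\<lambda>v. s v = t v)"
 using Def_subst[OF Def_eq_var, of A "\<lambda>i. if i = 0 then s else t" 0 1] assms by simp

lemma Def_less:
 assumes "Dfn A s" "Dfn A t"
 shows "Def A (\<lambda>v. s v < t v)"
 using Def_subst[OF Def_sat[of A "Less (Var 0) (Var 1)"], of "\<lambda>i. if i = 0 then s else t"] assms
 by simp

lemma Def_le: "Dfn A s ==> Dfn A t ==> Def A (\<lambda>v. s v \<le> t v)"
 using Def_not[of A "\<lambda>v. t v < s v"] Def_less[of A t s] by (simp add: not_less)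

section \<open>Tuples of definable functions and membership in definable sets\<close>

definition Dfnl :: "'a::linordered_ab_group_add set => nat => ((nat => 'a) => 'a list) => bool" where
 "Dfnl A n l \<longleftrightarrow> (\<forall>v. length (l v) = n) \<and> (\<forall>i<n. Dfn A (\<lambda>v. l v ! i))"

lemma Dfnl_length: "Dfnl A n l ==> length (l v) = n"
 by (simp add: Dfnl_def)

lemma Dfnl_nth: "Dfnl A n l ==> i < n ==> Dfn A (\<lambda>v. l v ! i)"
 by (simp add: Dfnl_def)

lemma Dfnl_Nil: "Dfnl A 0 (\<lambda>v. [])"
 by (simp add: Dfnl_def)

lemma Dfnl_Cons: "Dfn A t ==> Dfnl A n l ==> Dfnl A (Suc n) (\<lambda>v. t v # l v)"
 unfolding Dfnl_def by (auto simp: less_Suc_eq_0_disj)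

lemma Dfnl_append: "Dfnl A m k ==> Dfnl A n l ==> Dfnl A (m + n) (\<lambda>v. k v @ l v)"
proof -
 assume a: "Dfnl A m k" "Dfnl A n l"
 have "Dfn A (\<lambda>v. (k v @ l v) ! i)" if "i < m + n" for i
  using a that by (cases "i < m") (auto simp: Dfnl_def nth_append)
 then show ?thesis using a by (simp add: Dfnl_def)
qed

lemma Dfnl_upt: "(\<And>i. Dfn A (\<lambda>v. t v i)) ==> Dfnl A (b - a) (\<lambda>v. map (t v) [a..<b])"
 unfolding Dfnl_def by auto

lemma Dfnl_vars: "Dfnl A n (\<lambda>v. map v [0..<n])"
 using Dfnl_upt[of A "\<lambda>v. v" n 0] Dfn_var by auto

lemma Dfnl_const: "set l \<subseteq> A ==> Dfnl A (length l) (\<lambda>v. l)"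
 unfolding Dfnl_def by (auto intro!: Dfn_const)

lemma Dfnl_take: "Dfnl A n l ==> Dfnl A (min n m) (\<lambda>v. take m (l v))"
 unfolding Dfnl_def by auto

lemma Dfnl_drop: "Dfnl A n l ==> Dfnl A (n - m) (\<lambda>v. drop m (l v))"
 unfolding Dfnl_def by auto

lemma Dfnl_reindex: "Dfnl A n l ==> Dfnl A n (\<lambda>w. l (\<lambda>j. w (r j)))"
 unfolding Dfnl_def using Dfn_reindex[of A _ r] by auto

lemma Dfnl_cast: "Dfnl A n l ==> n = m ==> Dfnl A m l"
 by simp

lemma Def_eql:
 assumes "Dfnl A n l" "Dfnl A n' l'"
 shows "Def A (\<lambda>v. l v = l' v)"
proof (cases "n = n'")
 case True
 have "Def A (\<lambda>v. \<forall>i<n. l v ! i = l' v ! i)"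
  by (rule Def_all_less, rule Def_eq) (use assms True in "auto simp: Dfnl_def")
 moreover have "(\<forall>i<n. l v ! i = l' v ! i) \<longleftrightarrow> l v = l' v" for v
  using assms True by (auto simp: Dfnl_def list_eq_iff_nth_eq)
 ultimately show ?thesis by simp
next
 case False
 then have "(l v = l' v) = False" for v
  using Dfnl_length[OF assms(1), of v] Dfnl_length[OF assms(2), of v] by auto
 then show ?thesis using Def_const by simp
qed

text \<open>The bridge between the two layouts: parameters last and free variables bounded in
  \<open>definable_over\<close>, parameters first and no bound in \<open>Def\<close>.\<close>

lemma definable_over_iff:
 "definable_over A n X \<longleftrightarrow> (\<forall>x\<in>X. length x = n) \<and> Def A (\<lambda>v. map v [0..<n] \<in> X)"
proof
 assume "definable_over A n X"
 then obtain p b where p: "set b \<subseteq> A" "X = solutions n p b"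
  unfolding definable_over_def by blast
 have "Def A (\<lambda>v. sat UNIV (\<lambda>i. (if i < n then v i else if i < n + length b then b ! (i - n) else 0)) p)"
 proof (rule Def_subst[OF Def_sat])
  fix i
  show "Dfn A (\<lambda>v. if i < n then v i else if i < n + length b then b ! (i - n) else 0)"
  proof (cases "i < n")
   case True
   then show ?thesis by (simp add: Dfn_var)
  next
   case False
   show ?thesis
   proof (cases "i < n + length b")
    case True
    then have "b ! (i - n) \<in> A" using False p(1) by (auto simp: subset_iff)
    then show ?thesis using False True by (simp add: Dfn_const)
   qed (use False in "simp add: Dfn_zero")
  qed
 qed
 moreover have "assignment (map v [0..<n] @ b) =
   (\<lambda>i. (if i < n then v i else if i < n + length b then b ! (i - n) else 0))" for v :: "nat => 'a"
  by (auto simp: fun_eq_iff assignment_def nth_append)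
 ultimately show "(\<forall>x\<in>X. length x = n) \<and> Def A (\<lambda>v. map v [0..<n] \<in> X)"
  unfolding p(2) solutions_def by simp
next
 assume *: "(\<forall>x\<in>X. length x = n) \<and> Def A (\<lambda>v. map v [0..<n] \<in> X)"
 then obtain p b where p: "set b \<subseteq> A" "\<And>v. map v [0..<n] \<in> X \<longleftrightarrow> sat UNIV (pval b v) p"
  unfolding Def_def by blast
 \<comment> \<open>\<open>r\<close> exchanges the block of parameters with the block of the
   \<open>n\<close> variables.\<close>
 define r where "r = (\<lambda>i. if i < length b then i + n else if i < length b + n then i - length b else i)"
 have inj: "inj r" by (auto simp: r_def inj_def split: if_splits)
 \<comment> \<open>The variables beyond both blocks; \<open>assignment\<close> sends them to 0, so
   \<open>zero_out\<close> may remove them.\<close>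
 define F where "F = fv (fm_ren r p) - {..<n + length b}"
 have "finite F" by (simp add: F_def finite_fv)
 from zero_out[OF this, of "fm_ren r p"] obtain q where q: "fv q \<subseteq> fv (fm_ren r p) - F"
  "\<And>v::nat => 'a. (\<forall>i\<in>F. v i = 0) ==> sat UNIV v q = sat UNIV v (fm_ren r p)"
  by blast
 have "x \<in> X \<longleftrightarrow> sat UNIV (assignment (x @ b)) q" if "length x = n" for x
 proof -
  have "map (assignment x) [0..<n] = x"
   using that by (auto simp: assignment_def list_eq_iff_nth_eq)
  then have "x \<in> X \<longleftrightarrow> sat UNIV (pval b (assignment x)) p" using p(2)[of "assignment x"] by simp
  also have "pval b (assignment x) = assignment (x @ b) \<circ> r"
   using that by (auto simp: fun_eq_iff pval_def assignment_def r_def nth_append)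
  also have "sat UNIV (assignment (x @ b) \<circ> r) p = sat UNIV (assignment (x @ b)) (fm_ren r p)"
   using sat_ren[OF inj] by blast
  also have "\<dots> = sat UNIV (assignment (x @ b)) q"
   by (rule q(2)[symmetric]) (use that in "auto simp: F_def assignment_def")
  finally show ?thesis .
 qed
 then have "X = solutions n q b" using * by (auto simp: solutions_def)
 moreover have "fv q \<subseteq> {..<n + length b}" using q(1) by (auto simp: F_def)
 ultimately show "definable_over A n X"
  unfolding definable_over_def using p(1) by blast
qed

lemma definable_length: "definable_over A n X ==> x \<in> X ==> length x = n"
 by (simp add: definable_over_iff)

lemma definable_mono: "definable_over A n X ==> A \<subseteq> B ==> definable_over B n X"
 unfolding definable_over_def by blast

lemma Def_mem:
 assumes "definable_over A n X" "Dfnl A n' l"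
 shows "Def A (\<lambda>v. l v \<in> X)"
proof (cases "n = n'")
 case True
 have "Def A (\<lambda>v. map (\<lambda>i. if i < n then l v ! i else 0) [0..<n] \<in> X)"
 proof (rule Def_subst[of A "\<lambda>w. map w [0..<n] \<in> X"])
  show "Def A (\<lambda>w. map w [0..<n] \<in> X)" using assms(1) by (simp add: definable_over_iff)
  show "Dfn A (\<lambda>v. if i < n then l v ! i else 0)" for i
   using assms(2) True by (cases "i < n") (auto simp: Dfnl_def Dfn_zero)
 qed
 moreover have "map (\<lambda>i. if i < n then l v ! i else 0) [0..<n] = l v" for v
  using assms(2) True by (auto simp: Dfnl_def list_eq_iff_nth_eq)
 ultimately show ?thesis by simp
next
 case False
 then have "(l v \<in> X) = False" for v
  using assms by (auto simp: definable_over_iff Dfnl_def)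
 then show ?thesis using Def_const by simp
qed

lemma definableI:
 assumes "Def A (\<lambda>v. P (map v [0..<n]))"
 shows "definable_over A n {x. length x = n \<and> P x}"
 using assms by (simp add: definable_over_iff)

lemmas Def_intros = Def_not Def_conj Def_disj Def_imp Def_iff Def_ex Def_all Def_exl Def_alll
 Def_const Def_less Def_le Def_eq Def_eql Dfn_var Dfn_zero Dfn_plus Dfn_minus Dfn_diff
 Dfnl_Nil Dfnl_Cons Dfnl_append Dfnl_upt

text \<open>Parameters in \<open>B\<close> are kept; each of the others is an entry of
  \<open>b\<close> and is turned into a variable, \<open>s\<close> recording its position in
  \<open>b\<close>.\<close>

lemma Def_param_out:
 assumes "Def A P" "A \<subseteq> B \<union> set b"
 obtains P' where "Def B P'" "\<And>v. P v \<longleftrightarrow> P' (pval b v)"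
proof -
 obtain p c where p: "set c \<subseteq> A" "\<And>v. P v \<longleftrightarrow> sat UNIV (pval c v) p"
  using assms(1) unfolding Def_def by blast
 have "\<forall>j. \<exists>k. j < length c --> c ! j \<notin> B --> k < length b \<and> b ! k = c ! j"
  using p(1) assms(2) by (metis UnE in_set_conv_nth subset_iff)
 then obtain s where s: "\<And>j. j < length c ==> c ! j \<notin> B ==> s j < length b \<and> b ! (s j) = c ! j"
  by metis
 define t where "t = (\<lambda>i w. if i < length c then (if c ! i \<in> B then c ! i else w (s i))
   else w (i - length c + length b) :: 'a)"
 define P' where "P' = (\<lambda>w. sat UNIV (\<lambda>i. t i w) p)"
 have "Def B P'"
  unfolding P'_def
 proof (rule Def_subst[OF Def_sat])
  fix i show "Dfn B (t i)"
   unfolding t_def by (cases "i < length c"; cases "c ! i \<in> B") (auto intro: Dfn_var Dfn_const)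
 qed
 moreover have "P v \<longleftrightarrow> P' (pval b v)" for v
 proof -
  have "pval c v = (\<lambda>i. t i (pval b v))"
   using s by (auto simp: fun_eq_iff t_def pval_def)
  then show ?thesis unfolding p(2) P'_def by simp
 qed
 ultimately show ?thesis using that by blast
qed

text \<open>Parameters are opened up: a set defined with the help of \<open>b\<close> becomes the
  fibre at \<open>b\<close> of a family over \<open>B\<close>. This is the entry to the uniformity
  arguments, in which \<open>b\<close> is then varied.\<close>

lemma definable_param_out:
 assumes "definable_over A n X" "A \<subseteq> B \<union> set b"
 obtains S where "definable_over B (length b + n) S" "X = {x. b @ x \<in> S}"
proof -
 have X: "\<forall>x\<in>X. length x = n" "Def A (\<lambda>v. map v [0..<n] \<in> X)"
  using assms(1) by (auto simp: definable_over_iff)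
 from Def_param_out[OF X(2) assms(2)] obtain P' where
  P': "Def B P'" "\<And>v. map v [0..<n] \<in> X \<longleftrightarrow> P' (pval b v)" by blast
 define S where "S = {y. length y = length b + n \<and> P' (\<lambda>i. if i < length b + n then y ! i else 0)}"
 have "definable_over B (length b + n) S"
  unfolding S_def
 proof (rule definableI)
  have "Def B (\<lambda>v. P' (\<lambda>i. if i < length b + n then v i else 0))"
  proof (rule Def_subst[OF P'(1)])
   show "Dfn B (\<lambda>v. if i < length b + n then v i else 0)" for i
    by (cases "i < length b + n") (auto intro: Dfn_var Dfn_zero)
  qed
  moreover have "(\<lambda>i. if i < length b + n then map v [0..<length b + n] ! i else 0) =
    (\<lambda>i. if i < length b + n then v i else 0)" for v :: "nat => 'a" by (auto simp: fun_eq_iff)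
  ultimately show "Def B (\<lambda>v. P' (\<lambda>i. if i < length b + n then map v [0..<length b + n] ! i else 0))"
   by simp
 qed
 moreover have "x \<in> X \<longleftrightarrow> b @ x \<in> S" for x
 proof (cases "length x = n")
  case True
  then have "map (assignment x) [0..<n] = x"
   by (auto simp: assignment_def list_eq_iff_nth_eq)
  then have "x \<in> X \<longleftrightarrow> P' (pval b (assignment x))" using P'(2)[of "assignment x"] by simp
  also have "pval b (assignment x) = (\<lambda>i. if i < length b + n then (b @ x) ! i else 0)"
   using True by (auto simp: fun_eq_iff pval_def assignment_def nth_append)
  finally show ?thesis using True by (simp add: S_def)
 qed (use X(1) in \<open>auto simp: S_def\<close>)
 ultimately show ?thesis using that by blast
qed

lemma definable_fibre:
 assumes "definable_over A (k + n) S" "length y = k" "set y \<subseteq> A"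
 shows "definable_over A n {x. y @ x \<in> S}"
proof -
 have *: "{x. y @ x \<in> S} = {x. length x = n \<and> y @ x \<in> S}"
  using definable_length[OF assms(1)] assms(2) by fastforce
 show ?thesis unfolding *
  by (intro definableI Def_mem[OF assms(1)], rule Dfnl_append[OF Dfnl_const[OF assms(3)] Dfnl_vars])
qed

section \<open>Arithmetic of Z-groups\<close>

text \<open>Integer multiples in an arbitrary abelian group. One of the two sums is always empty, so
  the difference serves both signs.\<close>

definition zsc :: "int => 'a::ab_group_add => 'a" (infixr "\<cdot>" 75) where
 "k \<cdot> a = (\<Sum>i<nat k. a) - (\<Sum>i<nat (- k). a)"

text \<open>Any presentation of the integer as a difference of naturals gives the same multiple,
  which makes additivity in the integer free of case distinctions on signs.\<close>

lemma zsc_diff_nat: "(int m - int n) \<cdot> a = (\<Sum>i<m. a) - (\<Sum>i<n. a)"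
proof -
 have s: "(\<Sum>i<p + q. a) = (\<Sum>i<p. a) + (\<Sum>i<q. a)" for p q :: nat
  by (induction p) (auto simp: algebra_simps)
 show ?thesis
 proof (cases "n \<le> m")
  case True
  then obtain k where "m = n + k" using le_Suc_ex by blast
  then show ?thesis by (simp add: zsc_def s)
 next
  case False
  then obtain k where "n = m + k" using le_Suc_ex nat_le_linear by blast
  then show ?thesis by (simp add: zsc_def s)
 qed
qed

lemma zsc_add_left: "(k + l) \<cdot> a = k \<cdot> a + l \<cdot> a"
proof -
 have s: "(\<Sum>i<p + q. a) = (\<Sum>i<p. a) + (\<Sum>i<q. a)" for p q :: nat
  by (induction p) (auto simp: algebra_simps)
 obtain m n p q where kl: "k = int m - int n" "l = int p - int q"
  by (metis diff_0 diff_zero int_diff_cases)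
 have "k + l = int (m + p) - int (n + q)" by (simp add: kl)
 then show ?thesis unfolding kl by (simp only: zsc_diff_nat s) (simp add: algebra_simps)
qed

lemma zsc_0_left [simp]: "0 \<cdot> a = 0"
 by (simp add: zsc_def)

lemma zsc_1_left [simp]: "1 \<cdot> a = a"
 by (simp add: zsc_def)

lemma zsc_0_right [simp]: "k \<cdot> 0 = 0"
 by (simp add: zsc_def)

lemma zsc_add_right: "k \<cdot> (a + b) = k \<cdot> a + k \<cdot> b"
 by (simp add: zsc_def sum.distrib algebra_simps)

lemma zsc_minus_left [simp]: "(- k) \<cdot> a = - (k \<cdot> a)"
 using zsc_add_left[of k "- k" a] by (simp add: eq_neg_iff_add_eq_0 add.commute)

lemma zsc_minus_right [simp]: "k \<cdot> (- a) = - (k \<cdot> a)"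
 using zsc_add_right[of k a "- a"] by (simp add: eq_neg_iff_add_eq_0 add.commute)

lemma zsc_diff_left: "(k - l) \<cdot> a = k \<cdot> a - l \<cdot> a"
 using zsc_add_left[of k "- l" a] by simp

lemma zsc_diff_right: "k \<cdot> (a - b) = k \<cdot> a - k \<cdot> b"
 using zsc_add_right[of k a "- b"] by simp

lemma zsc_mult: "(k * l) \<cdot> a = k \<cdot> l \<cdot> a"
proof (induction k rule: int_induct[where k = 0])
 case (step1 i)
 then show ?case by (simp add: zsc_add_left distrib_right)
next
 case (step2 i)
 then show ?case by (simp add: zsc_diff_left left_diff_distrib)
qed simp

lemma zsc_sum_right: "k \<cdot> (\<Sum>i\<in>I. f i) = (\<Sum>i\<in>I. k \<cdot> f i)"
 by (induction I rule: infinite_finite_induct) (auto simp: zsc_add_right)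

lemma zsc_sum_left: "(\<Sum>i\<in>I. f i) \<cdot> a = (\<Sum>i\<in>I. f i \<cdot> a)"
 by (induction I rule: infinite_finite_induct) (auto simp: zsc_add_left)

lemma zsc_int [simp]: "k \<cdot> (a :: int) = k * a"
 by (simp add: zsc_def)

lemma zsc_pos:
 fixes a :: "'a::linordered_ab_group_add"
 assumes "0 < k" "0 < a" shows "0 < k \<cdot> a"
 using assms(1)
proof (induction k rule: int_gr_induct)
 case base
 then show ?case using assms by simp
next
 case (step i)
 then show ?case using assms by (simp add: zsc_add_left add_pos_pos)
qed

lemma zsc_nonneg:
 fixes a :: "'a::linordered_ab_group_add"
 assumes "0 \<le> k" "0 \<le> a" shows "0 \<le> k \<cdot> a"
 using assms zsc_pos[of k a] by (cases "k = 0"; cases "a = 0") (auto simp: order_less_le)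

lemma zsc_less_iff:
 fixes a b :: "'a::linordered_ab_group_add"
 assumes "0 < k" shows "k \<cdot> a < k \<cdot> b \<longleftrightarrow> a < b"
proof -
 have 1: "k \<cdot> a < k \<cdot> b" if "a < b" for a b :: 'a
  using zsc_pos[OF assms, of "b - a"] that by (simp add: zsc_diff_right)
 show ?thesis using 1[of a b] 1[of b a] by (metis linorder_neqE order_less_asym)
qed

lemma zsc_le_iff:
 fixes a b :: "'a::linordered_ab_group_add"
 assumes "0 < k" shows "k \<cdot> a \<le> k \<cdot> b \<longleftrightarrow> a \<le> b"
 using zsc_less_iff[OF assms, of b a] by (simp add: not_less[symmetric])

lemma zsc_cancel:
 fixes a b :: "'a::linordered_ab_group_add"
 assumes "k \<noteq> 0" shows "k \<cdot> a = k \<cdot> b \<longleftrightarrow> a = b"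
proof (cases "0 < k")
 case True
 then show ?thesis using zsc_less_iff[of k a b] zsc_less_iff[of k b a]
  by (metis linorder_neqE order_less_irrefl)
next
 case False
 then have "0 < - k" using assms by simp
 then have "(- k) \<cdot> a = (- k) \<cdot> b \<longleftrightarrow> a = b" using zsc_less_iff[of "- k" a b] zsc_less_iff[of "- k" b a]
  by (metis linorder_neqE order_less_irrefl)
 then show ?thesis by simp
qed

lemma zsc_eq_0:
 fixes a :: "'a::linordered_ab_group_add"
 shows "k \<cdot> a = 0 \<longleftrightarrow> k = 0 \<or> a = 0"
 using zsc_cancel[of k a 0] by (cases "k = 0") auto

lemma zsc_left_less:
 fixes a :: "'a::linordered_ab_group_add"
 assumes "0 < a" shows "k \<cdot> a < l \<cdot> a \<longleftrightarrow> k < l"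
proof -
 have 1: "k \<cdot> a < l \<cdot> a" if "k < l" for k l :: int
  using zsc_pos[of "l - k" a] that assms by (simp add: zsc_diff_left)
 show ?thesis using 1[of k l] 1[of l k] by (metis linorder_neqE order_less_asym)
qed

section \<open>Facts about the integers transferred as first-order sentences\<close>

primrec tmn :: "nat => tm => tm" where
 "tmn 0 t = Zero"
| "tmn (Suc n) t = Plus t (tmn n t)"

lemma tm_val_tmn: "tm_val v (tmn n t) = int n \<cdot> tm_val v t"
 by (induction n) (auto simp: zsc_add_left)

abbreviation zone :: "'a::zgroup" where "zone \<equiv> of_Z 1"

lemma zone_pos: "0 < (zone :: 'a::zgroup)"
 using sat_of_Z[where 'a = 'a, of "\<lambda>_. 1" "Less Zero (Var 0)"] by simp

text \<open>The language has no symbol for 1, so the transferred formula receives it as the value of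
  variable 0.\<close>

lemma zone_least: "0 < a ==> zone \<le> (a :: 'a::zgroup)"
proof -
 let ?p = "Neg (Exists 1 (Conj (Less Zero (Var 1)) (Less (Var 1) (Var 0))))"
 have "sat UNIV (\<lambda>_. 1::int) ?p" by simp
 then have "sat UNIV ((of_Z :: int => 'a) \<circ> (\<lambda>_. 1)) ?p" using sat_of_Z by blast
 then show "0 < a ==> zone \<le> a" by (auto simp: not_less dest: leD)
qed

lemma of_Z_zsc: "of_Z k = k \<cdot> (zone :: 'a::zgroup)"
proof -
 have 0: "of_Z 0 = (0 :: 'a)" using of_Z_add[of 0 0] by simp
 show ?thesis
 proof (induction k rule: int_induct[where k = 0])
  case base
  then show ?case by (simp add: 0)
 next
  case (step1 i)
  then show ?case by (simp add: zsc_add_left of_Z_add)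
 next
  case (step2 i)
  then show ?case using of_Z_add[of "i - 1" 1, where 'a = 'a] by (simp add: zsc_diff_left)
 qed
qed

text \<open>By \<open>zone_least\<close> nothing lies strictly between consecutive multiples of
  \<open>zone\<close>; the induction on \<open>K\<close> removes the top multiple.\<close>

lemma std_between:
 assumes "0 \<le> a" "a \<le> int K \<cdot> (zone :: 'a::zgroup)"
 shows "\<exists>k. 0 \<le> k \<and> k \<le> int K \<and> a = k \<cdot> zone"
 using assms
proof (induction K arbitrary: a)
 case 0
 then show ?case by (intro exI[of _ 0]) auto
next
 case (Suc K)
 show ?case
 proof (cases "a \<le> int K \<cdot> zone")
  case True
  then show ?thesis using Suc.IH[of a] Suc.prems by force
 next
  case False
  then have "zone \<le> a - int K \<cdot> zone" by (intro zone_least) simp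
  then have "int (Suc K) \<cdot> zone \<le> a" by (simp add: zsc_add_left algebra_simps)
  then have "a = int (Suc K) \<cdot> zone" using Suc.prems by simp
  then show ?thesis by (intro exI[of _ "int (Suc K)"]) auto
 qed
qed

text \<open>An element that is no multiple of \<open>zone\<close> is infinitely far from 0, by
  \<open>std_between\<close>, so adding a standard integer cannot change its sign. This is the
  mechanism behind \<open>definable_translate\<close>.\<close>

lemma nonstd_add:
 assumes "\<And>k. y \<noteq> k \<cdot> (zone :: 'a::zgroup)"
 shows "0 < y + k \<cdot> zone \<longleftrightarrow> 0 < y"
proof -
 have *: "0 < y + k \<cdot> zone" if y: "0 < y" "\<And>k. y \<noteq> k \<cdot> (zone :: 'a)" for y k
 proof (rule ccontr)
  assume "\<not> 0 < y + k \<cdot> zone"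
  then have "y + k \<cdot> zone \<le> 0" by (simp add: not_less)
  then have "y \<le> (- k) \<cdot> zone" by (metis add_le_imp_le_right add.left_inverse zsc_minus_left)
  moreover have "(- k) \<cdot> zone \<le> int (nat (- k)) \<cdot> (zone :: 'a)"
   using zsc_left_less[OF zone_pos[where 'a = 'a], of "int (nat (- k))" "- k"]
   by (cases "0 \<le> - k") (auto simp: not_less[symmetric])
  ultimately obtain j where "y = j \<cdot> zone" using std_between[of y "nat (- k)"] y by force
  then show False using y by blast
 qed
 show ?thesis
 proof
  assume "0 < y + k \<cdot> zone"
  moreover have "y + k \<cdot> zone \<noteq> j \<cdot> zone" for j
   using assms[of "j - k"] by (auto simp: zsc_diff_left algebra_simps)
  ultimately show "0 < y" using *[of "y + k \<cdot> zone" "- k"] by simp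
 qed (use * assms in blast)
qed

text \<open>For each fixed \<open>N\<close>, division with remainder is a first-order statement
  about the integers. After the transfer the remainder is only known to lie in
  \<open>[0, N \<cdot> zone)\<close>; \<open>std_between\<close> turns it into a standard
  integer.\<close>

lemma zdivision:
 assumes "0 < N"
 shows "\<exists>q r. (a :: 'a::zgroup) = N \<cdot> q + r \<cdot> zone \<and> 0 \<le> r \<and> r < N"
proof -
 define n where "n = nat N"
 have N: "N = int n" "0 < n" using assms by (auto simp: n_def)
 \<comment> \<open>Variable 0 has the value 1, so \<open>tmn n (Var 0)\<close> denotes the integer
   \<open>n\<close>.\<close>
 let ?p = "Neg (Exists 1 (Neg (Exists 2 (Exists 3 (Conj (Neg (Less (Var 3) Zero))
   (Conj (Less (Var 3) (tmn n (Var 0))) (Eq (Var 1) (Plus (tmn n (Var 2)) (Var 3)))))))))"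
 have "\<exists>q r. 0 \<le> r \<and> r < int n \<and> a = int n * q + r" for a
  using N by (intro exI[of _ "a div int n"] exI[of _ "a mod int n"]) auto
 then have "sat UNIV (\<lambda>_. 1::int) ?p" by (simp add: tm_val_tmn not_less)
 then have "sat UNIV ((of_Z :: int => 'a) \<circ> (\<lambda>_. 1)) ?p" using sat_of_Z by blast
 then have "\<forall>a :: 'a. \<exists>q r. 0 \<le> r \<and> r < int n \<cdot> zone \<and> a = int n \<cdot> q + r"
  by (simp add: tm_val_tmn not_less not_le)
 then obtain q r where qr: "0 \<le> r" "r < int n \<cdot> zone" "a = int n \<cdot> q + r"
  by blast
 then obtain k where k: "0 \<le> k" "k \<le> int n" "r = k \<cdot> zone"
  using std_between[of r n] order_less_imp_le by blast
 have "k \<noteq> int n" using k qr by auto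
 then show ?thesis using k qr N by (intro exI[of _ q] exI[of _ k]) auto
qed

lemma zdivision_unique:
 assumes "N \<cdot> q + r \<cdot> (zone :: 'a::zgroup) = N \<cdot> q' + r' \<cdot> zone" "0 \<le> r" "r < N" "0 \<le> r'" "r' < N"
 shows "q = q' \<and> r = r'"
proof -
 have *: "\<not> q < q'" if "N \<cdot> q + r \<cdot> (zone :: 'a) = N \<cdot> q' + r' \<cdot> zone" "0 \<le> r" "r < N" "0 \<le> r'" "r' < N"
  for q q' r r'
 proof
  assume "q < q'"
  then have "zone \<le> q' - q" by (intro zone_least) simp
  then have "N \<cdot> zone \<le> N \<cdot> (q' - q)" using that zsc_le_iff by (metis order_le_less_trans)
  also have "\<dots> = (r - r') \<cdot> zone"
   using that(1) by (simp add: zsc_diff_left zsc_diff_right algebra_simps)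
  also have "\<dots> < N \<cdot> (zone :: 'a)"
   using zsc_left_less[OF zone_pos[where 'a = 'a], of "r - r'" N] that by simp
  finally show False by simp
 qed
 have "q = q'" using *[OF assms] *[OF assms(1)[symmetric] assms(4,5,2,3)] by simp
 moreover from this have "r \<cdot> (zone :: 'a) = r' \<cdot> zone" using assms by simp
 then have "r = r'" using zsc_left_less[OF zone_pos[where 'a = 'a], of r r']
   zsc_left_less[OF zone_pos[where 'a = 'a], of r' r] by auto
 ultimately show ?thesis by simp
qed

text \<open>The floor of \<open>a / N\<close>. The quotient lives in the group, whereas the
  remainder \<open>zmod\<close> is an honest integer.\<close>

definition zdiv :: "'a::zgroup => int => 'a" where
 "zdiv a N = (SOME q. \<exists>r. a = N \<cdot> q + r \<cdot> zone \<and> 0 \<le> r \<and> r < N)"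

definition zmod :: "'a::zgroup => int => int" where
 "zmod a N = (SOME r. a = N \<cdot> zdiv a N + r \<cdot> zone \<and> 0 \<le> r \<and> r < N)"

lemma zdiv_zmod:
 assumes "0 < N"
 shows "a = N \<cdot> zdiv a N + zmod a N \<cdot> (zone :: 'a::zgroup) \<and> 0 \<le> zmod a N \<and> zmod a N < N"
proof -
 have "\<exists>r. a = N \<cdot> zdiv a N + r \<cdot> zone \<and> 0 \<le> r \<and> r < N"
  unfolding zdiv_def by (rule someI_ex) (rule zdivision[OF assms])
 then show ?thesis unfolding zmod_def by (rule someI_ex)
qed

lemma zdiv_eqI:
 assumes "a = N \<cdot> q + r \<cdot> (zone :: 'a::zgroup)" "0 \<le> r" "r < N"
 shows "zdiv a N = q" "zmod a N = r"
proof -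
 have "0 < N" using assms by simp
 from zdiv_zmod[OF this, of a] zdivision_unique[of N q r "zdiv a N" "zmod a N"] assms
 show "zdiv a N = q" "zmod a N = r" by auto
qed

lemma zdiv_add_mult:
 assumes "0 < N"
 shows "zdiv (a + N \<cdot> b) N = zdiv a N + (b :: 'a::zgroup)"
proof -
 have "a + N \<cdot> b = N \<cdot> (zdiv a N + b) + zmod a N \<cdot> zone"
  using zdiv_zmod[OF assms, of a] by (simp add: zsc_add_right algebra_simps)
 then show ?thesis using zdiv_eqI zdiv_zmod[OF assms, of a] by blast
qed

lemma zdiv_mult: "0 < N ==> zdiv (N \<cdot> b) N = (b :: 'a::zgroup)"
 using zdiv_eqI(1)[of "N \<cdot> b" N b 0] by simp

text \<open>The adjunction that characterises the floor. It turns conditions on quotients into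
  linear inequalities, which are definable.\<close>

lemma le_zdiv_iff:
 assumes "0 < N"
 shows "x \<le> zdiv a N \<longleftrightarrow> N \<cdot> x \<le> (a :: 'a::zgroup)"
proof
 assume "x \<le> zdiv a N"
 then have "N \<cdot> x \<le> N \<cdot> zdiv a N" using zsc_le_iff assms by blast
 also have "\<dots> \<le> N \<cdot> zdiv a N + zmod a N \<cdot> zone"
 proof -
  have "0 \<le> zmod a N \<cdot> (zone :: 'a)"
   using zdiv_zmod[OF assms, of a] zone_pos[where 'a = 'a] by (intro zsc_nonneg) auto
  then show ?thesis by (simp only: le_add_same_cancel1)
 qed
 also have "\<dots> = a" using zdiv_zmod[OF assms, of a] by simp
 finally show "N \<cdot> x \<le> a" .
next
 assume le: "N \<cdot> x \<le> a"
 show "x \<le> zdiv a N"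
 proof (rule ccontr)
  assume "\<not> x \<le> zdiv a N"
  then have "zone \<le> x - zdiv a N" by (intro zone_least) simp
  then have "N \<cdot> zone \<le> N \<cdot> (x - zdiv a N)" using zsc_le_iff assms by blast
  then have "N \<cdot> zdiv a N + N \<cdot> zone \<le> N \<cdot> x" by (simp add: zsc_diff_right algebra_simps)
  moreover have "a < N \<cdot> zdiv a N + N \<cdot> zone"
   using zdiv_zmod[OF assms, of a] zsc_left_less[OF zone_pos[where 'a = 'a], of "zmod a N" N]
   by (metis add_strict_left_mono)
  ultimately show False using le by simp
 qed
qed

lemma less_iff_zone: "x < y \<longleftrightarrow> x + zone \<le> (y :: 'a::zgroup)"
proof
 assume "x < y"
 then have "zone \<le> y - x" by (intro zone_least) simp
 then show "x + zone \<le> y" by (simp add: algebra_simps)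
next
 assume "x + zone \<le> y"
 moreover have "x < x + zone" using zone_pos[where 'a = 'a] by simp
 ultimately show "x < y" by (rule order_less_le_trans[rotated])
qed

text \<open>Congruence modulo \<open>M\<close> in the group; definable predicates see the residues
  of their arguments only through it.\<close>

definition zcong :: "int => 'a::ab_group_add => 'a => bool" where
 "zcong M a b \<longleftrightarrow> (\<exists>q. a = b + M \<cdot> q)"

lemma zcong_refl: "zcong M a a"
 unfolding zcong_def by (intro exI[of _ 0]) simp

lemma zcong_sym: "zcong M a b ==> zcong M b a"
 unfolding zcong_def by (metis add_diff_cancel add_diff_eq diff_add_eq diff_minus_eq_add zsc_minus_right)

lemma zcong_trans: "zcong M a b ==> zcong M b c ==> zcong M a c"
 unfolding zcong_def by (auto simp: add.assoc zsc_add_right[symmetric])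

lemma zcong_add: "zcong M a b ==> zcong M c d ==> zcong M (a + c) (b + d)"
proof -
 assume "zcong M a b" "zcong M c d"
 then obtain q r where "a = b + M \<cdot> q" "c = d + M \<cdot> r" unfolding zcong_def by blast
 then show ?thesis unfolding zcong_def by (intro exI[of _ "q + r"]) (simp add: zsc_add_right algebra_simps)
qed

lemma zcong_zsc: "zcong M a b ==> zcong M (k \<cdot> a) (k \<cdot> b)"
proof -
 assume "zcong M a b"
 then obtain q where "a = b + M \<cdot> q" unfolding zcong_def by blast
 then show ?thesis unfolding zcong_def
  by (intro exI[of _ "k \<cdot> q"]) (simp add: zsc_add_right zsc_mult[symmetric] mult.commute)
qed

lemma zcong_sum: "(\<And>i. i \<in> I ==> zcong M (f i) (g i)) ==> zcong M (\<Sum>i\<in>I. f i) (\<Sum>i\<in>I. g i)"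
 by (induction I rule: infinite_finite_induct) (auto simp: zcong_refl zcong_add)

lemma zcong_dvd: "zcong M a b ==> M' dvd M ==> zcong M' a b"
 unfolding zcong_def dvd_def by (auto simp: zsc_mult)

lemma Dfn_zsc: "Dfn A t ==> Dfn A (\<lambda>v. k \<cdot> t v)"
proof -
 assume t: "Dfn A t"
 have *: "Dfn A (\<lambda>v. \<Sum>i<n. t v)" for n :: nat
  by (induction n) (use t in "auto intro: Dfn_zero Dfn_plus")
 show ?thesis unfolding zsc_def by (intro Dfn_diff *)
qed

lemma Dfn_zone: "Dfn A (\<lambda>v. zone :: 'a::zgroup)"
proof -
 have "w 0 = zone \<longleftrightarrow> 0 < w 0 \<and> (\<forall>a. 0 < a --> w 0 \<le> a)" for w :: "nat => 'a"
  using zone_pos[where 'a = 'a] zone_least by (metis order_antisym)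
 moreover have "Def A (\<lambda>w. 0 < w 0 \<and> (\<forall>a. 0 < a --> w 0 \<le> (a :: 'a)))"
  by (intro Def_intros)
 ultimately show ?thesis unfolding Dfn_def by simp
qed

lemma Dfn_sum: "(\<And>i. i \<in> I ==> Dfn A (t i)) ==> Dfn A (\<lambda>v. \<Sum>i\<in>I. t i v)"
 by (induction I rule: infinite_finite_induct) (auto intro: Dfn_zero Dfn_plus)

section \<open>The group generated by the parameters and 1, and its divisible hull within the
  model\<close>

inductive_set grp :: "'a::zgroup set => 'a set" for A where
 grp_zero: "0 \<in> grp A"
| grp_zone: "zone \<in> grp A"
| grp_base: "a \<in> A ==> a \<in> grp A"
| grp_add: "a \<in> grp A ==> b \<in> grp A ==> a + b \<in> grp A"
| grp_minus: "a \<in> grp A ==> - a \<in> grp A"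

lemma grp_diff: "a \<in> grp A ==> b \<in> grp A ==> a - b \<in> grp A"
 using grp_add[OF _ grp_minus, of a A b] by simp

lemma grp_sum: "(\<And>i. i \<in> I ==> f i \<in> grp A) ==> (\<Sum>i\<in>I. f i) \<in> grp A"
 by (induction I rule: infinite_finite_induct) (auto intro: grp.intros)

lemma grp_zsc: "a \<in> grp A ==> k \<cdot> a \<in> grp A"
 unfolding zsc_def by (intro grp_diff grp_sum)

text \<open>Quotients of elements of \<open>grp A\<close> by positive integers, as far as they exist
  in the model. These are definable over \<open>A\<close> by \<open>Dfn_zhull\<close>, and floors of
  such elements stay among them by \<open>zhull_zdiv\<close>.\<close>

definition zhull :: "'a::zgroup set => 'a set" where
 "zhull A = {x. \<exists>N>0. N \<cdot> x \<in> grp A}"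

lemma grp_subset_zhull: "grp A \<subseteq> zhull A"
 unfolding zhull_def by (auto intro!: exI[of _ 1])

lemma zhull_zero: "0 \<in> zhull A" and zhull_zone: "zone \<in> zhull A"
 using grp_subset_zhull grp.intros by blast+

lemma zhull_add: "a \<in> zhull A ==> b \<in> zhull A ==> a + b \<in> zhull A"
proof -
 assume "a \<in> zhull A" "b \<in> zhull A"
 then obtain N M where NM: "N > 0" "M > 0" "N \<cdot> a \<in> grp A" "M \<cdot> b \<in> grp A" unfolding zhull_def by blast
 have "(N * M) \<cdot> (a + b) = M \<cdot> N \<cdot> a + N \<cdot> M \<cdot> b"
  by (metis mult.commute zsc_add_right zsc_mult)
 moreover have "\<dots> \<in> grp A" using grp_zsc[OF NM(3), of M] grp_zsc[OF NM(4), of N] by (rule grp_add)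
 ultimately show ?thesis using NM unfolding zhull_def by (intro CollectI exI[of _ "N * M"]) auto
qed

lemma zhull_minus: "a \<in> zhull A ==> - a \<in> zhull A"
 unfolding zhull_def using grp_minus by fastforce

lemma zhull_diff: "a \<in> zhull A ==> b \<in> zhull A ==> a - b \<in> zhull A"
 using zhull_add[OF _ zhull_minus, of a A b] by simp

lemma zhull_zsc: "a \<in> zhull A ==> k \<cdot> a \<in> zhull A"
proof -
 assume "a \<in> zhull A"
 then obtain N where "N > 0" "N \<cdot> a \<in> grp A" unfolding zhull_def by blast
 then have "N \<cdot> k \<cdot> a \<in> grp A" using grp_zsc[of "N \<cdot> a" A k] by (metis mult.commute zsc_mult)
 then show ?thesis using \<open>N > 0\<close> unfolding zhull_def by blast
qed

lemma zhull_div: "k \<noteq> 0 ==> k \<cdot> a \<in> zhull A ==> a \<in> zhull A"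
proof -
 assume k: "k \<noteq> 0" "k \<cdot> a \<in> zhull A"
 then obtain N where N: "N > 0" "N \<cdot> k \<cdot> a \<in> grp A" unfolding zhull_def by blast
 have "(N * \<bar>k\<bar>) \<cdot> a \<in> grp A"
  using N grp_minus by (cases "k > 0") (auto simp: zsc_mult)
 then show ?thesis using N k unfolding zhull_def by (intro CollectI exI[of _ "N * \<bar>k\<bar>"]) auto
qed

lemma zhull_zdiv: "0 < N ==> a \<in> zhull A ==> zdiv a N \<in> zhull A"
proof -
 assume a: "0 < N" "a \<in> zhull A"
 then have "N \<cdot> zdiv a N = a - zmod a N \<cdot> zone" using zdiv_zmod[of N a] by (metis add_diff_cancel_right')
 moreover have "a - zmod a N \<cdot> zone \<in> zhull A" using a by (intro zhull_diff zhull_zsc zhull_zone)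
 ultimately show ?thesis using zhull_div[of N "zdiv a N" A] a by simp
qed

lemma Dfn_grp: "a \<in> grp A ==> Dfn A (\<lambda>v. a)"
 by (induction rule: grp.induct) (auto intro: Dfn_zero Dfn_zone Dfn_const Dfn_plus Dfn_minus)

text \<open>Multiplication by \<open>N\<close> is injective in an ordered group, so \<open>a\<close>
  is the only solution of \<open>N \<cdot> w = N \<cdot> a\<close>, an equation over
  \<open>A\<close>.\<close>

lemma Dfn_zhull: "a \<in> zhull A ==> Dfn A (\<lambda>v. a)"
proof -
 assume "a \<in> zhull A"
 then obtain N where N: "N > 0" "N \<cdot> a \<in> grp A" unfolding zhull_def by blast
 have "Def A (\<lambda>w. N \<cdot> w 0 = N \<cdot> a)" by (intro Def_eq Dfn_zsc Dfn_var Dfn_grp N)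
 then show ?thesis unfolding Dfn_def using zsc_cancel[of N _ a] N(1) by simp
qed

section \<open>Quantifier elimination by a back-and-forth argument\<close>

definition LF :: "nat => ((nat => 'a::zgroup) => 'a) => bool" where
 "LF m f \<longleftrightarrow> (\<exists>c k. \<forall>v. f v = (\<Sum>i<m. c i \<cdot> v i) + k \<cdot> zone)"

lemma LF_mono:
 assumes "LF m f" "m \<le> m'" shows "LF m' f"
proof -
 obtain c k where f: "\<And>v. f v = (\<Sum>i<m. c i \<cdot> v i) + k \<cdot> zone" using assms unfolding LF_def by blast
 have "f v = (\<Sum>i<m'. (if i < m then c i else 0) \<cdot> v i) + k \<cdot> zone" for v
 proof -
  have "(\<Sum>i<m'. (if i < m then c i else 0) \<cdot> v i) = (\<Sum>i<m. (if i < m then c i else 0) \<cdot> v i)"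
   by (rule sum.mono_neutral_right) (use assms(2) in auto)
  then show ?thesis by (simp add: f)
 qed
 then show ?thesis unfolding LF_def by (intro exI[of _ "\<lambda>i. if i < m then c i else 0"] exI[of _ k]) blast
qed

lemma LF_var: "i < m ==> LF m (\<lambda>v. v i)"
proof -
 assume "i < m"
 have "v i = (\<Sum>j<m. (if j = i then 1 else 0) \<cdot> v j) + 0 \<cdot> zone" for v :: "nat => 'a"
 proof -
  have "(\<Sum>j<m. (if j = i then 1 else 0) \<cdot> v j) = (\<Sum>j<m. if j = i then v j else 0)"
   by (rule sum.cong) auto
  then show ?thesis using \<open>i < m\<close> by simp
 qed
 then show ?thesis unfolding LF_def by (intro exI[of _ "\<lambda>j. if j = i then 1 else 0"] exI[of _ 0]) blast
qed

lemma LF_zone: "LF m (\<lambda>v. k \<cdot> zone)"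
 unfolding LF_def by (intro exI[of _ "\<lambda>_. 0"] exI[of _ k]) simp

lemma LF_zero: "LF m (\<lambda>v. 0)"
 using LF_zone[of m 0] by simp

lemma LF_add:
 assumes "LF m f" "LF m g" shows "LF m (\<lambda>v. f v + g v)"
proof -
 obtain c k where f: "\<And>v. f v = (\<Sum>i<m. c i \<cdot> v i) + k \<cdot> zone" using assms(1) unfolding LF_def by blast
 obtain d l where g: "\<And>v. g v = (\<Sum>i<m. d i \<cdot> v i) + l \<cdot> zone" using assms(2) unfolding LF_def by blast
 show ?thesis unfolding LF_def
  by (intro exI[of _ "\<lambda>i. c i + d i"] exI[of _ "k + l"])
   (simp add: f g zsc_add_left sum.distrib algebra_simps)
qed

lemma LF_zsc:
 assumes "LF m f" shows "LF m (\<lambda>v. n \<cdot> f v)"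
proof -
 obtain c k where f: "\<And>v. f v = (\<Sum>i<m. c i \<cdot> v i) + k \<cdot> zone" using assms(1) unfolding LF_def by blast
 show ?thesis unfolding LF_def
  by (intro exI[of _ "\<lambda>i. n * c i"] exI[of _ "n * k"])
   (simp add: f zsc_mult zsc_add_right zsc_sum_right)
qed

lemma LF_minus: "LF m f ==> LF m (\<lambda>v. - f v)"
 using LF_zsc[of m f "-1"] by simp

lemma LF_diff: "LF m f ==> LF m g ==> LF m (\<lambda>v. f v - g v)"
 using LF_add[of m f "\<lambda>v. - g v"] LF_minus[of m g] by simp

lemma LF_tm: "\<forall>i\<in>tm_vars t. i < m ==> LF m (\<lambda>v. tm_val v t)"
 by (induction t) (auto intro: LF_var LF_zero LF_add LF_minus)

lemma LF_zcong:
 assumes "LF m f" "\<And>i. i < m ==> zcong M (v i) (w i)"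
 shows "zcong M (f v) (f w)"
proof -
 obtain c k where f: "\<And>v. f v = (\<Sum>i<m. c i \<cdot> v i) + k \<cdot> zone" using assms(1) unfolding LF_def by blast
 show ?thesis unfolding f by (intro zcong_add zcong_sum zcong_zsc zcong_refl) (use assms(2) in auto)
qed

lemma LF_upd:
 assumes "LF m f" "i < m"
 shows "\<exists>n. (\<forall>v a. f (v(i := a)) = n \<cdot> a + f (v(i := 0))) \<and> LF m (\<lambda>v. f (v(i := 0)))"
proof -
 obtain c k where f: "\<And>v. f v = (\<Sum>j<m. c j \<cdot> v j) + k \<cdot> zone" using assms(1) unfolding LF_def by blast
 have 0: "(\<Sum>j<m. c j \<cdot> (v(i := a)) j) = c i \<cdot> a + (\<Sum>j\<in>{..<m} - {i}. c j \<cdot> v j)" for v a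
  using assms(2) by (subst sum.remove[of _ i]) auto
 have 1: "f (v(i := a)) = c i \<cdot> a + (\<Sum>j\<in>{..<m} - {i}. c j \<cdot> v j) + k \<cdot> zone" for v a
  unfolding f 0 ..
 have 2: "f (v(i := 0)) = (\<Sum>j<m. (c(i := 0)) j \<cdot> v j) + k \<cdot> zone" for v
  unfolding 1 using assms(2) by (subst sum.remove[of _ i]) auto
 have 3: "f (v(i := a)) = c i \<cdot> a + f (v(i := 0))" for v a
  unfolding 1 by (simp add: add.assoc)
 show ?thesis
  using 2 3 unfolding LF_def by blast
qed

text \<open>Agreement in the data that quantifier elimination for these groups works with. Only
  residues of the variables enter; those of linear forms follow by \<open>LF_zcong\<close>.\<close>

definition similar :: "nat => int => ((nat => 'a::zgroup) => 'a) set => (nat => 'a) => (nat => 'a) => bool" where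
 "similar m M L v w \<longleftrightarrow> (\<forall>i<m. zcong M (v i) (w i)) \<and> (\<forall>f\<in>L. 0 < f v \<longleftrightarrow> 0 < f w)"

text \<open>Quantifier elimination in semantic form: the truth value depends on finitely many
  residues and signs. No normal form of formulas is computed.\<close>

definition tame :: "((nat => 'a::zgroup) => bool) => bool" where
 "tame P \<longleftrightarrow> (\<exists>m M L. 0 < M \<and> finite L \<and> (\<forall>f\<in>L. LF m f) \<and> (\<forall>v w. similar m M L v w --> P v = P w))"

lemma similar_sym: "similar m M L v w ==> similar m M L w v"
 unfolding similar_def using zcong_sym by blast

lemma tame_pos:
 assumes "LF m f" shows "tame (\<lambda>v. 0 < f v)"
 unfolding tame_def
 by (intro exI[of _ m] exI[of _ 1] exI[of _ "{f}"]) (use assms in "auto simp: similar_def")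

lemma tame_not: "tame P ==> tame (\<lambda>v. \<not> P v)"
 unfolding tame_def by (simp only: simp_thms not_iff)

lemma tame_conj:
 assumes "tame P" "tame Q" shows "tame (\<lambda>v. P v \<and> Q v)"
proof -
 obtain m M L where P: "0 < M" "finite L" "\<forall>f\<in>L. LF m f" "\<And>v w. similar m M L v w ==> P v = P w"
  using assms(1) unfolding tame_def by blast
 obtain m' M' L' where Q: "0 < M'" "finite L'" "\<forall>f\<in>L'. LF m' f" "\<And>v w. similar m' M' L' v w ==> Q v = Q w"
  using assms(2) unfolding tame_def by blast
 have "(P v \<and> Q v) = (P w \<and> Q w)" if "similar (max m m') (M * M') (L \<union> L') v w" for v w
 proof -
  have "zcong M (v i) (w i) \<and> zcong M' (v i) (w i)" if "i < max m m'" for i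
   using \<open>similar _ _ _ _ _\<close> that zcong_dvd[of "M * M'" "v i" "w i"] unfolding similar_def by simp
  then have "similar m M L v w" "similar m' M' L' v w"
   using that unfolding similar_def by auto
  then show ?thesis using P(4) Q(4) by blast
 qed
 moreover have "\<forall>f\<in>L \<union> L'. LF (max m m') f"
  using P(3) Q(3) LF_mono[of m _ "max m m'"] LF_mono[of m' _ "max m m'"] by auto
 ultimately show ?thesis unfolding tame_def using P(1,2) Q(1,2)
  by (intro exI[of _ "max m m'"] exI[of _ "M * M'"] exI[of _ "L \<union> L'"]) simp
qed

text \<open>Given \<open>N \<cdot> a\<close> among finitely many thresholds, \<open>a\<close> can be moved, within its residue class and without
 crossing a threshold, so close to one of them that the distance is a standard integer.\<close>

lemma move_close:
 fixes a :: "'a::zgroup"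
 assumes "finite T" "T \<noteq> {}" "0 < N" "0 < M"
 obtains b t k where "zcong M b a" "t \<in> T" "\<bar>k\<bar> \<le> N * M" "N \<cdot> b = t + k \<cdot> zone"
  "\<And>s. s \<in> T ==> (s < N \<cdot> b \<longleftrightarrow> s < N \<cdot> a) \<and> (N \<cdot> b < s \<longleftrightarrow> N \<cdot> a < s)"
proof -
 \<comment> \<open>Moving \<open>a\<close> by multiples of \<open>M\<close> moves
   \<open>N \<cdot> a\<close> in steps of \<open>K\<close>.\<close>
 define K where "K = N * M"
 have K: "0 < K" using assms by (simp add: K_def)
 have cong: "zcong M (a + M \<cdot> q) a" for q unfolding zcong_def by blast
 have mul: "N \<cdot> (a + M \<cdot> q) = N \<cdot> a + K \<cdot> q" for q
  by (simp add: K_def zsc_add_right zsc_mult)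
 define Lo where "Lo = {t \<in> T. t \<le> N \<cdot> a}"
 have fin: "finite Lo" using assms by (simp add: Lo_def)
 show ?thesis
 proof (cases "Lo = {}")
  case False
  define t where "t = Max Lo"
  have t: "t \<in> T" "t \<le> N \<cdot> a" using Max_in[OF fin False] by (auto simp: t_def Lo_def)
  have tmax: "s \<le> t \<or> N \<cdot> a < s" if "s \<in> T" for s
   using Max_ge[OF fin, of s] that by (cases "s \<le> N \<cdot> a") (auto simp: t_def Lo_def)
  show ?thesis
  proof (cases "N \<cdot> a - t \<le> int (nat K) \<cdot> zone")
   case True
   then obtain k where "0 \<le> k" "k \<le> K" "N \<cdot> a - t = k \<cdot> zone"
    using std_between[of "N \<cdot> a - t" "nat K"] t K by auto
   then show ?thesis using t
    by (intro that[of a t k]) (auto simp: zcong_refl K_def algebra_simps)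
  next
   case False
   then have far: "t + K \<cdot> zone < N \<cdot> a" using K by (simp add: algebra_simps)
   \<comment> \<open>The remainder is shifted from \<open>0, ..., K - 1\<close> to
     \<open>1, ..., K\<close>: this keeps the new value strictly above \<open>t\<close>, while
     \<open>far\<close> keeps it below \<open>N \<cdot> a\<close>.\<close>
   define y where "y = N \<cdot> a - t - zone"
   define k where "k = zmod y K + 1"
   define q where "q = - zdiv y K"
   have kk: "1 \<le> k" "k \<le> K" using zdiv_zmod[OF K, of y] by (auto simp: k_def)
   have e: "N \<cdot> a + K \<cdot> q = t + k \<cdot> zone"
   proof -
    have "N \<cdot> a - t - zone = K \<cdot> zdiv y K + zmod y K \<cdot> zone"
     using zdiv_zmod[OF K, of y] by (simp add: y_def)
    then show ?thesis by (simp add: q_def k_def zsc_add_left algebra_simps)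
   qed
   have lt: "t < t + k \<cdot> zone" using kk zsc_pos[of k "zone :: 'a"] zone_pos[where 'a = 'a] by simp
   have le: "t + k \<cdot> zone < N \<cdot> a"
   proof -
    have "k \<cdot> zone \<le> K \<cdot> (zone :: 'a)"
     using zsc_left_less[OF zone_pos[where 'a = 'a], of K k] kk by (simp add: not_less[symmetric])
    then show ?thesis using far by (metis add_le_cancel_left order_le_less_trans)
   qed
   show ?thesis
   proof (rule that[of "a + M \<cdot> q" t k])
    fix s assume s: "s \<in> T"
    show "(s < N \<cdot> (a + M \<cdot> q) \<longleftrightarrow> s < N \<cdot> a) \<and> (N \<cdot> (a + M \<cdot> q) < s \<longleftrightarrow> N \<cdot> a < s)"
     unfolding mul e using tmax[OF s]
    proof
     assume "s \<le> t"
     then have "s < t + k \<cdot> zone" using lt by (rule order_le_less_trans)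
     then show "(s < t + k \<cdot> zone \<longleftrightarrow> s < N \<cdot> a) \<and> (t + k \<cdot> zone < s \<longleftrightarrow> N \<cdot> a < s)"
      using le by auto
    qed (use le in auto)
   qed (use cong t kk mul e in "auto simp: K_def")
  qed
 next
  \<comment> \<open>Here \<open>N \<cdot> a\<close> is below all thresholds and is moved up to just
    below the least one.\<close>
  case True
  then have above: "N \<cdot> a < s" if "s \<in> T" for s using that by (auto simp: Lo_def)
  define t where "t = Min T"
  have t: "t \<in> T" "\<And>s. s \<in> T ==> t \<le> s" using assms by (auto simp: t_def)
  have at: "N \<cdot> a < t" using above t by blast
  define y where "y = t - N \<cdot> a - zone"
  define k where "k = zmod y K + 1"
  define q where "q = zdiv y K"
  have kk: "1 \<le> k" "k \<le> K" using zdiv_zmod[OF K, of y] by (auto simp: k_def)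
  have e: "N \<cdot> a + K \<cdot> q = t + (- k) \<cdot> zone"
  proof -
   have "t - N \<cdot> a - zone = K \<cdot> zdiv y K + zmod y K \<cdot> zone"
    using zdiv_zmod[OF K, of y] by (simp add: y_def)
   then show ?thesis by (simp add: q_def k_def zsc_add_left zsc_diff_left algebra_simps)
  qed
  have lt: "t + (- k) \<cdot> zone < t" using kk zsc_pos[of k "zone :: 'a"] zone_pos[where 'a = 'a] by simp
  show ?thesis
  proof (rule that[of "a + M \<cdot> q" t "- k"])
   fix s assume s: "s \<in> T"
   have "t + (- k) \<cdot> zone < s" using lt t(2)[OF s] by (rule order_less_le_trans)
   then show "(s < N \<cdot> (a + M \<cdot> q) \<longleftrightarrow> s < N \<cdot> a) \<and> (N \<cdot> (a + M \<cdot> q) < s \<longleftrightarrow> N \<cdot> a < s)"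
    unfolding mul e using above[OF s] by auto
  qed (use cong t kk mul e in "auto simp: K_def")
 qed
qed

text \<open>The witness for \<open>v\<close> is moved by \<open>move_close\<close> to a threshold,
  say that of \<open>f0\<close>, plus a standard \<open>k\<close>; the witness for \<open>w\<close>
  is placed at the same distance from the corresponding threshold of \<open>w\<close>. The enlarged
  data must therefore record the signs of all differences of thresholds shifted by such
  \<open>k\<close>, and residues modulo \<open>N * M\<close>, so that the new position is again
  divisible by \<open>N\<close> and the quotient has the right residue modulo
  \<open>M\<close>.\<close>

lemma tame_ex:
 assumes "tame P" shows "tame (\<lambda>v. \<exists>a. P (v(i := a)))"
proof -
 obtain m M L where P: "0 < M" "finite L" "\<forall>f\<in>L. LF m f" "i < m"
  "\<And>v w. similar m M L v w ==> P v = P w"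
 proof -
  obtain m M L where P: "0 < M" "finite L" "\<forall>f\<in>L. LF m f" "\<And>v w. similar m M L v w ==> P v = P w"
   using assms(1) unfolding tame_def by blast
  have "similar m M L v w" if "similar (max m (Suc i)) M L v w" for v w
   using that unfolding similar_def by auto
  moreover have "LF (max m (Suc i)) f" if "f \<in> L" for f
   using LF_mono[of m f "max m (Suc i)"] P(3) that by simp
  ultimately show ?thesis using P
   by (intro that[of M L "max m (Suc i)"]) auto
 qed
 define g where "g = (\<lambda>f v. f (v(i := 0 :: 'a)) :: 'a)"
 have "\<forall>f\<in>L. \<exists>n. (\<forall>v a. f (v(i := a)) = n \<cdot> a + g f v) \<and> LF m (g f)"
  unfolding g_def using LF_upd P(3,4) by blast
 then obtain n where n: "\<And>f v a. f \<in> L ==> f (v(i := a)) = n f \<cdot> a + g f v" "\<And>f. f \<in> L ==> LF m (g f)"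
  by metis
 define L1 where "L1 = {f \<in> L. n f \<noteq> 0}"
 have fin1: "finite L1" using P(2) by (simp add: L1_def)
 \<comment> \<open>A common multiple of the coefficients of variable \<open>i\<close>, over the
   forms that contain it. Scaled up to \<open>N\<close>, these forms compare
   \<open>N \<cdot> a\<close> with the thresholds \<open>\<tau> f v\<close>.\<close>
 define N where "N = (\<Prod>f\<in>L1. \<bar>n f\<bar>)"
 have N: "0 < N" unfolding N_def by (rule prod_pos) (auto simp: L1_def)
 have Ndvd: "n f dvd N" if "f \<in> L1" for f
  unfolding N_def using dvd_prodI[OF fin1 that, of "\<lambda>f. \<bar>n f\<bar>"] by simp
 define \<tau> where "\<tau> = (\<lambda>f v. (- (N div n f)) \<cdot> g f v)"
 have tau: "0 < n f \<cdot> a + g f v \<longleftrightarrow> (if 0 < n f then \<tau> f v < N \<cdot> a else N \<cdot> a < \<tau> f v)" if "f \<in> L1" for f a v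
 proof -
  have nf: "n f \<noteq> 0" using that by (simp add: L1_def)
  from Ndvd[OF that] obtain d where d: "N = n f * d" by (auto elim: dvdE)
  have dd: "N div n f = d" using d nf by simp
  have "N \<cdot> a - \<tau> f v = d \<cdot> (n f \<cdot> a + g f v)"
   unfolding \<tau>_def dd by (simp add: d zsc_add_right zsc_mult[symmetric] mult.commute)
  then have eq: "N \<cdot> a = \<tau> f v + d \<cdot> (n f \<cdot> a + g f v)" by (simp add: algebra_simps)
  show ?thesis
  proof (cases "0 < n f")
   case True
   then have "0 < d" using N d by (simp add: zero_less_mult_iff)
   from zsc_less_iff[OF this, of 0 "n f \<cdot> a + g f v"] show ?thesis using True unfolding eq by simp
  next
   case False
   then have "0 < - d" using N d nf by (simp add: zero_less_mult_iff)
   from zsc_less_iff[OF this, of 0 "n f \<cdot> a + g f v"] have "0 < n f \<cdot> a + g f v \<longleftrightarrow> d \<cdot> (n f \<cdot> a + g f v) < 0"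
    by (simp only: zsc_minus_left zsc_0_right neg_0_less_iff_less)
   then show ?thesis using False unfolding eq by simp
  qed
 qed
 define K where "K = N * M"
 have K: "0 < K" using N P(1) by (simp add: K_def)
 \<comment> \<open>The range of \<open>k\<close> is the one promised by \<open>move_close\<close>;
   it keeps \<open>L2\<close> finite.\<close>
 define L2 where "L2 = (\<lambda>(f, f', k). (\<lambda>v. \<tau> f v - \<tau> f' v + k \<cdot> zone)) ` (L1 \<times> L1 \<times> {- K..K})"
 define L' where "L' = g ` L \<union> L2"
 have LFtau: "LF m (\<tau> f)" if "f \<in> L" for f
  unfolding \<tau>_def by (rule LF_zsc[OF n(2)[OF that]])
 have fin: "finite L'" unfolding L'_def L2_def using P(2) fin1 by simp
 have LF': "\<forall>f\<in>L'. LF m f"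
  unfolding L'_def L2_def using LFtau n(2) by (auto simp: L1_def intro!: LF_add LF_diff LF_zone)
 have main: "\<exists>a'. P (w(i := a'))" if vw: "similar m K L' v w" and a: "P (v(i := a))" for v w a
 proof -
  have cong: "zcong K (v j) (w j)" if "j < m" for j
   using vw that unfolding similar_def by blast
  have congM: "zcong M (v j) (w j)" if "j < m" for j
   using zcong_dvd[OF cong[OF that], of M] by (simp add: K_def)
  have sgn: "0 < f v \<longleftrightarrow> 0 < f w" if "f \<in> L'" for f
   using vw that unfolding similar_def by blast
  have L0: "0 < f (v(i := a)) \<longleftrightarrow> 0 < f (w(i := a'))" if "f \<in> L" "f \<notin> L1" for f a'
   using sgn[of "g f"] that n(1)[OF that(1)] by (auto simp: L1_def L'_def)
  show ?thesis
  proof (cases "L1 = {}")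
   case True
   have "similar m M L (v(i := a)) (w(i := a))"
    unfolding similar_def using congM zcong_refl L0 True by auto
   then show ?thesis using P(5) a by blast
  next
   case False
   define T where "T = (\<lambda>f. \<tau> f v) ` L1"
   have "finite T" "T \<noteq> {}" using fin1 False by (auto simp: T_def)
   from move_close[OF this N P(1), of a] obtain b t k where b: "zcong M b a" "t \<in> T" "\<bar>k\<bar> \<le> N * M"
    "N \<cdot> b = t + k \<cdot> zone"
    "\<And>s. s \<in> T ==> (s < N \<cdot> b \<longleftrightarrow> s < N \<cdot> a) \<and> (N \<cdot> b < s \<longleftrightarrow> N \<cdot> a < s)" by metis
   obtain f0 where f0: "f0 \<in> L1" "t = \<tau> f0 v" using b(2) by (auto simp: T_def)
   then have "f0 \<in> L" by (simp add: L1_def)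
   have "zcong K (\<tau> f0 v) (\<tau> f0 w)"
    by (rule LF_zcong[OF LFtau[OF \<open>f0 \<in> L\<close>]]) (use cong in blast)
   from zcong_sym[OF this] obtain q where q: "\<tau> f0 w = \<tau> f0 v + K \<cdot> q" unfolding zcong_def by blast
   \<comment> \<open>From \<open>v\<close> to \<open>w\<close> the threshold moves by a multiple
     \<open>K \<cdot> q\<close> of \<open>N * M\<close>, so \<open>b\<close> can follow by
     \<open>M \<cdot> q\<close> and keep its residue modulo \<open>M\<close>.\<close>
   define a' where "a' = b + M \<cdot> q"
   have Na': "N \<cdot> a' = \<tau> f0 w + k \<cdot> zone"
    by (simp add: a'_def zsc_add_right b(4) f0 q K_def zsc_mult add.assoc add.commute[of "k \<cdot> zone"])
   have acong: "zcong M a a'"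
    using b(1) unfolding a'_def by (metis zcong_def zcong_sym zcong_trans)
   have kK: "k \<in> {- K..K}" "- k \<in> {- K..K}" using b(3) by (auto simp: K_def)
   have cmp: "(\<tau> f v < N \<cdot> a \<longleftrightarrow> \<tau> f w < N \<cdot> a') \<and> (N \<cdot> a < \<tau> f v \<longleftrightarrow> N \<cdot> a' < \<tau> f w)" if f: "f \<in> L1" for f
   proof -
    have L'I: "(\<lambda>v. \<tau> f v - \<tau> f' v + k \<cdot> zone) \<in> L'" if "f \<in> L1" "f' \<in> L1" "k \<in> {- K..K}" for f f' k
     unfolding L'_def L2_def by (rule UnI2, rule image_eqI[of _ _ "(f, f', k)"]) (use that in auto)
    have "(\<lambda>v. \<tau> f0 v - \<tau> f v + k \<cdot> zone) \<in> L'" "(\<lambda>v. \<tau> f v - \<tau> f0 v + (- k) \<cdot> zone) \<in> L'"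
     using L'I[OF f0(1) f kK(1)] L'I[OF f f0(1) kK(2)] by blast+
    from sgn[OF this(1)] sgn[OF this(2)]
    have "(\<tau> f v < N \<cdot> b \<longleftrightarrow> \<tau> f w < N \<cdot> a') \<and> (N \<cdot> b < \<tau> f v \<longleftrightarrow> N \<cdot> a' < \<tau> f w)"
     unfolding Na' b(4) f0(2) by (simp add: algebra_simps)
    then show ?thesis using b(5)[of "\<tau> f v"] f by (auto simp: T_def)
   qed
   have "similar m M L (v(i := a)) (w(i := a'))"
    unfolding similar_def
   proof (intro conjI allI impI ballI)
    fix j assume "j < m"
    then show "zcong M ((v(i := a)) j) ((w(i := a')) j)" using congM acong by auto
   next
    fix f assume f: "f \<in> L"
    show "0 < f (v(i := a)) \<longleftrightarrow> 0 < f (w(i := a'))"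
    proof (cases "f \<in> L1")
     case True
     then show ?thesis using cmp[OF True] tau[OF True] n(1)[OF f] by auto
    qed (use L0 f in blast)
   qed
   then show ?thesis using P(5) a by blast
  qed
 qed
 have "(\<exists>a. P (v(i := a))) = (\<exists>a. P (w(i := a)))" if "similar m K L' v w" for v w
  using main[OF that] main[OF similar_sym[OF that]] by blast
 then show ?thesis unfolding tame_def using K fin LF' by blast
qed

text \<open>Only signs are recorded in \<open>similar\<close>, so an equation is expressed as the
  failure of both strict inequalities; the quantifier step is \<open>tame_ex\<close>.\<close>

lemma tame_sat: "tame (\<lambda>v :: nat => 'a::zgroup. sat UNIV v p)"
proof (induction p)
 case (Eq s t)
 obtain m where m: "\<forall>i\<in>tm_vars s \<union> tm_vars t. i < m"
  using finite_tm_vars finite_nat_set_iff_bounded[of "tm_vars s \<union> tm_vars t"] by auto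
 have "tame (\<lambda>v. \<not> 0 < tm_val v s - tm_val v t \<and> \<not> 0 < tm_val v t - (tm_val v s :: 'a))"
  by (intro tame_conj tame_not tame_pos[of m] LF_diff LF_tm) (use m in auto)
 moreover have "(\<not> 0 < tm_val v s - tm_val v t \<and> \<not> 0 < tm_val v t - tm_val v s) = sat UNIV v (Eq s t)"
  for v :: "nat => 'a" by auto
 ultimately show ?case by (simp only:)
next
 case (Less s t)
 obtain m where m: "\<forall>i\<in>tm_vars s \<union> tm_vars t. i < m"
  using finite_tm_vars finite_nat_set_iff_bounded[of "tm_vars s \<union> tm_vars t"] by auto
 have "tame (\<lambda>v. 0 < tm_val v t - (tm_val v s :: 'a))"
  by (intro tame_pos[of m] LF_diff LF_tm) (use m in auto)
 then show ?case by simp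
next
 case (Neg p)
 then show ?case by (simp add: tame_not)
next
 case (Conj p q)
 then show ?case by (simp add: tame_conj)
next
 case (Exists i p)
 then show ?case using tame_ex[of "\<lambda>v. sat UNIV v p" i] by simp
qed

text \<open>In one variable the parameters are absorbed into the constants of the linear forms,
  which stay in \<open>grp A\<close>. What remains is a finite set of cuts of the line and a
  modulus.\<close>

lemma definable_cuts:
 fixes X :: "'a::zgroup set"
 assumes "Def A (\<lambda>v. v 0 \<in> X)"
 obtains M C where "0 < M" "finite C" "C \<subseteq> UNIV \<times> grp A"
  "\<And>x y. zcong M x y ==> (\<And>n g. (n, g) \<in> C ==> 0 < n \<cdot> x + g \<longleftrightarrow> 0 < n \<cdot> y + g) ==> x \<in> X \<longleftrightarrow> y \<in> X"
proof -
 obtain p b where p: "set b \<subseteq> A" "\<And>v. v 0 \<in> X \<longleftrightarrow> sat UNIV (pval b v) p"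
  using assms unfolding Def_def by blast
 obtain m M L where L: "0 < M" "finite L" "\<forall>f\<in>L. LF m f"
  "\<And>v w :: nat => 'a. similar m M L v w ==> sat UNIV v p = sat UNIV w p"
  using tame_sat[of p] unfolding tame_def by blast
 have "\<exists>n g. g \<in> grp A \<and> (\<forall>x. f (pval b (\<lambda>_. x)) = n \<cdot> x + g)" if "f \<in> L" for f
 proof -
  obtain c k where f: "\<And>v. f v = (\<Sum>i<m. c i \<cdot> v i) + k \<cdot> zone" using L(3) \<open>f \<in> L\<close> unfolding LF_def by blast
  let ?n = "\<Sum>i<m. if i < length b then 0 else c i"
  let ?g = "(\<Sum>i<m. if i < length b then c i \<cdot> b ! i else 0) + k \<cdot> zone"
  have "f (pval b (\<lambda>_. x)) = ?n \<cdot> x + ?g" for x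
  proof -
   have "(\<Sum>i<m. c i \<cdot> pval b (\<lambda>_. x) i) =
     (\<Sum>i<m. (if i < length b then 0 else c i) \<cdot> x + (if i < length b then c i \<cdot> b ! i else 0))"
    by (rule sum.cong) (auto simp: pval_def)
   then show ?thesis unfolding f by (simp add: sum.distrib zsc_sum_left add.assoc)
  qed
  moreover have "?g \<in> grp A"
   by (intro grp_add grp_sum grp_zsc grp_zone)
    (use p(1) in \<open>auto intro!: grp_zsc grp_zero intro: grp_base nth_mem\<close>)
  ultimately show ?thesis by blast
 qed
 then obtain n g where ng: "\<And>f. f \<in> L ==> g f \<in> grp A" "\<And>f x. f \<in> L ==> f (pval b (\<lambda>_. x)) = n f \<cdot> x + g f"
  by metis
 show ?thesis
 proof (rule that[of M "(\<lambda>f. (n f, g f)) ` L"])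
  fix x y :: 'a assume xy: "zcong M x y"
   "\<And>n' g'. (n', g') \<in> (\<lambda>f. (n f, g f)) ` L ==> 0 < n' \<cdot> x + g' \<longleftrightarrow> 0 < n' \<cdot> y + g'"
  have "similar m M L (pval b (\<lambda>_. x)) (pval b (\<lambda>_. y))"
   unfolding similar_def using xy by (auto simp: ng(2)) (auto simp: pval_def zcong_refl)
  then show "x \<in> X \<longleftrightarrow> y \<in> X" using L(4) p(2)[of "\<lambda>_. x"] p(2)[of "\<lambda>_. y"] by blast
 qed (use L ng in auto)
qed

text \<open>For \<open>x\<close> outside \<open>zhull A\<close> a value
  \<open>n \<cdot> x + g\<close> with \<open>n\<close> nonzero is never standard, so by
  \<open>nonstd_add\<close> no cut separates \<open>x\<close> from
  \<open>x + (i * M) \<cdot> zone\<close>. Such a point brings a whole integer progression with it,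
  which supplies the many zeros needed in \<open>PF_vanish\<close>.\<close>

lemma definable_translate:
 fixes X :: "'a::zgroup set"
 assumes "Def A (\<lambda>v. v 0 \<in> X)" "x \<in> X" "x \<notin> zhull A"
 obtains M where "0 < M" "\<And>i. x + (i * M) \<cdot> zone \<in> X"
proof -
 obtain M C where M: "0 < M" "finite C" "C \<subseteq> UNIV \<times> grp A"
  "\<And>x y. zcong M x y ==> (\<And>n g. (n, g) \<in> C ==> 0 < n \<cdot> x + g \<longleftrightarrow> 0 < n \<cdot> y + g) ==> x \<in> X \<longleftrightarrow> y \<in> X"
  using definable_cuts[OF assms(1)] by metis
 have "x + (i * M) \<cdot> zone \<in> X" for i
 proof -
  have "x \<in> X \<longleftrightarrow> x + (i * M) \<cdot> zone \<in> X"
  proof (rule M(4))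
   show "zcong M x (x + (i * M) \<cdot> zone)"
    by (rule zcong_sym) (auto simp: zcong_def mult.commute[of i] zsc_mult)
   fix n g assume ng: "(n, g) \<in> C"
   show "0 < n \<cdot> x + g \<longleftrightarrow> 0 < n \<cdot> (x + (i * M) \<cdot> zone) + g"
   proof (cases "n = 0")
    case False
    have "n \<cdot> x + g \<noteq> k \<cdot> zone" for k
    proof
     assume "n \<cdot> x + g = k \<cdot> zone"
     then have "n \<cdot> x = k \<cdot> zone - g" by (metis add_diff_cancel)
     then have "n \<cdot> x \<in> grp A" using ng M(3) by (auto intro!: grp_diff grp_zsc grp_zone)
     then show False using zhull_div[OF False] grp_subset_zhull assms(3) by blast
    qed
    from nonstd_add[OF this, of "n * (i * M)"] show ?thesis
     by (simp add: zsc_add_right zsc_mult add.assoc add.commute[of g])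
   qed simp
  qed
  then show ?thesis using assms(2) by simp
 qed
 then show ?thesis using that M(1) by blast
qed

section \<open>Definable subsets of the line\<close>

text \<open>The length \<open>a\<close> is an element of the group, possibly infinite, not a natural
  number.\<close>

definition prog :: "int => 'a::zgroup => 'a => 'a set" where
 "prog N t a = {t + N \<cdot> s | s. 0 \<le> s \<and> s < a}"

text \<open>Rounding \<open>- g / n\<close> in the appropriate direction replaces the cut by
  \<open>\<theta> \<le> x\<close> or its negation, according to the sign of \<open>n\<close>. The
  direction is not recorded, since only invariance is used.\<close>

lemma threshold:
 fixes g :: "'a::zgroup"
 assumes "n \<noteq> 0" "g \<in> grp A"
 obtains \<theta> where "\<theta> \<in> zhull A"
  "\<And>x y. (\<theta> \<le> x \<longleftrightarrow> \<theta> \<le> y) ==> (0 < n \<cdot> x + g \<longleftrightarrow> 0 < n \<cdot> y + g)"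
proof -
 have nle: "\<not> x \<le> z \<longleftrightarrow> z + zone \<le> x" for x z :: 'a
  by (simp add: not_le less_iff_zone)
 show ?thesis
 proof (cases "0 < n")
  case True
  have "0 < n \<cdot> x + g \<longleftrightarrow> zdiv (- g) n + zone \<le> x" for x
  proof -
   have "0 < n \<cdot> x + g \<longleftrightarrow> \<not> n \<cdot> x \<le> - g" by (metis add.commute diff_gt_0_iff_gt diff_minus_eq_add not_le)
   also have "\<dots> \<longleftrightarrow> \<not> x \<le> zdiv (- g) n" using le_zdiv_iff[OF True, of x "- g"] by simp
   finally show ?thesis unfolding nle .
  qed
  moreover have "zdiv (- g) n + zone \<in> zhull A"
   using assms True grp_subset_zhull by (intro zhull_add zhull_zdiv zhull_zone zhull_minus) auto
  ultimately show ?thesis using that by blast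
 next
  case False
  then have n: "0 < - n" using assms by simp
  have "0 < n \<cdot> x + g \<longleftrightarrow> \<not> zdiv (g - zone) (- n) + zone \<le> x" for x
  proof -
   have "0 < n \<cdot> x + g \<longleftrightarrow> (- n) \<cdot> x < g" by (simp add: algebra_simps) (metis add.commute diff_gt_0_iff_gt diff_minus_eq_add minus_minus zsc_minus_left)
   also have "\<dots> \<longleftrightarrow> (- n) \<cdot> x \<le> g - zone" by (simp add: less_iff_zone algebra_simps)
   also have "\<dots> \<longleftrightarrow> x \<le> zdiv (g - zone) (- n)" using le_zdiv_iff[OF n] by blast
   finally show ?thesis unfolding nle[symmetric] by simp
  qed
  moreover have "zdiv (g - zone) (- n) + zone \<in> zhull A"
   using assms n grp_subset_zhull by (intro zhull_add zhull_zdiv zhull_zone zhull_diff) auto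
  ultimately show ?thesis using that by blast
 qed
qed

text \<open>A residue class inside a half-open interval is a progression. Its last index is the
  floor of the distance from the first point to \<open>\<theta>' - zone\<close>, divided by
  \<open>N\<close>; one more is the number of terms.\<close>

lemma prog_cell:
 fixes \<theta> \<theta>' :: "'a::zgroup"
 assumes "0 < N"
 shows "x \<in> prog N (\<theta> + int j \<cdot> zone) (zdiv (\<theta>' - \<theta> - int j \<cdot> zone - zone) N + zone) \<longleftrightarrow>
  \<theta> + int j \<cdot> zone \<le> x \<and> x < \<theta>' \<and> zcong N x (\<theta> + int j \<cdot> zone)"
proof -
 define t where "t = \<theta> + int j \<cdot> zone"
 define a where "a = zdiv (\<theta>' - \<theta> - int j \<cdot> zone - zone) N + zone"
 have "s < a \<longleftrightarrow> t + N \<cdot> s < \<theta>'" for s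
 proof -
  have "s < a \<longleftrightarrow> s \<le> zdiv (\<theta>' - \<theta> - int j \<cdot> zone - zone) N" unfolding a_def by (simp add: less_iff_zone)
  also have "\<dots> \<longleftrightarrow> N \<cdot> s \<le> \<theta>' - \<theta> - int j \<cdot> zone - zone" by (rule le_zdiv_iff[OF assms])
  also have "\<dots> \<longleftrightarrow> t + N \<cdot> s < \<theta>'" by (simp add: t_def less_iff_zone algebra_simps)
  finally show ?thesis .
 qed
 moreover have "0 \<le> s \<longleftrightarrow> t \<le> t + N \<cdot> s" for s
  using zsc_le_iff[OF assms, of 0 s] by simp
 ultimately show ?thesis unfolding prog_def zcong_def a_def[symmetric] t_def[symmetric] by auto
qed

text \<open>Membership is constant on a residue class between consecutive thresholds, and each such
  piece is a progression by \<open>prog_cell\<close>. The divisor \<open>N0\<close> of the step is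
  at the disposal of the caller, who uses it to clear denominators.\<close>

lemma prog_decomp:
 fixes X :: "'a::zgroup set"
 assumes "Def A (\<lambda>v. v 0 \<in> X)" "X \<subseteq> {lo..hi}" "0 < N0"
 obtains N I where "0 < N" "N0 dvd N" "finite I" "I \<subseteq> zhull A \<times> zhull A"
  "X = (\<Union>(t, a)\<in>I. prog N t a)"
  "\<And>t a u b. (t, a) \<in> I ==> (u, b) \<in> I ==> (t, a) \<noteq> (u, b) ==> prog N t a \<inter> prog N u b = {}"
proof -
 obtain M C where M: "0 < M" "finite C" "C \<subseteq> UNIV \<times> grp A"
  "\<And>x y. zcong M x y ==> (\<And>n g. (n, g) \<in> C ==> 0 < n \<cdot> x + g \<longleftrightarrow> 0 < n \<cdot> y + g) ==> x \<in> X \<longleftrightarrow> y \<in> X"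
  using definable_cuts[OF assms(1)] by metis
 have "\<forall>c\<in>C. \<exists>\<theta>. \<theta> \<in> zhull A \<and> (\<forall>x y. (\<theta> \<le> x \<longleftrightarrow> \<theta> \<le> y) --> (0 < fst c \<cdot> x + snd c \<longleftrightarrow> 0 < fst c \<cdot> y + snd c))"
 proof
  fix c assume c: "c \<in> C"
  show "\<exists>\<theta>. \<theta> \<in> zhull A \<and> (\<forall>x y. (\<theta> \<le> x \<longleftrightarrow> \<theta> \<le> y) --> (0 < fst c \<cdot> x + snd c \<longleftrightarrow> 0 < fst c \<cdot> y + snd c))"
  proof (cases "fst c = 0")
   case True
   then show ?thesis using zhull_zero by auto
  next
   case False
   have "snd c \<in> grp A" using M(3) c by auto
   from threshold[OF False this] show ?thesis by metis
  qed
 qed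
 then obtain th where th: "\<And>c. c \<in> C ==> th c \<in> zhull A"
  "\<And>c x y. c \<in> C ==> (th c \<le> x \<longleftrightarrow> th c \<le> y) ==> (0 < fst c \<cdot> x + snd c \<longleftrightarrow> 0 < fst c \<cdot> y + snd c)"
  by metis
 define \<Theta> where "\<Theta> = th ` C"
 have Th: "finite \<Theta>" "\<Theta> \<subseteq> zhull A" using M(2) th(1) by (auto simp: \<Theta>_def)
 define N where "N = M * N0"
 have N: "0 < N" using M assms by (simp add: N_def)
 have inv: "x \<in> X \<longleftrightarrow> y \<in> X" if "zcong N x y" "\<And>\<theta>. \<theta> \<in> \<Theta> ==> \<theta> \<le> x \<longleftrightarrow> \<theta> \<le> y" for x y
 proof (rule M(4))
  show "zcong M x y" using zcong_dvd[OF that(1)] by (simp add: N_def)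
  fix n g assume "(n, g) \<in> C"
  then show "0 < n \<cdot> x + g \<longleftrightarrow> 0 < n \<cdot> y + g" using th(2)[of "(n, g)" x y] that(2) by (auto simp: \<Theta>_def)
 qed
 have far: "a \<le> N \<cdot> a" if "0 \<le> a" for a :: 'a
 proof -
  have "(N - 1) \<cdot> a \<ge> 0" using that N by (intro zsc_nonneg) auto
  then show ?thesis by (simp add: zsc_diff_left)
 qed
 \<comment> \<open>A point of \<open>X\<close> not below any threshold could be moved up by
   arbitrary multiples of \<open>N\<close> without leaving \<open>X\<close>, against the bound
   \<open>hi\<close>; \<open>down\<close> is the mirror image.\<close>
 have up: "\<exists>\<theta>\<in>\<Theta>. x < \<theta>" if "x \<in> X" for x
 proof (rule ccontr)
  assume "\<not> (\<exists>\<theta>\<in>\<Theta>. x < \<theta>)"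
  then have le: "\<theta> \<le> x" if "\<theta> \<in> \<Theta>" for \<theta> using that by (auto simp: not_less)
  define d where "d = hi - x + zone"
  have d: "0 \<le> d" using assms(2) that zone_pos[where 'a = 'a] by (auto simp: d_def intro!: add_nonneg_nonneg)
  have gt: "x \<le> x + N \<cdot> d" using far[OF d] d by simp
  have "x \<in> X \<longleftrightarrow> x + N \<cdot> d \<in> X"
  proof (rule inv)
   show "zcong N x (x + N \<cdot> d)" by (rule zcong_sym) (auto simp: zcong_def)
   fix \<theta> assume "\<theta> \<in> \<Theta>"
   from le[OF this] show "\<theta> \<le> x \<longleftrightarrow> \<theta> \<le> x + N \<cdot> d" using order_trans[OF _ gt] by blast
  qed
  then have "x + N \<cdot> d \<le> hi" using that assms(2) by auto
  moreover have "x + d \<le> x + N \<cdot> d" using far[OF d] by simp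
  moreover have "hi < x + d" using zone_pos[where 'a = 'a] by (simp add: d_def)
  ultimately show False by (meson not_le order_trans)
 qed
 have down: "\<exists>\<theta>\<in>\<Theta>. \<theta> \<le> x" if "x \<in> X" for x
 proof (rule ccontr)
  assume "\<not> (\<exists>\<theta>\<in>\<Theta>. \<theta> \<le> x)"
  then have le: "x < \<theta>" if "\<theta> \<in> \<Theta>" for \<theta> using that by (auto simp: not_le)
  define d where "d = x - lo + zone"
  have d: "0 \<le> d" using assms(2) that zone_pos[where 'a = 'a] by (auto simp: d_def intro!: add_nonneg_nonneg)
  have gt: "x - N \<cdot> d \<le> x" using far[OF d] d by simp
  have "x \<in> X \<longleftrightarrow> x - N \<cdot> d \<in> X"
  proof (rule inv)
   show "zcong N x (x - N \<cdot> d)" by (auto simp: zcong_def)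
   fix \<theta> assume "\<theta> \<in> \<Theta>"
   from le[OF this] show "\<theta> \<le> x \<longleftrightarrow> \<theta> \<le> x - N \<cdot> d" using order_trans[OF _ gt] by (meson not_le)
  qed
  then have "lo \<le> x - N \<cdot> d" using that assms(2) by auto
  moreover have "x - N \<cdot> d \<le> x - d" using far[OF d] by simp
  moreover have "x - d < lo" using zone_pos[where 'a = 'a] by (simp add: d_def)
  ultimately show False by (meson not_le order_trans)
 qed
 define nx where "nx = (\<lambda>\<theta>. Min {\<theta>' \<in> \<Theta>. \<theta> < \<theta>'})"
 define cell where "cell = (\<lambda>\<theta> j. (\<theta> + int j \<cdot> zone, zdiv (nx \<theta> - \<theta> - int j \<cdot> zone - zone) N + zone))"
 define P where "P = {(\<theta>, j). \<theta> \<in> \<Theta> \<and> j < nat N \<and> (\<exists>\<theta>'\<in>\<Theta>. \<theta> < \<theta>') \<and> \<theta> + int j \<cdot> zone \<in> X \<and>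
  \<theta> + int j \<cdot> zone < nx \<theta>}"
 have nx: "nx \<theta> \<in> \<Theta>" "\<theta> < nx \<theta>" "\<And>\<theta>'. \<theta>' \<in> \<Theta> ==> \<theta>' \<le> \<theta> \<or> nx \<theta> \<le> \<theta>'"
  if "\<exists>\<theta>'\<in>\<Theta>. \<theta> < \<theta>'" for \<theta>
 proof -
  have f: "finite {\<theta>' \<in> \<Theta>. \<theta> < \<theta>'}" "{\<theta>' \<in> \<Theta>. \<theta> < \<theta>'} \<noteq> {}" using Th that by auto
  show "nx \<theta> \<in> \<Theta>" "\<theta> < nx \<theta>" using Min_in[OF f] by (auto simp: nx_def)
  show "\<theta>' \<le> \<theta> \<or> nx \<theta> \<le> \<theta>'" if "\<theta>' \<in> \<Theta>" for \<theta>'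
   using Min_le[OF f(1), of \<theta>'] that by (cases "\<theta>' \<le> \<theta>") (auto simp: nx_def)
 qed
 have mem: "x \<in> prog N (fst (cell \<theta> j)) (snd (cell \<theta> j)) \<longleftrightarrow>
   \<theta> + int j \<cdot> zone \<le> x \<and> x < nx \<theta> \<and> zcong N x (\<theta> + int j \<cdot> zone)" for x \<theta> j
  unfolding cell_def using prog_cell[OF N] by simp
 have uniq: "\<theta> = \<theta>' \<and> j = j'" if "(\<theta>, j) \<in> P" "(\<theta>', j') \<in> P"
  "x \<in> prog N (fst (cell \<theta> j)) (snd (cell \<theta> j))" "x \<in> prog N (fst (cell \<theta>' j')) (snd (cell \<theta>' j'))" for x \<theta> \<theta>' j j'
 proof -
  have le: "\<theta>0 \<le> x" if "\<theta>0 + int i \<cdot> zone \<le> x" for \<theta>0 i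
  proof -
   have "0 \<le> int i \<cdot> (zone :: 'a)" using zone_pos[where 'a = 'a] by (intro zsc_nonneg) auto
   then show ?thesis using that by (metis add_increasing2 order_refl order_trans)
  qed
  note xm = that(3)[unfolded mem zcong_def] that(4)[unfolded mem zcong_def]
  have x: "\<theta> \<le> x" "\<theta>' \<le> x" "x < nx \<theta>" "x < nx \<theta>'" using that(3,4) le unfolding mem by auto
  have "\<theta> = \<theta>'" using nx(3)[of \<theta> \<theta>'] nx(3)[of \<theta>' \<theta>] that(1,2) x unfolding P_def by fastforce
  moreover have "j = j'"
  proof -
   obtain q where q: "x = \<theta> + int j \<cdot> zone + N \<cdot> q" using xm(1) by blast
   obtain q' where q': "x = \<theta> + int j' \<cdot> zone + N \<cdot> q'" using xm(2) \<open>\<theta> = \<theta>'\<close> by blast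
   have "N \<cdot> q + int j \<cdot> zone = N \<cdot> q' + int j' \<cdot> zone" using q q' by (simp add: algebra_simps)
   then show ?thesis using zdivision_unique[of N q "int j" q' "int j'"] that(1,2) by (auto simp: P_def)
  qed
  ultimately show ?thesis by blast
 qed
 have XP: "x \<in> X \<longleftrightarrow> (\<exists>(\<theta>, j)\<in>P. x \<in> prog N (fst (cell \<theta> j)) (snd (cell \<theta> j)))" for x
 proof
  assume x: "x \<in> X"
  have f: "finite {\<theta> \<in> \<Theta>. \<theta> \<le> x}" "{\<theta> \<in> \<Theta>. \<theta> \<le> x} \<noteq> {}" using Th down[OF x] by auto
  define \<theta> where "\<theta> = Max {\<theta> \<in> \<Theta>. \<theta> \<le> x}"
  have \<theta>: "\<theta> \<in> \<Theta>" "\<theta> \<le> x" using Max_in[OF f] by (auto simp: \<theta>_def)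
  have \<theta>max: "\<theta>' \<le> \<theta>" if "\<theta>' \<in> \<Theta>" "\<theta>' \<le> x" for \<theta>' using Max_ge[OF f(1)] that by (auto simp: \<theta>_def)
  have ex: "\<exists>\<theta>'\<in>\<Theta>. \<theta> < \<theta>'" using up[OF x] \<theta>(2) by (meson order_le_less_trans)
  have xnx: "x < nx \<theta>" using \<theta>max[OF nx(1)[OF ex]] nx(2)[OF ex] by force
  define j where "j = nat (zmod (x - \<theta>) N)"
  have d: "x - \<theta> = N \<cdot> zdiv (x - \<theta>) N + zmod (x - \<theta>) N \<cdot> zone" "0 \<le> zmod (x - \<theta>) N" "zmod (x - \<theta>) N < N"
   using zdiv_zmod[OF N, of "x - \<theta>"] by blast+
  have xj: "x = \<theta> + int j \<cdot> zone + N \<cdot> zdiv (x - \<theta>) N" using d by (simp add: j_def algebra_simps)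
  have "0 \<le> zdiv (x - \<theta>) N" using le_zdiv_iff[OF N, of 0 "x - \<theta>"] \<theta>(2) by simp
  then have "0 \<le> N \<cdot> zdiv (x - \<theta>) N" using N by (intro zsc_nonneg) auto
  then have lex: "\<theta> + int j \<cdot> zone \<le> x" by (subst xj) simp
  have cong: "zcong N x (\<theta> + int j \<cdot> zone)" unfolding zcong_def using xj by blast
  have inX: "\<theta> + int j \<cdot> zone \<in> X"
  proof (subst inv[of _ x])
   show "zcong N (\<theta> + int j \<cdot> zone) x" using cong by (rule zcong_sym)
   fix \<theta>' assume t: "\<theta>' \<in> \<Theta>"
   have "\<theta> \<le> \<theta> + int j \<cdot> zone" using zone_pos[where 'a = 'a] by (simp add: zsc_nonneg)
   then show "\<theta>' \<le> \<theta> + int j \<cdot> zone \<longleftrightarrow> \<theta>' \<le> x" using \<theta>max[OF t] lex by (meson order_trans)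
  qed (rule x)
  have "(\<theta>, j) \<in> P" unfolding P_def using \<theta> d ex inX lex xnx by (auto simp: j_def)
  moreover have "x \<in> prog N (fst (cell \<theta> j)) (snd (cell \<theta> j))" unfolding mem using lex xnx cong by blast
  ultimately show "\<exists>(\<theta>, j)\<in>P. x \<in> prog N (fst (cell \<theta> j)) (snd (cell \<theta> j))" by blast
 next
  assume "\<exists>(\<theta>, j)\<in>P. x \<in> prog N (fst (cell \<theta> j)) (snd (cell \<theta> j))"
  then obtain \<theta> j where p: "(\<theta>, j) \<in> P" and x: "\<theta> + int j \<cdot> zone \<le> x" "x < nx \<theta>" "zcong N x (\<theta> + int j \<cdot> zone)"
   unfolding mem by blast
  show "x \<in> X"
  proof (subst inv[of _ "\<theta> + int j \<cdot> zone"])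
   show "\<theta> + int j \<cdot> zone \<in> X" using p by (simp add: P_def)
   fix \<theta>' assume "\<theta>' \<in> \<Theta>"
   have "\<theta> \<le> \<theta> + int j \<cdot> zone" using zone_pos[where 'a = 'a] by (simp add: zsc_nonneg)
   moreover have "\<theta>' \<le> \<theta> \<or> nx \<theta> \<le> \<theta>'" using nx(3) \<open>\<theta>' \<in> \<Theta>\<close> p by (auto simp: P_def)
   ultimately show "\<theta>' \<le> x \<longleftrightarrow> \<theta>' \<le> \<theta> + int j \<cdot> zone" using x(1,2)
    by (meson not_le order_trans)
  qed (rule x)
 qed
 have finP: "finite P"
  by (rule finite_subset[of _ "\<Theta> \<times> {..<nat N}"]) (use Th in "auto simp: P_def")
 show ?thesis
 proof (rule that[of N "(\<lambda>(\<theta>, j). cell \<theta> j) ` P"])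
  show "0 < N" "N0 dvd N" using N by (auto simp: N_def)
  show "finite ((\<lambda>(\<theta>, j). cell \<theta> j) ` P)" using finP by simp
  show "(\<lambda>(\<theta>, j). cell \<theta> j) ` P \<subseteq> zhull A \<times> zhull A"
  proof (intro image_subsetI)
   fix p assume p: "p \<in> P"
   obtain \<theta> j where "p = (\<theta>, j)" by (cases p)
   with p show "(case p of (\<theta>, j) => cell \<theta> j) \<in> zhull A \<times> zhull A"
    unfolding cell_def using Th nx(1) N
    by (auto simp: P_def intro!: zhull_add zhull_zsc zhull_zone zhull_zdiv zhull_diff)
  qed
  show "X = (\<Union>(t, a)\<in>(\<lambda>(\<theta>, j). cell \<theta> j) ` P. prog N t a)"
   using XP by (intro set_eqI) (simp add: case_prod_unfold)
  fix t a u b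
  assume "(t, a) \<in> (\<lambda>(\<theta>, j). cell \<theta> j) ` P" "(u, b) \<in> (\<lambda>(\<theta>, j). cell \<theta> j) ` P" "(t, a) \<noteq> (u, b)"
  then obtain \<theta> j \<theta>' j' where *: "(\<theta>, j) \<in> P" "(t, a) = cell \<theta> j" "(\<theta>', j') \<in> P" "(u, b) = cell \<theta>' j'" by auto
  show "prog N t a \<inter> prog N u b = {}"
  proof (rule ccontr)
   assume "prog N t a \<inter> prog N u b \<noteq> {}"
   then obtain x where "x \<in> prog N t a" "x \<in> prog N u b" by blast
   then have "\<theta> = \<theta>' \<and> j = j'" using uniq[OF *(1,3), of x] *(2,4) by (metis fst_conv snd_conv)
   then show False using * \<open>(t, a) \<noteq> (u, b)\<close> by simp
  qed
 qed
qed

section \<open>Positive bases\<close>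

definition indep :: "'a::ab_group_add set => bool" where
 "indep E \<longleftrightarrow> (\<forall>c. (\<Sum>e\<in>E. c e \<cdot> e) = 0 --> (\<forall>e\<in>E. c e = 0))"

definition pos_cone :: "'a::ab_group_add set => 'a set" where
 "pos_cone E = {x. \<exists>c. (\<forall>e\<in>E. 0 \<le> c e) \<and> x = (\<Sum>e\<in>E. c e \<cdot> e)}"

text \<open>A homomorphism from \<open>Sym\<close> to the rationals has the value 1 at
  \<open>zone\<close>. With \<open>zone\<close> among the independent elements, the values at the
  other ones can be prescribed freely.\<close>

definition pbasis :: "'a::zgroup set => 'a set => bool" where
 "pbasis A E \<longleftrightarrow> finite E \<and> zone \<in> E \<and> (\<forall>e\<in>E. 0 < e) \<and> E \<subseteq> zhull A \<and> indep E"

lemma pos_cone_sum: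
 assumes "\<And>i. i \<in> I ==> x i \<in> pos_cone E"
 shows "(\<Sum>i\<in>I. x i) \<in> pos_cone E"
proof -
 have 0: "0 \<in> pos_cone E" unfolding pos_cone_def by (auto intro!: exI[of _ "\<lambda>_. 0"])
 have add: "x + y \<in> pos_cone E" if "x \<in> pos_cone E" "y \<in> pos_cone E" for x y
 proof -
  obtain c d where "\<forall>e\<in>E. 0 \<le> c e" "x = (\<Sum>e\<in>E. c e \<cdot> e)" "\<forall>e\<in>E. 0 \<le> d e" "y = (\<Sum>e\<in>E. d e \<cdot> e)"
   using \<open>x \<in> pos_cone E\<close> \<open>y \<in> pos_cone E\<close> unfolding pos_cone_def by blast
  then show ?thesis unfolding pos_cone_def
   by (auto intro!: exI[of _ "\<lambda>e. c e + d e"] simp: zsc_add_left sum.distrib)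
 qed
 show ?thesis using assms
  by (induction I rule: infinite_finite_induct) (auto simp: 0 add)
qed

lemma pos_cone_zsc:
 assumes "x \<in> pos_cone E" "0 \<le> k" shows "k \<cdot> x \<in> pos_cone E"
proof -
 obtain c where "\<forall>e\<in>E. 0 \<le> c e" "x = (\<Sum>e\<in>E. c e \<cdot> e)" using assms(1) unfolding pos_cone_def by blast
 then show ?thesis unfolding pos_cone_def using assms(2)
  by (auto intro!: exI[of _ "\<lambda>e. k * c e"] simp: zsc_mult zsc_sum_right)
qed

lemma pos_cone_add: "x \<in> pos_cone E ==> y \<in> pos_cone E ==> x + y \<in> pos_cone E"
 using pos_cone_sum[of "UNIV :: bool set" "\<lambda>b. if b then x else y"] by (auto simp: UNIV_bool add.commute)

lemma pos_cone_base:
 assumes "finite E" "e \<in> E" shows "e \<in> pos_cone E"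
proof -
 have "(\<Sum>x\<in>E. (if x = e then 1 else 0) \<cdot> x) = (\<Sum>x\<in>E. if x = e then x else 0)"
  by (rule sum.cong) auto
 then have "e = (\<Sum>x\<in>E. (if x = e then 1 else 0) \<cdot> x)" using assms by simp
 then show ?thesis unfolding pos_cone_def by (intro CollectI exI[of _ "\<lambda>x. if x = e then 1 else 0"]) auto
qed

lemma pos_cone_subset: "E \<subseteq> pos_cone E' ==> pos_cone E \<subseteq> pos_cone E'"
proof
 fix x assume E: "E \<subseteq> pos_cone E'" "x \<in> pos_cone E"
 then obtain c where "\<forall>e\<in>E. 0 \<le> c e" "x = (\<Sum>e\<in>E. c e \<cdot> e)" unfolding pos_cone_def by blast
 then show "x \<in> pos_cone E'" using E(1) by (auto intro!: pos_cone_sum pos_cone_zsc)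
qed

lemma zone_le_pbasis: "pbasis A E ==> e \<in> E ==> zone \<le> e"
 using zone_least unfolding pbasis_def by blast

text \<open>One Euclidean step, from \<open>c p \<cdot> p + c q \<cdot> q = (c p + c q) \<cdot> p +
  c q \<cdot> (q - p)\<close>. The cone can only grow, since \<open>q\<close> is recovered as
  \<open>p + (q - p)\<close>.\<close>

lemma pbasis_step:
 fixes E :: "'a::zgroup set"
 assumes E: "pbasis A E" and pq: "p \<in> E" "q \<in> E" "p < q"
 defines "E' \<equiv> insert (q - p) (E - {q})"
 shows "pbasis A E'" "pos_cone E \<subseteq> pos_cone E'" "q - p \<notin> E"
  "(\<Sum>e\<in>E. c e \<cdot> e) = (\<Sum>e\<in>E'. (c(q - p := c q, p := c p + c q)) e \<cdot> e)"
proof -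
 have fin: "finite E" and pos: "\<And>e. e \<in> E ==> 0 < e" and ind: "indep E"
  using E by (auto simp: pbasis_def)
 have p0: "0 < p" "0 < q" using pos pq by auto
 \<comment> \<open>Otherwise \<open>(q - p) + p - q = 0\<close> would be a relation among elements
   of \<open>E\<close>. So the replacement does not merge two basis elements.\<close>
 show new: "q - p \<notin> E"
 proof
  assume r: "q - p \<in> E"
  let ?d = "\<lambda>x e. (if e = x then 1 else 0 :: int)"
  have s: "(\<Sum>e\<in>E. ?d x e \<cdot> e) = x" if "x \<in> E" for x
  proof -
   have "(\<Sum>e\<in>E. ?d x e \<cdot> e) = (\<Sum>e\<in>E. if e = x then e else 0)" by (rule sum.cong) auto
   then show ?thesis using fin that by simp
  qed
  have "(\<Sum>e\<in>E. (?d (q - p) e + ?d p e - ?d q e) \<cdot> e) = 0"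
   by (simp only: zsc_diff_left zsc_add_left sum.distrib sum_subtractf s[OF r] s[OF pq(1)] s[OF pq(2)]) simp
  then have "?d (q - p) q + ?d p q - ?d q q = 0"
   using ind[unfolded indep_def, THEN spec, of "\<lambda>e. ?d (q - p) e + ?d p e - ?d q e"] pq(2) by blast
  then show False using pq(3) p0 by (auto split: if_splits)
 qed
 have pqne: "q - p \<noteq> p" using new pq by auto
 have key: "(\<Sum>e\<in>E'. c' e \<cdot> e) = (\<Sum>e\<in>E. c e \<cdot> e)"
  if c: "c' (q - p) = c q" "c' p = c p + c q" "\<And>e. e \<in> E ==> e \<noteq> p ==> e \<noteq> q ==> c' e = c e" for c c' :: "'a => int"
 proof -
  have "(\<Sum>e\<in>E'. c' e \<cdot> e) = c q \<cdot> (q - p) + (\<Sum>e\<in>E - {q}. c' e \<cdot> e)"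
   unfolding E'_def using fin new by (subst sum.insert) (auto simp: c)
  also have "(\<Sum>e\<in>E - {q}. c' e \<cdot> e) = c' p \<cdot> p + (\<Sum>e\<in>E - {q} - {p}. c' e \<cdot> e)"
   using fin pq by (subst sum.remove[of _ p]) auto
  also have "(\<Sum>e\<in>E - {q} - {p}. c' e \<cdot> e) = (\<Sum>e\<in>E - {q} - {p}. c e \<cdot> e)"
   by (rule sum.cong) (auto simp: c)
  also have "c q \<cdot> (q - p) + (c' p \<cdot> p + (\<Sum>e\<in>E - {q} - {p}. c e \<cdot> e)) =
    c q \<cdot> q + (c p \<cdot> p + (\<Sum>e\<in>E - {q} - {p}. c e \<cdot> e))"
   by (simp add: c zsc_diff_right zsc_add_left algebra_simps)
  also have "c p \<cdot> p + (\<Sum>e\<in>E - {q} - {p}. c e \<cdot> e) = (\<Sum>e\<in>E - {q}. c e \<cdot> e)"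
   using fin pq by (subst (2) sum.remove[of _ p]) auto
  also have "c q \<cdot> q + (\<Sum>e\<in>E - {q}. c e \<cdot> e) = (\<Sum>e\<in>E. c e \<cdot> e)"
   using fin pq by (subst (2) sum.remove[of _ q]) auto
  finally show ?thesis .
 qed
 show "(\<Sum>e\<in>E. c e \<cdot> e) = (\<Sum>e\<in>E'. (c(q - p := c q, p := c p + c q)) e \<cdot> e)"
  by (rule key[symmetric]) (use pqne new in auto)
 have ind': "indep E'"
  unfolding indep_def
 proof (intro allI impI)
  fix d assume d: "(\<Sum>e\<in>E'. d e \<cdot> e) = 0"
  define c where "c = d(q := d (q - p), p := d p - d (q - p))"
  have "(\<Sum>e\<in>E. c e \<cdot> e) = 0"
   using d by (subst key[symmetric, of d c]) (use pq in "auto simp: c_def")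
  then have z: "\<forall>e\<in>E. c e = 0" using ind unfolding indep_def by blast
  have "q \<noteq> p" using pq by auto
  then have "d (q - p) = 0" using bspec[OF z pq(2)] by (simp add: c_def)
  moreover have "d p = 0" using bspec[OF z pq(1)] calculation by (simp add: c_def)
  moreover have "d e = 0" if "e \<in> E" "e \<noteq> p" "e \<noteq> q" for e
   using bspec[OF z that(1)] that by (simp add: c_def)
  ultimately show "\<forall>e\<in>E'. d e = 0" by (auto simp: E'_def)
 qed
 \<comment> \<open>The larger element of a pair is never the least positive element, so
   \<open>zone\<close> is never the one replaced.\<close>
 have "zone \<noteq> q" using zone_le_pbasis[OF E pq(1)] pq(3) by auto
 then show "pbasis A E'"
  using E ind' pq unfolding pbasis_def E'_def by (auto intro: zhull_diff)
 have "q \<in> pos_cone E'"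
 proof -
  have "q - p \<in> pos_cone E'" "p \<in> pos_cone E'" using fin pq by (auto simp: E'_def intro!: pos_cone_base)
  from pos_cone_add[OF this] show ?thesis by simp
 qed
 then have "E \<subseteq> pos_cone E'" using fin pos_cone_base[of E'] by (auto simp: E'_def)
 then show "pos_cone E \<subseteq> pos_cone E'" by (rule pos_cone_subset)
qed

text \<open>The algorithm subtracts a smaller basis element from a larger one; what decreases is, in lexicographic
 order, the most negative coefficient, the number of its occurrences, and the sum of the positive coefficients.\<close>

lemma pbasis_nonneg:
 fixes E :: "'a::zgroup set"
 assumes "pbasis A E" "0 \<le> (\<Sum>e\<in>E. c e \<cdot> e)"
 shows "\<exists>E'. pbasis A E' \<and> pos_cone E \<subseteq> pos_cone E' \<and> (\<Sum>e\<in>E. c e \<cdot> e) \<in> pos_cone E'"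
proof -
 define m :: "'a set \<times> ('a => int) => nat" where "m = (\<lambda>(E, c). Max ((\<lambda>e. nat (- c e)) ` E))"
 define n :: "'a set \<times> ('a => int) => nat" where "n = (\<lambda>(E, c). card {e \<in> E. nat (- c e) = m (E, c)})"
 define s :: "'a set \<times> ('a => int) => nat" where "s = (\<lambda>(E, c). \<Sum>e\<in>E. nat (c e))"
 define Q where "Q = (\<lambda>(E :: 'a set, c :: 'a => int). pbasis A E --> 0 \<le> (\<Sum>e\<in>E. c e \<cdot> e) -->
  (\<exists>E'. pbasis A E' \<and> pos_cone E \<subseteq> pos_cone E' \<and> (\<Sum>e\<in>E. c e \<cdot> e) \<in> pos_cone E'))"
 have "Q (E, c)"
 proof (induction "(E, c)" arbitrary: E c rule: wf_induct_rule[OF wf_measures[of "[m, n, s]"]])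
  case (1 E c)
  show ?case unfolding Q_def prod.case
  proof (intro impI)
   assume E: "pbasis A E" and x: "0 \<le> (\<Sum>e\<in>E. c e \<cdot> e)"
   have fin: "finite E" and pos: "\<And>e. e \<in> E ==> 0 < e" and ne: "E \<noteq> {}"
    using E by (auto simp: pbasis_def)
   have mge: "nat (- c e) \<le> m (E, c)" if "e \<in> E" for e
    unfolding m_def using fin that by simp
   show "\<exists>E'. pbasis A E' \<and> pos_cone E \<subseteq> pos_cone E' \<and> (\<Sum>e\<in>E. c e \<cdot> e) \<in> pos_cone E'"
   proof (cases "m (E, c) = 0")
    case True
    then have "\<forall>e\<in>E. 0 \<le> c e" using mge by fastforce
    then have "(\<Sum>e\<in>E. c e \<cdot> e) \<in> pos_cone E" unfolding pos_cone_def by blast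
    then show ?thesis using E by blast
   next
    case False
    have "m (E, c) \<in> (\<lambda>e. nat (- c e)) ` E" unfolding m_def prod.case using fin ne by (intro Max_in) auto
    then obtain q where q: "q \<in> E" "m (E, c) = nat (- c q)" by auto
    have cq: "c q < 0" "- c q = int (m (E, c))" using q False by auto
    have "\<exists>p\<in>E. 0 < c p"
    proof (rule ccontr)
     assume "\<not> (\<exists>p\<in>E. 0 < c p)"
     then have "c e \<le> 0" if "e \<in> E" for e using that by (meson not_less)
     then have "(\<Sum>e\<in>E - {q}. c e \<cdot> e) \<le> 0"
     proof (intro sum_nonpos)
      fix e assume "e \<in> E - {q}"
      then have "0 \<le> (- c e) \<cdot> e" using pos[of e] \<open>\<And>e. e \<in> E ==> c e \<le> 0\<close>[of e]
       by (intro zsc_nonneg) auto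
      then show "c e \<cdot> e \<le> 0" by simp
     qed
     moreover have "c q \<cdot> q < 0" using zsc_pos[of "- c q" q] cq(1) pos[OF q(1)] by simp
     ultimately have "(\<Sum>e\<in>E. c e \<cdot> e) < 0"
      unfolding sum.remove[OF fin q(1), of "\<lambda>e. c e \<cdot> e"] by (intro add_neg_nonpos)
     then show False using x by simp
    qed
    then obtain p where p: "p \<in> E" "0 < c p" by blast
    have "p \<noteq> q" using p cq by auto
    \<comment> \<open>The induction hypothesis in reusable form: any Euclidean step that lowers the
      measure finishes the proof.\<close>
    have step: ?thesis
     if ab: "a \<in> E" "b \<in> E" "a < b" and less: "(m (E', c') < m (E, c) \<or> m (E', c') = m (E, c) \<and>
      (n (E', c') < n (E, c) \<or> n (E', c') = n (E, c) \<and> s (E', c') < s (E, c)))"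
      and E': "E' = insert (b - a) (E - {b})" and c': "c' = c(b - a := c b, a := c a + c b)" for a b E' c'
    proof -
     note st = pbasis_step[OF E ab, folded E']
     have eq: "(\<Sum>e\<in>E. c e \<cdot> e) = (\<Sum>e\<in>E'. c' e \<cdot> e)" unfolding c' by (rule st(4))
     have "((E', c'), (E, c)) \<in> measures [m, n, s]" using less by auto
     then have "Q (E', c')" by (rule 1)
     then obtain E'' where "pbasis A E''" "pos_cone E' \<subseteq> pos_cone E''" "(\<Sum>e\<in>E'. c' e \<cdot> e) \<in> pos_cone E''"
      unfolding Q_def using st(1) x eq by auto
     then show ?thesis using st(2) eq by auto
    qed
    show ?thesis
    proof (cases "q < p")
     \<comment> \<open>Now \<open>p\<close> is replaced by \<open>p - q\<close>, and the coefficient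
       of \<open>q\<close> rises to \<open>c q + c p\<close>: one occurrence of the most negative
       coefficient disappears.\<close>
     case True
     note new = pbasis_step(3)[OF E q(1) p(1) True]
     define E' where "E' = insert (p - q) (E - {p})"
     define c' where "c' = c(p - q := c p, q := c q + c p)"
     have qne: "q \<noteq> p - q" using new q by auto
     have fin': "finite E'" using fin by (simp add: E'_def)
     have c'v: "c' (p - q) = c p" "c' q = c q + c p" "\<And>e. e \<in> E ==> e \<noteq> q ==> c' e = c e"
      using qne new by (auto simp: c'_def)
     have le: "nat (- c' e) \<le> m (E, c)" "nat (- c' e) = m (E, c) ==> e \<in> E \<and> nat (- c e) = m (E, c) \<and> e \<noteq> q"
      if "e \<in> E'" for e
     proof -
      have cases3: "e = p - q \<or> e = q \<or> e \<in> E \<and> e \<noteq> q" using that by (auto simp: E'_def)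
      show "nat (- c' e) \<le> m (E, c)"
       using cases3 c'v(1,2) c'v(3)[of e] p(2) cq mge[of e] by auto
      show "nat (- c' e) = m (E, c) ==> e \<in> E \<and> nat (- c e) = m (E, c) \<and> e \<noteq> q"
       using cases3 c'v(1,2) c'v(3)[of e] p(2) cq mge[of e] by auto
     qed
     have m': "m (E', c') \<le> m (E, c)"
      unfolding m_def[of] prod.case using le(1) fin' by (subst Max_le_iff) (auto simp: E'_def m_def)
     have "n (E', c') < n (E, c)" if "m (E', c') = m (E, c)"
     proof -
      have "{e \<in> E'. nat (- c' e) = m (E', c')} \<subset> {e \<in> E. nat (- c e) = m (E, c)}"
       using le(2) q unfolding that by (intro psubsetI) auto
      then show ?thesis unfolding n_def prod.case using fin by (intro psubset_card_mono) auto
     qed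
     then show ?thesis using step[OF q(1) p(1) True _ E'_def c'_def] m' order_le_less by blast
    next
     \<comment> \<open>Now \<open>q\<close> is replaced by \<open>q - p\<close>, which inherits
       \<open>c q\<close>. The most negative coefficient and the number of its occurrences stay the
       same, but the positive coefficient of \<open>p\<close> drops to
       \<open>c p + c q\<close>.\<close>
     case False
     with \<open>p \<noteq> q\<close> have lt: "p < q" by simp
     note new = pbasis_step(3)[OF E p(1) q(1) lt]
     define E' where "E' = insert (q - p) (E - {q})"
     define c' where "c' = c(q - p := c q, p := c p + c q)"
     have pne: "p \<noteq> q - p" using new p by auto
     have fin': "finite E'" using fin by (simp add: E'_def)
     have c'v: "c' (q - p) = c q" "c' p = c p + c q" "\<And>e. e \<in> E ==> e \<noteq> p ==> c' e = c e"
      using pne new by (auto simp: c'_def)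
     have lep: "nat (- c' p) < m (E, c)" using c'v p cq by simp
     have le: "nat (- c' e) \<le> m (E, c)" if "e \<in> E'" for e
     proof -
      have cases3: "e = q - p \<or> e = p \<or> e \<in> E \<and> e \<noteq> p" using that by (auto simp: E'_def)
      show "nat (- c' e) \<le> m (E, c)"
       using cases3 c'v(1,2) c'v(3)[of e] lep cq mge[of e] by auto
     qed
     have m': "m (E', c') = m (E, c)"
     proof (rule antisym)
      show "m (E', c') \<le> m (E, c)"
       unfolding m_def[of] prod.case using le fin' by (subst Max_le_iff) (auto simp: E'_def m_def)
      have "nat (- c' (q - p)) \<le> m (E', c')"
       unfolding m_def prod.case using fin' by (intro Max_ge) (auto simp: E'_def)
      then show "m (E, c) \<le> m (E', c')" using c'v q(2) by simp
     qed
     have "{e \<in> E'. nat (- c' e) = m (E', c')} = insert (q - p) ({e \<in> E. nat (- c e) = m (E, c)} - {q})"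
     proof (intro set_eqI iffI)
      fix e assume e: "e \<in> {e \<in> E'. nat (- c' e) = m (E', c')}"
      then have "e \<noteq> p" using lep m' by auto
      then show "e \<in> insert (q - p) ({e \<in> E. nat (- c e) = m (E, c)} - {q})"
       using e c'v(3)[of e] m' by (auto simp: E'_def)
     next
      fix e assume e: "e \<in> insert (q - p) ({e \<in> E. nat (- c e) = m (E, c)} - {q})"
      have "nat (- c p) \<noteq> m (E, c)" using p q(2) cq(1) by auto
      then show "e \<in> {e \<in> E'. nat (- c' e) = m (E', c')}"
       using e c'v(1) c'v(3)[of e] q(2) m' by (cases "e = p") (auto simp: E'_def)
     qed
     moreover have "card (insert (q - p) ({e \<in> E. nat (- c e) = m (E, c)} - {q})) = card {e \<in> E. nat (- c e) = m (E, c)}"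
     proof -
      have "card {e \<in> E. nat (- c e) = m (E, c)} = Suc (card ({e \<in> E. nat (- c e) = m (E, c)} - {q}))"
       by (rule card.remove) (use fin q in auto)
      then show ?thesis using fin new by (subst card_insert_disjoint) auto
     qed
     ultimately have n': "n (E', c') = n (E, c)" unfolding n_def by simp
     have "s (E', c') < s (E, c)"
     proof -
      have "s (E', c') = nat (c q) + (\<Sum>e\<in>E - {q}. nat (c' e))"
       unfolding s_def E'_def prod.case using fin new by (subst sum.insert) (auto simp: c'v)
      also have "\<dots> < nat (c q) + (\<Sum>e\<in>E - {q}. nat (c e))"
      proof (rule add_strict_left_mono, rule sum_strict_mono_ex1)
       show "\<forall>x\<in>E - {q}. nat (c' x) \<le> nat (c x)" using c'v cq by (metis DiffD1 add.commute add_le_same_cancel2 nat_mono order_refl order_less_imp_le)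
       show "\<exists>a\<in>E - {q}. nat (c' a) < nat (c a)" using c'v cq p \<open>p \<noteq> q\<close> by (intro bexI[of _ p]) auto
      qed (use fin in simp)
      also have "\<dots> = s (E, c)" unfolding s_def prod.case using fin q by (subst (2) sum.remove[of _ q]) auto
      finally show ?thesis .
     qed
     then show ?thesis using step[OF p(1) q(1) lt _ E'_def c'_def] m' n' by blast
    qed
   qed
  qed
 qed
 then show ?thesis using assms unfolding Q_def by simp
qed

text \<open>If \<open>a\<close> is independent of \<open>E\<close>, it is adjoined. Otherwise some
  \<open>N \<cdot> a\<close> is a combination of \<open>E\<close>; dividing the basis elements by
  \<open>N\<close>, with remainders that are multiples of \<open>zone\<close>, gives a finer basis
  of which \<open>a\<close> itself is an integer combination. \<open>pbasis_nonneg\<close> then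
  makes the coefficients nonnegative.\<close>

lemma pbasis_insert:
 fixes E :: "'a::zgroup set"
 assumes E: "pbasis A E" and a: "a \<in> zhull A" "0 \<le> a"
 shows "\<exists>E'. pbasis A E' \<and> pos_cone E \<subseteq> pos_cone E' \<and> a \<in> pos_cone E'"
proof (cases "\<exists>N c. 0 < N \<and> N \<cdot> a = (\<Sum>e\<in>E. c e \<cdot> e)")
 case False
 have fin: "finite E" using E by (simp add: pbasis_def)
 have indE: "indep E" using E by (simp add: pbasis_def)
 have "a \<noteq> 0"
 proof
  assume "a = 0"
  then have "\<exists>N c. 0 < N \<and> N \<cdot> a = (\<Sum>e\<in>E. c e \<cdot> e)"
   by (intro exI[of _ 1] exI[of _ "\<lambda>_. 0"]) simp
  then show False using False by blast
 qed
 have "a \<notin> E"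
 proof
  assume "a \<in> E"
  then obtain c where "a = (\<Sum>e\<in>E. c e \<cdot> e)" using pos_cone_base[OF fin] unfolding pos_cone_def by blast
  then have "\<exists>N c. 0 < N \<and> N \<cdot> a = (\<Sum>e\<in>E. c e \<cdot> e)"
   by (intro exI[of _ 1] exI[of _ c]) simp
  then show False using False by blast
 qed
 have "indep (insert a E)"
  unfolding indep_def
 proof (intro allI impI)
  fix c assume "(\<Sum>e\<in>insert a E. c e \<cdot> e) = 0"
  then have s: "c a \<cdot> a = - (\<Sum>e\<in>E. c e \<cdot> e)" using fin \<open>a \<notin> E\<close> by (simp add: eq_neg_iff_add_eq_0)
  have "c a = 0"
  proof (rule ccontr)
   assume "c a \<noteq> 0"
   then consider "0 < c a" | "0 < - c a" by linarith
   then show False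
   proof cases
    case 1
    have "c a \<cdot> a = (\<Sum>e\<in>E. (- c e) \<cdot> e)" using s by (simp add: sum_negf)
    then have "\<exists>N c. 0 < N \<and> N \<cdot> a = (\<Sum>e\<in>E. c e \<cdot> e)"
     using 1 by (intro exI[of _ "c a"] exI[of _ "\<lambda>e. - c e"]) simp
    then show False using False by blast
   next
    case 2
    have "(- c a) \<cdot> a = (\<Sum>e\<in>E. c e \<cdot> e)" using s by simp
    then have "\<exists>N c. 0 < N \<and> N \<cdot> a = (\<Sum>e\<in>E. c e \<cdot> e)"
     using 2 by (intro exI[of _ "- c a"] exI[of _ c]) simp
    then show False using False by blast
   qed
  qed
  then show "\<forall>e\<in>insert a E. c e = 0" using s indE unfolding indep_def by simp
 qed
 then have "pbasis A (insert a E)" using E a \<open>a \<noteq> 0\<close> unfolding pbasis_def by auto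
 moreover have "pos_cone E \<subseteq> pos_cone (insert a E)" using fin by (intro pos_cone_subset) (auto intro: pos_cone_base)
 ultimately show ?thesis using fin pos_cone_base[of "insert a E" a] by blast
next
 case True
 then obtain N c where N: "0 < N" "N \<cdot> a = (\<Sum>e\<in>E. c e \<cdot> e)" by blast
 have fin: "finite E" and pos: "\<And>e. e \<in> E ==> 0 < e" and ind: "indep E" and zE: "zone \<in> E"
  using E by (auto simp: pbasis_def)
 \<comment> \<open>\<open>zone\<close> is kept, because its quotient by \<open>N\<close> would be 0
   for \<open>N > 1\<close>, and because it carries the remainders of the other elements.\<close>
 define \<phi> :: "'a => 'a" where "\<phi> = (\<lambda>e. if e = zone then zone else zdiv e N)"
 define r :: "'a => int" where "r = (\<lambda>e. zmod e N)"
 have e: "e = N \<cdot> \<phi> e + r e \<cdot> zone" if "e \<noteq> zone" for e :: 'a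
  using zdiv_zmod[OF N(1), of e] that by (simp add: \<phi>_def r_def)
 \<comment> \<open>A relation among the quotients, multiplied by \<open>N\<close>, becomes a
   relation among the elements of \<open>E\<close>, all remainders being collected in the
   coefficient of \<open>zone\<close>.\<close>
 have fam: "\<forall>e\<in>E. d e = 0" if "(\<Sum>e\<in>E. d e \<cdot> \<phi> e) = 0" for d
 proof -
  define R where "R = (\<Sum>e\<in>E - {zone}. d e * r e)"
  have "0 = N \<cdot> (\<Sum>e\<in>E. d e \<cdot> \<phi> e)" using that by simp
  also have "\<dots> = N \<cdot> d zone \<cdot> zone + (\<Sum>e\<in>E - {zone}. N \<cdot> d e \<cdot> \<phi> e)"
   using fin zE by (subst sum.remove[of _ zone]) (auto simp: zsc_add_right zsc_sum_right \<phi>_def)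
  also have "(\<Sum>e\<in>E - {zone}. N \<cdot> d e \<cdot> \<phi> e) = (\<Sum>e\<in>E - {zone}. d e \<cdot> e - (d e * r e) \<cdot> zone)"
  proof (rule sum.cong)
   fix x assume "x \<in> E - {zone}"
   then have "d x \<cdot> x = d x \<cdot> (N \<cdot> \<phi> x + r x \<cdot> zone)" using e[of x] by auto
   then show "N \<cdot> d x \<cdot> \<phi> x = d x \<cdot> x - (d x * r x) \<cdot> zone"
    by (simp add: zsc_add_right zsc_mult[symmetric] mult.commute)
  qed simp
  also have "\<dots> = (\<Sum>e\<in>E - {zone}. d e \<cdot> e) - R \<cdot> zone"
   by (simp add: sum_subtractf R_def zsc_sum_left)
  finally have "(N * d zone - R) \<cdot> zone + (\<Sum>e\<in>E - {zone}. d e \<cdot> e) = 0"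
   by (simp add: zsc_diff_left zsc_mult algebra_simps)
  then have "(\<Sum>e\<in>E. (d(zone := N * d zone - R)) e \<cdot> e) = 0"
   using fin zE by (subst sum.remove[of _ zone]) auto
  then have *: "\<forall>e\<in>E. (d(zone := N * d zone - R)) e = 0" using ind unfolding indep_def by blast
  have d0: "d e = 0" if "e \<in> E - {zone}" for e using bspec[OF *, of e] that by simp
  then have "R = 0" by (simp add: R_def)
  then have "d zone = 0" using bspec[OF * zE] N(1) by simp
  then show ?thesis using d0 by auto
 qed
 have inj: "inj_on \<phi> E"
 proof (rule inj_onI, rule ccontr)
  fix x y assume xy: "x \<in> E" "y \<in> E" "\<phi> x = \<phi> y" "x \<noteq> y"
  have "(\<Sum>e\<in>E. ((if e = x then 1 else 0) - (if e = y then 1 else 0)) \<cdot> \<phi> e) =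
    (\<Sum>e\<in>E. (if e = x then \<phi> e else 0) - (if e = y then \<phi> e else 0))"
   by (rule sum.cong) (auto simp: zsc_diff_left)
  also have "\<dots> = 0" using fin xy by (simp add: sum_subtractf)
  finally have "\<forall>e\<in>E. (if e = x then 1 else 0) - (if e = y then 1 else 0 :: int) = 0" by (rule fam)
  then show False using xy by auto
 qed
 define E' where "E' = \<phi> ` E"
 have fin': "finite E'" using fin by (simp add: E'_def)
 have sumE': "(\<Sum>e\<in>E'. d e \<cdot> e) = (\<Sum>e\<in>E. d (\<phi> e) \<cdot> \<phi> e)" for d
  unfolding E'_def using inj by (simp add: sum.reindex)
 have ind': "indep E'" unfolding indep_def sumE' using fam[of "\<lambda>e. _ (\<phi> e)"] by (auto simp: E'_def)
 have pos': "0 < \<phi> e" if "e \<in> E" for e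
 proof (cases "e = zone")
  case False
  have "0 \<le> \<phi> e" using le_zdiv_iff[OF N(1), of 0 e] pos[OF that] False by (simp add: \<phi>_def)
  moreover have "\<phi> e \<noteq> 0"
  proof
   assume "\<phi> e = 0"
   then have "(\<Sum>x\<in>E. (if x = e then 1 else 0) \<cdot> \<phi> x) = 0" by (intro sum.neutral) auto
   from fam[OF this] that show False by auto
  qed
  ultimately show ?thesis by simp
 qed (simp add: \<phi>_def zone_pos)
 have zE': "zone \<in> E'" using zE by (auto simp: E'_def \<phi>_def intro!: image_eqI[of _ _ zone])
 have "E' \<subseteq> zhull A" using E N(1) by (auto simp: E'_def \<phi>_def pbasis_def intro: zhull_zdiv)
 then have pb: "pbasis A E'" using fin' ind' pos' zE' by (auto simp: pbasis_def E'_def)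
 have "E \<subseteq> pos_cone E'"
 proof
  fix x assume x: "x \<in> E"
  show "x \<in> pos_cone E'"
  proof (cases "x = zone")
   case False
   have "N \<cdot> \<phi> x + r x \<cdot> zone \<in> pos_cone E'"
    using N(1) zdiv_zmod[OF N(1), of x] x zE'
    by (intro pos_cone_add pos_cone_zsc pos_cone_base fin') (auto simp: E'_def r_def)
   then show ?thesis using e[OF False] by simp
  qed (use pos_cone_base[OF fin' zE'] in simp)
 qed
 then have sub: "pos_cone E \<subseteq> pos_cone E'" by (rule pos_cone_subset)
 define S where "S = (\<Sum>e\<in>E - {zone}. c e \<cdot> \<phi> e)"
 define k where "k = c zone + (\<Sum>e\<in>E - {zone}. c e * r e)"
 have "N \<cdot> a = c zone \<cdot> zone + (\<Sum>e\<in>E - {zone}. c e \<cdot> e)"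
  unfolding N(2) using fin zE by (subst sum.remove[of _ zone]) auto
 also have "(\<Sum>e\<in>E - {zone}. c e \<cdot> e) = (\<Sum>e\<in>E - {zone}. N \<cdot> c e \<cdot> \<phi> e + (c e * r e) \<cdot> zone)"
 proof (rule sum.cong)
  fix x assume "x \<in> E - {zone}"
  then have "c x \<cdot> x = c x \<cdot> (N \<cdot> \<phi> x + r x \<cdot> zone)" using e[of x] by auto
  then show "c x \<cdot> x = N \<cdot> c x \<cdot> \<phi> x + (c x * r x) \<cdot> zone"
   by (simp add: zsc_add_right zsc_mult[symmetric] mult.commute)
 qed simp
 also have "c zone \<cdot> zone + \<dots> = N \<cdot> S + k \<cdot> zone"
  by (simp add: sum.distrib S_def k_def zsc_sum_right zsc_sum_left zsc_add_left algebra_simps)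
 finally have Na: "N \<cdot> a = N \<cdot> S + k \<cdot> zone" .
 \<comment> \<open>Uniqueness of division with remainder, applied to
   \<open>N \<cdot> (a - S) = k \<cdot> zone\<close>, shows that \<open>N\<close> divides
   \<open>k\<close>.\<close>
 obtain l where l: "k = N * l"
 proof -
  have "N \<cdot> (a - S) + 0 \<cdot> zone = N \<cdot> ((k div N) \<cdot> zone) + (k mod N) \<cdot> zone"
  proof -
   have "k \<cdot> zone = (N * (k div N) + k mod N) \<cdot> (zone :: 'a)" by simp
   also have "\<dots> = N \<cdot> ((k div N) \<cdot> zone) + (k mod N) \<cdot> zone" by (simp only: zsc_add_left zsc_mult)
   finally show ?thesis using Na by (simp add: zsc_diff_right)
  qed
  from zdivision_unique[OF this] N(1) have "k mod N = 0" by simp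
  then show ?thesis using that by (auto elim: dvdE)
 qed
 have "N \<cdot> a = N \<cdot> (S + l \<cdot> zone)" using Na l by (simp add: zsc_add_right zsc_mult)
 then have "a = S + l \<cdot> zone" using zsc_cancel[of N a "S + l \<cdot> zone"] N(1) by simp
 also have "\<dots> = (\<Sum>e\<in>E. (c(zone := l)) e \<cdot> \<phi> e)"
  using fin zE by (subst sum.remove[of _ zone]) (auto simp: S_def \<phi>_def add.commute intro!: sum.cong)
 also have "\<dots> = (\<Sum>e\<in>E'. ((c(zone := l)) \<circ> the_inv_into E \<phi>) e \<cdot> e)"
  unfolding sumE' by (rule sum.cong) (auto simp: the_inv_into_f_f[OF inj])
 finally have "0 \<le> (\<Sum>e\<in>E'. ((c(zone := l)) \<circ> the_inv_into E \<phi>) e \<cdot> e)"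
  and "a = (\<Sum>e\<in>E'. ((c(zone := l)) \<circ> the_inv_into E \<phi>) e \<cdot> e)" using a by simp_all
 with pbasis_nonneg[OF pb this(1)] sub show ?thesis by auto
qed

lemma pbasis_exists:
 fixes F :: "'a::zgroup set"
 assumes "finite F" "F \<subseteq> zhull A" "\<And>a. a \<in> F ==> 0 \<le> a"
 shows "\<exists>E. pbasis A E \<and> F \<subseteq> pos_cone E"
 using assms
proof (induction F)
 case empty
 have "indep {zone :: 'a}" unfolding indep_def using zone_pos[where 'a = 'a] by (auto simp: zsc_eq_0)
 then have "pbasis A {zone}" unfolding pbasis_def using zone_pos zhull_zone by auto
 then show ?case by blast
next
 case (insert a F)
 then obtain E where "pbasis A E" "F \<subseteq> pos_cone E" by auto
 with pbasis_insert[OF this(1), of a] insert.prems show ?case by blast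
qed

section \<open>Definable decompositions\<close>

text \<open>\<open>G i\<close> is the set of all \<open>x @ z\<close> such that the point \<open>x\<close> of \<open>X\<close> corresponds to the point \<open>z\<close> of the
 summand \<open>B i\<close>, under a bijection from \<open>X\<close> to the disjoint union of the \<open>B i\<close>. The conditions are
 first-order, so that they define a definable set of parameters in a definable family.\<close>

definition is_graph ::
  "nat => 'a list set => 'i set => ('i => nat) => ('i => 'a list set) => ('i => 'a list set) => bool" where
 "is_graph n X I m B G \<longleftrightarrow>
   (\<forall>i\<in>I. \<forall>x. length x = n --> (\<forall>z. length z = m i --> (x @ z \<in> G i --> x \<in> X \<and> z \<in> B i))) \<and>
   (\<forall>x. length x = n --> (x \<in> X --> (\<exists>i\<in>I. \<exists>z. length z = m i \<and> x @ z \<in> G i))) \<and>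
   (\<forall>i\<in>I. \<forall>j\<in>I. \<forall>x. length x = n --> (\<forall>z. length z = m i --> (\<forall>z'. length z' = m j -->
    (x @ z \<in> G i \<and> x @ z' \<in> G j --> i = j \<and> z = z')))) \<and>
   (\<forall>i\<in>I. \<forall>z. length z = m i --> (z \<in> B i --> (\<exists>x. length x = n \<and> x @ z \<in> G i))) \<and>
   (\<forall>i\<in>I. \<forall>z. length z = m i --> (\<forall>x. length x = n --> (\<forall>x'. length x' = n -->
    (x @ z \<in> G i \<and> x' @ z \<in> G i --> x = x'))))"

text \<open>The type of indices is arbitrary, so that iterated decompositions can be indexed by
  dependent pairs.\<close>

definition dsum ::
  "'a::linordered_ab_group_add set => nat => 'a list set => 'i set => ('i => nat) => ('i => 'a list set) => bool" where
 "dsum A n X I m B \<longleftrightarrow> finite I \<and> (\<forall>x\<in>X. length x = n) \<and> (\<forall>i\<in>I. \<forall>z\<in>B i. length z = m i) \<and>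
   (\<exists>G. (\<forall>i\<in>I. definable_over A (n + m i) (G i)) \<and> is_graph n X I m B G)"

lemma dsum_mono: "dsum A n X I m B ==> A \<subseteq> A' ==> dsum A' n X I m B"
 unfolding dsum_def using definable_mono by blast

text \<open>The five clauses of \<open>is_graph\<close> say in turn that the relation lives on
  \<open>X\<close> and the pieces, is total on \<open>X\<close>, is single-valued (in the index
  too), reaches every point of every piece, and is injective.\<close>

lemma is_graph_bij:
 assumes X: "\<And>x. x \<in> X ==> length x = n" and B: "\<And>i z. i \<in> I ==> z \<in> B i ==> length z = m i"
  and G: "is_graph n X I m B G"
 obtains h where "bij_betw h X (Sigma I B)"
  "\<And>i x z. i \<in> I ==> length x = n ==> length z = m i ==> x @ z \<in> G i \<longleftrightarrow> x \<in> X \<and> h x = (i, z)"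
proof -
 have a: "\<And>i x z. i \<in> I ==> length x = n ==> length z = m i ==> x @ z \<in> G i ==> x \<in> X \<and> z \<in> B i"
  using G unfolding is_graph_def by (elim conjE) blast
 have b: "\<And>x. x \<in> X ==> \<exists>i\<in>I. \<exists>z. length z = m i \<and> x @ z \<in> G i"
  using G X unfolding is_graph_def by (elim conjE) blast
 have c: "\<And>i j x z z'. i \<in> I ==> j \<in> I ==> length x = n ==> length z = m i ==> length z' = m j ==>
   x @ z \<in> G i ==> x @ z' \<in> G j ==> i = j \<and> z = z'"
  using G unfolding is_graph_def by (elim conjE) blast
 have d: "\<And>i z. i \<in> I ==> z \<in> B i ==> \<exists>x. length x = n \<and> x @ z \<in> G i"
  using G B unfolding is_graph_def by (elim conjE) blast
 have e: "\<And>i x x' z. i \<in> I ==> length z = m i ==> length x = n ==> length x' = n ==>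
   x @ z \<in> G i ==> x' @ z \<in> G i ==> x = x'"
  using G unfolding is_graph_def by (elim conjE) blast
 have "\<forall>x\<in>X. \<exists>p. fst p \<in> I \<and> length (snd p) = m (fst p) \<and> x @ snd p \<in> G (fst p)"
  using b by fastforce
 then obtain h where h: "\<And>x. x \<in> X ==> fst (h x) \<in> I \<and> length (snd (h x)) = m (fst (h x)) \<and> x @ snd (h x) \<in> G (fst (h x))"
  by metis
 have eq: "x @ z \<in> G i \<longleftrightarrow> x \<in> X \<and> h x = (i, z)" if "i \<in> I" "length x = n" "length z = m i" for i x z
 proof
  assume xz: "x @ z \<in> G i"
  then have x: "x \<in> X" using a that by blast
  have "fst (h x) = i \<and> snd (h x) = z" using c[OF _ that(1,2) _ that(3) _ xz] h[OF x] by blast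
  then show "x \<in> X \<and> h x = (i, z)" using x by (metis prod.collapse)
 next
  assume "x \<in> X \<and> h x = (i, z)"
  then show "x @ z \<in> G i" using h[of x] by simp
 qed
 have "bij_betw h X (Sigma I B)"
  unfolding bij_betw_def
 proof (intro conjI inj_onI set_eqI iffI)
  fix x y assume xy: "x \<in> X" "y \<in> X" "h x = h y"
  then show "x = y" using e[of "fst (h x)" "snd (h x)" x y] h[of x] h[of y] X by simp
 next
  fix p assume "p \<in> h ` X"
  then obtain x where x: "x \<in> X" "p = h x" by blast
  then have "snd p \<in> B (fst p)" using a h[OF x(1)] X by blast
  then show "p \<in> Sigma I B" using h[OF x(1)] x by (metis SigmaI prod.collapse)
 next
  fix p assume "p \<in> Sigma I B"
  then obtain i z where p: "p = (i, z)" "i \<in> I" "z \<in> B i" by blast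
  then obtain x where x: "length x = n" "x @ z \<in> G i" using d by blast
  then have "x \<in> X \<and> h x = (i, z)" using eq[OF p(2) x(1) B[OF p(2,3)]] by blast
  then show "p \<in> h ` X" using p by force
 qed
 then show ?thesis using eq that by blast
qed

lemma is_graph_cong:
 assumes "\<And>i. i \<in> I ==> G i = G' i"
 shows "is_graph n X I m B G = is_graph n X I m B G'"
 unfolding is_graph_def by (simp only: assms cong: ball_cong bex_cong)

lemma bij_is_graph:
 assumes X: "\<And>x. x \<in> X ==> length x = n" and B: "\<And>i z. i \<in> I ==> z \<in> B i ==> length z = m i"
  and h: "bij_betw h X (Sigma I B)"
  and G: "\<And>i x z. i \<in> I ==> length x = n ==> length z = m i ==> x @ z \<in> G i \<longleftrightarrow> x \<in> X \<and> h x = (i, z)"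
 shows "is_graph n X I m B G"
proof -
 have im: "h x \<in> Sigma I B" if "x \<in> X" for x using h that by (auto simp: bij_betw_def)
 have inj: "x = y" if "x \<in> X" "y \<in> X" "h x = h y" for x y using h that by (auto simp: bij_betw_def inj_on_def)
 have surj: "\<exists>x\<in>X. h x = (i, z)" if "i \<in> I" "z \<in> B i" for i z
 proof -
  have "(i, z) \<in> h ` X" using h that by (auto simp: bij_betw_def)
  then show ?thesis by force
 qed
 show ?thesis
  unfolding is_graph_def
 proof (intro conjI ballI allI impI)
  fix i x z assume *: "i \<in> I" "length x = n" "length z = m i" "x @ z \<in> G i"
  then have "x \<in> X" "h x = (i, z)" using G by blast+
  with im[of x] show "x \<in> X" "z \<in> B i" by auto
 next
  fix x assume "x \<in> X"
  then obtain i z where "h x = (i, z)" "i \<in> I" "z \<in> B i" using im[of x] by auto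
  then show "\<exists>i\<in>I. \<exists>z. length z = m i \<and> x @ z \<in> G i" using G X B \<open>x \<in> X\<close> by blast
 next
  fix i j x z z'
  assume "i \<in> I" "j \<in> I" "length x = n" "length z = m i" "length z' = m j" "x @ z \<in> G i \<and> x @ z' \<in> G j"
  then have "h x = (i, z)" "h x = (j, z')" using G by blast+
  then show "i = j" "z = z'" by simp_all
 next
  fix i z assume "i \<in> I" "length z = m i" "z \<in> B i"
  then show "\<exists>x. length x = n \<and> x @ z \<in> G i" using surj[of i z] G X by blast
 next
  fix i z x x' assume "i \<in> I" "length z = m i" "length x = n" "length x' = n" "x @ z \<in> G i \<and> x' @ z \<in> G i"
  then have "x \<in> X" "x' \<in> X" "h x = h x'" using G by fastforce+
  then show "x = x'" by (rule inj)
 qed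
qed

text \<open>\<open>dsum\<close> asserts only the existence of graphs; this form also names the
  bijection that they encode, for use in compositions.\<close>

definition dvia where
 "dvia A n X I m B h G \<longleftrightarrow> finite I \<and> (\<forall>x\<in>X. length x = n) \<and> (\<forall>i\<in>I. \<forall>z\<in>B i. length z = m i) \<and>
   bij_betw h X (Sigma I B) \<and> (\<forall>i\<in>I. definable_over A (n + m i) (G i)) \<and>
   (\<forall>i\<in>I. \<forall>x z. length x = n --> length z = m i --> (x @ z \<in> G i \<longleftrightarrow> x \<in> X \<and> h x = (i, z)))"

lemma dviaD:
 assumes "dvia A n X I m B h G"
 shows "finite I" "\<And>x. x \<in> X ==> length x = n" "\<And>i z. i \<in> I ==> z \<in> B i ==> length z = m i"
  "bij_betw h X (Sigma I B)" "\<And>i. i \<in> I ==> definable_over A (n + m i) (G i)"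
  "\<And>i x z. i \<in> I ==> length x = n ==> length z = m i ==> x @ z \<in> G i \<longleftrightarrow> x \<in> X \<and> h x = (i, z)"
proof -
 note d = assms[unfolded dvia_def]
 show "finite I" by (rule d[THEN conjunct1])
 show "x \<in> X ==> length x = n" for x by (rule d[THEN conjunct2, THEN conjunct1, THEN bspec])
 show "i \<in> I ==> z \<in> B i ==> length z = m i" for i z
  by (rule d[THEN conjunct2, THEN conjunct2, THEN conjunct1, THEN bspec, THEN bspec])
 show "bij_betw h X (Sigma I B)" by (rule d[THEN conjunct2, THEN conjunct2, THEN conjunct2, THEN conjunct1])
 show "i \<in> I ==> definable_over A (n + m i) (G i)" for i
  by (rule d[THEN conjunct2, THEN conjunct2, THEN conjunct2, THEN conjunct2, THEN conjunct1, THEN bspec])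
 show "i \<in> I ==> length x = n ==> length z = m i ==> x @ z \<in> G i \<longleftrightarrow> x \<in> X \<and> h x = (i, z)" for i x z
  by (rule d[THEN conjunct2, THEN conjunct2, THEN conjunct2, THEN conjunct2, THEN conjunct2,
    THEN bspec, THEN spec, THEN spec, THEN mp, THEN mp])
qed

lemma dsum_dvia:
 assumes "dsum A n X I m B"
 obtains h G where "dvia A n X I m B h G"
proof -
 obtain G where d: "finite I" "\<forall>x\<in>X. length x = n" "\<forall>i\<in>I. \<forall>z\<in>B i. length z = m i"
   and G: "\<forall>i\<in>I. definable_over A (n + m i) (G i)" "is_graph n X I m B G"
  using assms unfolding dsum_def by blast
 show ?thesis
 proof (rule is_graph_bij[OF _ _ G(2)])
  fix h assume "bij_betw h X (Sigma I B)"
   "\<And>i x z. i \<in> I ==> length x = n ==> length z = m i ==> x @ z \<in> G i \<longleftrightarrow> x \<in> X \<and> h x = (i, z)"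
  then have "dvia A n X I m B h G" unfolding dvia_def using d G(1) by (intro conjI ballI allI impI) auto
  then show ?thesis by (rule that)
 qed (use d in auto)
qed

lemma dsumI:
 assumes "finite I" "\<And>x. x \<in> X ==> length x = n" "\<And>i z. i \<in> I ==> z \<in> B i ==> length z = m i"
  "bij_betw h X (Sigma I B)" "\<And>i. i \<in> I ==> definable_over A (n + m i) (G i)"
  "\<And>i x z. i \<in> I ==> length x = n ==> length z = m i ==> x @ z \<in> G i \<longleftrightarrow> x \<in> X \<and> h x = (i, z)"
 shows "dsum A n X I m B"
 unfolding dsum_def
 by (intro conjI exI[of _ G] ballI bij_is_graph[OF assms(2-4,6)]) (use assms(1-3,5) in simp_all)

lemma DfnlI:
 assumes "\<And>v. f v = map (\<lambda>j. t j v) [0..<n]" "\<And>j. j < n ==> Dfn A (t j)"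
 shows "Dfnl A n f"
 unfolding Dfnl_def using assms by simp

lemma split_list_set:
 assumes "length w = n + m"
 shows "\<exists>x z. w = x @ z \<and> length x = n \<and> length z = m"
 using assms by (intro exI[of _ "take n w"] exI[of _ "drop n w"]) auto

text \<open>Decompositions mostly arise from definable maps out of the pieces. The graphs are read
  off from these maps, and the bijection of \<open>dsum\<close> is their joint inverse.\<close>

lemma dsum_map:
 fixes A :: "'a::linordered_ab_group_add set"
 assumes "finite I" "\<And>i. i \<in> I ==> definable_over A (m i) (B i)"
  and g: "\<And>i. i \<in> I ==> Dfnl A n (\<lambda>v. g i (map v [0..<m i]))"
  and bij: "bij_betw (\<lambda>(i, z). g i z) (Sigma I B) X"
 shows "dsum A n X I m B"
proof -
 have len: "length (g i z) = n" if "i \<in> I" "z \<in> B i" for i z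
 proof -
  have "length z = m i" using definable_length[OF assms(2)] that by blast
  then have "z = map (\<lambda>j. z ! j) [0..<m i]" by (intro nth_equalityI) auto
  then show ?thesis using Dfnl_length[OF g[OF that(1)], of "\<lambda>j. z ! j"] by simp
 qed
 have X: "\<exists>i\<in>I. \<exists>z\<in>B i. x = g i z" if "x \<in> X" for x
 proof -
  have "x \<in> (\<lambda>(i, z). g i z) ` Sigma I B" using bij that by (simp add: bij_betw_def)
  then show ?thesis by auto
 qed
 define h where "h = the_inv_into (Sigma I B) (\<lambda>(i, z). g i z)"
 have inj: "inj_on (\<lambda>(i, z). g i z) (Sigma I B)" using bij by (simp add: bij_betw_def)
 have hg: "h (g i z) = (i, z)" if "i \<in> I" "z \<in> B i" for i z
  using the_inv_into_f_f[OF inj, of "(i, z)"] that by (simp add: h_def)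
 show ?thesis
 proof (rule dsumI[where h = h and G = "\<lambda>i. {w. length w = n + m i \<and> drop n w \<in> B i \<and> take n w = g i (drop n w)}"])
  show "finite I" by fact
  show "\<And>x. x \<in> X ==> length x = n" using X len by auto
  show "\<And>i z. i \<in> I ==> z \<in> B i ==> length z = m i" using definable_length[OF assms(2)] by blast
  show "bij_betw h X (Sigma I B)" unfolding h_def using bij by (rule bij_betw_the_inv_into)
  show "definable_over A (n + m i) {w. length w = n + m i \<and> drop n w \<in> B i \<and> take n w = g i (drop n w)}" if "i \<in> I" for i
  proof (rule definableI)
   have 1: "drop n (map v [0..<n + m i]) = map (\<lambda>j. v (j + n)) [0..<m i]" for v :: "nat => 'a"
    by (rule nth_equalityI) (auto simp: add.commute)
   have 2: "take n (map v [0..<n + m i]) = map v [0..<n]" for v :: "nat => 'a"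
    by (rule nth_equalityI) auto
   show "Def A (\<lambda>v. drop n (map v [0..<n + m i]) \<in> B i \<and>
     take n (map v [0..<n + m i]) = g i (drop n (map v [0..<n + m i])))"
    unfolding 1 2
   proof (intro Def_conj)
    show "Def A (\<lambda>v. map (\<lambda>j. v (j + n)) [0..<m i] \<in> B i)"
     by (rule Def_mem[OF assms(2)[OF that]], rule Dfnl_upt, rule Dfn_var)
    show "Def A (\<lambda>v. map v [0..<n] = g i (map (\<lambda>j. v (j + n)) [0..<m i]))"
     by (rule Def_eql[OF Dfnl_vars], rule Dfnl_reindex[OF g[OF that], of "\<lambda>j. j + n"])
   qed
  qed
  fix i and x z :: "'a list" assume i: "i \<in> I" and x: "length x = n" and z: "length z = m i"
  show "x @ z \<in> {w. length w = n + m i \<and> drop n w \<in> B i \<and> take n w = g i (drop n w)} \<longleftrightarrow> x \<in> X \<and> h x = (i, z)"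
  proof
   assume "x @ z \<in> {w. length w = n + m i \<and> drop n w \<in> B i \<and> take n w = g i (drop n w)}"
   then have zx: "z \<in> B i" "x = g i z" using x by auto
   moreover have "g i z \<in> X" using bij i zx(1) by (force simp: bij_betw_def)
   ultimately show "x \<in> X \<and> h x = (i, z)" using hg i by blast
  next
   assume *: "x \<in> X \<and> h x = (i, z)"
   then obtain j y where "j \<in> I" "y \<in> B j" "x = g j y" using X by blast
   then have "z \<in> B i" "x = g i z" using hg * by auto
   then show "x @ z \<in> {w. length w = n + m i \<and> drop n w \<in> B i \<and> take n w = g i (drop n w)}"
    using x z by auto
  qed
 qed
qed

lemma dsum_partition:
 assumes "finite I" "\<And>i. i \<in> I ==> definable_over A n (B i)" "X = (\<Union>i\<in>I. B i)"
  "\<And>i j. i \<in> I ==> j \<in> I ==> i \<noteq> j ==> B i \<inter> B j = {}"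
 shows "dsum A n X I (\<lambda>_. n) B"
proof (rule dsum_map[where g = "\<lambda>i z. z"])
 show "bij_betw (\<lambda>(i, z). z) (Sigma I B) X"
  unfolding bij_betw_def assms(3)
 proof
  show "inj_on (\<lambda>(i, z). z) (Sigma I B)" using assms(4) by (fastforce simp: inj_on_def)
  show "(\<lambda>(i, z). z) ` Sigma I B = (\<Union>i\<in>I. B i)" by force
 qed
qed (use assms Dfnl_vars in auto)

lemma dsum_reindex:
 assumes "dsum A n X I m B" "bij_betw f J I"
 shows "dsum A n X J (\<lambda>j. m (f j)) (\<lambda>j. B (f j))"
proof -
 from assms(1) obtain h G where "dvia A n X I m B h G" by (rule dsum_dvia)
 note d = dviaD[OF this]
 have fI: "f j \<in> I" if "j \<in> J" for j using assms(2) that by (auto simp: bij_betw_def)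
 have inj: "inj_on f J" and im: "f ` J = I" using assms(2) by (auto simp: bij_betw_def)
 define k where "k = (\<lambda>(i, z). (the_inv_into J f i, z :: 'a list))"
 have kf: "k (f j, z) = (j, z)" if "j \<in> J" for j z using the_inv_into_f_f[OF inj that] by (simp add: k_def)
 show ?thesis
 proof (rule dsumI[where h = "k \<circ> h" and G = "\<lambda>j. G (f j)"])
  show "finite J" using d(1) bij_betw_finite[OF assms(2)] by simp
  have "bij_betw k (Sigma I B) (Sigma J (\<lambda>j. B (f j)))"
   unfolding bij_betw_def
  proof
   show "inj_on k (Sigma I B)"
   proof (rule inj_onI)
    fix p q assume pq: "p \<in> Sigma I B" "q \<in> Sigma I B" "k p = k q"
    obtain j z where p: "p = (f j, z)" "j \<in> J" using pq(1) im by blast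
    obtain j' z' where q: "q = (f j', z')" "j' \<in> J" using pq(2) im by blast
    show "p = q" using pq(3) kf[OF p(2), of z] kf[OF q(2), of z'] unfolding p q by simp
   qed
   show "k ` Sigma I B = Sigma J (\<lambda>j. B (f j))"
   proof (intro set_eqI iffI)
    fix p assume "p \<in> k ` Sigma I B"
    then obtain j z where "j \<in> J" "z \<in> B (f j)" "p = k (f j, z)" using im by auto
    then show "p \<in> Sigma J (\<lambda>j. B (f j))" using kf by simp
   next
    fix p assume "p \<in> Sigma J (\<lambda>j. B (f j))"
    then obtain j z where "j \<in> J" "z \<in> B (f j)" "p = (j, z)" by blast
    then show "p \<in> k ` Sigma I B" using kf[of j z] fI by (intro image_eqI[of _ _ "(f j, z)"]) auto
   qed
  qed
  then show "bij_betw (k \<circ> h) X (Sigma J (\<lambda>j. B (f j)))" using d(4) bij_betw_trans by blast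
  fix j and x z :: "'a list" assume j: "j \<in> J" and l: "length x = n" "length z = m (f j)"
  have "(k \<circ> h) x = (j, z) \<longleftrightarrow> h x = (f j, z)" if "x \<in> X"
  proof -
   have "h x \<in> Sigma I B" using d(4) that by (auto simp: bij_betw_def)
   then obtain j' z' where "h x = (f j', z')" "j' \<in> J" using im by auto
   then show ?thesis using kf inj j by (auto simp: inj_on_def)
  qed
  then show "x @ z \<in> G (f j) \<longleftrightarrow> x \<in> X \<and> (k \<circ> h) x = (j, z)" using d(6)[OF fI[OF j] l] by blast
 qed (use d fI in auto)
qed

lemma dsum_cong:
 assumes "dsum A n X I m B" "\<And>i. i \<in> I ==> m i = m' i" "\<And>i. i \<in> I ==> B i = B' i"
 shows "dsum A n X I m' B'"
proof -
 from assms(1) obtain h G where "dvia A n X I m B h G" by (rule dsum_dvia)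
 note d = dviaD[OF this]
 have S: "Sigma I B = Sigma I B'" using assms(3) by auto
 show ?thesis
  by (rule dsumI[where h = h and G = G]) (use d assms(2,3) S in auto)
qed

text \<open>The graph of the composite quantifies over the intermediate point \<open>z\<close> of
  \<open>B i\<close>.\<close>

lemma dsum_trans:
 assumes "dsum A n X I m B" "\<And>i. i \<in> I ==> dsum A (m i) (B i) (J i) (p i) (C i)"
 shows "dsum A n X (Sigma I J) (\<lambda>(i, j). p i j) (\<lambda>(i, j). C i j)"
proof -
 from assms(1) obtain h G where "dvia A n X I m B h G" by (rule dsum_dvia)
 note d = dviaD[OF this]
 have "\<forall>i\<in>I. \<exists>h' G'. dvia A (m i) (B i) (J i) (p i) (C i) h' G'"
  using assms(2) dsum_dvia by metis
 then obtain h' G' where "\<And>i. i \<in> I ==> dvia A (m i) (B i) (J i) (p i) (C i) (h' i) (G' i)"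
  by metis
 note h' = dviaD(4)[OF this] and G' = dviaD(5,6)[OF this]
 define k where "k = (\<lambda>(i, z). ((i, fst (h' i z)), snd (h' i z)))"
 define P where "P = (\<lambda>(i, j). {w. length w = n + p i j \<and> (\<exists>z. length z = m i \<and> take n w @ z \<in> G i \<and> z @ drop n w \<in> G' i j)})"
 have k: "bij_betw k (Sigma I B) (Sigma (Sigma I J) (\<lambda>(i, j). C i j))"
  unfolding bij_betw_def
 proof
  show "inj_on k (Sigma I B)"
  proof (rule inj_onI)
   fix q r assume qr: "q \<in> Sigma I B" "r \<in> Sigma I B" "k q = k r"
   obtain i z where q: "q = (i, z)" "i \<in> I" "z \<in> B i" using qr(1) by blast
   obtain i' z' where r: "r = (i', z')" "i' \<in> I" "z' \<in> B i'" using qr(2) by blast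
   have "i' = i" "h' i z = h' i z'" using qr(3) q r by (auto simp: k_def prod_eq_iff)
   then show "q = r" using h'[OF q(2)] q r by (auto simp: bij_betw_def inj_on_def)
  qed
  show "k ` Sigma I B = Sigma (Sigma I J) (\<lambda>(i, j). C i j)"
  proof (intro set_eqI iffI)
   fix q assume "q \<in> k ` Sigma I B"
   then obtain i z where q: "q = k (i, z)" "i \<in> I" "z \<in> B i" by blast
   then have "h' i z \<in> Sigma (J i) (C i)" using h' by (auto simp: bij_betw_def)
   then show "q \<in> Sigma (Sigma I J) (\<lambda>(i, j). C i j)" using q by (auto simp: k_def)
  next
   fix q assume "q \<in> Sigma (Sigma I J) (\<lambda>(i, j). C i j)"
   then obtain i j w where q: "q = ((i, j), w)" "i \<in> I" "j \<in> J i" "w \<in> C i j" by auto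
   then have "(j, w) \<in> h' i ` B i" using h'[OF q(2)] by (auto simp: bij_betw_def)
   then obtain z where "z \<in> B i" "h' i z = (j, w)" by force
   then show "q \<in> k ` Sigma I B" using q by (intro image_eqI[of _ _ "(i, z)"]) (auto simp: k_def)
  qed
 qed
 have len: "length w = p i j" if "i \<in> I" "j \<in> J i" "w \<in> C i j" for i j w
  using assms(2)[OF that(1)] that unfolding dsum_def by blast
 show ?thesis
 proof (rule dsumI[where h = "k \<circ> h" and G = P])
  show "finite (Sigma I J)" using d(1) assms(2) unfolding dsum_def by (intro finite_SigmaI) auto
  show "length x = n" if "x \<in> X" for x using d(2) that .
  show "length z = (case q of (i, j) => p i j)" if "q \<in> Sigma I J" "z \<in> (case q of (i, j) => C i j)" for q z
   using that len by auto
  show "bij_betw (k \<circ> h) X (Sigma (Sigma I J) (\<lambda>(i, j). C i j))" using bij_betw_trans[OF d(4) k] .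
  fix q assume "q \<in> Sigma I J"
  then obtain i j where q: "q = (i, j)" "i \<in> I" "j \<in> J i" by blast
  have "definable_over A (n + p i j) {w. length w = n + p i j \<and> (\<exists>z. length z = m i \<and> take n w @ z \<in> G i \<and> z @ drop n w \<in> G' i j)}"
  proof (rule definableI)
   have 1: "drop n (map v [0..<n + p i j]) = map (\<lambda>j. v (j + n)) [0..<p i j]" for v :: "nat => 'a"
    by (rule nth_equalityI) (auto simp: add.commute)
   have 2: "take n (map v [0..<n + p i j]) = map v [0..<n]" for v :: "nat => 'a"
    by (rule nth_equalityI) auto
   show "Def A (\<lambda>v. \<exists>z. length z = m i \<and> take n (map v [0..<n + p i j]) @ z \<in> G i \<and>
     z @ drop n (map v [0..<n + p i j]) \<in> G' i j)"
    unfolding 1 2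
    by (intro Def_exl Def_conj Def_mem[OF d(5)[OF q(2)]] Def_mem[OF G'(1)[OF q(2,3)]])
     (rule Dfnl_append Dfnl_upt Dfn_var)+
  qed
  then show "definable_over A (n + (case q of (i, j) => p i j)) (P q)" using q by (simp add: P_def)
  fix x w :: "'a list" assume l: "length x = n" "length w = (case q of (i, j) => p i j)"
  have "x @ w \<in> P q \<longleftrightarrow> (\<exists>z. length z = m i \<and> x @ z \<in> G i \<and> z @ w \<in> G' i j)" using l q by (simp add: P_def)
  also have "\<dots> \<longleftrightarrow> (\<exists>z. length z = m i \<and> (x \<in> X \<and> h x = (i, z)) \<and> z \<in> B i \<and> h' i z = (j, w))"
   using d(6)[OF q(2) l(1)] G'(2)[OF q(2,3)] l q(1) by auto
  also have "\<dots> \<longleftrightarrow> x \<in> X \<and> (k \<circ> h) x = (q, w)"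
  proof
   assume "\<exists>z. length z = m i \<and> (x \<in> X \<and> h x = (i, z)) \<and> z \<in> B i \<and> h' i z = (j, w)"
   then show "x \<in> X \<and> (k \<circ> h) x = (q, w)" using q by (auto simp: k_def)
  next
   assume *: "x \<in> X \<and> (k \<circ> h) x = (q, w)"
   then have "h x \<in> Sigma I B" using d(4) by (auto simp: bij_betw_def)
   then obtain i' z where z: "h x = (i', z)" "i' \<in> I" "z \<in> B i'" by blast
   have "k (i', z) = ((i, j), w)" using * z(1) q(1) by simp
   then have "i' = i" "h' i z = (j, w)" by (auto simp: k_def prod_eq_iff)
   then show "\<exists>z. length z = m i \<and> (x \<in> X \<and> h x = (i, z)) \<and> z \<in> B i \<and> h' i z = (j, w)"
    using * z d(3)[OF z(2,3)] by blast
  qed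
  finally show "x @ w \<in> P q \<longleftrightarrow> x \<in> X \<and> (k \<circ> h) x = (q, w)" .
 qed
qed

text \<open>A definable bijection as a decomposition with a single piece, so that the facts on
  \<open>dsum\<close>, in particular on uniformity and on parameters, apply to it.\<close>

definition dbij :: "'a::linordered_ab_group_add set => nat => nat => 'a list set => 'a list set => bool" where
 "dbij A n n' X X' \<longleftrightarrow> dsum A n X {()} (\<lambda>_. n') (\<lambda>_. X')"

text \<open>Points of \<open>X\<close> and \<open>X'\<close> are matched if they correspond to the
  same point \<open>(i, z)\<close> of the common disjoint union.\<close>

lemma dsum_dbij:
 assumes "dsum A n X I m B" "dsum A n' X' I m B"
 shows "dbij A n n' X X'"
proof -
 from assms(1) obtain h G where "dvia A n X I m B h G" by (rule dsum_dvia)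
 note d = dviaD[OF this]
 from assms(2) obtain h' G' where "dvia A n' X' I m B h' G'" by (rule dsum_dvia)
 note d' = dviaD(2,4-6)[OF this]
 define k where "k = the_inv_into X' h'"
 have k: "bij_betw k (Sigma I B) X'" unfolding k_def using d'(2) by (rule bij_betw_the_inv_into)
 have inj: "inj_on h' X'" using d'(2) by (simp add: bij_betw_def)
 have kh: "k (h' x) = x" if "x \<in> X'" for x unfolding k_def using the_inv_into_f_f[OF inj that] .
 have hk: "h' (k p) = p" if "p \<in> Sigma I B" for p
  unfolding k_def using f_the_inv_into_f[OF inj, of p] d'(2) that by (auto simp: bij_betw_def)
 define P where "P = {w. length w = n + n' \<and> (\<exists>i\<in>I. \<exists>z. length z = m i \<and> take n w @ z \<in> G i \<and> drop n w @ z \<in> G' i)}"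
 show ?thesis
  unfolding dbij_def
 proof (rule dsumI[where h = "\<lambda>x. ((), k (h x))" and G = "\<lambda>_. P"])
  have "bij_betw (k \<circ> h) X X'" using bij_betw_trans[OF d(4) k] .
  then show "bij_betw (\<lambda>x. ((), k (h x))) X ({()} \<times> X')" by (auto simp: bij_betw_def inj_on_def image_iff)
  have "definable_over A (n + n') P"
   unfolding P_def
  proof (rule definableI)
   have 1: "drop n (map v [0..<n + n']) = map (\<lambda>j. v (j + n)) [0..<n']" for v :: "nat => 'a"
    by (rule nth_equalityI) (auto simp: add.commute)
   have 2: "take n (map v [0..<n + n']) = map v [0..<n]" for v :: "nat => 'a"
    by (rule nth_equalityI) auto
   show "Def A (\<lambda>v. \<exists>i\<in>I. \<exists>z. length z = m i \<and> take n (map v [0..<n + n']) @ z \<in> G i \<and>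
     drop n (map v [0..<n + n']) @ z \<in> G' i)"
    unfolding 1 2
   proof (rule Def_Bex[OF d(1)])
    fix i assume i: "i \<in> I"
    show "Def A (\<lambda>v. \<exists>z. length z = m i \<and> map v [0..<n] @ z \<in> G i \<and> map (\<lambda>j. v (j + n)) [0..<n'] @ z \<in> G' i)"
     by (intro Def_exl Def_conj Def_mem[OF d(5)[OF i]] Def_mem[OF d'(3)[OF i]])
      (rule Dfnl_append Dfnl_upt Dfn_var)+
   qed
  qed
  then show "definable_over A (n + n') P" .
  fix i and x y :: "'a list" assume l: "length x = n" "length y = n'"
  have "x @ y \<in> P \<longleftrightarrow> (\<exists>i\<in>I. \<exists>z. length z = m i \<and> x @ z \<in> G i \<and> y @ z \<in> G' i)" using l by (simp add: P_def)
  also have "\<dots> \<longleftrightarrow> (\<exists>i\<in>I. \<exists>z. length z = m i \<and> (x \<in> X \<and> h x = (i, z)) \<and> y \<in> X' \<and> h' y = (i, z))"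
   using d(6)[OF _ l(1)] d'(4)[OF _ l(2)] by blast
  also have "\<dots> \<longleftrightarrow> x \<in> X \<and> k (h x) = y"
  proof
   assume "\<exists>i\<in>I. \<exists>z. length z = m i \<and> (x \<in> X \<and> h x = (i, z)) \<and> y \<in> X' \<and> h' y = (i, z)"
   then show "x \<in> X \<and> k (h x) = y" using kh by metis
  next
   assume *: "x \<in> X \<and> k (h x) = y"
   then have hx: "h x \<in> Sigma I B" using d(4) by (auto simp: bij_betw_def)
   then obtain i z where z: "h x = (i, z)" "i \<in> I" "z \<in> B i" by blast
   have "y \<in> X'" using k hx * by (auto simp: bij_betw_def)
   moreover have "h' y = (i, z)" using hk[OF hx] * z by auto
   ultimately show "\<exists>i\<in>I. \<exists>z. length z = m i \<and> (x \<in> X \<and> h x = (i, z)) \<and> y \<in> X' \<and> h' y = (i, z)"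
    using * z d(3)[OF z(2,3)] by blast
  qed
  finally show "x @ y \<in> P \<longleftrightarrow> x \<in> X \<and> ((), k (h x)) = (i, y)" by simp
 qed (use d(2) d'(1) in auto)
qed

text \<open>\<open>is_graph\<close> is a first-order condition. Once the parameters \<open>c\<close>
  are opened up, the tuples at which the same formulas decompose the fibre form a definable set
  \<open>W\<close> containing \<open>c\<close>.\<close>

lemma dsum_uniform:
 assumes S: "definable_over A (k + n) S" and T: "\<And>i. i \<in> I ==> definable_over A (k + m i) (T i)"
  and c: "length c = k" and d: "dsum (A \<union> set c) n {x. c @ x \<in> S} I m (\<lambda>i. {z. c @ z \<in> T i})"
 obtains W G where "definable_over A k W" "c \<in> W" "\<And>i. i \<in> I ==> definable_over A (k + (n + m i)) (G i)"
  "\<And>y. y \<in> W ==> is_graph n {x. y @ x \<in> S} I m (\<lambda>i. {z. y @ z \<in> T i}) (\<lambda>i. {w. y @ w \<in> G i})"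
proof -
 obtain H where fin: "finite I" and H: "\<And>i. i \<in> I ==> definable_over (A \<union> set c) (n + m i) (H i)"
  "is_graph n {x. c @ x \<in> S} I m (\<lambda>i. {z. c @ z \<in> T i}) H"
  using d unfolding dsum_def by blast
 have "\<exists>G. definable_over A (k + (n + m i)) G \<and> H i = {x. c @ x \<in> G}" if "i \<in> I" for i
  using definable_param_out[OF H(1)[OF that] order_refl] c by metis
 then obtain G where G: "\<And>i. i \<in> I ==> definable_over A (k + (n + m i)) (G i)" "\<And>i. i \<in> I ==> H i = {x. c @ x \<in> G i}"
  by metis
 define W where "W = {y. length y = k \<and> is_graph n {x. y @ x \<in> S} I m (\<lambda>i. {z. y @ z \<in> T i}) (\<lambda>i. {w. y @ w \<in> G i})}"
 have "is_graph n {x. c @ x \<in> S} I m (\<lambda>i. {z. c @ z \<in> T i}) (\<lambda>i. {w. c @ w \<in> G i})"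
  using H(2) is_graph_cong[of I H "\<lambda>i. {w. c @ w \<in> G i}" n "{x. c @ x \<in> S}" m] G(2) by blast
 then have "c \<in> W" using c by (simp add: W_def)
 moreover have "definable_over A k W"
  unfolding W_def is_graph_def mem_Collect_eq
  by (rule definableI, intro Def_conj Def_Ball[OF fin] Def_alll Def_exl Def_imp Def_Bex[OF fin]
    Def_mem[OF S] Def_mem[OF T] Def_mem[OF G(1)] Def_const Def_eql; (assumption | rule Dfnl_append Dfnl_upt Dfn_var)+)
 ultimately show ?thesis using that G(1) unfolding W_def by blast
qed

section \<open>Definable families over a set of parameters\<close>

definition fam :: "'a list set => ('a list => 'a list set) => 'a list set" where
 "fam T X = {s @ x | s x. s \<in> T \<and> x \<in> X s}"

lemma fam_iff:
 assumes "\<And>s. s \<in> T ==> length s = l"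
 shows "u \<in> fam T X \<longleftrightarrow> take l u \<in> T \<and> drop l u \<in> X (take l u)"
proof
 assume "u \<in> fam T X"
 then obtain s x where "u = s @ x" "s \<in> T" "x \<in> X s" unfolding fam_def by blast
 then show "take l u \<in> T \<and> drop l u \<in> X (take l u)" using assms by auto
next
 assume "take l u \<in> T \<and> drop l u \<in> X (take l u)"
 then show "u \<in> fam T X" unfolding fam_def by (metis (mono_tags, lifting) append_take_drop_id mem_Collect_eq)
qed

lemma fam_append_iff:
 assumes "\<And>s. s \<in> T ==> length s = l" "length s = l"
 shows "s @ x \<in> fam T X \<longleftrightarrow> s \<in> T \<and> x \<in> X s"
 using fam_iff[of T l "s @ x" X] assms by simp

lemma fam_cong: "(\<And>s. s \<in> T ==> X s = Y s) ==> fam T X = fam T Y"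
 unfolding fam_def by auto

text \<open>Each fibre has its own bijection, but all are read from the same \<open>G i\<close>;
  keeping the base point as a prefix on both sides glues them to one bijection of total
  spaces.\<close>

lemma dsum_total:
 fixes A :: "'a::linordered_ab_group_add set"
 assumes T: "definable_over A k T" and fin: "finite I"
  and X: "\<And>y x. y \<in> T ==> x \<in> X y ==> length x = n"
  and B: "\<And>i y z. i \<in> I ==> y \<in> T ==> z \<in> B i y ==> length z = m i"
  and G: "\<And>i. i \<in> I ==> definable_over A (k + (n + m i)) (G i)"
  and g: "\<And>y. y \<in> T ==> is_graph n (X y) I m (\<lambda>i. B i y) (\<lambda>i. {w. y @ w \<in> G i})"
 shows "dsum A (k + n) (fam T X) I (\<lambda>i. k + m i) (\<lambda>i. fam T (B i))"
proof -
 have Tl: "length s = k" if "s \<in> T" for s using definable_length[OF T that] .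
 have "\<exists>h. bij_betw h (X y) (Sigma I (\<lambda>i. B i y)) \<and>
   (\<forall>i\<in>I. \<forall>x z. length x = n --> length z = m i --> (y @ x @ z \<in> G i \<longleftrightarrow> x \<in> X y \<and> h x = (i, z)))" if "y \<in> T" for y
 proof (rule is_graph_bij[OF X[OF that] B[OF _ that] g[OF that]])
  fix h assume *: "bij_betw h (X y) (Sigma I (\<lambda>i. B i y))"
   "\<And>i x z. i \<in> I ==> length x = n ==> length z = m i ==> x @ z \<in> {w. y @ w \<in> G i} \<longleftrightarrow> x \<in> X y \<and> h x = (i, z)"
  show ?thesis using * by (intro exI[of _ h]) simp
 qed
 then obtain h where h: "\<And>y. y \<in> T ==> bij_betw (h y) (X y) (Sigma I (\<lambda>i. B i y))"
  and hG: "\<And>y i x z. y \<in> T ==> i \<in> I ==> length x = n ==> length z = m i ==> y @ x @ z \<in> G i \<longleftrightarrow> x \<in> X y \<and> h y x = (i, z)"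
  by metis
 define H where "H = (\<lambda>u. (fst (h (take k u) (drop k u)), take k u @ snd (h (take k u) (drop k u))))"
 have Hs: "H (s @ x) = (fst (h s x), s @ snd (h s x))" if "s \<in> T" for s x using Tl[OF that] by (simp add: H_def)
 \<comment> \<open>The base point occurs in both arguments of the graph, so equality of the two
   copies becomes part of the condition.\<close>
 define P where "P = (\<lambda>i. {w. length w = k + n + (k + m i) \<and> take k w \<in> T \<and> take k (drop (k + n) w) = take k w \<and>
   take (k + n) w @ drop (k + n + k) w \<in> G i})"
 show ?thesis
 proof (rule dsumI[where h = H and G = P])
  show "finite I" by fact
  show "\<And>x. x \<in> fam T X ==> length x = k + n" using Tl X by (auto simp: fam_def)
  show "\<And>i z. i \<in> I ==> z \<in> fam T (B i) ==> length z = k + m i" using Tl B by (auto simp: fam_def)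
  show "bij_betw H (fam T X) (Sigma I (\<lambda>i. fam T (B i)))"
   unfolding bij_betw_def
  proof
   show "inj_on H (fam T X)"
   proof (rule inj_onI)
    fix u u' assume u: "u \<in> fam T X" "u' \<in> fam T X" "H u = H u'"
    obtain s x where s: "u = s @ x" "s \<in> T" "x \<in> X s" using u(1) unfolding fam_def by blast
    obtain s' x' where s': "u' = s' @ x'" "s' \<in> T" "x' \<in> X s'" using u(2) unfolding fam_def by blast
    have "s = s'" "h s x = h s' x'"
     using u(3) Hs[OF s(2), of x] Hs[OF s'(2), of x'] Tl[OF s(2)] Tl[OF s'(2)] s(1) s'(1)
     by (auto simp: prod_eq_iff)
    then show "u = u'" using h[OF s(2)] s s' by (auto simp: bij_betw_def inj_on_def)
   qed
   show "H ` fam T X = Sigma I (\<lambda>i. fam T (B i))"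
   proof (intro set_eqI iffI)
    fix p assume "p \<in> H ` fam T X"
    then obtain s x where s: "p = H (s @ x)" "s \<in> T" "x \<in> X s" unfolding fam_def by blast
    have "h s x \<in> Sigma I (\<lambda>i. B i s)" using h[OF s(2)] s(3) by (auto simp: bij_betw_def)
    then obtain i z where "h s x = (i, z)" "i \<in> I" "z \<in> B i s" by blast
    then show "p \<in> Sigma I (\<lambda>i. fam T (B i))" unfolding s(1) Hs[OF s(2)] using s(2)
     unfolding fam_def by auto
   next
    fix p assume "p \<in> Sigma I (\<lambda>i. fam T (B i))"
    then obtain i s z where p: "p = (i, s @ z)" "i \<in> I" "s \<in> T" "z \<in> B i s" unfolding fam_def by blast
    then have "(i, z) \<in> h s ` X s" using h[OF p(3)] by (auto simp: bij_betw_def)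
    then obtain x where x: "x \<in> X s" "h s x = (i, z)" by force
    then have "H (s @ x) = p" using Hs[OF p(3)] p by simp
    then show "p \<in> H ` fam T X" using x p unfolding fam_def by blast
   qed
  qed
  fix i assume i: "i \<in> I"
  show "definable_over A (k + n + (k + m i)) (P i)"
   unfolding P_def
  proof (rule definableI)
   have 1: "take k (map v [0..<k + n + (k + m i)]) = map v [0..<k]"
    "take k (drop (k + n) (map v [0..<k + n + (k + m i)])) = map (\<lambda>j. v (j + (k + n))) [0..<k]"
    "take (k + n) (map v [0..<k + n + (k + m i)]) = map v [0..<k + n]"
    "drop (k + n + k) (map v [0..<k + n + (k + m i)]) = map (\<lambda>j. v (j + (k + n + k))) [0..<m i]" for v :: "nat => 'a"
    by (rule nth_equalityI; auto simp: add.commute add.left_commute)+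
   have 2: "Dfnl A (k + n + m i) (\<lambda>v. map v [0..<k + n] @ map (\<lambda>j. v (j + (k + n + k))) [0..<m i])"
    by (rule Dfnl_cast, rule Dfnl_append[OF Dfnl_vars], rule Dfnl_upt, rule Dfn_var) simp
   have 3: "Dfnl A k (\<lambda>v. map (\<lambda>j. v (j + (k + n))) [0..<k])"
    by (rule Dfnl_cast, rule Dfnl_upt, rule Dfn_var) simp
   show "Def A (\<lambda>v. take k (map v [0..<k + n + (k + m i)]) \<in> T \<and>
    take k (drop (k + n) (map v [0..<k + n + (k + m i)])) = take k (map v [0..<k + n + (k + m i)]) \<and>
    take (k + n) (map v [0..<k + n + (k + m i)]) @ drop (k + n + k) (map v [0..<k + n + (k + m i)]) \<in> G i)"
    unfolding 1
    by (intro Def_conj Def_mem[OF T Dfnl_vars] Def_eql[OF 3 Dfnl_vars] Def_mem[OF G[OF i] 2])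
  qed
  fix u w :: "'a list" assume l: "length u = k + n" "length w = k + m i"
  obtain s x where u: "u = s @ x" "length s = k" "length x = n" using split_list_set[OF l(1)] by blast
  obtain s' z where w: "w = s' @ z" "length s' = k" "length z = m i" using split_list_set[OF l(2)] by blast
  have "u @ w \<in> P i \<longleftrightarrow> s \<in> T \<and> s' = s \<and> s @ x @ z \<in> G i"
   unfolding P_def using u w by auto
  also have "\<dots> \<longleftrightarrow> s \<in> T \<and> s' = s \<and> x \<in> X s \<and> h s x = (i, z)" using hG[OF _ i u(3) w(3)] by blast
  also have "\<dots> \<longleftrightarrow> u \<in> fam T X \<and> H u = (i, w)"
  proof -
   have "H u = (fst (h s x), s @ snd (h s x))" unfolding u(1) H_def using u(2) by simp
   then have "H u = (i, w) \<longleftrightarrow> fst (h s x) = i \<and> s = s' \<and> snd (h s x) = z"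
    unfolding w(1) using u(2) w(2) by simp
   moreover have "h s x = (i, z) \<longleftrightarrow> fst (h s x) = i \<and> snd (h s x) = z" by (rule prod_eq_iff[of _ "(i, z)", simplified])
   moreover have "u \<in> fam T X \<longleftrightarrow> s \<in> T \<and> x \<in> X s" unfolding u(1) by (rule fam_append_iff[OF Tl u(2)])
   ultimately show ?thesis by blast
  qed
  finally show "u @ w \<in> P i \<longleftrightarrow> u \<in> fam T X \<and> H u = (i, w)" .
 qed
qed

text \<open>Applies a bijection that concerns one block of coordinates inside a product: the base
  point \<open>s\<close> in front and the remaining block \<open>w\<close> behind are carried
  along.\<close>

lemma dsum_lift:
 fixes A :: "'a::linordered_ab_group_add set"
 assumes fin: "finite I" and T: "\<And>s. s \<in> T ==> length s = l"
  and def: "\<And>i. i \<in> I ==> definable_over A (l + (m i + e)) (fam T (\<lambda>s. {z @ w | z w. z \<in> D i s \<and> w \<in> R s}))"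
  and D: "\<And>i s z. i \<in> I ==> s \<in> T ==> z \<in> D i s ==> length z = m i"
  and E: "\<And>s z. s \<in> T ==> z \<in> E s ==> length z = n" and R: "\<And>s w. s \<in> T ==> w \<in> R s ==> length w = e"
  and bij: "\<And>s. s \<in> T ==> bij_betw (\<lambda>(i, z). k i s z) (SIGMA i:I. D i s) (E s)"
  and k: "\<And>i. i \<in> I ==> Dfnl A n (\<lambda>v. k i (map v [0..<l]) (map (\<lambda>j. v (j + l)) [0..<m i]))"
 shows "dsum A (l + (n + e)) (fam T (\<lambda>s. {z @ w | z w. z \<in> E s \<and> w \<in> R s})) I (\<lambda>i. l + (m i + e))
   (\<lambda>i. fam T (\<lambda>s. {z @ w | z w. z \<in> D i s \<and> w \<in> R s}))"
proof (rule dsum_map[OF fin def, where g = "\<lambda>i u. take l u @ k i (take l u) (take (m i) (drop l u)) @ drop (l + m i) u"])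
 fix i assume i: "i \<in> I"
 have 1: "take l (map v [0..<l + (m i + e)]) = map v [0..<l]"
  "take (m i) (drop l (map v [0..<l + (m i + e)])) = map (\<lambda>j. v (j + l)) [0..<m i]"
  "drop (l + m i) (map v [0..<l + (m i + e)]) = map (\<lambda>j. v (j + (l + m i))) [0..<e]" for v :: "nat => 'a"
  by (rule nth_equalityI; auto simp: add.commute add.left_commute)+
 have 2: "Dfnl A e (\<lambda>v. map (\<lambda>j. v (j + (l + m i))) [0..<e])"
  by (rule Dfnl_cast, rule Dfnl_upt, rule Dfn_var) simp
 show "Dfnl A (l + (n + e)) (\<lambda>v. take l (map v [0..<l + (m i + e)]) @
   k i (take l (map v [0..<l + (m i + e)])) (take (m i) (drop l (map v [0..<l + (m i + e)]))) @
   drop (l + m i) (map v [0..<l + (m i + e)]))"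
  unfolding 1 by (intro Dfnl_append[OF Dfnl_vars] Dfnl_append[OF k[OF i]] 2)
next
 let ?F = "\<lambda>i. fam T (\<lambda>s. {z @ w | z w. z \<in> D i s \<and> w \<in> R s})"
 let ?g = "\<lambda>i u. take l u @ k i (take l u) (take (m i) (drop l u)) @ drop (l + m i) u"
 have g: "?g i (s @ z @ w) = s @ k i s z @ w" if "i \<in> I" "s \<in> T" "z \<in> D i s" for i s z w
  using T[OF that(2)] D[OF that] by simp
 have kE: "k i s z \<in> E s" if "i \<in> I" "s \<in> T" "z \<in> D i s" for i s z
  using bij[OF that(2)] that by (force simp: bij_betw_def)
 show "bij_betw (\<lambda>(i, z). ?g i z) (Sigma I ?F) (fam T (\<lambda>s. {z @ w | z w. z \<in> E s \<and> w \<in> R s}))"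
  unfolding bij_betw_def
 proof
  show "inj_on (\<lambda>(i, z). ?g i z) (Sigma I ?F)"
  proof (rule inj_onI)
   fix p q assume pq: "p \<in> Sigma I ?F" "q \<in> Sigma I ?F" "(\<lambda>(i, z). ?g i z) p = (\<lambda>(i, z). ?g i z) q"
   obtain i s z w where p: "p = (i, s @ z @ w)" "i \<in> I" "s \<in> T" "z \<in> D i s" "w \<in> R s" using pq(1) unfolding fam_def by blast
   obtain i' s' z' w' where q: "q = (i', s' @ z' @ w')" "i' \<in> I" "s' \<in> T" "z' \<in> D i' s'" "w' \<in> R s'"
    using pq(2) unfolding fam_def by blast
   have eq: "s @ k i s z @ w = s' @ k i' s' z' @ w'"
    using pq(3) unfolding p(1) q(1) prod.case g[OF p(2-4)] g[OF q(2-4)] .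
   then have "s = s'" "k i s z @ w = k i' s' z' @ w'" using T[OF p(3)] T[OF q(3)] by auto
   moreover have "length (k i s z) = length (k i' s' z')" using E[OF p(3) kE[OF p(2-4)]] E[OF q(3) kE[OF q(2-4)]] by simp
   ultimately have e: "s = s'" "k i s z = k i' s z'" "w = w'" by auto
   then have "(i, z) = (i', z')" using bij[OF p(3)] p q unfolding bij_betw_def inj_on_def by fastforce
   then show "p = q" using p(1) q(1) e by simp
  qed
  show "(\<lambda>(i, z). ?g i z) ` Sigma I ?F = fam T (\<lambda>s. {z @ w | z w. z \<in> E s \<and> w \<in> R s})"
  proof (intro set_eqI iffI)
   fix u assume "u \<in> (\<lambda>(i, z). ?g i z) ` Sigma I ?F"
   then obtain i y where y: "u = ?g i y" "i \<in> I" "y \<in> ?F i" by auto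
   then obtain s z w where p: "y = s @ z @ w" "s \<in> T" "z \<in> D i s" "w \<in> R s" unfolding fam_def by blast
   have "u = s @ k i s z @ w" unfolding y(1) p(1) by (rule g[OF y(2) p(2,3)])
   then show "u \<in> fam T (\<lambda>s. {z @ w | z w. z \<in> E s \<and> w \<in> R s})"
    using kE[OF y(2) p(2,3)] p unfolding fam_def by blast
  next
   fix u assume "u \<in> fam T (\<lambda>s. {z @ w | z w. z \<in> E s \<and> w \<in> R s})"
   then obtain s z w where u: "u = s @ z @ w" "s \<in> T" "z \<in> E s" "w \<in> R s" unfolding fam_def by blast
   then have "z \<in> (\<lambda>(i, z). k i s z) ` (SIGMA i:I. D i s)" using bij[OF u(2)] by (auto simp: bij_betw_def)
   then obtain i y where y: "i \<in> I" "y \<in> D i s" "z = k i s y" by auto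
   have "u = ?g i (s @ y @ w)" unfolding g[OF y(1) u(2) y(2)] u(1) y(3) ..
   moreover have "s @ y @ w \<in> ?F i" using u y unfolding fam_def by blast
   ultimately show "u \<in> (\<lambda>(i, z). ?g i z) ` Sigma I ?F" using y(1) by (intro image_eqI[of _ _ "(i, s @ y @ w)"]) auto
  qed
 qed
qed

section \<open>Chains and boxes\<close>

text \<open>A definable model of the \<open>d\<close>-element subsets of \<open>[0, a)\<close>: for
  an integer \<open>a \<ge> 0\<close> in the group of integers the number of points is the binomial
  coefficient of \<open>a\<close> over \<open>d\<close>.\<close>

definition chain :: "nat => 'a::linordered_ab_group_add => 'a list set" where
 "chain d a = {z. length z = d \<and> sorted_wrt (<) z \<and> (\<forall>x\<in>set z. 0 \<le> x \<and> x < a)}"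

fun box :: "(nat \<times> 'a::linordered_ab_group_add) list => 'a list set" where
 "box [] = {[]}"
| "box (p # \<beta>) = {z @ w | z w. z \<in> chain (fst p) (snd p) \<and> w \<in> box \<beta>}"

definition bdim :: "(nat \<times> 'b) list => nat" where
 "bdim \<beta> = sum_list (map fst \<beta>)"

lemma bdim_simps [simp]: "bdim [] = 0" "bdim (p # \<beta>) = fst p + bdim \<beta>" "bdim (\<beta> @ \<gamma>) = bdim \<beta> + bdim \<gamma>"
 by (auto simp: bdim_def)

lemma chain_length: "z \<in> chain d a ==> length z = d"
 by (simp add: chain_def)

lemma box_length: "w \<in> box \<beta> ==> length w = bdim \<beta>"
 by (induction \<beta> arbitrary: w) (auto simp: chain_length)

lemma chain_0 [simp]: "chain 0 a = {[]}"
 by (auto simp: chain_def)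

lemma chain_empty: "a \<le> 0 ==> 0 < d ==> chain d a = {}"
proof (intro equals0I)
 fix z assume a: "a \<le> 0" "0 < d" and "z \<in> chain d a"
 then have "z ! 0 \<in> set z" "\<forall>x\<in>set z. 0 \<le> x \<and> x < a" by (auto simp: chain_def)
 then have "0 \<le> z ! 0" "z ! 0 < a" by auto
 then show False using a by simp
qed

lemma box_Cons_iff: "w \<in> box ((d, a) # \<beta>) \<longleftrightarrow> take d w \<in> chain d a \<and> drop d w \<in> box \<beta>"
proof
 assume "w \<in> box ((d, a) # \<beta>)"
 then obtain z w' where "w = z @ w'" "z \<in> chain d a" "w' \<in> box \<beta>" by auto
 then show "take d w \<in> chain d a \<and> drop d w \<in> box \<beta>" using chain_length[of z d a] by auto
next
 assume *: "take d w \<in> chain d a \<and> drop d w \<in> box \<beta>"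
 then show "w \<in> box ((d, a) # \<beta>)" unfolding box.simps mem_Collect_eq
  by (intro exI[of _ "take d w"] exI[of _ "drop d w"]) simp
qed

lemma box_append: "box (\<beta> @ \<gamma>) = {z @ w | z w. z \<in> box \<beta> \<and> w \<in> box \<gamma>}"
proof (induction \<beta>)
 case (Cons p \<beta>)
 show ?case unfolding append_Cons box.simps Cons.IH
 proof (intro set_eqI iffI)
  fix u assume "u \<in> {z @ w | z w. z \<in> chain (fst p) (snd p) \<and> w \<in> {z @ w | z w. z \<in> box \<beta> \<and> w \<in> box \<gamma>}}"
  then obtain z x w where "u = (z @ x) @ w" "z \<in> chain (fst p) (snd p)" "x \<in> box \<beta>" "w \<in> box \<gamma>" by fastforce
  then show "u \<in> {z @ w | z w. z \<in> {z @ w | z w. z \<in> chain (fst p) (snd p) \<and> w \<in> box \<beta>} \<and> w \<in> box \<gamma>}" by blast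
 next
  fix u assume "u \<in> {z @ w | z w. z \<in> {z @ w | z w. z \<in> chain (fst p) (snd p) \<and> w \<in> box \<beta>} \<and> w \<in> box \<gamma>}"
  then obtain z x w where "u = z @ (x @ w)" "z \<in> chain (fst p) (snd p)" "x \<in> box \<beta>" "w \<in> box \<gamma>" by fastforce
  then show "u \<in> {z @ w | z w. z \<in> chain (fst p) (snd p) \<and> w \<in> {z @ w | z w. z \<in> box \<beta> \<and> w \<in> box \<gamma>}}" by blast
 qed
qed auto

lemma Def_chain:
 assumes "Dfnl A d' l" "Dfn A t"
 shows "Def A (\<lambda>v. l v \<in> chain d (t v))"
proof (cases "d' = d")
 case True
 have len: "length (l v) = d" for v using Dfnl_length[OF assms(1)] True by simp
 have "l v \<in> chain d (t v) \<longleftrightarrow> (\<forall>i<d. \<forall>j<d. i < j --> l v ! i < l v ! j) \<and> (\<forall>i<d. 0 \<le> l v ! i \<and> l v ! i < t v)" for v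
  unfolding chain_def using len[of v] by (auto simp: sorted_wrt_iff_nth_less all_set_conv_all_nth)
 moreover have "Def A (\<lambda>v. (\<forall>i<d. \<forall>j<d. i < j --> l v ! i < l v ! j) \<and> (\<forall>i<d. 0 \<le> l v ! i \<and> l v ! i < t v))"
  by (intro Def_conj Def_all_less Def_imp Def_const Def_less Def_le Dfn_zero assms(2) Dfnl_nth[OF assms(1)])
   (use True in auto)
 ultimately show ?thesis using Def_cong[of "\<lambda>v. l v \<in> chain d (t v)"] by simp
next
 case False
 then have "(l v \<in> chain d (t v)) = False" for v
  using Dfnl_length[OF assms(1)] chain_length[of "l v" d "t v"] by auto
 then show ?thesis by (simp add: Def_const)
qed

lemma Def_box:
 assumes "Dfnl A (bdim \<beta>) w" "\<And>d t. (d, t) \<in> set \<beta> ==> Dfn A t"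
 shows "Def A (\<lambda>v. w v \<in> box (map (\<lambda>(d, t). (d, t v)) \<beta>))"
 using assms
proof (induction \<beta> arbitrary: w)
 case Nil
 then have "w v \<in> box (map (\<lambda>(d, t). (d, t v)) [])" for v using Dfnl_length[OF Nil(1)] by simp
 then show ?case by (simp add: Def_const)
next
 case (Cons p \<beta>)
 obtain d t where p: "p = (d, t)" by (cases p)
 have w1: "Dfnl A d (\<lambda>v. take d (w v))"
  by (rule Dfnl_cast[OF Dfnl_take[OF Cons.prems(1)]]) (simp add: p)
 have w2: "Dfnl A (bdim \<beta>) (\<lambda>v. drop d (w v))"
  by (rule Dfnl_cast[OF Dfnl_drop[OF Cons.prems(1)]]) (simp add: p)
 have "Def A (\<lambda>v. take d (w v) \<in> chain d (t v) \<and> drop d (w v) \<in> box (map (\<lambda>(d, t). (d, t v)) \<beta>))"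
  by (intro Def_conj Def_chain[OF w1] Cons.IH[OF w2]) (use Cons.prems(2) p in auto)
 moreover have "w v \<in> box (map (\<lambda>(d, t). (d, t v)) (p # \<beta>)) \<longleftrightarrow>
   take d (w v) \<in> chain d (t v) \<and> drop d (w v) \<in> box (map (\<lambda>(d, t). (d, t v)) \<beta>)" for v
  using box_Cons_iff[of "w v" d "t v"] by (simp add: p del: box.simps)
 ultimately show ?case by (simp only:)
qed

definition Dfs :: "'a::linordered_ab_group_add set => nat => ('a list => 'a) => bool" where
 "Dfs A l \<phi> \<longleftrightarrow> Dfn A (\<lambda>v. \<phi> (map v [0..<l]))"

definition fbox :: "(nat \<times> ('a list => 'a::linordered_ab_group_add)) list => 'a list => 'a list set" where
 "fbox \<beta> s = box (map (\<lambda>(d, \<phi>). (d, \<phi> s)) \<beta>)"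

lemma bdim_map: "bdim (map (\<lambda>(d, \<phi>). (d, f \<phi>)) \<beta>) = bdim \<beta>"
 by (induction \<beta>) auto

lemma fbox_length: "w \<in> fbox \<beta> s ==> length w = bdim \<beta>"
 unfolding fbox_def using box_length bdim_map by metis

lemma fbox_simps: "fbox [] s = {[]}" "fbox ((d, \<phi>) # \<beta>) s = {z @ w | z w. z \<in> chain d (\<phi> s) \<and> w \<in> fbox \<beta> s}"
 "fbox (\<beta> @ \<gamma>) s = {z @ w | z w. z \<in> fbox \<beta> s \<and> w \<in> fbox \<gamma> s}"
 unfolding fbox_def by (simp_all add: box_append)

lemma FB_definable:
 assumes T: "definable_over A l T" and \<beta>: "\<And>d \<phi>. (d, \<phi>) \<in> set \<beta> ==> Dfs A l \<phi>"
 shows "definable_over A (l + bdim \<beta>) (fam T (fbox \<beta>))"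
proof -
 have eq: "fam T (fbox \<beta>) = {u. length u = l + bdim \<beta> \<and> (take l u \<in> T \<and> drop l u \<in> fbox \<beta> (take l u))}"
 proof (intro set_eqI)
  fix u
  have "length u = l + bdim \<beta>" if "u \<in> fam T (fbox \<beta>)"
  proof -
   obtain s w where "u = s @ w" "s \<in> T" "w \<in> fbox \<beta> s" using \<open>u \<in> _\<close> unfolding fam_def by blast
   then show ?thesis using definable_length[OF T, of s] fbox_length[of w \<beta> s] by simp
  qed
  then show "u \<in> fam T (fbox \<beta>) \<longleftrightarrow> u \<in> {u. length u = l + bdim \<beta> \<and> (take l u \<in> T \<and> drop l u \<in> fbox \<beta> (take l u))}"
   using fam_iff[OF definable_length[OF T], where u = u and X = "fbox \<beta>"] by blast
 qed
 show ?thesis unfolding eq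
 proof (rule definableI)
  have 1: "drop l (map v [0..<l + bdim \<beta>]) = map (\<lambda>j. v (j + l)) [0..<bdim \<beta>]"
   "take l (map v [0..<l + bdim \<beta>]) = map v [0..<l]" for v :: "nat => 'a"
   by (rule nth_equalityI; auto simp: add.commute)+
  have 2: "Dfnl A (bdim \<beta>) (\<lambda>v. map (\<lambda>j. v (j + l)) [0..<bdim \<beta>])"
   by (rule Dfnl_cast, rule Dfnl_upt, rule Dfn_var) simp
  define \<gamma> where "\<gamma> = map (\<lambda>(d, \<phi>). (d, \<lambda>v. \<phi> (map v [0..<l]))) \<beta>"
  have g: "map (\<lambda>(d, t). (d, t v)) \<gamma> = map (\<lambda>(d, \<phi>). (d, \<phi> (map v [0..<l]))) \<beta>" for v
   by (auto simp: \<gamma>_def)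
  have bg: "bdim \<gamma> = bdim \<beta>" unfolding \<gamma>_def by (rule bdim_map)
  have "Def A (\<lambda>v. map (\<lambda>j. v (j + l)) [0..<bdim \<beta>] \<in> box (map (\<lambda>(d, t). (d, t v)) \<gamma>))"
   by (rule Def_box) (use 2 bg \<beta> in \<open>auto simp: \<gamma>_def Dfs_def\<close>)
  then show "Def A (\<lambda>v. take l (map v [0..<l + bdim \<beta>]) \<in> T \<and>
    drop l (map v [0..<l + bdim \<beta>]) \<in> fbox \<beta> (take l (map v [0..<l + bdim \<beta>])))"
   unfolding 1 fbox_def g by (intro Def_conj Def_mem[OF T Dfnl_vars])
 qed
qed

lemma sorted_filter_split:
 "sorted_wrt (<) V ==> filter (\<lambda>t. t < a) V @ filter (\<lambda>t. \<not> t < (a :: 'a::linorder)) V = V"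
proof (induction V)
 case (Cons x V)
 show ?case
 proof (cases "x < a")
  case True
  then show ?thesis using Cons by simp
 next
  case False
  then have e: "filter (\<lambda>t. t < a) V = []" using Cons.prems by (auto simp: filter_empty_conv)
  then have "filter (\<lambda>t. \<not> t < a) V = V" using Cons.IH Cons.prems by simp
  then show ?thesis using False e by simp
 qed
qed simp

text \<open>Vandermonde's identity as a bijection: \<open>i\<close> is the number of entries below
  \<open>a\<close>, and the other entries are translated down by \<open>a\<close>.\<close>

lemma chain_split:
 fixes a c :: "'a::linordered_ab_group_add"
 assumes "0 \<le> a" "0 \<le> c"
 shows "bij_betw (\<lambda>(i, z). take i z @ map (\<lambda>t. t + a) (drop i z))
   (SIGMA i:{..d}. {x @ y | x y. x \<in> chain i a \<and> y \<in> chain (d - i) c}) (chain d (a + c))"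
proof -
 let ?k = "\<lambda>(i, z). take i z @ map (\<lambda>t. t + a) (drop i z)"
 let ?D = "SIGMA i:{..d}. {x @ y | x y. x \<in> chain i a \<and> y \<in> chain (d - i) c}"
 have k: "?k (i, x @ y) = x @ map (\<lambda>t. t + a) y" if "x \<in> chain i a" for i x y
  using chain_length[OF that] by simp
 have f: "filter (\<lambda>t. t < a) (x @ map (\<lambda>t. t + a) y) = x" "filter (\<lambda>t. \<not> t < a) (x @ map (\<lambda>t. t + a) y) = map (\<lambda>t. t + a) y"
  if "x \<in> chain i a" "y \<in> chain j c" for i j x y
 proof -
  have "filter (\<lambda>t. t < a) x = x" "filter (\<lambda>t. \<not> t < a) x = []" using that(1) by (auto simp: chain_def filter_empty_conv filter_id_conv)
  moreover have "filter (\<lambda>t. t < a) (map (\<lambda>t. t + a) y) = []" "filter (\<lambda>t. \<not> t < a) (map (\<lambda>t. t + a) y) = map (\<lambda>t. t + a) y"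
   using that(2) by (auto simp: chain_def filter_empty_conv filter_id_conv not_less)
  ultimately show "filter (\<lambda>t. t < a) (x @ map (\<lambda>t. t + a) y) = x"
   "filter (\<lambda>t. \<not> t < a) (x @ map (\<lambda>t. t + a) y) = map (\<lambda>t. t + a) y" by simp_all
 qed
 show ?thesis unfolding bij_betw_def
 proof
  show "inj_on ?k ?D"
  proof (rule inj_onI)
   fix p q assume pq: "p \<in> ?D" "q \<in> ?D" "?k p = ?k q"
   obtain i x y where p: "p = (i, x @ y)" "x \<in> chain i a" "y \<in> chain (d - i) c" using pq(1) by blast
   obtain i' x' y' where q: "q = (i', x' @ y')" "x' \<in> chain i' a" "y' \<in> chain (d - i') c" using pq(2) by blast
   have eq: "x @ map (\<lambda>t. t + a) y = x' @ map (\<lambda>t. t + a) y'"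
    using pq(3) unfolding p(1) q(1) k[OF p(2)] k[OF q(2)] .
   have "x = x'" using f(1)[OF p(2,3)] f(1)[OF q(2,3)] eq by simp
   moreover have "map (\<lambda>t. t + a) y = map (\<lambda>t. t + a) y'" using f(2)[OF p(2,3)] f(2)[OF q(2,3)] eq by simp
   then have "y = y'" by (rule map_injective) (auto simp: inj_def)
   moreover have "i = i'" using chain_length[OF p(2)] chain_length[OF q(2)] \<open>x = x'\<close> by simp
   ultimately show "p = q" using p(1) q(1) by simp
  qed
  show "?k ` ?D = chain d (a + c)"
  proof (intro set_eqI iffI)
   fix V assume "V \<in> ?k ` ?D"
   then obtain i x y where *: "i \<le> d" "x \<in> chain i a" "y \<in> chain (d - i) c" "V = ?k (i, x @ y)" by blast
   have "sorted_wrt (<) (map (\<lambda>t. t + a) y)" using *(3) by (simp add: chain_def sorted_wrt_map)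
   moreover have "s < t + a" if "s \<in> set x" "t \<in> set y" for s t
   proof -
    have "s < a" "0 \<le> t" using * that by (auto simp: chain_def)
    then show ?thesis by (metis add_increasing order_less_le_trans order_refl)
   qed
   moreover have "x1 < a + c" if "x1 \<in> set x" for x1
    using *(2) that assms(2) by (auto simp: chain_def intro: order_less_le_trans)
   ultimately show "V \<in> chain d (a + c)" using * k[OF *(2)] assms
    by (auto simp: chain_def sorted_wrt_append add.commute)
  next
   fix V assume V: "V \<in> chain d (a + c)"
   define x where "x = filter (\<lambda>t. t < a) V"
   define y where "y = map (\<lambda>t. t - a) (filter (\<lambda>t. \<not> t < a) V)"
   have sV: "sorted_wrt (<) V" using V by (simp add: chain_def)
   have my: "map (\<lambda>t. t + a) y = filter (\<lambda>t. \<not> t < a) V" by (simp add: y_def comp_def)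
   have eq: "V = x @ map (\<lambda>t. t + a) y" unfolding my x_def by (rule sorted_filter_split[OF sV, symmetric])
   have len: "length x + length y = d" using V arg_cong[OF eq, of length] by (simp add: chain_def)
   have x: "x \<in> chain (length x) a" using V unfolding x_def chain_def by (auto intro: sorted_wrt_filter)
   have "sorted_wrt (<) y"
    unfolding y_def sorted_wrt_map using sorted_wrt_filter[OF sV] by simp
   then have y: "y \<in> chain (d - length x) c"
    using V len by (auto simp: chain_def y_def not_less algebra_simps)
   show "V \<in> ?k ` ?D"
    by (rule image_eqI[of _ _ "(length x, x @ y)"]) (use eq k[OF x] x y len in auto)
  qed
 qed
qed

section \<open>Products of two chains below the same bound\<close>

text \<open>The patterns in which sets of sizes \<open>p\<close> and \<open>q\<close> can cover
  \<open>r\<close> points: \<open>S1\<close> and \<open>S2\<close> are the positions of their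
  elements in the increasing enumeration of the union. Overlaps are allowed, so \<open>r\<close> may
  be less than \<open>p + q\<close>.\<close>

definition merges :: "nat => nat => (nat \<times> nat set \<times> nat set) set" where
 "merges p q = {(r, S1, S2). r \<le> p + q \<and> S1 \<union> S2 = {..<r} \<and> card S1 = p \<and> card S2 = q}"

lemma finite_merges: "finite (merges p q)"
proof (rule finite_subset)
 show "merges p q \<subseteq> {..p + q} \<times> Pow {..<p + q} \<times> Pow {..<p + q}"
 proof
  fix x assume "x \<in> merges p q"
  then obtain r S1 S2 where x: "x = (r, S1, S2)" "r \<le> p + q" "S1 \<union> S2 = {..<r}" unfolding merges_def by blast
  have "S1 \<union> S2 \<subseteq> {..<p + q}" unfolding x(3) using x(2) by auto
  then show "x \<in> {..p + q} \<times> Pow {..<p + q} \<times> Pow {..<p + q}" using x(1,2) by auto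
 qed
qed auto

lemma nths_chain:
 assumes "W \<in> chain r a" "S \<subseteq> {..<r}"
 shows "nths W S \<in> chain (card S) a"
proof -
 have l: "length W = r" and s: "sorted W" "distinct W" using assms(1) by (auto simp: chain_def strict_sorted_iff)
 have "{i. i < length W \<and> i \<in> S} = S" using assms(2) l by auto
 then have "length (nths W S) = card S" by (simp add: length_nths)
 moreover have "sorted_wrt (<) (nths W S)" unfolding strict_sorted_iff using s by (simp add: sorted_nths distinct_nthsI)
 moreover have "\<forall>x\<in>set (nths W S). 0 \<le> x \<and> x < a" using assms(1) set_nths_subset[of W S] by (auto simp: chain_def)
 ultimately show ?thesis by (simp add: chain_def)
qed

text \<open>Two finite subsets of \<open>[0, a)\<close> are determined by their union and by the
  positions that each occupies in it. The block \<open>F\<close> is placed in between because the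
  two factors need not be adjacent in a box.\<close>

lemma chain_merge:
 fixes a :: "'a::linordered_ab_group_add"
 assumes F: "\<And>w. w \<in> F ==> length w = e"
 shows "bij_betw (\<lambda>((r, S1, S2), u). nths (drop e u) S1 @ take e u @ nths (drop e u) S2)
   (SIGMA j:merges p q. {w @ W | w W. w \<in> F \<and> W \<in> chain (fst j) a})
   {x @ w @ y | x w y. x \<in> chain p a \<and> w \<in> F \<and> y \<in> chain q a}"
proof -
 let ?k = "\<lambda>((r, S1, S2), u). nths (drop e u) S1 @ take e u @ nths (drop e u) S2"
 let ?D = "SIGMA j:merges p q. {w @ W | w W. w \<in> F \<and> W \<in> chain (fst j) a}"
 have k: "?k ((r, S1, S2), w @ W) = nths W S1 @ w @ nths W S2" if "w \<in> F" for r S1 S2 w W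
  using F[OF that] by simp
 have mem: "nths W S1 \<in> chain p a" "nths W S2 \<in> chain q a" "set (nths W S1) \<union> set (nths W S2) = set W"
  "S1 = {i. i < length W \<and> W ! i \<in> set (nths W S1)}" "S2 = {i. i < length W \<and> W ! i \<in> set (nths W S2)}"
  if "(r, S1, S2) \<in> merges p q" "W \<in> chain r a" for r S1 S2 W
 proof -
  have S: "S1 \<subseteq> {..<r}" "S2 \<subseteq> {..<r}" "S1 \<union> S2 = {..<r}" "card S1 = p" "card S2 = q"
   using that(1) unfolding merges_def by auto
  have l: "length W = r" and d: "distinct W" using that(2) by (auto simp: chain_def strict_sorted_iff)
  show "nths W S1 \<in> chain p a" "nths W S2 \<in> chain q a" using nths_chain[OF that(2)] S by auto
  have "set (nths W S1) \<union> set (nths W S2) = {W ! i | i. i < length W \<and> i \<in> S1 \<union> S2}"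
   unfolding set_nths by blast
  also have "\<dots> = set W" unfolding S(3) using l by (auto simp: set_conv_nth)
  finally show "set (nths W S1) \<union> set (nths W S2) = set W" .
  have *: "S = {i. i < length W \<and> W ! i \<in> set (nths W S)}" if "S \<subseteq> {..<r}" for S
   using that l d by (auto simp: set_nths nth_eq_iff_index_eq)
  show "S1 = {i. i < length W \<and> W ! i \<in> set (nths W S1)}" "S2 = {i. i < length W \<and> W ! i \<in> set (nths W S2)}"
   by (rule *[OF S(1)], rule *[OF S(2)])
 qed
 show ?thesis unfolding bij_betw_def
 proof
  show "inj_on ?k ?D"
  proof (rule inj_onI)
   fix P Q assume PQ: "P \<in> ?D" "Q \<in> ?D" "?k P = ?k Q"
   obtain r S1 S2 w W where P: "P = ((r, S1, S2), w @ W)" "(r, S1, S2) \<in> merges p q" "w \<in> F" "W \<in> chain r a"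
    using PQ(1) by auto
   obtain r' S1' S2' w' W' where Q: "Q = ((r', S1', S2'), w' @ W')" "(r', S1', S2') \<in> merges p q" "w' \<in> F" "W' \<in> chain r' a"
    using PQ(2) by auto
   have eq: "nths W S1 @ w @ nths W S2 = nths W' S1' @ w' @ nths W' S2'"
    using PQ(3) unfolding P(1) Q(1) k[OF P(3)] k[OF Q(3)] .
   have "length (nths W S1) = length (nths W' S1')"
    using chain_length[OF mem(1)[OF P(2,4)]] chain_length[OF mem(1)[OF Q(2,4)]] by simp
   then have e: "nths W S1 = nths W' S1'" "w = w'" "nths W S2 = nths W' S2'" using eq F[OF P(3)] F[OF Q(3)] by auto
   then have "set W = set W'" using mem(3)[OF P(2,4)] mem(3)[OF Q(2,4)] by simp
   then have W: "W = W'" using P(4) Q(4) strict_sorted_equal by (auto simp: chain_def)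
   moreover have "r = r'" using W P(4) Q(4) by (simp add: chain_def)
   moreover have "S1 = S1'" using mem(4)[OF P(2,4)] mem(4)[OF Q(2,4)] W e by simp
   moreover have "S2 = S2'" using mem(5)[OF P(2,4)] mem(5)[OF Q(2,4)] W e by simp
   ultimately show "P = Q" using P(1) Q(1) e by simp
  qed
  show "?k ` ?D = {x @ w @ y | x w y. x \<in> chain p a \<and> w \<in> F \<and> y \<in> chain q a}"
  proof (intro set_eqI iffI)
   fix V assume "V \<in> ?k ` ?D"
   then obtain r S1 S2 w W where P: "V = ?k ((r, S1, S2), w @ W)" "(r, S1, S2) \<in> merges p q" "w \<in> F" "W \<in> chain r a"
    by auto
   show "V \<in> {x @ w @ y | x w y. x \<in> chain p a \<and> w \<in> F \<and> y \<in> chain q a}"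
    using mem(1,2)[OF P(2,4)] P(3) unfolding P(1) k[OF P(3)] by blast
  next
   fix V assume "V \<in> {x @ w @ y | x w y. x \<in> chain p a \<and> w \<in> F \<and> y \<in> chain q a}"
   then obtain x w y where V: "V = x @ w @ y" "x \<in> chain p a" "w \<in> F" "y \<in> chain q a" by blast
   \<comment> \<open>The inverse map: the union of both chains, sorted; \<open>S1\<close> and
     \<open>S2\<close> below recover the positions.\<close>
   define W where "W = sorted_list_of_set (set x \<union> set y)"
   define r where "r = length W"
   define S1 where "S1 = {i. i < r \<and> W ! i \<in> set x}"
   define S2 where "S2 = {i. i < r \<and> W ! i \<in> set y}"
   have W: "sorted_wrt (<) W" "set W = set x \<union> set y" by (auto simp: W_def)
   have dist: "distinct x" "distinct y" "sorted_wrt (<) x" "sorted_wrt (<) y" "length x = p" "length y = q"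
    using V by (auto simp: chain_def strict_sorted_iff)
   have "r = card (set x \<union> set y)" unfolding r_def using W by (metis distinct_card strict_sorted_iff)
   also have "\<dots> \<le> card (set x) + card (set y)" by (rule card_Un_le)
   finally have r: "r \<le> p + q" using dist by (simp add: distinct_card)
   have Wc: "W \<in> chain r a" using W V by (auto simp: chain_def r_def)
   have sub: "nths W {i. i < r \<and> W ! i \<in> set z} = z" if "sorted_wrt (<) z" "set z \<subseteq> set W" for z
   proof -
    have "nths W {i. i < r \<and> W ! i \<in> set z} = filter (\<lambda>t. t \<in> set z) W"
     unfolding r_def by (rule filter_eq_nths[symmetric])
    also have "\<dots> = z"
     by (rule strict_sorted_equal) (use that W in "auto intro: sorted_wrt_filter")
    finally show ?thesis .
   qed
   have n1: "nths W S1 = x" unfolding S1_def by (rule sub) (use dist W in auto)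
   have n2: "nths W S2 = y" unfolding S2_def by (rule sub) (use dist W in auto)
   have c: "card S1 = p" "card S2 = q"
   proof -
    have "S1 \<subseteq> {..<r}" "S2 \<subseteq> {..<r}" by (auto simp: S1_def S2_def)
    then show "card S1 = p" "card S2 = q"
     using chain_length[OF nths_chain[OF Wc, of S1]] chain_length[OF nths_chain[OF Wc, of S2]] dist
     unfolding n1 n2 by auto
   qed
   have "S1 \<union> S2 = {..<r}" using W(2) by (auto simp: S1_def S2_def r_def dest: nth_mem)
   then have "(r, S1, S2) \<in> merges p q" unfolding merges_def using r c by simp
   moreover have "V = ?k ((r, S1, S2), w @ W)" unfolding k[OF V(3)] n1 n2 V(1) ..
   ultimately show "V \<in> ?k ` ?D" using V(3) Wc by (intro image_eqI[of _ _ "((r, S1, S2), w @ W)"]) auto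
  qed
 qed
qed

lemma Dfnl_nths:
 assumes "Dfnl A r W" "S \<subseteq> {..<r}"
 shows "Dfnl A (card S) (\<lambda>v. nths (W v) S)"
proof -
 define js where "js = nths [0..<r] S"
 have js: "set js \<subseteq> {..<r}" using set_nths_subset[of "[0..<r]" S] by (auto simp: js_def)
 have eq: "nths (W v) S = map (\<lambda>j. W v ! j) js" for v
 proof -
  have "W v = map (\<lambda>j. W v ! j) [0..<r]" using Dfnl_length[OF assms(1)] by (intro nth_equalityI) auto
  then have "nths (W v) S = nths (map (\<lambda>j. W v ! j) [0..<r]) S" by simp
  then show ?thesis unfolding js_def nths_map .
 qed
 have "{i. i < r \<and> i \<in> S} = S" using assms(2) by auto
 then have "length js = card S" by (simp add: js_def length_nths)
 moreover have "Dfn A (\<lambda>v. map (\<lambda>j. W v ! j) js ! i)" if "i < length js" for i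
  using Dfnl_nth[OF assms(1), of "js ! i"] js that nth_mem[OF that] by (simp add: subset_iff)
 ultimately show ?thesis unfolding eq Dfnl_def by simp
qed

text \<open>\<open>chain_split\<close> in families, applied to the first factor: a side that is a
  sum of two nonnegative functions is cut into these.\<close>

lemma box_split:
 fixes A :: "'a::linordered_ab_group_add set"
 assumes T: "definable_over A l T" and \<beta>: "\<And>d \<phi>. (d, \<phi>) \<in> set \<beta> ==> Dfs A l \<phi>"
  and D: "Dfs A l \<phi>" "Dfs A l \<psi>"
  and sum: "\<And>s. s \<in> T ==> \<chi> s = \<phi> s + \<psi> s" "\<And>s. s \<in> T ==> 0 \<le> \<phi> s" "\<And>s. s \<in> T ==> 0 \<le> \<psi> s"
 shows "dsum A (l + bdim ((d, \<chi>) # \<beta>)) (fam T (fbox ((d, \<chi>) # \<beta>))) {..d}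
  (\<lambda>i. l + bdim ((i, \<phi>) # (d - i, \<psi>) # \<beta>)) (\<lambda>i. fam T (fbox ((i, \<phi>) # (d - i, \<psi>) # \<beta>)))"
proof -
 define E where "E = (\<lambda>s. chain d (\<chi> s))"
 define Di where "Di = (\<lambda>i s. {x @ y | x y. x \<in> chain i (\<phi> s) \<and> y \<in> chain (d - i) (\<psi> s)})"
 have X: "fam T (fbox ((d, \<chi>) # \<beta>)) = fam T (\<lambda>s. {z @ w | z w. z \<in> E s \<and> w \<in> fbox \<beta> s})"
  by (rule fam_cong) (simp add: fbox_simps(2) E_def)
 have B: "fam T (fbox ((i, \<phi>) # (d - i, \<psi>) # \<beta>)) = fam T (\<lambda>s. {z @ w | z w. z \<in> Di i s \<and> w \<in> fbox \<beta> s})" for i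
 proof (rule fam_cong)
  fix s assume "s \<in> T"
  show "fbox ((i, \<phi>) # (d - i, \<psi>) # \<beta>) s = {z @ w | z w. z \<in> Di i s \<and> w \<in> fbox \<beta> s}"
   using fbox_simps(3)[of "[(i, \<phi>), (d - i, \<psi>)]" \<beta> s] by (simp add: fbox_simps Di_def)
 qed
 have "dsum A (l + (d + bdim \<beta>)) (fam T (\<lambda>s. {z @ w | z w. z \<in> E s \<and> w \<in> fbox \<beta> s})) {..d}
   (\<lambda>i. l + (d + bdim \<beta>)) (\<lambda>i. fam T (\<lambda>s. {z @ w | z w. z \<in> Di i s \<and> w \<in> fbox \<beta> s}))"
 proof (rule dsum_lift[where k = "\<lambda>i s z. take i z @ map (\<lambda>t. t + \<phi> s) (drop i z)"])
  show "finite {..d}" by simp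
  show "length s = l" if "s \<in> T" for s using definable_length[OF T that] .
  show "definable_over A (l + (d + bdim \<beta>)) (fam T (\<lambda>s. {z @ w | z w. z \<in> Di i s \<and> w \<in> fbox \<beta> s}))" if "i \<in> {..d}" for i
   using FB_definable[OF T, of "(i, \<phi>) # (d - i, \<psi>) # \<beta>"] \<beta> D that unfolding B by auto
  show "length z = d" if "i \<in> {..d}" "s \<in> T" "z \<in> Di i s" for i s z
  proof -
   obtain x y where "z = x @ y" "x \<in> chain i (\<phi> s)" "y \<in> chain (d - i) (\<psi> s)" using \<open>z \<in> Di i s\<close> unfolding Di_def by blast
   then show ?thesis using chain_length[of x] chain_length[of y] \<open>i \<in> {..d}\<close> by simp
  qed
  show "length z = d" if "s \<in> T" "z \<in> E s" for s z using that chain_length by (simp add: E_def chain_def)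
  show "length w = bdim \<beta>" if "s \<in> T" "w \<in> fbox \<beta> s" for s w using fbox_length[OF that(2)] .
  show "bij_betw (\<lambda>(i, z). take i z @ map (\<lambda>t. t + \<phi> s) (drop i z)) (SIGMA i:{..d}. Di i s) (E s)" if "s \<in> T" for s
   unfolding E_def Di_def sum(1)[OF that] by (rule chain_split[OF sum(2,3)[OF that]])
  fix i assume i: "i \<in> {..d}"
  show "Dfnl A d (\<lambda>v. take i (map (\<lambda>j. v (j + l)) [0..<d]) @
    map (\<lambda>t. t + \<phi> (map v [0..<l])) (drop i (map (\<lambda>j. v (j + l)) [0..<d])))"
  proof (rule DfnlI)
   fix v :: "nat => 'a"
   show "take i (map (\<lambda>j. v (j + l)) [0..<d]) @ map (\<lambda>t. t + \<phi> (map v [0..<l])) (drop i (map (\<lambda>j. v (j + l)) [0..<d])) =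
    map (\<lambda>j. (if j < i then v (j + l) else v (j + l) + \<phi> (map v [0..<l]))) [0..<d]"
    using i by (intro nth_equalityI) (auto simp: nth_append)
  next
   fix j
   show "Dfn A (\<lambda>v. if j < i then v (j + l) else v (j + l) + \<phi> (map v [0..<l]))"
    using D(1) by (cases "j < i") (auto simp: Dfs_def intro!: Dfn_var Dfn_plus)
  qed
 qed
 then have "dsum A (l + bdim ((d, \<chi>) # \<beta>)) (fam T (fbox ((d, \<chi>) # \<beta>))) {..d} (\<lambda>i. l + (d + bdim \<beta>))
   (\<lambda>i. fam T (fbox ((i, \<phi>) # (d - i, \<psi>) # \<beta>)))" unfolding X B by simp
 then show ?thesis by (rule dsum_cong) auto
qed

text \<open>\<open>chain_merge\<close> in families. The two factors with the same side become one,
  in the place of the second.\<close>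

lemma box_merge:
 fixes A :: "'a::linordered_ab_group_add set"
 assumes T: "definable_over A l T" and \<beta>: "\<And>d \<phi>. (d, \<phi>) \<in> set \<beta> ==> Dfs A l \<phi>"
  and \<gamma>: "\<And>d \<phi>. (d, \<phi>) \<in> set \<gamma> ==> Dfs A l \<phi>" and D: "Dfs A l \<phi>"
 shows "dsum A (l + bdim ((p, \<phi>) # \<beta> @ (q, \<phi>) # \<gamma>)) (fam T (fbox ((p, \<phi>) # \<beta> @ (q, \<phi>) # \<gamma>))) (merges p q)
  (\<lambda>j. l + bdim (\<beta> @ (fst j, \<phi>) # \<gamma>)) (\<lambda>j. fam T (fbox (\<beta> @ (fst j, \<phi>) # \<gamma>)))"
proof -
 define e where "e = bdim \<beta>"
 define E where "E = (\<lambda>s. {x @ w @ y | x w y. x \<in> chain p (\<phi> s) \<and> w \<in> fbox \<beta> s \<and> y \<in> chain q (\<phi> s)})"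
 define Dj where "Dj = (\<lambda>j :: nat \<times> nat set \<times> nat set. \<lambda>s. {w @ W | w W. w \<in> fbox \<beta> s \<and> W \<in> chain (fst j) (\<phi> s)})"
 define k :: "nat \<times> nat set \<times> nat set => 'a list => 'a list => 'a list"
  where "k = (\<lambda>(r, S1, S2) s u. nths (drop e u) S1 @ take e u @ nths (drop e u) S2)"
 have X: "fam T (fbox ((p, \<phi>) # \<beta> @ (q, \<phi>) # \<gamma>)) = fam T (\<lambda>s. {z @ w | z w. z \<in> E s \<and> w \<in> fbox \<gamma> s})"
 proof (rule fam_cong)
  fix s assume "s \<in> T"
  have "fbox ((p, \<phi>) # \<beta> @ (q, \<phi>) # \<gamma>) s = fbox (((p, \<phi>) # \<beta> @ [(q, \<phi>)]) @ \<gamma>) s" by simp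
  also have "\<dots> = {z @ w | z w. z \<in> fbox ((p, \<phi>) # \<beta> @ [(q, \<phi>)]) s \<and> w \<in> fbox \<gamma> s}" by (rule fbox_simps(3))
  also have "fbox ((p, \<phi>) # \<beta> @ [(q, \<phi>)]) s = E s"
   unfolding E_def fbox_simps(2,3) by (auto simp: fbox_simps(1,2))
  finally show "fbox ((p, \<phi>) # \<beta> @ (q, \<phi>) # \<gamma>) s = {z @ w | z w. z \<in> E s \<and> w \<in> fbox \<gamma> s}" .
 qed
 have B: "fam T (fbox (\<beta> @ (fst j, \<phi>) # \<gamma>)) = fam T (\<lambda>s. {z @ w | z w. z \<in> Dj j s \<and> w \<in> fbox \<gamma> s})" for j
 proof (rule fam_cong)
  fix s assume "s \<in> T"
  have "fbox (\<beta> @ (fst j, \<phi>) # \<gamma>) s = fbox ((\<beta> @ [(fst j, \<phi>)]) @ \<gamma>) s" by simp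
  also have "\<dots> = {z @ w | z w. z \<in> fbox (\<beta> @ [(fst j, \<phi>)]) s \<and> w \<in> fbox \<gamma> s}" by (rule fbox_simps(3))
  also have "fbox (\<beta> @ [(fst j, \<phi>)]) s = Dj j s"
   unfolding Dj_def fbox_simps(3) by (simp add: fbox_simps(1,2))
  finally show "fbox (\<beta> @ (fst j, \<phi>) # \<gamma>) s = {z @ w | z w. z \<in> Dj j s \<and> w \<in> fbox \<gamma> s}" .
 qed
 have "dsum A (l + ((p + (e + q)) + bdim \<gamma>)) (fam T (\<lambda>s. {z @ w | z w. z \<in> E s \<and> w \<in> fbox \<gamma> s})) (merges p q)
   (\<lambda>j. l + ((e + fst j) + bdim \<gamma>)) (\<lambda>j. fam T (\<lambda>s. {z @ w | z w. z \<in> Dj j s \<and> w \<in> fbox \<gamma> s}))"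
 proof (rule dsum_lift[where k = k])
  show "finite (merges p q)" by (rule finite_merges)
  show "length s = l" if "s \<in> T" for s using definable_length[OF T that] .
  show "definable_over A (l + ((e + fst j) + bdim \<gamma>)) (fam T (\<lambda>s. {z @ w | z w. z \<in> Dj j s \<and> w \<in> fbox \<gamma> s}))" for j
   using FB_definable[OF T, of "\<beta> @ (fst j, \<phi>) # \<gamma>"] \<beta> \<gamma> D unfolding B by (auto simp: e_def add.assoc)
  show "length z = e + fst j" if "z \<in> Dj j s" for j s z
  proof -
   obtain w W where "z = w @ W" "w \<in> fbox \<beta> s" "W \<in> chain (fst j) (\<phi> s)" using \<open>z \<in> Dj j s\<close> unfolding Dj_def by blast
   then show ?thesis using chain_length[of W] fbox_length[of w] by (simp add: e_def)
  qed
  show "length z = p + (e + q)" if "z \<in> E s" for s z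
  proof -
   obtain x w y where "z = x @ w @ y" "x \<in> chain p (\<phi> s)" "w \<in> fbox \<beta> s" "y \<in> chain q (\<phi> s)"
    using \<open>z \<in> E s\<close> unfolding E_def by blast
   then show ?thesis using chain_length[of x] chain_length[of y] fbox_length[of w] by (simp add: e_def)
  qed
  show "length w = bdim \<gamma>" if "w \<in> fbox \<gamma> s" for s w using fbox_length[OF that] .
  show "bij_betw (\<lambda>(j, z). k j s z) (SIGMA j:merges p q. Dj j s) (E s)" for s
  proof -
   have *: "(\<lambda>(j, z). k j s z) = (\<lambda>((r, S1, S2), u). nths (drop e u) S1 @ take e u @ nths (drop e u) S2)"
    by (auto simp: fun_eq_iff k_def)
   show ?thesis
    unfolding E_def Dj_def * by (rule chain_merge) (simp add: e_def fbox_length)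
  qed
  fix j assume j: "j \<in> merges p q"
  obtain r S1 S2 where jj: "j = (r, S1, S2)" by (cases j)
  have S: "S1 \<subseteq> {..<r}" "S2 \<subseteq> {..<r}" "card S1 = p" "card S2 = q" using j jj by (auto simp: merges_def)
  have 1: "drop e (map (\<lambda>j. v (j + l)) [0..<e + r]) = map (\<lambda>j. v (j + (e + l))) [0..<r]"
   "take e (map (\<lambda>j. v (j + l)) [0..<e + r]) = map (\<lambda>j. v (j + l)) [0..<e]" for v :: "nat => 'a"
   by (rule nth_equalityI; auto simp: add.commute add.left_commute)+
  have 2: "Dfnl A r (\<lambda>v. map (\<lambda>j. v (j + (e + l))) [0..<r])" "Dfnl A e (\<lambda>v. map (\<lambda>j. v (j + l)) [0..<e])"
   by (rule Dfnl_cast, rule Dfnl_upt, rule Dfn_var, simp)+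
  have 3: "Dfnl A p (\<lambda>v. nths (map (\<lambda>j. v (j + (e + l))) [0..<r]) S1)"
   "Dfnl A q (\<lambda>v. nths (map (\<lambda>j. v (j + (e + l))) [0..<r]) S2)"
   using Dfnl_nths[OF 2(1) S(1)] Dfnl_nths[OF 2(1) S(2)] S(3,4) by simp_all
  show "Dfnl A (p + (e + q)) (\<lambda>v. k j (map v [0..<l]) (map (\<lambda>j. v (j + l)) [0..<e + fst j]))"
   unfolding jj k_def prod.case fst_conv 1 by (intro Dfnl_append 3 2)
 qed
 then show ?thesis unfolding X[symmetric] B[symmetric] by (simp add: e_def add.assoc)
qed

section \<open>Normal forms of families of boxes\<close>

text \<open>Normal form over a base \<open>T\<close>: all boxes have exactly the sides
  \<open>\<phi>s\<close>, in this order, and only the lengths of the chains vary; a length 0 makes a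
  factor trivial.\<close>

definition good where
 "good A l T \<phi>s n X \<longleftrightarrow> (\<exists>(I :: nat set) \<delta>. (\<forall>i\<in>I. length (\<delta> i) = length \<phi>s) \<and>
   dsum A n X I (\<lambda>i. l + bdim (zip (\<delta> i) \<phi>s)) (\<lambda>i. fam T (fbox (zip (\<delta> i) \<phi>s))))"

lemma dsum_nat_index:
 assumes "dsum A n X J m B" obtains f :: "nat => 'j" and N
 where "bij_betw f {0..<N} J" "dsum A n X {0..<N} (\<lambda>i. m (f i)) (\<lambda>i. B (f i))"
proof -
 have "finite J" using assms by (simp add: dsum_def)
 then obtain f where "bij_betw f {0..<card J} J" using ex_bij_betw_nat_finite by blast
 then show ?thesis using dsum_reindex[OF assms] that by blast
qed

lemma good_trans:
 assumes "dsum A n X J m B" "\<And>j. j \<in> J ==> good A l T \<phi>s (m j) (B j)"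
 shows "good A l T \<phi>s n X"
proof -
 have "\<forall>j\<in>J. \<exists>(I :: nat set) \<delta>. (\<forall>i\<in>I. length (\<delta> i) = length \<phi>s) \<and>
   dsum A (m j) (B j) I (\<lambda>i. l + bdim (zip (\<delta> i) \<phi>s)) (\<lambda>i. fam T (fbox (zip (\<delta> i) \<phi>s)))"
  using assms(2) unfolding good_def by blast
 then obtain I :: "'b => nat set" and \<delta> where
  I: "\<And>j i. j \<in> J ==> i \<in> I j ==> length (\<delta> j i) = length \<phi>s"
  "\<And>j. j \<in> J ==> dsum A (m j) (B j) (I j) (\<lambda>i. l + bdim (zip (\<delta> j i) \<phi>s)) (\<lambda>i. fam T (fbox (zip (\<delta> j i) \<phi>s)))"
  by metis
 obtain f N where f: "bij_betw f {0..<N :: nat} (Sigma J I)"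
  "dsum A n X {0..<N} (\<lambda>i. (\<lambda>(j, i). l + bdim (zip (\<delta> j i) \<phi>s)) (f i)) (\<lambda>i. (\<lambda>(j, i). fam T (fbox (zip (\<delta> j i) \<phi>s))) (f i))"
  using dsum_nat_index[OF dsum_trans[OF assms(1) I(2)]] by blast
 define \<delta>' where "\<delta>' = (\<lambda>i. \<delta> (fst (f i)) (snd (f i)))"
 have "length (\<delta>' i) = length \<phi>s" if "i \<in> {0..<N}" for i
 proof -
  have "f i \<in> Sigma J I" using bij_betw_apply[OF f(1) that] .
  then show ?thesis using I(1) unfolding \<delta>'_def by auto
 qed
 moreover have "dsum A n X {0..<N} (\<lambda>i. l + bdim (zip (\<delta>' i) \<phi>s)) (\<lambda>i. fam T (fbox (zip (\<delta>' i) \<phi>s)))"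
  using f(2) by (simp add: \<delta>'_def case_prod_unfold)
 ultimately show ?thesis unfolding good_def by blast
qed

lemma dsum_self: "definable_over A n X ==> dsum A n X {i} (\<lambda>_. n) (\<lambda>_. X)"
 by (rule dsum_partition) auto

lemma dsum_empty: "dsum A n {} {} m B"
proof -
 have "dsum A n {} {} (\<lambda>_. n) B" by (rule dsum_partition) auto
 then show ?thesis by (rule dsum_cong) auto
qed

lemma good_empty: "good A l T \<phi>s n {}"
 unfolding good_def using dsum_empty by blast

lemma set_zipD: "(d, \<phi>) \<in> set (zip ds \<phi>s) ==> \<phi> \<in> set \<phi>s"
 by (rule set_zip_rightD)

lemma good_self:
 assumes "definable_over A l T" "\<And>\<phi>. \<phi> \<in> set \<phi>s ==> Dfs A l \<phi>" "length ds = length \<phi>s"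
 shows "good A l T \<phi>s (l + bdim (zip ds \<phi>s)) (fam T (fbox (zip ds \<phi>s)))"
proof -
 have "definable_over A (l + bdim (zip ds \<phi>s)) (fam T (fbox (zip ds \<phi>s)))"
  by (rule FB_definable[OF assms(1)]) (use assms(2) set_zipD in fast)
 from dsum_self[OF this, of "0 :: nat"] show ?thesis
  unfolding good_def using assms(3) by (intro exI[of _ "{0}"] exI[of _ "\<lambda>_. ds"]) simp
qed

text \<open>The coefficients are natural numbers because a side is used up one unit at a time, and
  each unit cut off must be nonnegative.\<close>

definition comb :: "('a list => 'a::ab_group_add) list => (nat => nat) => 'a list => 'a" where
 "comb \<phi>s c s = (\<Sum>j<length \<phi>s. int (c j) \<cdot> (\<phi>s ! j) s)"

lemma Dfs_comb: "(\<And>\<phi>. \<phi> \<in> set \<phi>s ==> Dfs A l \<phi>) ==> Dfs A l (comb \<phi>s c)"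
 unfolding Dfs_def comb_def by (intro Dfn_sum Dfn_zsc) auto

lemma comb_nonneg:
 fixes \<phi>s :: "('a list => 'a::linordered_ab_group_add) list"
 shows "(\<And>\<phi>. \<phi> \<in> set \<phi>s ==> 0 \<le> \<phi> s) ==> 0 \<le> comb \<phi>s c s"
 unfolding comb_def by (intro sum_nonneg zsc_nonneg) auto

text \<open>One unit of a side is split off at a time and merged into the corresponding factor.\<close>

lemma good_boxes:
 fixes A :: "'a::linordered_ab_group_add set"
 assumes T: "definable_over A l T" and \<phi>s: "\<And>\<phi>. \<phi> \<in> set \<phi>s ==> Dfs A l \<phi>"
  "\<And>\<phi> s. \<phi> \<in> set \<phi>s ==> s \<in> T ==> 0 \<le> \<phi> s"
  and len: "length ds = length \<phi>s"
 shows "good A l T \<phi>s (l + bdim (map (\<lambda>(d, c). (d, comb \<phi>s c)) bs @ zip ds \<phi>s))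
  (fam T (fbox (map (\<lambda>(d, c). (d, comb \<phi>s c)) bs @ zip ds \<phi>s)))"
 using len
proof (induction bs arbitrary: ds)
 case Nil
 then show ?case using good_self[OF T \<phi>s(1)] by simp
next
 case (Cons b bs)
 define \<beta> where "\<beta> = map (\<lambda>(d, c). (d, comb \<phi>s c)) bs"
 have D\<beta>: "Dfs A l \<phi>" if "(d, \<phi>) \<in> set \<beta>" for d \<phi> using that Dfs_comb[OF \<phi>s(1)] by (auto simp: \<beta>_def)
 have Dz: "Dfs A l \<phi>" if "(d, \<phi>) \<in> set (zip ds \<phi>s)" for d \<phi> ds using set_zipD[OF that] \<phi>s(1) by blast
 have IH: "good A l T \<phi>s (l + bdim (\<beta> @ zip ds \<phi>s)) (fam T (fbox (\<beta> @ zip ds \<phi>s)))" if "length ds = length \<phi>s" for ds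
  unfolding \<beta>_def using Cons.IH[OF that] .
 \<comment> \<open>The inner induction runs over the number \<open>N\<close> of units in the side of
   the first factor; the lengths \<open>d\<close> and \<open>ds\<close> have to be general, since
   splitting and merging change them.\<close>
 have "good A l T \<phi>s (l + bdim ((d, comb \<phi>s c) # \<beta> @ zip ds \<phi>s)) (fam T (fbox ((d, comb \<phi>s c) # \<beta> @ zip ds \<phi>s)))"
  if "length ds = length \<phi>s" "N = (\<Sum>j<length \<phi>s. c j)" for N d c ds
  using that
 proof (induction N arbitrary: d c ds)
  case 0
  then have "comb \<phi>s c s = 0" for s unfolding comb_def by (intro sum.neutral) simp
  \<comment> \<open>A chain below 0 is empty, except the chain of length 0.\<close>
  then have *: "fbox ((d, comb \<phi>s c) # \<beta> @ zip ds \<phi>s) s = (if d = 0 then fbox (\<beta> @ zip ds \<phi>s) s else {})" for s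
   by (cases "d = 0") (auto simp: fbox_simps(2) chain_empty)
  show ?case
  proof (cases "d = 0")
   case True
   then have "fam T (fbox ((d, comb \<phi>s c) # \<beta> @ zip ds \<phi>s)) = fam T (fbox (\<beta> @ zip ds \<phi>s))"
   proof (intro fam_cong)
    fix s assume "s \<in> T"
    show "fbox ((d, comb \<phi>s c) # \<beta> @ zip ds \<phi>s) s = fbox (\<beta> @ zip ds \<phi>s) s" by (rule HOL.trans[OF *[of s] if_P[OF True]])
   qed
   then show ?thesis using IH[OF 0(1)] True by simp
  next
   case False
   then have "fam T (fbox ((d, comb \<phi>s c) # \<beta> @ zip ds \<phi>s)) = {}" unfolding fam_def * by simp
   then show ?thesis using good_empty by simp
  qed
 next
  case (Suc N)
  obtain j where j: "j < length \<phi>s" "0 < c j"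
  proof (rule ccontr)
   assume "\<not> thesis"
   then have "\<forall>j<length \<phi>s. c j = 0" using that by blast
   then have "(\<Sum>j<length \<phi>s. c j) = 0" by (intro sum.neutral) simp
   then show False using Suc.prems by simp
  qed
  define \<phi> where "\<phi> = \<phi>s ! j"
  define c' where "c' = c(j := c j - 1)"
  define \<psi> where "\<psi> = comb \<phi>s c'"
  have \<phi>: "\<phi> \<in> set \<phi>s" using j by (simp add: \<phi>_def)
  have eq: "comb \<phi>s c s = \<phi> s + \<psi> s" for s
  proof -
   have "comb \<phi>s c s = int (c j) \<cdot> \<phi> s + (\<Sum>i\<in>{..<length \<phi>s} - {j}. int (c i) \<cdot> (\<phi>s ! i) s)"
    unfolding comb_def \<phi>_def using j by (subst sum.remove[of _ j]) auto
   also have "int (c j) \<cdot> \<phi> s = \<phi> s + int (c' j) \<cdot> \<phi> s"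
    using j(2) zsc_add_left[of 1 "int (c j - 1)" "\<phi> s"] by (simp add: c'_def of_nat_diff)
   also have "(\<Sum>i\<in>{..<length \<phi>s} - {j}. int (c i) \<cdot> (\<phi>s ! i) s) = (\<Sum>i\<in>{..<length \<phi>s} - {j}. int (c' i) \<cdot> (\<phi>s ! i) s)"
    by (rule sum.cong) (auto simp: c'_def)
   also have "\<phi> s + int (c' j) \<cdot> \<phi> s + \<dots> = \<phi> s + (int (c' j) \<cdot> \<phi> s + \<dots>)" by (simp add: add.assoc)
   also have "int (c' j) \<cdot> \<phi> s + (\<Sum>i\<in>{..<length \<phi>s} - {j}. int (c' i) \<cdot> (\<phi>s ! i) s) = \<psi> s"
    unfolding \<psi>_def comb_def \<phi>_def using j by (subst (2) sum.remove[of _ j]) auto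
   finally show ?thesis .
  qed
  have N: "N = (\<Sum>i<length \<phi>s. c' i)"
  proof -
   have "(\<Sum>i<length \<phi>s. c i) = c j + (\<Sum>i\<in>{..<length \<phi>s} - {j}. c i)" using j by (subst sum.remove[of _ j]) auto
   moreover have "(\<Sum>i<length \<phi>s. c' i) = c' j + (\<Sum>i\<in>{..<length \<phi>s} - {j}. c' i)" using j by (subst sum.remove[of _ j]) auto
   moreover have "(\<Sum>i\<in>{..<length \<phi>s} - {j}. c' i) = (\<Sum>i\<in>{..<length \<phi>s} - {j}. c i)"
    by (rule sum.cong) (auto simp: c'_def)
   ultimately show ?thesis using Suc.prems(2) j(2) by (simp add: c'_def)
  qed
  have Dfs: "Dfs A l \<phi>" "Dfs A l \<psi>" using \<phi>s(1)[OF \<phi>] Dfs_comb[OF \<phi>s(1)] by (auto simp: \<psi>_def)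
  have D1: "Dfs A l \<phi>'" if "(d, \<phi>') \<in> set (\<beta> @ zip ds \<phi>s)" for d \<phi>' using that D\<beta> Dz by auto
  \<comment> \<open>One unit \<open>\<phi>\<close> is cut off; the remaining side
    \<open>\<psi>\<close> has one unit less.\<close>
  have split: "dsum A (l + bdim ((d, comb \<phi>s c) # \<beta> @ zip ds \<phi>s)) (fam T (fbox ((d, comb \<phi>s c) # \<beta> @ zip ds \<phi>s))) {..d}
   (\<lambda>i. l + bdim ((i, \<phi>) # (d - i, \<psi>) # \<beta> @ zip ds \<phi>s)) (\<lambda>i. fam T (fbox ((i, \<phi>) # (d - i, \<psi>) # \<beta> @ zip ds \<phi>s)))"
   by (rule box_split[OF T D1 Dfs]) (use \<phi>s(2)[OF \<phi>] comb_nonneg[of \<phi>s] \<phi>s(2) eq in \<open>auto simp: \<psi>_def\<close>)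
  show ?case
  proof (rule good_trans[OF split])
   fix i
   define \<beta>1 where "\<beta>1 = (d - i, \<psi>) # \<beta> @ take j (zip ds \<phi>s)"
   define \<gamma> where "\<gamma> = drop (Suc j) (zip ds \<phi>s)"
   have lz: "j < length (zip ds \<phi>s)" using j Suc.prems by simp
   have z: "zip ds \<phi>s = take j (zip ds \<phi>s) @ (ds ! j, \<phi>) # \<gamma>"
    using id_take_nth_drop[OF lz] Suc.prems j by (simp add: \<gamma>_def \<phi>_def)
   have zu: "zip (ds[j := r]) \<phi>s = take j (zip ds \<phi>s) @ (r, \<phi>) # \<gamma>" for r
   proof -
    have "zip (ds[j := r]) \<phi>s = (zip ds \<phi>s)[j := (r, \<phi>)]"
     using Suc.prems j by (intro nth_equalityI) (auto simp: nth_list_update \<phi>_def)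
    then show ?thesis using upd_conv_take_nth_drop[OF lz] by (simp add: \<gamma>_def)
   qed
   have e1: "(i, \<phi>) # (d - i, \<psi>) # \<beta> @ zip ds \<phi>s = (i, \<phi>) # \<beta>1 @ (ds ! j, \<phi>) # \<gamma>"
    by (subst z) (simp add: \<beta>1_def)
   have D1': "Dfs A l \<phi>'" if "(e, \<phi>') \<in> set \<beta>1" for e \<phi>'
    using that Dfs D\<beta> Dz[of e \<phi>' ds] by (auto simp: \<beta>1_def dest: in_set_takeD)
   have D2': "Dfs A l \<phi>'" if "(e, \<phi>') \<in> set \<gamma>" for e \<phi>'
    using that Dz[of e \<phi>' ds] by (auto simp: \<gamma>_def dest: in_set_dropD)
   show "good A l T \<phi>s (l + bdim ((i, \<phi>) # (d - i, \<psi>) # \<beta> @ zip ds \<phi>s)) (fam T (fbox ((i, \<phi>) # (d - i, \<psi>) # \<beta> @ zip ds \<phi>s)))"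
    unfolding e1
   proof (rule good_trans[OF box_merge[OF T D1' D2' Dfs(1)]])
    \<comment> \<open>The factor with side \<open>\<phi>\<close> is merged into the
      \<open>j\<close>-th factor of the normal form; only the length there changes, to
      \<open>fst r\<close>.\<close>
    fix r :: "nat \<times> nat set \<times> nat set"
    have "\<beta>1 @ (fst r, \<phi>) # \<gamma> = (d - i, comb \<phi>s c') # \<beta> @ zip (ds[j := fst r]) \<phi>s"
     unfolding zu \<beta>1_def \<psi>_def by simp
    then show "good A l T \<phi>s (l + bdim (\<beta>1 @ (fst r, \<phi>) # \<gamma>)) (fam T (fbox (\<beta>1 @ (fst r, \<phi>) # \<gamma>)))"
     using Suc.IH[of "ds[j := fst r]" c' "d - i"] N Suc.prems(1) by simp
   qed
  qed
 qed
 from this[OF Cons.prems HOL.refl] show ?case by (simp add: \<beta>_def case_prod_unfold)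
qed

section \<open>Decomposition of bounded sets into boxes\<close>

text \<open>The sides are still arbitrary nonnegative elements of \<open>zhull A\<close>; a common
  basis for them is introduced only when two sets are compared.\<close>

definition boxy :: "'a::zgroup set => nat => 'a list set => bool" where
 "boxy A n X \<longleftrightarrow> (\<exists>(I :: nat set) bx. (\<forall>i\<in>I. \<forall>p\<in>set (bx i). snd p \<in> zhull A \<and> 0 \<le> snd p) \<and>
   dsum A n X I (\<lambda>i. bdim (bx i)) (\<lambda>i. box (bx i)))"

lemma boxy_trans:
 assumes "dsum A n X J m B" "\<And>j. j \<in> J ==> boxy A (m j) (B j)"
 shows "boxy A n X"
proof -
 have "\<forall>j\<in>J. \<exists>(I :: nat set) bx. (\<forall>i\<in>I. \<forall>p\<in>set (bx i). snd p \<in> zhull A \<and> 0 \<le> snd p) \<and>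
   dsum A (m j) (B j) I (\<lambda>i. bdim (bx i)) (\<lambda>i. box (bx i))"
  using assms(2) unfolding boxy_def by blast
 then obtain I :: "'b => nat set" and bx where
  I: "\<And>j i p. j \<in> J ==> i \<in> I j ==> p \<in> set (bx j i) ==> snd p \<in> zhull A \<and> 0 \<le> snd p"
  "\<And>j. j \<in> J ==> dsum A (m j) (B j) (I j) (\<lambda>i. bdim (bx j i)) (\<lambda>i. box (bx j i))"
  by metis
 obtain f N where f: "bij_betw f {0..<N :: nat} (Sigma J I)"
  "dsum A n X {0..<N} (\<lambda>i. (\<lambda>(j, i). bdim (bx j i)) (f i)) (\<lambda>i. (\<lambda>(j, i). box (bx j i)) (f i))"
  using dsum_nat_index[OF dsum_trans[OF assms(1) I(2)]] by blast
 define bx' where "bx' = (\<lambda>i. bx (fst (f i)) (snd (f i)))"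
 have "snd p \<in> zhull A \<and> 0 \<le> snd p" if "i \<in> {0..<N}" "p \<in> set (bx' i)" for i p
 proof -
  have "f i \<in> Sigma J I" using bij_betw_apply[OF f(1) that(1)] .
  then show ?thesis using I(1)[of "fst (f i)" "snd (f i)" p] that(2) unfolding bx'_def by auto
 qed
 moreover have "dsum A n X {0..<N} (\<lambda>i. bdim (bx' i)) (\<lambda>i. box (bx' i))"
  using f(2) by (simp add: bx'_def case_prod_unfold)
 ultimately show ?thesis unfolding boxy_def by blast
qed

lemma boxy_empty: "boxy A n {}"
 unfolding boxy_def using dsum_empty by blast

lemma box_definable:
 assumes "\<And>p. p \<in> set bx ==> snd p \<in> zhull A"
 shows "definable_over A (bdim bx) (box bx)"
proof -
 define \<beta> where "\<beta> = map (\<lambda>(d, a). (d, \<lambda>v :: nat => 'a. a)) bx"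
 have b: "bdim \<beta> = bdim bx" unfolding \<beta>_def by (induction bx) auto
 have "Def A (\<lambda>v. map v [0..<bdim bx] \<in> box (map (\<lambda>(d, t). (d, t v)) \<beta>))"
 proof (rule Def_box)
  show "Dfnl A (bdim \<beta>) (\<lambda>v. map v [0..<bdim bx])" unfolding b by (rule Dfnl_vars)
  fix d t assume "(d, t) \<in> set \<beta>"
  then obtain a where a: "t = (\<lambda>v. a)" "(d, a) \<in> set bx" by (auto simp: \<beta>_def)
  show "Dfn A t" unfolding a(1) by (rule Dfn_zhull) (use assms[OF a(2)] in simp)
 qed
 moreover have "map (\<lambda>(d, t). (d, t v)) \<beta> = bx" for v
  unfolding \<beta>_def map_map by (rule map_idI) auto
 moreover have "\<forall>x\<in>box bx. length x = bdim bx" using box_length by blast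
 ultimately show ?thesis by (simp only: definable_over_iff)
qed

lemma boxy_box:
 assumes "\<And>p. p \<in> set bx ==> snd p \<in> zhull A \<and> 0 \<le> snd p"
 shows "boxy A (bdim bx) (box bx)"
proof -
 have "definable_over A (bdim bx) (box bx)" by (rule box_definable) (use assms in blast)
 from dsum_self[OF this, of "0 :: nat"] show ?thesis
  unfolding boxy_def using assms by (intro exI[of _ "{0}"] exI[of _ "\<lambda>_. bx"]) simp
qed

text \<open>A chain consists of its entry \<open>s\<close> in position \<open>p\<close>, the
  \<open>p\<close> entries below, and the \<open>q\<close> entries above, which are translated by
  \<open>s + zone\<close> into \<open>[0, a - zone - s)\<close>. Read backwards, it absorbs a
  coordinate \<open>s\<close> and two sides that depend on it into one chain with a constant
  side.\<close>

lemma chain_point: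
 fixes a :: "'a::zgroup"
 shows "bij_betw (\<lambda>z. [z ! p] @ take p z @ map (\<lambda>t. t - z ! p - zone) (drop (Suc p) z)) (chain (Suc (p + q)) a)
  {[s] @ x @ y | s x y. 0 \<le> s \<and> s < a \<and> x \<in> chain p s \<and> y \<in> chain q (a - zone - s)}"
proof (rule bij_betw_byWitness[where f' = "\<lambda>u. take p (tl u) @ [hd u] @ map (\<lambda>t. t + hd u + zone) (drop (Suc p) u)"])
 let ?C = "chain (Suc (p + q)) a"
 let ?P = "{[s] @ x @ y | s x y. 0 \<le> s \<and> s < a \<and> x \<in> chain p s \<and> y \<in> chain q (a - zone - s)}"
 have dec: "\<exists>x s w. z = x @ s # w \<and> length x = p \<and> length w = q" if "z \<in> ?C" for z
 proof -
  have "p < length z" using that by (simp add: chain_def)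
  from id_take_nth_drop[OF this] show ?thesis using that
   by (intro exI[of _ "take p z"] exI[of _ "z ! p"] exI[of _ "drop (Suc p) z"]) (simp add: chain_def)
 qed
 show "\<forall>z\<in>?C. take p (tl ([z ! p] @ take p z @ map (\<lambda>t. t - z ! p - zone) (drop (Suc p) z))) @
   [hd ([z ! p] @ take p z @ map (\<lambda>t. t - z ! p - zone) (drop (Suc p) z))] @
   map (\<lambda>t. t + hd ([z ! p] @ take p z @ map (\<lambda>t. t - z ! p - zone) (drop (Suc p) z)) + zone)
    (drop (Suc p) ([z ! p] @ take p z @ map (\<lambda>t. t - z ! p - zone) (drop (Suc p) z))) = z"
 proof
  fix z assume "z \<in> ?C"
  then obtain x s w where z: "z = x @ s # w" "length x = p" using dec by blast
  show "take p (tl ([z ! p] @ take p z @ map (\<lambda>t. t - z ! p - zone) (drop (Suc p) z))) @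
   [hd ([z ! p] @ take p z @ map (\<lambda>t. t - z ! p - zone) (drop (Suc p) z))] @
   map (\<lambda>t. t + hd ([z ! p] @ take p z @ map (\<lambda>t. t - z ! p - zone) (drop (Suc p) z)) + zone)
    (drop (Suc p) ([z ! p] @ take p z @ map (\<lambda>t. t - z ! p - zone) (drop (Suc p) z))) = z"
   using z by (simp add: nth_append comp_def algebra_simps)
 qed
 show "\<forall>u\<in>?P. [(take p (tl u) @ [hd u] @ map (\<lambda>t. t + hd u + zone) (drop (Suc p) u)) ! p] @
   take p (take p (tl u) @ [hd u] @ map (\<lambda>t. t + hd u + zone) (drop (Suc p) u)) @
   map (\<lambda>t. t - (take p (tl u) @ [hd u] @ map (\<lambda>t. t + hd u + zone) (drop (Suc p) u)) ! p - zone)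
    (drop (Suc p) (take p (tl u) @ [hd u] @ map (\<lambda>t. t + hd u + zone) (drop (Suc p) u))) = u"
 proof
  fix u assume "u \<in> ?P"
  then obtain s x y where u: "u = s # x @ y" "length x = p" by (auto simp: chain_def)
  show "[(take p (tl u) @ [hd u] @ map (\<lambda>t. t + hd u + zone) (drop (Suc p) u)) ! p] @
   take p (take p (tl u) @ [hd u] @ map (\<lambda>t. t + hd u + zone) (drop (Suc p) u)) @
   map (\<lambda>t. t - (take p (tl u) @ [hd u] @ map (\<lambda>t. t + hd u + zone) (drop (Suc p) u)) ! p - zone)
    (drop (Suc p) (take p (tl u) @ [hd u] @ map (\<lambda>t. t + hd u + zone) (drop (Suc p) u))) = u"
   using u by (simp add: nth_append comp_def algebra_simps)
 qed
 show "(\<lambda>z. [z ! p] @ take p z @ map (\<lambda>t. t - z ! p - zone) (drop (Suc p) z)) ` ?C \<subseteq> ?P"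
 proof (rule image_subsetI)
  fix z assume zC: "z \<in> ?C"
  then obtain x s w where z: "z = x @ s # w" "length x = p" "length w = q" using dec by blast
  have srt: "sorted_wrt (<) x" "sorted_wrt (<) w" "\<And>t. t \<in> set x ==> t < s" "\<And>t. t \<in> set w ==> s < t"
   and bd: "\<And>t. t \<in> set x ==> 0 \<le> t" "\<And>t. t \<in> set w ==> t < a" "0 \<le> s" "s < a"
   using zC unfolding z(1) chain_def by (auto simp: sorted_wrt_append)
  define y where "y = map (\<lambda>t. t - s - zone) w"
  have "0 \<le> t - s - zone \<and> t - s - zone < a - zone - s" if "t \<in> set w" for t
   using srt(4)[OF that] bd(2)[OF that] unfolding less_iff_zone[of s t] by (simp add: algebra_simps)
  moreover have "sorted_wrt (<) y" unfolding y_def sorted_wrt_map using srt(2) by simp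
  ultimately have "y \<in> chain q (a - zone - s)" using z(3) by (auto simp: chain_def y_def)
  moreover have "x \<in> chain p s" using srt bd z(2) by (simp add: chain_def)
  moreover have "[z ! p] @ take p z @ map (\<lambda>t. t - z ! p - zone) (drop (Suc p) z) = [s] @ x @ y"
   using z by (simp add: nth_append y_def)
  ultimately show "[z ! p] @ take p z @ map (\<lambda>t. t - z ! p - zone) (drop (Suc p) z) \<in> ?P" using bd(3,4) by blast
 qed
 show "(\<lambda>u. take p (tl u) @ [hd u] @ map (\<lambda>t. t + hd u + zone) (drop (Suc p) u)) ` ?P \<subseteq> ?C"
 proof (rule image_subsetI)
  fix u assume "u \<in> ?P"
  then obtain s x y where u: "u = s # x @ y" "0 \<le> s" "s < a" "x \<in> chain p s" "y \<in> chain q (a - zone - s)" by auto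
  have "take p (tl u) @ [hd u] @ map (\<lambda>t. t + hd u + zone) (drop (Suc p) u) = x @ [s] @ map (\<lambda>t. t + s + zone) y"
   using u(1) chain_length[OF u(4)] by simp
  moreover have "x @ [s] @ map (\<lambda>t. t + s + zone) y \<in> ?C"
  proof -
   have x: "\<And>t. t \<in> set x ==> 0 \<le> t \<and> t < s" "sorted_wrt (<) x" "length x = p" using u(4) by (auto simp: chain_def)
   have y: "\<And>t. t \<in> set y ==> s < t + s + zone \<and> t + s + zone < a" "sorted_wrt (<) y" "length y = q"
   proof -
    fix t assume "t \<in> set y"
    then have "0 \<le> t" "t < a - zone - s" using u(5) by (auto simp: chain_def)
    moreover have "s + 0 < s + (t + zone)" using \<open>0 \<le> t\<close> zone_pos[where 'a = 'a] by (intro add_strict_left_mono add_nonneg_pos)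
    ultimately show "s < t + s + zone \<and> t + s + zone < a" by (simp add: algebra_simps)
   qed (use u(5) in \<open>auto simp: chain_def\<close>)
   have "sorted_wrt (<) (map (\<lambda>t. t + s + zone) y)" unfolding sorted_wrt_map using y(2) by simp
   moreover have "t < t' + s + zone" if "t \<in> set x" "t' \<in> set y" for t t'
    using x(1)[OF that(1)] y(1)[OF that(2)] by (meson order_less_trans)
   moreover have "0 \<le> t' + s + zone" if "t' \<in> set y" for t' using y(1)[OF that] u(2) by (meson order_le_less_trans order_less_imp_le)
   moreover have "t < a" if "t \<in> set x" for t using x(1)[OF that] u(3) by (meson order_less_trans)
   ultimately show ?thesis using x y u(2,3) by (auto simp: chain_def sorted_wrt_append)
  qed
  ultimately show "take p (tl u) @ [hd u] @ map (\<lambda>t. t + hd u + zone) (drop (Suc p) u) \<in> ?C" by simp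
 qed
qed

lemma fam_Nil: "fam {[]} X = X []"
 by (auto simp: fam_def)

lemma fbox_zeros: "fbox (zip (replicate (length \<phi>s) 0) \<phi>s) s = {[]}"
 by (induction \<phi>s) (auto simp: fbox_simps)

lemma bdim_zeros: "bdim (zip (replicate (length \<phi>s) 0) \<phi>s) = 0"
 by (induction \<phi>s) auto

lemma segment_definable:
 fixes t a :: "'a::zgroup"
 assumes "t \<in> zhull A" "a \<in> zhull A"
 shows "definable_over A 1 {[t + N \<cdot> s] | s. 0 \<le> s \<and> s < a}"
proof -
 have "{[t + N \<cdot> s] | s. 0 \<le> s \<and> s < a} = {y. length y = 1 \<and> (\<exists>s. 0 \<le> s \<and> s < a \<and> y ! 0 = t + N \<cdot> s)}"
  by (auto simp: length_Suc_conv)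
 also have "definable_over A 1 \<dots>"
  by (rule definableI, intro Def_ex Def_conj Def_le Def_less Def_eq Dfn_plus Dfn_zsc Dfn_zero)
   (auto intro: Dfn_var Dfn_zhull[OF assms(1)] Dfn_zhull[OF assms(2)])
 finally show ?thesis .
qed

text \<open>The sides are written as nonnegative combinations of \<open>s\<close>, \<open>a - 1 - s\<close> and constants; after passing to the
 normal form, \<open>s\<close> itself is the \<open>p\<close>-th point of a chain of length \<open>p + 1 + q\<close> in \<open>[0, a)\<close>.\<close>

lemma boxy_segment:
 fixes a :: "'a::zgroup" and bs :: "(nat \<times> int \<times> 'a) list"
 assumes a: "a \<in> zhull A" and c: "\<And>d m c. (d, m, c) \<in> set bs ==> c \<in> zhull A"
  and nonneg: "\<And>d m c s. (d, m, c) \<in> set bs ==> 0 \<le> s ==> s < a ==> 0 \<le> m \<cdot> s + c"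
 defines "T \<equiv> {[s] | s. 0 \<le> s \<and> s < a}"
  and "\<beta> \<equiv> map (\<lambda>(d, m, c). (d, \<lambda>u :: 'a list. m \<cdot> hd u + c)) bs"
 shows "boxy A (1 + bdim \<beta>) (fam T (fbox \<beta>))"
proof (cases "0 < a")
 case False
 then have "T = {}" unfolding T_def by auto
 then have "fam T (fbox \<beta>) = {}" by (simp add: fam_def)
 then show ?thesis using boxy_empty by simp
next
 case True
 have T: "definable_over A 1 T"
  using segment_definable[OF zhull_zero a, of 1] by (simp add: T_def)
 define L where "L = length bs"
 \<comment> \<open>For \<open>m < 0\<close> the side is rewritten as
   \<open>(- m) \<cdot> (a - zone - s)\<close> plus a constant. The constant is the value of the
   side at \<open>s = 0\<close> or at \<open>s = a - zone\<close>, and hence nonnegative.\<close>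
 define co where "co = (\<lambda>j. case bs ! j of (d, m, c) => if 0 \<le> m then c else c + m \<cdot> (a - zone))"
 define cs where "cs = map co [0..<L]"
 define \<phi>s where "\<phi>s = [\<lambda>u :: 'a list. hd u, \<lambda>u. a - zone - hd u] @ map (\<lambda>c u. c) cs"
 have \<phi>len: "length \<phi>s = Suc (Suc L)" by (simp add: \<phi>s_def cs_def)
 have co: "co j \<in> zhull A \<and> 0 \<le> co j" if "j < L" for j
 proof -
  obtain d m c' where b: "bs ! j = (d, m, c')" by (cases "bs ! j")
  then have m: "(d, m, c') \<in> set bs" using that by (metis L_def nth_mem)
  have a1: "0 \<le> a - zone" "a - zone < a" using True zone_least[OF True] zone_pos[where 'a = 'a] by auto
  show ?thesis
   using nonneg[OF m, of 0] nonneg[OF m a1] True c[OF m] a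
   by (auto simp: co_def b add.commute intro!: zhull_add zhull_zsc zhull_diff zhull_zone)
 qed
 have hd1: "hd (map v [0..<1]) = v 0" for v :: "nat => 'a" by simp
 have \<phi>cases: "\<phi> = (\<lambda>u. hd u) \<or> \<phi> = (\<lambda>u. a - zone - hd u) \<or> (\<exists>j<L. \<phi> = (\<lambda>u. co j))" if "\<phi> \<in> set \<phi>s" for \<phi>
  using that by (auto simp: \<phi>s_def cs_def)
 have \<phi>D: "Dfs A 1 \<phi>" if "\<phi> \<in> set \<phi>s" for \<phi>
 proof -
  have "a - zone \<in> zhull A" using a zhull_zone by (rule zhull_diff)
  then have "Dfn A (\<lambda>v :: nat => 'a. a - zone - v 0)" by (intro Dfn_diff[OF Dfn_zhull Dfn_var])
  moreover have "Dfn A (\<lambda>v. co j)" if "j < L" for j using co[OF that] by (intro Dfn_zhull) simp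
  ultimately show ?thesis using \<phi>cases[OF that] by (auto simp: Dfs_def intro: Dfn_var)
 qed
 have \<phi>pos: "0 \<le> \<phi> s" if "\<phi> \<in> set \<phi>s" "s \<in> T" for \<phi> s
 proof -
  obtain x where x: "s = [x]" "0 \<le> x" "x < a" using \<open>s \<in> T\<close> by (auto simp: T_def)
  have "0 \<le> a - zone - x" using x(3) unfolding less_iff_zone by (simp add: algebra_simps)
  then show ?thesis using \<phi>cases[OF \<open>\<phi> \<in> set \<phi>s\<close>] x co by auto
 qed
 \<comment> \<open>Coefficients of the \<open>k\<close>-th side with respect to
   \<open>\<phi>s\<close>: index 0 is \<open>s\<close>, index 1 is \<open>a - zone - s\<close>, and
   the constants begin at index 2.\<close>
 define cf :: "nat => nat => nat" where "cf = (\<lambda>k j. case bs ! k of (d, m, c) =>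
  (if j = (if 0 \<le> m then 0 else 1) then nat \<bar>m\<bar> else if j = k + 2 then 1 else 0))"
 define bs' where "bs' = map (\<lambda>k. (fst (bs ! k), cf k)) [0..<L]"
 have comb: "comb \<phi>s (cf k) [x] = m \<cdot> x + c" if "k < L" "bs ! k = (d, m, c)" for k d m c x
 proof -
  have "comb \<phi>s (cf k) [x] = int (cf k 0) \<cdot> x + int (cf k 1) \<cdot> (a - zone - x) + (\<Sum>j<L. int (cf k (j + 2)) \<cdot> co j)"
   unfolding comb_def \<phi>len sum.lessThan_Suc_shift
   by (simp add: \<phi>s_def cs_def add.assoc)
  also have "(\<Sum>j<L. int (cf k (j + 2)) \<cdot> co j) = (\<Sum>j<L. if j = k then co j else 0)"
   by (rule sum.cong) (auto simp: cf_def that(2))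
  also have "\<dots> = co k" using that(1) by simp
  also have "int (cf k 0) \<cdot> x + int (cf k 1) \<cdot> (a - zone - x) + co k = m \<cdot> x + c"
   by (cases "0 \<le> m") (auto simp: cf_def that(2) co_def zsc_diff_right zsc_add_right algebra_simps)
  finally show ?thesis .
 qed
 define zs where "zs = zip (replicate (length \<phi>s) (0 :: nat)) \<phi>s"
 have fb: "fbox (map (\<lambda>(d, c). (d, comb \<phi>s c)) bs' @ zs) s = fbox \<beta> s" if "s \<in> T" for s
 proof -
  obtain x where x: "s = [x]" using \<open>s \<in> T\<close> by (auto simp: T_def)
  have "map (\<lambda>(d, \<phi>). (d, \<phi> s)) (map (\<lambda>(d, c). (d, comb \<phi>s c)) bs') = map (\<lambda>(d, \<phi>). (d, \<phi> s)) \<beta>"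
  proof (rule nth_equalityI)
   fix k assume "k < length (map (\<lambda>(d, \<phi>). (d, \<phi> s)) (map (\<lambda>(d, c). (d, comb \<phi>s c)) bs'))"
   then have k: "k < L" by (simp add: bs'_def)
   obtain d m c where b: "bs ! k = (d, m, c)" by (cases "bs ! k")
   show "map (\<lambda>(d, \<phi>). (d, \<phi> s)) (map (\<lambda>(d, c). (d, comb \<phi>s c)) bs') ! k = map (\<lambda>(d, \<phi>). (d, \<phi> s)) \<beta> ! k"
    using k comb[OF k b] b by (simp add: bs'_def \<beta>_def L_def x)
  qed (simp add: bs'_def \<beta>_def L_def)
  then have "fbox (map (\<lambda>(d, c). (d, comb \<phi>s c)) bs') s = fbox \<beta> s" unfolding fbox_def by simp
  then show ?thesis unfolding fbox_simps(3) zs_def fbox_zeros by simp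
 qed
 have bd: "bdim (map (\<lambda>(d, c). (d, comb \<phi>s c)) bs' @ zs) = bdim \<beta>"
 proof -
  have "map fst (map (\<lambda>(d, c). (d, comb \<phi>s c)) bs') = map fst \<beta>"
   by (rule nth_equalityI) (auto simp: bs'_def \<beta>_def L_def case_prod_unfold)
  then show ?thesis unfolding bdim_simps(3) zs_def bdim_zeros by (simp add: bdim_def)
 qed
 have "good A 1 T \<phi>s (1 + bdim (map (\<lambda>(d, c). (d, comb \<phi>s c)) bs' @ zs))
   (fam T (fbox (map (\<lambda>(d, c). (d, comb \<phi>s c)) bs' @ zs)))"
  unfolding zs_def by (rule good_boxes) (use T \<phi>D \<phi>pos in auto)
 then have "good A 1 T \<phi>s (1 + bdim \<beta>) (fam T (fbox \<beta>))"
  unfolding bd using fam_cong[of T, OF fb] by simp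
 then obtain I :: "nat set" and \<delta> where \<delta>: "\<And>i. i \<in> I ==> length (\<delta> i) = Suc (Suc L)"
  "dsum A (1 + bdim \<beta>) (fam T (fbox \<beta>)) I (\<lambda>i. 1 + bdim (zip (\<delta> i) \<phi>s)) (\<lambda>i. fam T (fbox (zip (\<delta> i) \<phi>s)))"
  unfolding good_def \<phi>len by blast
 show ?thesis
 proof (rule boxy_trans[OF \<delta>(2)])
  fix i assume "i \<in> I"
  from \<delta>(1)[OF this] obtain p q ds where \<delta>i: "\<delta> i = p # q # ds" "length ds = L"
   by (auto simp: length_Suc_conv)
  define R where "R = box (zip ds cs)"
  \<comment> \<open>The dependence on \<open>s\<close> is now confined to the two factors with sides
    \<open>s\<close> and \<open>a - zone - s\<close>; \<open>chain_point\<close> combines them with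
    \<open>s\<close>.\<close>
  define E where "E = {[s] @ x @ y | s x y. 0 \<le> s \<and> s < a \<and> x \<in> chain p s \<and> y \<in> chain q (a - zone - s)}"
  have zip: "zip (\<delta> i) \<phi>s = (p, \<lambda>u. hd u) # (q, \<lambda>u. a - zone - hd u) # zip ds (map (\<lambda>c u. c) cs)"
   by (simp add: \<delta>i \<phi>s_def)
  have bdz: "bdim (zip ds (map f cs)) = bdim (zip ds cs)" for f :: "'a => 'b"
   unfolding bdim_def using \<delta>i(2) by (simp add: cs_def)
  have Rf: "fbox (zip ds (map (\<lambda>c u. c) cs)) s = R" for s :: "'a list"
   unfolding fbox_def R_def zip_map2 map_map by (rule arg_cong[of _ _ box]) (rule map_idI, auto)
  have X: "fam T (fbox (zip (\<delta> i) \<phi>s)) = fam {[]} (\<lambda>_. {z @ w | z w. z \<in> E \<and> w \<in> R})"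
  proof -
   have "fbox (zip (\<delta> i) \<phi>s) [s] = {x @ y @ w | x y w. x \<in> chain p s \<and> y \<in> chain q (a - zone - s) \<and> w \<in> R}" for s
    unfolding zip fbox_simps(2) Rf by auto
   note fb = this
   show ?thesis unfolding fam_Nil
   proof (intro set_eqI iffI)
    fix u assume "u \<in> fam T (fbox (zip (\<delta> i) \<phi>s))"
    then obtain s v where u: "u = [s] @ v" "0 \<le> s" "s < a" "v \<in> fbox (zip (\<delta> i) \<phi>s) [s]"
     unfolding fam_def T_def by blast
    then obtain x y w where "v = x @ y @ w" "x \<in> chain p s" "y \<in> chain q (a - zone - s)" "w \<in> R"
     unfolding fb by blast
    then have "u = ([s] @ x @ y) @ w" "[s] @ x @ y \<in> E" "w \<in> R" using u unfolding E_def by auto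
    then show "u \<in> {z @ w | z w. z \<in> E \<and> w \<in> R}" by blast
   next
    fix u assume "u \<in> {z @ w | z w. z \<in> E \<and> w \<in> R}"
    then obtain s x y w where u: "u = ([s] @ x @ y) @ w" "0 \<le> s" "s < a" "x \<in> chain p s" "y \<in> chain q (a - zone - s)" "w \<in> R"
     unfolding E_def by blast
    then have "x @ y @ w \<in> fbox (zip (\<delta> i) \<phi>s) [s]" unfolding fb by blast
    moreover have "u = [s] @ (x @ y @ w)" "[s] \<in> T" using u by (auto simp: T_def)
    ultimately show "u \<in> fam T (fbox (zip (\<delta> i) \<phi>s))" unfolding fam_def by blast
   qed
  qed
  have B: "box ((Suc (p + q), a) # zip ds cs) = fam {[]} (\<lambda>_. {z @ w | z w. z \<in> chain (Suc (p + q)) a \<and> w \<in> R})"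
   unfolding fam_Nil R_def by simp
  have csz: "c \<in> zhull A \<and> 0 \<le> c" if "(d, c) \<in> set (zip ds cs)" for d c
   using set_zip_rightD[OF that] co by (auto simp: cs_def)
  have sides: "snd r \<in> zhull A \<and> 0 \<le> snd r" if "r \<in> set ((Suc (p + q), a) # zip ds cs)" for r
   using that a True csz[of "fst r" "snd r"] by (cases "r = (Suc (p + q), a)") auto
  have "dsum A (0 + (Suc (p + q) + bdim (zip ds cs))) (fam {[]} (\<lambda>_. {z @ w | z w. z \<in> E \<and> w \<in> R})) {()}
   (\<lambda>_. 0 + (Suc (p + q) + bdim (zip ds cs))) (\<lambda>_. fam {[]} (\<lambda>_. {z @ w | z w. z \<in> chain (Suc (p + q)) a \<and> w \<in> R}))"
  proof (rule dsum_lift[where k = "\<lambda>_ s z. [z ! p] @ take p z @ map (\<lambda>t. t - z ! p - zone) (drop (Suc p) z)"])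
   show "definable_over A (0 + (Suc (p + q) + bdim (zip ds cs))) (fam {[]} (\<lambda>_. {z @ w | z w. z \<in> chain (Suc (p + q)) a \<and> w \<in> R}))"
   proof -
    have "definable_over A (bdim ((Suc (p + q), a) # zip ds cs)) (box ((Suc (p + q), a) # zip ds cs))"
     by (rule box_definable) (use sides in blast)
    then show ?thesis unfolding B[symmetric] by simp
   qed
   show "length z = Suc (p + q)" if "z \<in> chain (Suc (p + q)) a" for z using chain_length[OF that] .
   show "length z = Suc (p + q)" if "z \<in> E" for z using that by (auto simp: E_def chain_length)
   show "length w = bdim (zip ds cs)" if "w \<in> R" for w using box_length that unfolding R_def by blast
   have "(\<lambda>(i :: unit, z). [z ! p] @ take p z @ map (\<lambda>t. t - z ! p - zone) (drop (Suc p) z)) =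
     (\<lambda>z. [z ! p] @ take p z @ map (\<lambda>t. t - z ! p - zone) (drop (Suc p) z)) \<circ> (snd :: unit \<times> 'a list => 'a list)"
    by (auto simp: fun_eq_iff)
   moreover have "bij_betw (snd :: unit \<times> 'a list => 'a list) ({()} \<times> chain (Suc (p + q)) a) (chain (Suc (p + q)) a)"
    by (auto simp: bij_betw_def inj_on_def image_iff)
   ultimately show "bij_betw (\<lambda>(i, z). [z ! p] @ take p z @ map (\<lambda>t. t - z ! p - zone) (drop (Suc p) z))
     ({()} \<times> chain (Suc (p + q)) a) E"
    unfolding E_def using bij_betw_trans[OF _ chain_point] by simp
   have eq: "[map (\<lambda>j. v (j + 0)) [0..<Suc (p + q)] ! p] @ take p (map (\<lambda>j. v (j + 0)) [0..<Suc (p + q)]) @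
     map (\<lambda>t. t - map (\<lambda>j. v (j + 0)) [0..<Suc (p + q)] ! p - zone) (drop (Suc p) (map (\<lambda>j. v (j + 0)) [0..<Suc (p + q)])) =
    map (\<lambda>j. if j = 0 then v p else if j \<le> p then v (j - 1) else v j - v p - zone) [0..<Suc (p + q)]" for v :: "nat => 'a"
    by (rule nth_equalityI) (auto simp: nth_append nth_Cons' simp del: upt_Suc)
   show "Dfnl A (Suc (p + q)) (\<lambda>v. [map (\<lambda>j. v (j + 0)) [0..<Suc (p + q)] ! p] @ take p (map (\<lambda>j. v (j + 0)) [0..<Suc (p + q)]) @
     map (\<lambda>t. t - map (\<lambda>j. v (j + 0)) [0..<Suc (p + q)] ! p - zone) (drop (Suc p) (map (\<lambda>j. v (j + 0)) [0..<Suc (p + q)])))"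
   proof (rule DfnlI[OF eq])
    fix j
    show "Dfn A (\<lambda>v :: nat => 'a. if j = 0 then v p else if j \<le> p then v (j - 1) else v j - v p - zone)"
     by (cases "j = 0"; cases "j \<le> p") (auto intro!: Dfn_var Dfn_diff Dfn_zone)
   qed
  qed auto
  then have "dsum A (1 + bdim (zip (\<delta> i) \<phi>s)) (fam T (fbox (zip (\<delta> i) \<phi>s))) {()}
    (\<lambda>_. bdim ((Suc (p + q), a) # zip ds cs)) (\<lambda>_. box ((Suc (p + q), a) # zip ds cs))"
   unfolding X B by (simp add: zip bdz add.assoc)
  then show "boxy A (1 + bdim (zip (\<delta> i) \<phi>s)) (fam T (fbox (zip (\<delta> i) \<phi>s)))"
  proof (rule boxy_trans)
   show "boxy A (bdim ((Suc (p + q), a) # zip ds cs)) (box ((Suc (p + q), a) # zip ds cs))"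
    by (rule boxy_box) (use sides in blast)
  qed
 qed
qed

section \<open>Compactness, and decompositions uniform in one coordinate\<close>

text \<open>The form in which saturation is used: covers by definable sets have finite subcovers. As
  a hypothesis of later statements it keeps cardinals out of these arguments.\<close>

definition compact_over :: "'a::linordered_ab_group_add set => bool" where
 "compact_over A \<longleftrightarrow> (\<forall>k (Y :: 'a list set) \<W>. definable_over A k Y --> (\<forall>W\<in>\<W>. definable_over A k W) -->
   Y \<subseteq> \<Union>\<W> --> (\<exists>\<W>0\<subseteq>\<W>. finite \<W>0 \<and> Y \<subseteq> \<Union>\<W>0))"

lemma compact_overD:
 assumes "compact_over A" "definable_over A k Y" "\<And>W. W \<in> \<W> ==> definable_over A k W" "Y \<subseteq> \<Union>\<W>"
 obtains \<W>0 where "\<W>0 \<subseteq> \<W>" "finite \<W>0" "Y \<subseteq> \<Union>\<W>0"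
 using assms(1)[unfolded compact_over_def, THEN spec, THEN spec, THEN spec, THEN mp, THEN mp, THEN mp, OF assms(2) _ assms(4)]
  assms(3) by blast

lemma dsum_uniform_ex:
 assumes S: "definable_over A (k + n) S" and T: "\<And>i. i \<in> I ==> definable_over A (k + m i) (T i)"
  and c: "length c = k" and d: "dsum (A \<union> set c) n {x. c @ x \<in> S} I m (\<lambda>i. {z. c @ z \<in> T i})"
 shows "\<exists>W G. definable_over A k W \<and> c \<in> W \<and> (\<forall>i\<in>I. definable_over A (k + (n + m i)) (G i)) \<and>
  (\<forall>y\<in>W. is_graph n {x. y @ x \<in> S} I m (\<lambda>i. {z. y @ z \<in> T i}) (\<lambda>i. {w. y @ w \<in> G i}))"
proof (rule dsum_uniform[OF assms])
 fix W G
 assume W: "definable_over A k W" "c \<in> W" "\<And>i. i \<in> I ==> definable_over A (k + (n + m i)) (G i)"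
  "\<And>y. y \<in> W ==> is_graph n {x. y @ x \<in> S} I m (\<lambda>i. {z. y @ z \<in> T i}) (\<lambda>i. {w. y @ w \<in> G i})"
 show ?thesis
  by (intro exI[of _ W] exI[of _ G] conjI ballI) (fact W)+
qed

lemma Dfn_zdiv:
 assumes "Dfn A t" "0 < N" shows "Dfn A (\<lambda>v. zdiv (t v) N)"
proof -
 have "w 0 = zdiv (t (\<lambda>i. w (Suc i))) N \<longleftrightarrow>
   N \<cdot> w 0 \<le> t (\<lambda>i. w (Suc i)) \<and> \<not> N \<cdot> (w 0 + zone) \<le> t (\<lambda>i. w (Suc i))" for w :: "nat => 'a"
 proof -
  have "N \<cdot> w 0 \<le> t (\<lambda>i. w (Suc i)) \<longleftrightarrow> w 0 \<le> zdiv (t (\<lambda>i. w (Suc i))) N"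
   by (rule le_zdiv_iff[OF assms(2), symmetric])
  moreover have "N \<cdot> (w 0 + zone) \<le> t (\<lambda>i. w (Suc i)) \<longleftrightarrow> w 0 < zdiv (t (\<lambda>i. w (Suc i))) N"
   unfolding less_iff_zone by (rule le_zdiv_iff[OF assms(2), symmetric])
  ultimately show ?thesis by auto
 qed
 moreover have "Def A (\<lambda>w. N \<cdot> w 0 \<le> t (\<lambda>i. w (Suc i)) \<and> \<not> N \<cdot> (w 0 + zone) \<le> t (\<lambda>i. w (Suc i)))"
  by (intro Def_conj Def_not Def_le Dfn_zsc Dfn_plus Dfn_zone Dfn_var Dfn_reindex[OF assms(1)])
 ultimately show ?thesis unfolding Dfn_def by simp
qed

lemma grp_insert:
 assumes "x \<in> grp (insert t A)" shows "\<exists>m g. g \<in> grp A \<and> x = m \<cdot> t + g"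
 using assms
proof induction
 case grp_zero
 then show ?case using grp.grp_zero by (intro exI[of _ 0]) auto
next
 case grp_zone
 then show ?case using grp.grp_zone by (intro exI[of _ 0] exI[of _ zone]) auto
next
 case (grp_base a)
 then show ?case
 proof
  assume "a = t"
  then show ?thesis using grp.grp_zero by (intro exI[of _ 1] exI[of _ 0]) auto
 next
  assume "a \<in> A"
  then show ?thesis using grp.grp_base by (intro exI[of _ 0] exI[of _ a]) auto
 qed
next
 case (grp_add a b)
 then obtain m g m' g' where *: "g \<in> grp A" "a = m \<cdot> t + g" "g' \<in> grp A" "b = m' \<cdot> t + g'" by blast
 have "a + b = (m + m') \<cdot> t + (g + g')" by (simp add: * zsc_add_left algebra_simps)
 then show ?case using grp.grp_add[OF *(1,3)] by blast
next
 case (grp_minus a)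
 then obtain m g where *: "g \<in> grp A" "a = m \<cdot> t + g" by blast
 have "- a = (- m) \<cdot> t + - g" by (simp add: *)
 then show ?case using grp.grp_minus[OF *(1)] by blast
qed

text \<open>An element of the hull over \<open>A\<close> and \<open>t\<close> is an exact quotient.
  Written as a floor, it becomes a function that makes sense for every value of \<open>t\<close>,
  also where the division is not exact.\<close>

lemma zhull_insert:
 assumes "a \<in> zhull (insert t A)"
 shows "\<exists>N m g. 0 < N \<and> g \<in> grp A \<and> a = zdiv (m \<cdot> t + g) N"
proof -
 obtain N where N: "N > 0" "N \<cdot> a \<in> grp (insert t A)" using assms unfolding zhull_def by blast
 then obtain m g where "g \<in> grp A" "N \<cdot> a = m \<cdot> t + g" using grp_insert by blast
 then have "a = zdiv (m \<cdot> t + g) N" using zdiv_mult[OF N(1), of a] by simp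
 then show ?thesis using N(1) \<open>g \<in> grp A\<close> by blast
qed

text \<open>An entry \<open>(d, N, m, g)\<close> describes a chain of length \<open>d\<close> whose
  side is the floor of \<open>(m \<cdot> u + g) / N\<close>, as a function of the coordinate
  \<open>u\<close>.\<close>

type_synonym 'a scheme = "(nat \<times> int \<times> int \<times> 'a) list"

definition sbox :: "'a::zgroup scheme => (nat \<times> ('a list => 'a)) list" where
 "sbox \<sigma> = map (\<lambda>(d, N, m, g). (d, \<lambda>u. zdiv (m \<cdot> hd u + g) N)) \<sigma>"

definition sok :: "'a::zgroup set => 'a scheme => bool" where
 "sok A \<sigma> \<longleftrightarrow> (\<forall>(d, N, m, g)\<in>set \<sigma>. 0 < N \<and> g \<in> grp A)"

definition spos :: "'a::zgroup scheme => 'a list => bool" where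
 "spos \<sigma> y \<longleftrightarrow> (\<forall>(d, N, m, g)\<in>set \<sigma>. 0 \<le> zdiv (m \<cdot> hd y + g) N)"

lemma scheme_exists:
 assumes "\<And>p. p \<in> set bx ==> snd p \<in> zhull (insert t A) \<and> 0 \<le> snd p"
 shows "\<exists>\<sigma>. sok A \<sigma> \<and> spos \<sigma> [t] \<and> map (\<lambda>(d, \<phi>). (d, \<phi> [t])) (sbox \<sigma>) = bx"
 using assms
proof (induction bx)
 case Nil
 then show ?case by (intro exI[of _ "[]"]) (auto simp: sok_def spos_def sbox_def)
next
 case (Cons p bx)
 then obtain \<sigma> where \<sigma>: "sok A \<sigma>" "spos \<sigma> [t]" "map (\<lambda>(d, \<phi>). (d, \<phi> [t])) (sbox \<sigma>) = bx" by auto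
 obtain d a where p: "p = (d, a)" by (cases p)
 then have a: "a \<in> zhull (insert t A)" "0 \<le> a" using Cons.prems[of p] by auto
 obtain N m g where "0 < N" "g \<in> grp A" "a = zdiv (m \<cdot> t + g) N" using zhull_insert[OF a(1)] by blast
 then show ?case using \<sigma> p a(2)
  by (intro exI[of _ "(d, N, m, g) # \<sigma>"]) (auto simp: sok_def spos_def sbox_def)
qed

lemma sbox_Dfs:
 assumes "sok A \<sigma>" "(d, \<phi>) \<in> set (sbox \<sigma>)" shows "Dfs A 1 \<phi>"
proof -
 obtain N m g where *: "(d, N, m, g) \<in> set \<sigma>" "\<phi> = (\<lambda>u. zdiv (m \<cdot> hd u + g) N)"
  using assms(2) by (auto simp: sbox_def)
 have N: "0 < N" "g \<in> grp A" using assms(1) *(1) by (auto simp: sok_def)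
 have "Dfn A (\<lambda>v. zdiv (m \<cdot> v 0 + g) N)"
  by (intro Dfn_zdiv Dfn_plus Dfn_zsc Dfn_var Dfn_grp N)
 then show ?thesis by (simp add: Dfs_def *(2))
qed

text \<open>One scheme and one set of graphs decompose all fibres over \<open>W\<close>. Nonnegative
  sides are demanded because these functions were obtained at one point only, and their signs may
  change elsewhere.\<close>

definition uni_scheme :: "'a::zgroup set => nat => 'a list set => 'a list set => bool" where
 "uni_scheme A n X W \<longleftrightarrow> (\<exists>(I :: nat set) \<sigma> G. finite I \<and> (\<forall>i\<in>I. sok A (\<sigma> i)) \<and>
   (\<forall>i\<in>I. definable_over A (1 + (n + bdim (sbox (\<sigma> i)))) (G i)) \<and>
   (\<forall>y\<in>W. (\<forall>i\<in>I. spos (\<sigma> i) y) \<and>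
    is_graph n {x. y @ x \<in> X} I (\<lambda>i. bdim (sbox (\<sigma> i))) (\<lambda>i. fbox (sbox (\<sigma> i)) y) (\<lambda>i. {w. y @ w \<in> G i})))"

lemma Def_spos:
 assumes "sok A \<sigma>" shows "Def A (\<lambda>v. spos \<sigma> [v 0])"
proof -
 have "Def A (\<lambda>v. \<forall>q\<in>set \<sigma>. 0 \<le> zdiv (fst (snd (snd q)) \<cdot> v 0 + snd (snd (snd q))) (fst (snd q)))"
  by (intro Def_Ball Def_le Dfn_zdiv Dfn_plus Dfn_zsc Dfn_var Dfn_grp Dfn_zero)
   (use assms in "auto simp: sok_def")
 then show ?thesis unfolding spos_def by (simp add: case_prod_unfold)
qed

text \<open>The decomposition of the single fibre at \<open>t\<close> spreads to a definable set of
  points: \<open>scheme_exists\<close> turns the sides into functions of \<open>t\<close>,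
  \<open>dsum_uniform_ex\<close> spreads the graphs, and nonnegativity of the sides is a further
  definable condition.\<close>

lemma uni_scheme_exists:
 assumes X: "definable_over A (1 + n) X" and b: "boxy (insert t A) n {x. [t] @ x \<in> X}"
 shows "\<exists>W. definable_over A 1 W \<and> [t] \<in> W \<and> uni_scheme A n X W"
proof -
 obtain I :: "nat set" and bx where bx: "\<And>i p. i \<in> I ==> p \<in> set (bx i) ==> snd p \<in> zhull (insert t A) \<and> 0 \<le> snd p"
  "dsum (insert t A) n {x. [t] @ x \<in> X} I (\<lambda>i. bdim (bx i)) (\<lambda>i. box (bx i))"
  using b unfolding boxy_def by blast
 have fin: "finite I" using bx(2) by (simp add: dsum_def)
 have "\<forall>i\<in>I. \<exists>\<sigma>. sok A \<sigma> \<and> spos \<sigma> [t] \<and> map (\<lambda>(d, \<phi>). (d, \<phi> [t])) (sbox \<sigma>) = bx i"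
  using scheme_exists bx(1) by metis
 then obtain \<sigma> where \<sigma>: "\<And>i. i \<in> I ==> sok A (\<sigma> i)" "\<And>i. i \<in> I ==> spos (\<sigma> i) [t]"
  "\<And>i. i \<in> I ==> map (\<lambda>(d, \<phi>). (d, \<phi> [t])) (sbox (\<sigma> i)) = bx i" by metis
 define U where "U = {y :: 'a list. length y = 1 \<and> True}"
 have U: "definable_over A 1 U" unfolding U_def by (rule definableI) (rule Def_const)
 define F where "F = (\<lambda>i. fam U (fbox (sbox (\<sigma> i))))"
 have F: "definable_over A (1 + bdim (sbox (\<sigma> i))) (F i)" if "i \<in> I" for i
  unfolding F_def by (rule FB_definable[OF U]) (use sbox_Dfs \<sigma>(1)[OF that] in blast)
 have Fy: "{z. y @ z \<in> F i} = fbox (sbox (\<sigma> i)) y" if "length y = 1" for y i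
 proof -
  have "y \<in> U" "\<And>s. s \<in> U ==> length s = 1" using that by (auto simp: U_def)
  then show ?thesis unfolding F_def using fam_append_iff[of U 1 y] that by blast
 qed
 have bf: "fbox (sbox (\<sigma> i)) [t] = box (bx i)" if "i \<in> I" for i unfolding fbox_def \<sigma>(3)[OF that] ..
 have bd: "bdim (sbox (\<sigma> i)) = bdim (bx i)" if "i \<in> I" for i using \<sigma>(3)[OF that] bdim_map by metis
 have dd: "dsum (A \<union> set [t]) n {x. [t] @ x \<in> X} I (\<lambda>i. bdim (sbox (\<sigma> i))) (\<lambda>i. {z. [t] @ z \<in> F i})"
 proof (rule dsum_cong)
  show "dsum (A \<union> set [t]) n {x. [t] @ x \<in> X} I (\<lambda>i. bdim (bx i)) (\<lambda>i. box (bx i))"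
   by (rule dsum_mono[OF bx(2)]) simp
  show "bdim (bx i) = bdim (sbox (\<sigma> i))" if "i \<in> I" for i using bd[OF that] by (rule HOL.sym)
  show "box (bx i) = {z. [t] @ z \<in> F i}" if "i \<in> I" for i using Fy[of "[t]" i] bf[OF that] by simp
 qed
 have len: "length [t] = 1" by simp
 have ex: "\<exists>W G. definable_over A 1 W \<and> [t] \<in> W \<and> (\<forall>i\<in>I. definable_over A (1 + (n + bdim (sbox (\<sigma> i)))) (G i)) \<and>
  (\<forall>y\<in>W. is_graph n {x. y @ x \<in> X} I (\<lambda>i. bdim (sbox (\<sigma> i))) (\<lambda>i. {z. y @ z \<in> F i}) (\<lambda>i. {w. y @ w \<in> G i}))"
  by (rule dsum_uniform_ex[OF X F len dd])
 then obtain W G where W: "definable_over A 1 W" "[t] \<in> W"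
  "\<forall>i\<in>I. definable_over A (1 + (n + bdim (sbox (\<sigma> i)))) (G i)"
  "\<forall>y\<in>W. is_graph n {x. y @ x \<in> X} I (\<lambda>i. bdim (sbox (\<sigma> i))) (\<lambda>i. {z. y @ z \<in> F i}) (\<lambda>i. {w. y @ w \<in> G i})"
  by (elim exE conjE)
 define W' where "W' = {y. length y = 1 \<and> (y \<in> W \<and> (\<forall>i\<in>I. spos (\<sigma> i) [hd y]))}"
 have "definable_over A 1 W'"
  unfolding W'_def
 proof (rule definableI)
  have 1: "Def A (\<lambda>v. \<forall>i\<in>I. spos (\<sigma> i) [v 0])"
   by (rule Def_Ball[OF fin], rule Def_spos, rule \<sigma>(1))
  have 2: "hd (map v [0..<1]) = v 0" for v :: "nat => 'a" by simp
  show "Def A (\<lambda>v. map v [0..<1] \<in> W \<and> (\<forall>i\<in>I. spos (\<sigma> i) [hd (map v [0..<1])]))"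
   unfolding 2 by (rule Def_conj[OF Def_mem[OF W(1) Dfnl_vars] 1])
 qed
 moreover have "[t] \<in> W'" using W(2) \<sigma>(2) by (simp add: W'_def)
 moreover have "uni_scheme A n X W'"
  unfolding uni_scheme_def
 proof (intro exI[of _ I] exI[of _ \<sigma>] exI[of _ G] conjI ballI)
  fix y assume y: "y \<in> W'"
  then have l: "length y = 1" and yW: "y \<in> W" by (auto simp: W'_def)
  then have "[hd y] = y" by (cases y) auto
  then show "spos (\<sigma> i) y" if "i \<in> I" for i using y that by (auto simp: W'_def)
  show "is_graph n {x. y @ x \<in> X} I (\<lambda>i. bdim (sbox (\<sigma> i))) (\<lambda>i. fbox (sbox (\<sigma> i)) y) (\<lambda>i. {w. y @ w \<in> G i})"
   using bspec[OF W(4) yW] unfolding Fy[OF l] .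
 next
  show "definable_over A (1 + (n + bdim (sbox (\<sigma> i)))) (G i)" if "i \<in> I" for i using W(3) that by (rule bspec)
  show "finite I" by (rule fin)
  show "sok A (\<sigma> i)" if "i \<in> I" for i by (rule \<sigma>(1)[OF that])
 qed
 ultimately show ?thesis by blast
qed

lemma uni_scheme_mono:
 assumes "uni_scheme A n X W" "W' \<subseteq> W" shows "uni_scheme A n X W'"
proof -
 obtain I :: "nat set" and \<sigma> G where *: "finite I" "\<forall>i\<in>I. sok A (\<sigma> i)"
  "\<forall>i\<in>I. definable_over A (1 + (n + bdim (sbox (\<sigma> i)))) (G i)"
  "\<forall>y\<in>W. (\<forall>i\<in>I. spos (\<sigma> i) y) \<and>
    is_graph n {x. y @ x \<in> X} I (\<lambda>i. bdim (sbox (\<sigma> i))) (\<lambda>i. fbox (sbox (\<sigma> i)) y) (\<lambda>i. {w. y @ w \<in> G i})"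
  using assms(1) unfolding uni_scheme_def by (elim exE conjE)
 show ?thesis unfolding uni_scheme_def
 proof (intro exI[of _ I] exI[of _ \<sigma>] exI[of _ G] conjI[OF *(1)] conjI[OF *(2)] conjI[OF *(3)] ballI)
  fix y assume "y \<in> W'"
  then show "(\<forall>i\<in>I. spos (\<sigma> i) y) \<and>
    is_graph n {x. y @ x \<in> X} I (\<lambda>i. bdim (sbox (\<sigma> i))) (\<lambda>i. fbox (sbox (\<sigma> i)) y) (\<lambda>i. {w. y @ w \<in> G i})"
   using bspec[OF *(4)] assms(2) by blast
 qed
qed

text \<open>On a progression \<open>t + N \<cdot> s\<close> whose step is divisible by all denominators, the sides are linear in \<open>s\<close>.\<close>

lemma boxy_progression:
 fixes t a :: "'a::zgroup"
 assumes ta: "t \<in> zhull A" "a \<in> zhull A" and \<sigma>: "sok A \<sigma>" and N: "0 < N" "\<And>d M m g. (d, M, m, g) \<in> set \<sigma> ==> M dvd N"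
  and pos: "\<And>x. x \<in> prog N t a ==> spos \<sigma> [x]"
 shows "boxy A (1 + bdim (sbox \<sigma>)) (fam {[x] | x. x \<in> prog N t a} (fbox (sbox \<sigma>)))"
proof -
 define bs where "bs = map (\<lambda>(d, M, m, g). (d, m * (N div M), zdiv (m \<cdot> t + g) M)) \<sigma>"
 define \<beta> where "\<beta> = map (\<lambda>(d, m, c). (d, \<lambda>u :: 'a list. m \<cdot> hd u + c)) bs"
 define T where "T = {[s] | s :: 'a. 0 \<le> s \<and> s < a}"
 \<comment> \<open>Since \<open>M\<close> divides \<open>N\<close>, moving from \<open>t\<close> to
   \<open>t + N \<cdot> s\<close> changes the argument of the floor by a multiple of
   \<open>M\<close>, so the floor changes linearly in \<open>s\<close>.\<close>
 have val: "zdiv (m \<cdot> (t + N \<cdot> s) + g) M = (m * (N div M)) \<cdot> s + zdiv (m \<cdot> t + g) M" if "(d, M, m, g) \<in> set \<sigma>" for d M m g s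
 proof -
  have M: "0 < M" "M dvd N" using \<sigma> N(2) that by (auto simp: sok_def)
  have "m \<cdot> N \<cdot> s = M \<cdot> (m * (N div M)) \<cdot> s"
  proof -
   have "m * N = m * (M * (N div M))" using M(2) by simp
   then show ?thesis by (simp only: zsc_mult[symmetric] mult.left_commute)
  qed
  then have "m \<cdot> (t + N \<cdot> s) + g = (m \<cdot> t + g) + M \<cdot> (m * (N div M)) \<cdot> s" by (simp add: zsc_add_right algebra_simps)
  then show ?thesis by (simp only: zdiv_add_mult[OF M(1)] add.commute)
 qed
 have fb: "fbox (sbox \<sigma>) [t + N \<cdot> s] = fbox \<beta> [s]" for s
 proof -
  have "map (\<lambda>(d, \<phi>). (d, \<phi> [t + N \<cdot> s])) (sbox \<sigma>) = map (\<lambda>(d, \<phi>). (d, \<phi> [s])) \<beta>"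
   unfolding sbox_def \<beta>_def bs_def map_map by (rule map_cong) (use val in "auto")
  then show ?thesis by (simp add: fbox_def)
 qed
 have bd: "bdim \<beta> = bdim (sbox \<sigma>)"
  unfolding bdim_def \<beta>_def bs_def sbox_def map_map by (rule arg_cong[of _ _ sum_list], rule map_cong) auto
 have bs_zhull: "c \<in> zhull A" if "(d, m, c) \<in> set bs" for d m c
 proof -
  obtain M m' g where q: "(d, M, m', g) \<in> set \<sigma>" "c = zdiv (m' \<cdot> t + g) M" using \<open>_ \<in> set bs\<close> by (auto simp: bs_def)
  have "0 < M \<and> g \<in> grp A" using bspec[OF \<sigma>[unfolded sok_def] q(1)] by simp
  then have "0 < M" "g \<in> zhull A" using grp_subset_zhull by blast+
  then show ?thesis unfolding q(2) by (intro zhull_zdiv zhull_add zhull_zsc ta)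
 qed
 have box1: "boxy A (1 + bdim \<beta>) (fam T (fbox \<beta>))"
  unfolding \<beta>_def T_def
 proof (rule boxy_segment[OF ta(2) bs_zhull])
  fix d m c s assume *: "(d, m, c) \<in> set bs" "0 \<le> s" "s < a"
  then obtain M m' g where q: "(d, M, m', g) \<in> set \<sigma>" "m = m' * (N div M)" "c = zdiv (m' \<cdot> t + g) M"
   by (auto simp: bs_def)
  have "t + N \<cdot> s \<in> prog N t a" using * unfolding prog_def by blast
  then have "0 \<le> zdiv (m' \<cdot> (t + N \<cdot> s) + g) M" using pos q(1) by (fastforce simp: spos_def)
  then show "0 \<le> m \<cdot> s + c" unfolding val[OF q(1)] q(2,3) .
 qed
 have Dfs\<beta>: "Dfs A 1 \<phi>" if \<phi>: "(d, \<phi>) \<in> set \<beta>" for d \<phi>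
 proof -
  obtain m c where *: "(d, m, c) \<in> set bs" "\<phi> = (\<lambda>u. m \<cdot> hd u + c)" using \<phi> by (auto simp: \<beta>_def)
  have "Dfn A (\<lambda>v. m \<cdot> v 0 + c)" by (intro Dfn_plus Dfn_zsc Dfn_var Dfn_zhull bs_zhull[OF *(1)])
  then show ?thesis by (simp add: Dfs_def *(2))
 qed
 have T: "definable_over A 1 T" using segment_definable[OF zhull_zero ta(2), of 1] by (simp add: T_def)
 have "dsum A (1 + bdim (sbox \<sigma>)) (fam {[x] | x. x \<in> prog N t a} (fbox (sbox \<sigma>))) {()}
   (\<lambda>_. 1 + bdim \<beta>) (\<lambda>_. fam T (fbox \<beta>))"
 proof (rule dsum_map[where g = "\<lambda>_ u. (t + N \<cdot> hd u) # tl u"])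
  show "definable_over A (1 + bdim \<beta>) (fam T (fbox \<beta>))" by (rule FB_definable[OF T Dfs\<beta>])
  have "Dfnl A (Suc (bdim \<beta>)) (\<lambda>v. (t + N \<cdot> v 0) # map (\<lambda>j. v (Suc j)) [0..<bdim \<beta>])"
  proof (rule Dfnl_Cons)
   show "Dfn A (\<lambda>v. t + N \<cdot> v 0)" by (intro Dfn_plus Dfn_zsc Dfn_var Dfn_zhull ta)
   show "Dfnl A (bdim \<beta>) (\<lambda>v. map (\<lambda>j. v (Suc j)) [0..<bdim \<beta>])"
    by (rule Dfnl_cast, rule Dfnl_upt, rule Dfn_var) simp
  qed
  moreover have "map v [0..<1 + bdim \<beta>] = v 0 # map (\<lambda>j. v (Suc j)) [0..<bdim \<beta>]" for v :: "nat => 'a"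
   by (rule nth_equalityI) (auto simp: nth_Cons' simp del: upt_Suc)
  ultimately show "Dfnl A (1 + bdim (sbox \<sigma>)) (\<lambda>v. (t + N \<cdot> hd (map v [0..<1 + bdim \<beta>])) # tl (map v [0..<1 + bdim \<beta>]))"
   by (simp add: bd del: upt_Suc)
  show "bij_betw (\<lambda>(i, u). (t + N \<cdot> hd u) # tl u) (Sigma {()} (\<lambda>_. fam T (fbox \<beta>)))
    (fam {[x] | x. x \<in> prog N t a} (fbox (sbox \<sigma>)))"
   unfolding bij_betw_def
  proof
   have T1: "\<exists>s w. u = s # w" if "u \<in> fam T (fbox \<beta>)" for u using that by (auto simp: fam_def T_def)
   show "inj_on (\<lambda>(i, u). (t + N \<cdot> hd u) # tl u) (Sigma {()} (\<lambda>_. fam T (fbox \<beta>)))"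
   proof (rule inj_onI)
    fix p q :: "unit \<times> 'a list"
    assume pq: "p \<in> Sigma {()} (\<lambda>_. fam T (fbox \<beta>))" "q \<in> Sigma {()} (\<lambda>_. fam T (fbox \<beta>))"
     "(\<lambda>(i, u). (t + N \<cdot> hd u) # tl u) p = (\<lambda>(i, u). (t + N \<cdot> hd u) # tl u) q"
    obtain s w where p: "p = ((), s # w)" using pq(1) T1[of "snd p"] by (cases p) auto
    obtain s' w' where q: "q = ((), s' # w')" using pq(2) T1[of "snd q"] by (cases q) auto
    note p q
    then show "p = q" using pq(3) zsc_cancel[of N s s'] N(1) by simp
   qed
   show "(\<lambda>(i, u). (t + N \<cdot> hd u) # tl u) ` Sigma {()} (\<lambda>_. fam T (fbox \<beta>)) =
     fam {[x] | x. x \<in> prog N t a} (fbox (sbox \<sigma>))"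
   proof (intro set_eqI iffI)
    fix u assume "u \<in> (\<lambda>(i, u). (t + N \<cdot> hd u) # tl u) ` Sigma {()} (\<lambda>_. fam T (fbox \<beta>))"
    then obtain s w where u: "u = [t + N \<cdot> s] @ w" "0 \<le> s" "s < a" "w \<in> fbox \<beta> [s]"
     unfolding fam_def T_def by auto
    then have "t + N \<cdot> s \<in> prog N t a" "w \<in> fbox (sbox \<sigma>) [t + N \<cdot> s]" unfolding fb prog_def by blast+
    then show "u \<in> fam {[x] | x. x \<in> prog N t a} (fbox (sbox \<sigma>))" using u(1) unfolding fam_def by blast
   next
    fix u assume "u \<in> fam {[x] | x. x \<in> prog N t a} (fbox (sbox \<sigma>))"
    then obtain x w where u: "u = [x] @ w" "x \<in> prog N t a" "w \<in> fbox (sbox \<sigma>) [x]" unfolding fam_def by blast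
    then obtain s where s: "x = t + N \<cdot> s" "0 \<le> s" "s < a" unfolding prog_def by blast
    have "[s] @ w \<in> fam T (fbox \<beta>)" using u(3) s unfolding fam_def T_def s(1) fb by blast
    then show "u \<in> (\<lambda>(i, u). (t + N \<cdot> hd u) # tl u) ` Sigma {()} (\<lambda>_. fam T (fbox \<beta>))"
     using u(1) s(1) by (intro image_eqI[of _ _ "((), [s] @ w)"]) auto
   qed
  qed
 qed simp
 then show ?thesis by (rule boxy_trans) (rule box1)
qed

text \<open>The base is cut into progressions. Over each of them the common decomposition of the
  fibres lifts to the total space by \<open>dsum_total\<close>, and its pieces have linear sides, so
  that \<open>boxy_progression\<close> applies.\<close>

lemma boxy_uniform:
 fixes X :: "'a::zgroup list set"
 assumes X: "definable_over A (1 + n) X" and T: "definable_over A 1 T" and W: "uni_scheme A n X T"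
  and bd: "\<And>x. [x] \<in> T ==> lo \<le> x \<and> x \<le> hi"
 shows "boxy A (1 + n) (fam T (\<lambda>y. {x. y @ x \<in> X}))"
proof -
 obtain I :: "nat set" and \<sigma> G where *: "finite I" "\<forall>i\<in>I. sok A (\<sigma> i)"
  "\<forall>i\<in>I. definable_over A (1 + (n + bdim (sbox (\<sigma> i)))) (G i)"
  "\<forall>y\<in>T. (\<forall>i\<in>I. spos (\<sigma> i) y) \<and>
    is_graph n {x. y @ x \<in> X} I (\<lambda>i. bdim (sbox (\<sigma> i))) (\<lambda>i. fbox (sbox (\<sigma> i)) y) (\<lambda>i. {w. y @ w \<in> G i})"
  using W unfolding uni_scheme_def by (elim exE conjE)
 note I = *(1) bspec[OF *(2)] bspec[OF *(3)] bspec[OF bspec[OF *(4), THEN conjunct1]] bspec[OF *(4), THEN conjunct2]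
 define X1 where "X1 = {x. [x] \<in> T}"
 have "Def A (\<lambda>v. [v 0] \<in> T)" by (rule Def_mem[OF T], rule Dfnl_Cons[OF Dfn_var Dfnl_Nil])
 then have D1: "Def A (\<lambda>v. v 0 \<in> X1)" by (simp add: X1_def)
 have B1: "X1 \<subseteq> {lo..hi}" using bd by (auto simp: X1_def)
 \<comment> \<open>A common multiple of all denominators in the schemes; \<open>prog_decomp\<close>
   returns progressions with a step divisible by it.\<close>
 define N0 where "N0 = (\<Prod>i\<in>I. \<Prod>q\<in>set (\<sigma> i). fst (snd q))"
 have N0: "0 < N0" unfolding N0_def using I(2) by (intro prod_pos) (auto simp: sok_def case_prod_unfold)
 have dvd: "M dvd N0" if "i \<in> I" "(d, M, m, g) \<in> set (\<sigma> i)" for i d M m g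
 proof -
  have "M dvd (\<Prod>q\<in>set (\<sigma> i). fst (snd q))" using dvd_prodI[of "set (\<sigma> i)" "(d, M, m, g)" "\<lambda>q. fst (snd q)"] that by simp
  also have "\<dots> dvd N0" unfolding N0_def by (rule dvd_prodI[OF I(1) that(1)])
  finally show ?thesis .
 qed
 obtain N J where J: "0 < N" "N0 dvd N" "finite J" "J \<subseteq> zhull A \<times> zhull A" "X1 = (\<Union>(t, a)\<in>J. prog N t a)"
  "\<And>t a u b. (t, a) \<in> J ==> (u, b) \<in> J ==> (t, a) \<noteq> (u, b) ==> prog N t a \<inter> prog N u b = {}"
  using prog_decomp[OF D1 B1 N0] by metis
 define F where "F = (\<lambda>y. {x. y @ x \<in> X})"
 define P where "P = (\<lambda>p :: 'a \<times> 'a. {[x] | x. x \<in> prog N (fst p) (snd p)})"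
 have P: "definable_over A 1 (P p)" if "p \<in> J" for p
 proof -
  have "P p = {[fst p + N \<cdot> s] | s. 0 \<le> s \<and> s < snd p}" unfolding P_def prog_def by auto
  then show ?thesis using segment_definable[of "fst p" A "snd p" N] J(4) that by auto
 qed
 have Tlen: "\<exists>x. y = [x]" if "y \<in> T" for y using definable_length[OF T that] by (cases y) auto
 have PT: "P p \<subseteq> T" if "p \<in> J" for p
 proof
  fix y assume "y \<in> P p"
  then obtain x where "y = [x]" "x \<in> prog N (fst p) (snd p)" unfolding P_def by blast
  then have "x \<in> X1" unfolding J(5) using that by (auto simp: case_prod_unfold)
  then show "y \<in> T" using \<open>y = [x]\<close> by (simp add: X1_def)
 qed
 have FX: "fam S F \<subseteq> X" for S by (auto simp: fam_def F_def)
 have defF: "definable_over A (1 + n) (fam S F)" if S: "definable_over A 1 S" for S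
 proof -
  have "fam S F = {u. length u = 1 + n \<and> (take 1 u \<in> S \<and> u \<in> X)}"
  proof (intro set_eqI)
   fix u
   show "u \<in> fam S F \<longleftrightarrow> u \<in> {u. length u = 1 + n \<and> (take 1 u \<in> S \<and> u \<in> X)}"
    using fam_iff[of S 1 u F] definable_length[OF S] definable_length[OF X, of u] by (auto simp: F_def)
  qed
  also have "definable_over A (1 + n) \<dots>"
  proof (rule definableI, rule Def_conj)
   have "take 1 (map v [0..<1 + n]) = [v 0]" for v :: "nat => 'a" by (simp add: upt_conv_Cons del: upt_Suc)
   then show "Def A (\<lambda>v. take 1 (map v [0..<1 + n]) \<in> S)"
    using Def_mem[OF S Dfnl_Cons[OF Dfn_var Dfnl_Nil], of 0] by simp
   show "Def A (\<lambda>v. map v [0..<1 + n] \<in> X)" by (rule Def_mem[OF X Dfnl_vars])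
  qed
  finally show ?thesis .
 qed
 have "dsum A (1 + n) (fam T F) J (\<lambda>_. 1 + n) (\<lambda>p. fam (P p) F)"
 proof (rule dsum_partition[OF J(3)])
  show "definable_over A (1 + n) (fam (P p) F)" if "p \<in> J" for p using defF P that by blast
  show "fam T F = (\<Union>p\<in>J. fam (P p) F)"
  proof (intro set_eqI iffI)
   fix u assume "u \<in> fam T F"
   then obtain x w where u: "u = [x] @ w" "[x] \<in> T" "w \<in> F [x]" using Tlen unfolding fam_def by fastforce
   then have "x \<in> X1" by (simp add: X1_def)
   then obtain p where "p \<in> J" "x \<in> prog N (fst p) (snd p)" unfolding J(5) by (auto simp: case_prod_unfold)
   then show "u \<in> (\<Union>p\<in>J. fam (P p) F)" using u unfolding fam_def P_def by blast
  next
   fix u assume "u \<in> (\<Union>p\<in>J. fam (P p) F)"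
   then show "u \<in> fam T F" using PT unfolding fam_def by blast
  qed
  fix p q assume pq: "p \<in> J" "q \<in> J" "p \<noteq> q"
  then have "prog N (fst p) (snd p) \<inter> prog N (fst q) (snd q) = {}" using J(6)[of "fst p" "snd p" "fst q" "snd q"] by simp
  then show "fam (P p) F \<inter> fam (P q) F = {}" unfolding fam_def P_def by auto
 qed
 then have "boxy A (1 + n) (fam T F)"
 proof (rule boxy_trans)
  fix p assume p: "p \<in> J"
  then have ta: "fst p \<in> zhull A" "snd p \<in> zhull A" using J(4) by auto
  have "dsum A (1 + n) (fam (P p) F) I (\<lambda>i. 1 + bdim (sbox (\<sigma> i))) (\<lambda>i. fam (P p) (fbox (sbox (\<sigma> i))))"
  proof (rule dsum_total[OF P[OF p] I(1) _ _ I(3)])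
   show "length x = n" if "y \<in> P p" "x \<in> F y" for x y
    using definable_length[OF X, of "y @ x"] that definable_length[OF P[OF p] that(1)] by (simp add: F_def)
   show "length z = bdim (sbox (\<sigma> i))" if "z \<in> fbox (sbox (\<sigma> i)) y" for i y z using fbox_length[OF that] .
   show "is_graph n (F y) I (\<lambda>i. bdim (sbox (\<sigma> i))) (\<lambda>i. fbox (sbox (\<sigma> i)) y) (\<lambda>i. {w. y @ w \<in> G i})" if "y \<in> P p" for y
    unfolding F_def using I(5) PT[OF p] that by blast
  qed
  then show "boxy A (1 + n) (fam (P p) F)"
  proof (rule boxy_trans)
   fix i assume i: "i \<in> I"
   show "boxy A (1 + bdim (sbox (\<sigma> i))) (fam (P p) (fbox (sbox (\<sigma> i))))"
    unfolding P_def
   proof (rule boxy_progression[OF ta I(2)[OF i] J(1)])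
    show "M dvd N" if "(d, M, m, g) \<in> set (\<sigma> i)" for d M m g using dvd[OF i that] J(2) by (rule dvd_trans)
    show "spos (\<sigma> i) [x]" if "x \<in> prog N (fst p) (snd p)" for x
     using I(4)[OF _ i] PT[OF p] that unfolding P_def by blast
   qed
  qed
 qed
 then show ?thesis by (simp add: F_def)
qed

text \<open>Induction on the dimension with the first coordinate as base. The fibre over
  \<open>t\<close> needs \<open>t\<close> as a parameter, so the induction treats all finite
  parameter sets at once; compactness over \<open>A\<close> then leaves finitely many
  schemes.\<close>

theorem bounded_boxy:
 fixes X :: "'a::zgroup list set"
 assumes compact: "\<And>A :: 'a set. finite A ==> compact_over A"
  and "finite A" "definable_over A n X" "bounded_tuples X"
 shows "boxy A n X"
 using assms(2-)
proof (induction n arbitrary: A X)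
 case 0
 then have "X = {} \<or> X = {[]}" using definable_length[OF 0(2)] by auto
 then show ?case using boxy_empty boxy_box[of "[]" A] by auto
next
 case (Suc n)
 have X: "definable_over A (1 + n) X" using Suc.prems(2) by simp
 obtain c where c: "\<And>x e. x \<in> X ==> e \<in> set x ==> - c \<le> e \<and> e < c" using Suc.prems(3) unfolding bounded_tuples_def by blast
 define Y where "Y = {y. length y = 1 \<and> (\<exists>x. length x = n \<and> y @ x \<in> X)}"
 have Y: "definable_over A 1 Y"
  unfolding Y_def
  by (rule definableI, intro Def_exl Def_mem[OF X], rule Dfnl_append, (rule Dfnl_upt Dfn_var)+)
 define \<W> where "\<W> = {W. definable_over A 1 W \<and> uni_scheme A n X W}"
 have "Y \<subseteq> \<Union>\<W>"
 proof
  fix y assume "y \<in> Y"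
  then obtain t where y: "y = [t]" by (auto simp: Y_def length_Suc_conv)
  have "boxy (insert t A) n {x. [t] @ x \<in> X}"
  proof (rule Suc.IH)
   show "finite (insert t A)" using Suc.prems(1) by simp
   show "definable_over (insert t A) n {x. [t] @ x \<in> X}"
    by (rule definable_fibre[of _ 1], rule definable_mono[OF X]) auto
   show "bounded_tuples {x. [t] @ x \<in> X}"
    using Suc.prems(3) unfolding bounded_tuples_def by fastforce
  qed
  from uni_scheme_exists[OF X this] show "y \<in> \<Union>\<W>" unfolding \<W>_def y by blast
 qed
 moreover have "definable_over A 1 W" if "W \<in> \<W>" for W using that by (simp add: \<W>_def)
 ultimately obtain \<W>0 where W0: "\<W>0 \<subseteq> \<W>" "finite \<W>0" "Y \<subseteq> \<Union>\<W>0"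
  using compact_overD[OF compact[OF Suc.prems(1)] Y] by metis
 define F where "F = (\<lambda>y. {x. y @ x \<in> X})"
 have bdY: "- c \<le> x \<and> x \<le> c" if "[x] \<in> Y" for x
 proof -
  obtain z where "[x] @ z \<in> X" using \<open>[x] \<in> Y\<close> by (auto simp: Y_def)
  then show ?thesis using c[of "[x] @ z" x] by auto
 qed
 have defF: "definable_over A (1 + n) (fam S F)" if S: "definable_over A 1 S" for S
 proof -
  have "fam S F = {u. length u = 1 + n \<and> (take 1 u \<in> S \<and> u \<in> X)}"
  proof (intro set_eqI)
   fix u
   show "u \<in> fam S F \<longleftrightarrow> u \<in> {u. length u = 1 + n \<and> (take 1 u \<in> S \<and> u \<in> X)}"
    using fam_iff[of S 1 u F] definable_length[OF S] definable_length[OF X, of u] by (auto simp: F_def)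
  qed
  also have "definable_over A (1 + n) \<dots>"
  proof (rule definableI, rule Def_conj)
   have "take 1 (map v [0..<1 + n]) = [v 0]" for v :: "nat => 'a" by (simp add: upt_conv_Cons del: upt_Suc)
   then show "Def A (\<lambda>v. take 1 (map v [0..<1 + n]) \<in> S)"
    using Def_mem[OF S Dfnl_Cons[OF Dfn_var Dfnl_Nil], of 0] by simp
   show "Def A (\<lambda>v. map v [0..<1 + n] \<in> X)" by (rule Def_mem[OF X Dfnl_vars])
  qed
  finally show ?thesis .
 qed
 have inter: "definable_over A 1 (S \<inter> S')" "definable_over A 1 (S - S')" if "definable_over A 1 S" "definable_over A 1 S'" for S S' :: "'a list set"
  using that by (auto simp: definable_over_iff intro!: Def_conj Def_not)
 \<comment> \<open>The covering sets may overlap, so they are split off the base one at a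
   time.\<close>
 have "boxy A (1 + n) (fam T F)" if "definable_over A 1 T" "T \<subseteq> Y" "T \<subseteq> \<Union>\<W>0" for T
  using W0(2,1) that
 proof (induction \<W>0 arbitrary: T)
  case empty
  then have "fam T F = {}" by (simp add: fam_def)
  then show ?case using boxy_empty by simp
 next
  case (insert W \<W>0)
  have W: "definable_over A 1 W" "uni_scheme A n X W" using insert.prems(1) by (auto simp: \<W>_def)
  have "dsum A (1 + n) (fam T F) UNIV (\<lambda>_. 1 + n) (\<lambda>b. if b then fam (T \<inter> W) F else fam (T - W) F)"
  proof (rule dsum_partition)
   show "definable_over A (1 + n) (if b then fam (T \<inter> W) F else fam (T - W) F)" for b
    using defF inter[OF insert.prems(2) W(1)] by simp
   show "fam T F = (\<Union>b\<in>UNIV. if b then fam (T \<inter> W) F else fam (T - W) F)"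
    by (auto simp: fam_def UNIV_bool)
   have l: "length s = 1" if "s \<in> T" for s using definable_length[OF insert.prems(2) that] .
   have "fam (T \<inter> W) F \<inter> fam (T - W) F = {}"
   proof (intro equals0I)
    fix u assume "u \<in> fam (T \<inter> W) F \<inter> fam (T - W) F"
    then have "u \<in> fam (T \<inter> W) F" "u \<in> fam (T - W) F" by auto
    then obtain s x s' x' where *: "u = s @ x" "s \<in> T \<inter> W" "u = s' @ x'" "s' \<in> T - W"
     unfolding fam_def by blast
    have "s = s'" using *(1,3) l[of s] l[of s'] *(2,4) by auto
    then show False using *(2,4) by blast
   qed
   then show "(if b then fam (T \<inter> W) F else fam (T - W) F) \<inter> (if b' then fam (T \<inter> W) F else fam (T - W) F) = {}"
    if "b \<noteq> b'" for b b' using that by (auto split: if_splits)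
  qed simp
  then show ?case
  proof (rule boxy_trans)
   fix b
   have "boxy A (1 + n) (fam (T \<inter> W) F)"
    unfolding F_def
   proof (rule boxy_uniform[OF X inter(1)[OF insert.prems(2) W(1)]])
    show "uni_scheme A n X (T \<inter> W)" using uni_scheme_mono[OF W(2)] by blast
    show "- c \<le> x \<and> x \<le> c" if "[x] \<in> T \<inter> W" for x using bdY that insert.prems(3) by blast
   qed
   moreover have "boxy A (1 + n) (fam (T - W) F)"
    by (rule insert.IH) (use insert.prems inter(2)[OF insert.prems(2) W(1)] in auto)
   ultimately show "boxy A (1 + n) (if b then fam (T \<inter> W) F else fam (T - W) F)" by simp
  qed
 qed
 from this[OF Y order_refl W0(3)] have "boxy A (1 + n) (fam Y F)" .
 moreover have "fam Y F = X"
 proof (intro set_eqI iffI)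
  fix u assume u: "u \<in> X"
  then have l: "length u = 1 + n" using definable_length[OF X] by blast
  then obtain t x where "u = [t] @ x" "length x = n" by (cases u) auto
  then have "u = [t] @ x" "[t] \<in> Y" "x \<in> F [t]" using u by (auto simp: Y_def F_def)
  then show "u \<in> fam Y F" unfolding fam_def by blast
 qed (auto simp: fam_def F_def)
 ultimately show ?case by simp
qed

section \<open>Normal forms with respect to a positive basis\<close>

text \<open>The list \<open>es\<close> omits \<open>zone\<close>, whose factors have been evaluated.
  What remains are sides whose images under a homomorphism are free.\<close>

definition nform :: "'a::zgroup set => 'a list => nat => 'a list set => bool" where
 "nform A es n X \<longleftrightarrow> (\<exists>(I :: nat set) \<delta>. (\<forall>i\<in>I. length (\<delta> i) = length es) \<and>
   dsum A n X I (\<lambda>i. bdim (zip (\<delta> i) es)) (\<lambda>i. box (zip (\<delta> i) es)))"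

lemma nform_trans:
 assumes "dsum A n X J m B" "\<And>j. j \<in> J ==> nform A es (m j) (B j)"
 shows "nform A es n X"
proof -
 have "\<forall>j\<in>J. \<exists>(I :: nat set) \<delta>. (\<forall>i\<in>I. length (\<delta> i) = length es) \<and>
   dsum A (m j) (B j) I (\<lambda>i. bdim (zip (\<delta> i) es)) (\<lambda>i. box (zip (\<delta> i) es))"
  using assms(2) unfolding nform_def by blast
 then obtain I :: "'b => nat set" and \<delta> where
  I: "\<And>j i. j \<in> J ==> i \<in> I j ==> length (\<delta> j i) = length es"
  "\<And>j. j \<in> J ==> dsum A (m j) (B j) (I j) (\<lambda>i. bdim (zip (\<delta> j i) es)) (\<lambda>i. box (zip (\<delta> j i) es))"
  by metis
 obtain f N where f: "bij_betw f {0..<N :: nat} (Sigma J I)"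
  "dsum A n X {0..<N} (\<lambda>i. (\<lambda>(j, i). bdim (zip (\<delta> j i) es)) (f i)) (\<lambda>i. (\<lambda>(j, i). box (zip (\<delta> j i) es)) (f i))"
  using dsum_nat_index[OF dsum_trans[OF assms(1) I(2)]] by blast
 define \<delta>' where "\<delta>' = (\<lambda>i. \<delta> (fst (f i)) (snd (f i)))"
 have "length (\<delta>' i) = length es" if "i \<in> {0..<N}" for i
 proof -
  have "f i \<in> Sigma J I" using bij_betw_apply[OF f(1) that] .
  then show ?thesis using I(1) unfolding \<delta>'_def by auto
 qed
 moreover have "dsum A n X {0..<N} (\<lambda>i. bdim (zip (\<delta>' i) es)) (\<lambda>i. box (zip (\<delta>' i) es))"
  using f(2) by (simp add: \<delta>'_def case_prod_unfold)
 ultimately show ?thesis unfolding nform_def by blast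
qed

lemma nform_empty: "nform A es n {}"
 unfolding nform_def using dsum_empty by blast

lemma nform_box:
 assumes "set es \<subseteq> zhull A" "length ds = length es"
 shows "nform A es (bdim (zip ds es)) (box (zip ds es))"
proof -
 have "definable_over A (bdim (zip ds es)) (box (zip ds es))"
  by (rule box_definable) (use assms(1) set_zip_rightD in fastforce)
 from dsum_self[OF this, of "0 :: nat"] show ?thesis
  unfolding nform_def using assms(2) by (intro exI[of _ "{0}"] exI[of _ "\<lambda>_. ds"]) simp
qed

lemma chain_zone:
 "chain 1 (zone :: 'a::zgroup) = {[0]}" "1 < d ==> chain d (zone :: 'a) = {}"
proof -
 have 0: "x = 0" if "0 \<le> x" "x < zone" for x :: 'a
  using zone_least[of x] that by (metis not_le order_le_less)
 show "chain 1 (zone :: 'a) = {[0]}"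
  using zone_pos[where 'a = 'a] 0 by (auto simp: chain_def length_Suc_conv)
 show "chain d (zone :: 'a) = {}" if "1 < d"
 proof (intro equals0I)
  fix z :: "'a list" assume z: "z \<in> chain d zone"
  then have "z ! 0 < z ! 1" "z ! 0 \<in> set z" "z ! 1 \<in> set z"
   using that by (auto simp: chain_def sorted_wrt_iff_nth_less)
  moreover from this have "z ! 0 = 0" "z ! 1 = 0" using z 0 by (auto simp: chain_def)
  ultimately show False by simp
 qed
qed

lemma nform_zone:
 assumes es: "set es \<subseteq> zhull A" and l: "length ds = length es"
 shows "nform A es (bdim (zip (d # ds) (zone # es))) (box (zip (d # ds) (zone # es)))"
proof -
 consider "d = 0" | "d = 1" | "1 < d" by linarith
 then show ?thesis
 proof cases
  case 1
  then show ?thesis using nform_box[OF assms] by simp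
 next
  case 3
  then show ?thesis using chain_zone(2)[OF 3, where 'a = 'a] nform_empty by simp
 next
  case 2
  let ?B = "box (zip ds es)"
  have len: "length z = bdim (zip ds es)" if "z \<in> ?B" for z using box_length that by blast
  have "dsum A (bdim (zip (d # ds) (zone # es))) (box (zip (d # ds) (zone # es))) {()} (\<lambda>_. bdim (zip ds es)) (\<lambda>_. ?B)"
  proof (rule dsum_map[where g = "\<lambda>_ z. 0 # z"])
   show "definable_over A (bdim (zip ds es)) ?B"
    by (rule box_definable) (use es set_zip_rightD in fastforce)
   have "Dfnl A (Suc (bdim (zip ds es))) (\<lambda>v. 0 # map v [0..<bdim (zip ds es)])"
    by (rule Dfnl_Cons[OF Dfn_zero Dfnl_vars])
   then show "Dfnl A (bdim (zip (d # ds) (zone # es))) (\<lambda>v. 0 # map v [0..<bdim (zip ds es)])"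
    using 2 by simp
   show "bij_betw (\<lambda>(i :: unit, z). 0 # z) (Sigma {()} (\<lambda>_. ?B)) (box (zip (d # ds) (zone # es)))"
    using chain_zone(1)[where 'a = 'a] 2 by (auto simp: bij_betw_def inj_on_def image_iff)
  qed simp
  then show ?thesis by (rule nform_trans) (rule nform_box[OF assms])
 qed
qed

text \<open>This is \<open>good_boxes\<close> over the base with the single point \<open>[]\<close>,
  where all side functions are constants, followed by the removal of the factor with side
  \<open>zone\<close>.\<close>

lemma nform_boxes:
 fixes A :: "'a::zgroup set"
 assumes E: "pbasis A (set (zone # es))" "distinct (zone # es)" and bx: "\<And>p. p \<in> set bx ==> snd p \<in> pos_cone (set (zone # es))"
 shows "nform A es (bdim bx) (box bx)"
proof -
 define e where "e = zone # es"
 have eh: "set e \<subseteq> zhull A" and epos: "\<And>x. x \<in> set e ==> 0 \<le> x"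
  using E(1) by (auto simp: pbasis_def e_def order_less_imp_le)
 define \<phi>s where "\<phi>s = map (\<lambda>x (u :: 'a list). x) e"
 have len: "length \<phi>s = length e" by (simp add: \<phi>s_def)
 have "\<exists>c. a = comb \<phi>s c []" if "a \<in> pos_cone (set e)" for a
 proof -
  obtain k where k: "\<forall>x\<in>set e. 0 \<le> k x" "a = (\<Sum>x\<in>set e. k x \<cdot> x)" using \<open>a \<in> pos_cone (set e)\<close> unfolding pos_cone_def by blast
  have "(\<Sum>x\<in>set e. k x \<cdot> x) = (\<Sum>j<length e. k (e ! j) \<cdot> e ! j)"
   by (rule sum.reindex_bij_betw[symmetric], rule bij_betw_nth) (use E(2) in \<open>auto simp: e_def\<close>)
  also have "\<dots> = comb \<phi>s (\<lambda>j. nat (k (e ! j))) []"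
   unfolding comb_def len by (rule sum.cong) (use k(1) in \<open>auto simp: \<phi>s_def\<close>)
  finally show ?thesis using k(2) by blast
 qed
 then obtain c where c: "\<And>a. a \<in> pos_cone (set e) ==> a = comb \<phi>s (c a) []" by metis
 define bs where "bs = map (\<lambda>(d, a). (d, c a)) bx"
 define zs where "zs = zip (replicate (length \<phi>s) (0 :: nat)) \<phi>s"
 have box: "box bx = fam {[]} (fbox (map (\<lambda>(d, c). (d, comb \<phi>s c)) bs @ zs))"
 proof -
  have "map (\<lambda>(d, \<phi>). (d, \<phi> [])) (map (\<lambda>(d, c). (d, comb \<phi>s c)) bs) = bx"
   unfolding bs_def map_map by (rule map_idI) (use bx c in "force simp: e_def")
  then have "fbox (map (\<lambda>(d, c). (d, comb \<phi>s c)) bs) [] = box bx" by (simp add: fbox_def)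
  then show ?thesis unfolding fam_Nil fbox_simps(3) zs_def fbox_zeros by simp
 qed
 have bd: "bdim bx = 0 + bdim (map (\<lambda>(d, c). (d, comb \<phi>s c)) bs @ zs)"
 proof -
  have "map fst (map (\<lambda>(d, c). (d, comb \<phi>s c)) bs) = map fst bx" by (simp add: bs_def case_prod_unfold)
  then show ?thesis unfolding bdim_simps(3) zs_def bdim_zeros by (simp add: bdim_def)
 qed
 have "definable_over A 0 {[] :: 'a list}" unfolding definable_over_iff by (simp add: Def_const)
 moreover have "Dfs A 0 \<phi>" if "\<phi> \<in> set \<phi>s" for \<phi>
  using that eh by (auto simp: \<phi>s_def Dfs_def intro!: Dfn_zhull)
 moreover have "0 \<le> \<phi> s" if "\<phi> \<in> set \<phi>s" for \<phi> s using that epos by (auto simp: \<phi>s_def)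
 ultimately have "good A 0 {[]} \<phi>s (0 + bdim (map (\<lambda>(d, c). (d, comb \<phi>s c)) bs @ zs))
   (fam {[]} (fbox (map (\<lambda>(d, c). (d, comb \<phi>s c)) bs @ zs)))"
  unfolding zs_def by (intro good_boxes) auto
 then obtain I :: "nat set" and \<delta> where \<delta>: "\<And>i. i \<in> I ==> length (\<delta> i) = length e"
  "dsum A (bdim bx) (box bx) I (\<lambda>i. 0 + bdim (zip (\<delta> i) \<phi>s)) (\<lambda>i. fam {[]} (fbox (zip (\<delta> i) \<phi>s)))"
  unfolding good_def len box[symmetric] bd[symmetric] by blast
 show ?thesis
 proof (rule nform_trans[OF \<delta>(2)])
  fix i assume "i \<in> I"
  from \<delta>(1)[OF this] obtain d ds where ds: "\<delta> i = d # ds" "length ds = length es"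
   by (auto simp: e_def length_Suc_conv)
  have "fam {[]} (fbox (zip (\<delta> i) \<phi>s)) = box (zip (\<delta> i) e)"
   unfolding fam_Nil fbox_def \<phi>s_def zip_map2 map_map by (rule arg_cong[of _ _ box]) (rule map_idI, auto)
  moreover have "0 + bdim (zip (\<delta> i) \<phi>s) = bdim (zip (\<delta> i) e)"
   unfolding bdim_def \<phi>s_def zip_map2 map_map by (simp add: case_prod_unfold comp_def)
  moreover have "nform A es (bdim (zip (\<delta> i) e)) (box (zip (\<delta> i) e))"
   unfolding ds(1) e_def by (rule nform_zone[OF _ ds(2)]) (use eh in "auto simp: e_def")
  ultimately show "nform A es (0 + bdim (zip (\<delta> i) \<phi>s)) (fam {[]} (fbox (zip (\<delta> i) \<phi>s)))" by simp
 qed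
qed

text \<open>One basis is chosen for the sides of both sets together; only then can the lengths in
  the two decompositions be compared index by index.\<close>

lemma common_normal_form:
 fixes A :: "'a::zgroup set"
 assumes "boxy A n X" "boxy A n' X'"
 obtains es where "pbasis A (set (zone # es))" "distinct (zone # es)" "nform A es n X" "nform A es n' X'"
proof -
 obtain I :: "nat set" and bx where 1: "\<And>i p. i \<in> I ==> p \<in> set (bx i) ==> snd p \<in> zhull A \<and> 0 \<le> snd p"
   "dsum A n X I (\<lambda>i. bdim (bx i)) (\<lambda>i. box (bx i))" using assms(1) unfolding boxy_def by blast
 obtain I' :: "nat set" and bx' where 2: "\<And>i p. i \<in> I' ==> p \<in> set (bx' i) ==> snd p \<in> zhull A \<and> 0 \<le> snd p"
   "dsum A n' X' I' (\<lambda>i. bdim (bx' i)) (\<lambda>i. box (bx' i))" using assms(2) unfolding boxy_def by blast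
 define F where "F = (\<Union>i\<in>I. snd ` set (bx i)) \<union> (\<Union>i\<in>I'. snd ` set (bx' i))"
 have "finite I" "finite I'" using 1(2) 2(2) by (auto simp: dsum_def)
 then have "finite F" by (simp add: F_def)
 moreover have "F \<subseteq> zhull A" "\<And>a. a \<in> F ==> 0 \<le> a" using 1(1) 2(1) unfolding F_def by blast+
 ultimately obtain E where E: "pbasis A E" "F \<subseteq> pos_cone E" using pbasis_exists by metis
 have "finite (E - {zone})" using E(1) by (simp add: pbasis_def)
 from finite_distinct_list[OF this] obtain es where es: "set es = E - {zone}" "distinct es" by (elim exE conjE)
 have "zone \<in> E" using E(1) by (simp add: pbasis_def)
 then have Es: "set (zone # es) = E" unfolding list.set(2) es(1) by (rule insert_Diff)
 have d: "distinct (zone # es)" unfolding distinct.simps(2) es(1) using es(2) by simp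
 have pb: "pbasis A (set (zone # es))" using E(1) Es by simp
 have "nform A es n X"
 proof (rule nform_trans[OF 1(2)], rule nform_boxes[OF pb d])
  fix i p assume "i \<in> I" "p \<in> set (bx i)"
  then have "snd p \<in> F" unfolding F_def by blast
  then show "snd p \<in> pos_cone (set (zone # es))" unfolding Es using E(2) by blast
 qed
 moreover have "nform A es n' X'"
 proof (rule nform_trans[OF 2(2)], rule nform_boxes[OF pb d])
  fix i p assume "i \<in> I'" "p \<in> set (bx' i)"
  then have "snd p \<in> F" unfolding F_def by blast
  then show "snd p \<in> pos_cone (set (zone # es))" unfolding Es using E(2) by blast
 qed
 ultimately show ?thesis using that pb d by blast
qed

section \<open>Evaluation of polynomials\<close>

lemma sum_keys_superset:
 assumes "finite S" "Poly_Mapping.keys f \<subseteq> S" "\<And>k. g k 0 = 0"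
 shows "(\<Sum>k\<in>Poly_Mapping.keys f. g k (Poly_Mapping.lookup f k)) = (\<Sum>k\<in>S. g k (Poly_Mapping.lookup f k))"
 by (rule sum.mono_neutral_left) (use assms in "auto simp: in_keys_iff")

text \<open>Coefficients may cancel in \<open>s + t\<close>, so all three sums are first extended to
  the union of the supports, where the extra terms vanish.\<close>

lemma sum_keys_add:
 fixes g :: "'k => 'c::comm_monoid_add => 'r::comm_monoid_add"
 assumes g0: "\<And>k. g k 0 = 0" and ga: "\<And>k a b. g k (a + b) = g k a + g k b"
 shows "(\<Sum>k\<in>Poly_Mapping.keys (s + t). g k (Poly_Mapping.lookup (s + t) k)) =
  (\<Sum>k\<in>Poly_Mapping.keys s. g k (Poly_Mapping.lookup s k)) + (\<Sum>k\<in>Poly_Mapping.keys t. g k (Poly_Mapping.lookup t k))"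
proof -
 let ?S = "Poly_Mapping.keys s \<union> Poly_Mapping.keys t"
 have *: "finite ?S" by simp
 show ?thesis
  by (subst (1 2 3) sum_keys_superset[of ?S])
   (auto simp: g0 ga lookup_add sum.distrib dest: set_mp[OF Poly_Mapping.keys_add])
qed

lemma poly_mapping_add_induct [case_names single add]:
 assumes "\<And>m c. P (Poly_Mapping.single m c)" and "\<And>f g. P f ==> P g ==> P (f + g)"
 shows "P (f :: 'k \<Rightarrow>\<^sub>0 'c::comm_monoid_add)"
proof (induction f rule: update_induct)
 case const
 then show ?case using assms(1)[of undefined 0] by simp
next
 case (update f a b)
 have "Poly_Mapping.update a b f = Poly_Mapping.single a b + f"
  by (rule poly_mapping_eqI)
   (use update(1) in \<open>auto simp: lookup_update lookup_add lookup_single when_def in_keys_iff\<close>)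
 then show ?case using assms update(3) by simp
qed

definition monom_eval :: "('v => 'r::comm_monoid_mult) => ('v \<Rightarrow>\<^sub>0 nat) => 'r" where
 "monom_eval v m = (\<Prod>i\<in>Poly_Mapping.keys m. v i ^ Poly_Mapping.lookup m i)"

lemma monom_eval_0 [simp]: "monom_eval v 0 = 1"
 by (simp add: monom_eval_def)

lemma monom_eval_single [simp]: "monom_eval v (Poly_Mapping.single i d) = v i ^ d"
 by (simp add: monom_eval_def)

lemma monom_eval_add:
 fixes v :: "'v => 'r::comm_monoid_mult"
 shows "monom_eval v (m + m') = monom_eval v m * monom_eval v m'"
proof -
 let ?S = "Poly_Mapping.keys m \<union> Poly_Mapping.keys m'"
 have *: "monom_eval v l = (\<Prod>i\<in>?S. v i ^ Poly_Mapping.lookup l i)" if "Poly_Mapping.keys l \<subseteq> ?S" for l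
  unfolding monom_eval_def by (rule prod.mono_neutral_left) (use that in "auto simp: in_keys_iff")
 show ?thesis
  using *[of m] *[of m'] *[of "m + m'", OF Poly_Mapping.keys_add]
  by (auto simp: lookup_add power_add prod.distrib)
qed

lemma mpoly_eval_single:
 "h 0 = 0 ==> mpoly_eval h v (Poly_Mapping.single m c) = h c * monom_eval v m"
 by (simp add: mpoly_eval_def monom_eval_def)

text \<open>The conditions that make \<open>mpoly_eval\<close> a homomorphism, collected for three
  uses: the identity on the rationals, \<open>Sym_rat\<close>, and the embedding of the naturals
  into the rationals.\<close>

locale coeff_hom =
 fixes h :: "'c::comm_semiring_1 => 'r::{comm_semiring_0, comm_monoid_mult}"
 assumes zero: "h 0 = 0" and add: "h (a + b) = h a + h b"
  and mult: "h (a * b) = h a * h b" and one: "h 1 = 1"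
begin

lemma eval_add: "mpoly_eval h v (f + g) = mpoly_eval h v f + mpoly_eval h v g"
 unfolding mpoly_eval_def by (rule sum_keys_add) (simp_all add: zero add algebra_simps)

lemma eval_mult: "mpoly_eval h v (f * g) = mpoly_eval h v f * mpoly_eval h v g"
proof (induction f rule: poly_mapping_add_induct)
 case (single m c)
 show ?case
 proof (induction g rule: poly_mapping_add_induct)
  case (single m' c')
  then show ?case
   by (simp add: mult_single mpoly_eval_single zero mult monom_eval_add algebra_simps)
 qed (simp add: eval_add algebra_simps)
qed (simp add: eval_add algebra_simps)

lemma eval_0: "mpoly_eval h v 0 = 0"
 by (simp add: mpoly_eval_def)

lemma eval_1: "mpoly_eval h v 1 = 1"
 using mpoly_eval_single[of h v 0 1] by (simp add: zero one)

lemma eval_var: "mpoly_eval h v (Poly_Mapping.single (Poly_Mapping.single i 1) 1) = v i"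
 by (simp add: mpoly_eval_single zero one)

lemma eval_const: "mpoly_eval h v (Poly_Mapping.single 0 c) = h c"
 by (simp add: mpoly_eval_single zero)

lemma eval_sum: "mpoly_eval h v (\<Sum>i\<in>I. f i) = (\<Sum>i\<in>I. mpoly_eval h v (f i))"
 by (induction I rule: infinite_finite_induct) (auto simp: eval_add eval_0)

lemma eval_prod: "mpoly_eval h v (\<Prod>i\<in>I. f i) = (\<Prod>i\<in>I. mpoly_eval h v (f i))"
 by (induction I rule: infinite_finite_induct) (auto simp: eval_mult eval_1)

end

lemma mpoly_vars_add: "mpoly_vars (f + g) \<subseteq> mpoly_vars f \<union> mpoly_vars g"
 using Poly_Mapping.keys_add[of f g] unfolding mpoly_vars_def by blast

lemma mpoly_vars_mult:
 fixes f g :: "('v, 'c::comm_semiring_1) mpoly"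
 shows "mpoly_vars (f * g) \<subseteq> mpoly_vars f \<union> mpoly_vars g"
proof -
 have "Poly_Mapping.keys m \<subseteq> mpoly_vars f \<union> mpoly_vars g" if "m \<in> Poly_Mapping.keys (f * g)" for m
 proof -
  obtain a b where "m = a + b" "a \<in> Poly_Mapping.keys f" "b \<in> Poly_Mapping.keys g"
   using set_mp[OF keys_mult[of f g] \<open>m \<in> Poly_Mapping.keys (f * g)\<close>] by blast
  then show ?thesis using Poly_Mapping.keys_add[of a b] unfolding mpoly_vars_def by blast
 qed
 then show ?thesis unfolding mpoly_vars_def by blast
qed

section \<open>Additive functions into the rationals\<close>

text \<open>Graphs of additive functions from a subgroup to the rationals, described as subgroups of
  the product that contain no \<open>(0, q)\<close> with \<open>q\<close> nonzero. Ordered by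
  inclusion they suit Zorn's lemma.\<close>

definition rat_relation :: "('a::ab_group_add \<times> rat) set => bool" where
 "rat_relation G \<longleftrightarrow> (0, 0) \<in> G \<and>
   (\<forall>x q y r. (x, q) \<in> G --> (y, r) \<in> G --> (x - y, q - r) \<in> G) \<and> (\<forall>q. (0, q) \<in> G --> q = 0)"

lemma rat_relation_add:
 assumes "rat_relation G" "(x, q) \<in> G" "(y, r) \<in> G" shows "(x + y, q + r) \<in> G"
proof -
 have "(0 - y, 0 - r) \<in> G" using assms unfolding rat_relation_def by blast
 then have "(x - (0 - y), q - (0 - r)) \<in> G" using assms unfolding rat_relation_def by blast
 then show ?thesis by simp
qed

lemma rat_relation_zsc:
 assumes G: "rat_relation G" and xq: "(x, q) \<in> G" shows "(k \<cdot> x, of_int k * q) \<in> G"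
proof (induction k rule: int_induct[where k = 0])
 case base
 then show ?case using G by (simp add: rat_relation_def)
next
 case (step1 i)
 show ?case using rat_relation_add[OF G step1(2) xq] by (simp add: zsc_add_left algebra_simps)
next
 case (step2 i)
 have "(i \<cdot> x - x, of_int i * q - q) \<in> G" using G step2(2) xq unfolding rat_relation_def by blast
 then show ?case by (simp add: zsc_diff_left algebra_simps)
qed

text \<open>If a nonzero multiple \<open>N \<cdot> x\<close> already has a value \<open>p\<close>,
  then \<open>x\<close> must receive \<open>p / N\<close>, which agrees with the values at all other
  multiples. If there is no such multiple, the value 0 is as good as any.\<close>

lemma rat_relation_extend:
 assumes G: "rat_relation G" shows "\<exists>G'. rat_relation G' \<and> G \<subseteq> G' \<and> x \<in> fst ` G'"
proof -
 have "\<exists>r. \<forall>k q. (k \<cdot> x, q) \<in> G --> q = of_int k * r"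
 proof (cases "\<exists>N p. N \<noteq> 0 \<and> (N \<cdot> x, p) \<in> G")
  case True
  then obtain N p where N: "N \<noteq> 0" "(N \<cdot> x, p) \<in> G" by blast
  have "q = of_int k * (p / of_int N)" if "(k \<cdot> x, q) \<in> G" for k q
  proof -
   have "(k \<cdot> N \<cdot> x - N \<cdot> k \<cdot> x, of_int k * p - of_int N * q) \<in> G"
    using G rat_relation_zsc[OF G N(2), of k] rat_relation_zsc[OF G that, of N]
    unfolding rat_relation_def by blast
   then have "(0, of_int k * p - of_int N * q) \<in> G"
    by (simp add: zsc_mult[symmetric] mult.commute)
   then have "of_int k * p - of_int N * q = 0" using G unfolding rat_relation_def by blast
   then show ?thesis using N(1) by (simp add: field_simps)
  qed
  then show ?thesis by blast
 next
  case False
  then have "k = 0" if "(k \<cdot> x, q) \<in> G" for k q using that by blast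
  moreover have "q = 0" if "(0, q) \<in> G" for q using that G unfolding rat_relation_def by blast
  ultimately have "\<forall>k q. (k \<cdot> x, q) \<in> G --> q = of_int k * 0" by fastforce
  then show ?thesis by blast
 qed
 then obtain r where r: "\<And>k q. (k \<cdot> x, q) \<in> G ==> q = of_int k * r" by blast
 define G' where "G' = {(y + k \<cdot> x, q + of_int k * r) | y k q. (y, q) \<in> G}"
 have sub: "(y + k \<cdot> x, q + of_int k * r) \<in> G'" if "(y, q) \<in> G" for y q k
  using that unfolding G'_def by blast
 have "rat_relation G'"
  unfolding rat_relation_def
 proof (intro conjI allI impI)
  show "(0, 0) \<in> G'" using sub[of 0 0 0] G by (simp add: rat_relation_def)
  show "q = 0" if q: "(0, q) \<in> G'" for q
  proof -
   obtain y k s where s: "0 = y + k \<cdot> x" "q = s + of_int k * r" "(y, s) \<in> G"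
    using q unfolding G'_def by blast
   have "y = (- k) \<cdot> x" using s(1) by (simp add: eq_neg_iff_add_eq_0)
   then have "s = of_int (- k) * r" using s(3) r[of "- k" s] by simp
   then show ?thesis using s(2) by simp
  qed
  show "(a - b, s - t) \<in> G'" if a: "(a, s) \<in> G'" and b: "(b, t) \<in> G'" for a s b t
  proof -
   obtain y k q where 1: "a = y + k \<cdot> x" "s = q + of_int k * r" "(y, q) \<in> G"
    using a unfolding G'_def by blast
   obtain y' k' q' where 2: "b = y' + k' \<cdot> x" "t = q' + of_int k' * r" "(y', q') \<in> G"
    using b unfolding G'_def by blast
   have "(y - y', q - q') \<in> G" using G 1(3) 2(3) unfolding rat_relation_def by blast
   from sub[OF this, of "k - k'"] show ?thesis
    unfolding 1 2 by (simp add: zsc_diff_left algebra_simps)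
  qed
 qed
 moreover have "G \<subseteq> G'"
 proof
  fix p assume "p \<in> G" then show "p \<in> G'" using sub[of "fst p" "snd p" 0] by simp
 qed
 moreover have "(x, r) \<in> G'" using sub[of 0 0 1] G by (simp add: rat_relation_def)
 ultimately show ?thesis by (intro exI[of _ G']) (auto intro: rev_image_eqI)
qed

text \<open>The rationals being divisible, a homomorphism into them extends from a subgroup.\<close>

lemma additive_extension:
 fixes E :: "'a::ab_group_add set"
 assumes "finite E" "indep E"
 obtains l :: "'a => rat" where "\<And>x y. l (x + y) = l x + l y" "\<And>e. e \<in> E ==> l e = q e"
proof -
 \<comment> \<open>The prescribed values, extended to the group generated by \<open>E\<close>;
   independence makes this single-valued.\<close>
 define G0 where "G0 = {(\<Sum>e\<in>E. c e \<cdot> e, \<Sum>e\<in>E. of_int (c e) * q e) | c. True}"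
 have mem: "(\<Sum>e\<in>E. c e \<cdot> e, \<Sum>e\<in>E. of_int (c e) * q e) \<in> G0" for c
  unfolding G0_def by (rule CollectI, rule exI[of _ c]) simp
 let ?A = "{G. rat_relation G \<and> G0 \<subseteq> G}"
 have G0: "rat_relation G0"
  unfolding rat_relation_def
 proof (intro conjI allI impI)
  show "(0, 0) \<in> G0" using mem[of "\<lambda>_. 0"] by simp
  show "s = 0" if "(0, s) \<in> G0" for s
  proof -
   obtain c where c: "0 = (\<Sum>e\<in>E. c e \<cdot> e)" "s = (\<Sum>e\<in>E. of_int (c e) * q e)"
    using \<open>(0, s) \<in> G0\<close> unfolding G0_def by blast
   have "\<forall>e\<in>E. c e = 0" using assms(2) c(1)[symmetric] unfolding indep_def by blast
   then show ?thesis using c(2) by simp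
  qed
  show "(x - y, s - t) \<in> G0" if xs: "(x, s) \<in> G0" and yt: "(y, t) \<in> G0" for x s y t
  proof -
   obtain c where c: "x = (\<Sum>e\<in>E. c e \<cdot> e)" "s = (\<Sum>e\<in>E. of_int (c e) * q e)"
    using xs unfolding G0_def by blast
   obtain d where d: "y = (\<Sum>e\<in>E. d e \<cdot> e)" "t = (\<Sum>e\<in>E. of_int (d e) * q e)"
    using yt unfolding G0_def by blast
   show ?thesis
    using mem[of "\<lambda>e. c e - d e"] unfolding c d by (simp add: zsc_diff_left sum_subtractf algebra_simps)
  qed
 qed
 have "\<exists>M\<in>?A. \<forall>X\<in>?A. M \<subseteq> X --> X = M"
 proof (rule subset_Zorn_nonempty)
  show "?A \<noteq> {}" using G0 by blast
  fix C assume C: "C \<noteq> {}" "subset.chain ?A C"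
  have CA: "rat_relation G \<and> G0 \<subseteq> G" if "G \<in> C" for G
   using C(2) that unfolding subset.chain_def by blast
  have lin: "G \<subseteq> H \<or> H \<subseteq> G" if "G \<in> C" "H \<in> C" for G H
   using C(2) that unfolding subset_chain_def by blast
  obtain G1 where G1: "G1 \<in> C" using C(1) by blast
  have "rat_relation (\<Union>C)"
   unfolding rat_relation_def
  proof (intro conjI allI impI)
   show "(0, 0) \<in> \<Union>C" using CA[OF G1] G1 unfolding rat_relation_def by blast
   show "q = 0" if "(0, q) \<in> \<Union>C" for q
    using that CA unfolding rat_relation_def by blast
   fix x q y r assume "(x, q) \<in> \<Union>C" "(y, r) \<in> \<Union>C"
   then obtain G H where GH: "(x, q) \<in> G" "G \<in> C" "(y, r) \<in> H" "H \<in> C" by blast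
   then obtain K where K: "K \<in> C" "(x, q) \<in> K" "(y, r) \<in> K" using lin[OF GH(2,4)] by blast
   have "(x - y, q - r) \<in> K" using CA[OF K(1)] K(2,3) unfolding rat_relation_def by blast
   then show "(x - y, q - r) \<in> \<Union>C" using K(1) by blast
  qed
  then show "\<Union>C \<in> ?A" using CA[OF G1] G1 by blast
 qed
 then obtain M where M0: "M \<in> ?A" "\<forall>X\<in>?A. M \<subseteq> X --> X = M" by (rule bexE)
 have M: "rat_relation M" "G0 \<subseteq> M" using M0(1) by simp_all
 have M3: "X = M" if "rat_relation X" "M \<subseteq> X" for X
 proof -
  have "X \<in> ?A" using that M(2) by auto
  then show ?thesis using bspec[OF M0(2)] \<open>M \<subseteq> X\<close> by simp
 qed
 have uni: "q = r" if "(x, q) \<in> M" "(x, r) \<in> M" for x q r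
 proof -
  have "(x - x, q - r) \<in> M" using M(1) that unfolding rat_relation_def by blast
  then have "(0, q - r) \<in> M" by simp
  then have "q - r = 0" using M(1) unfolding rat_relation_def by blast
  then show ?thesis by simp
 qed
 have "\<exists>r. (x, r) \<in> M" for x
 proof -
  obtain G' where G': "rat_relation G'" "M \<subseteq> G'" "x \<in> fst ` G'"
   using rat_relation_extend[OF M(1), of x] by blast
  then have "x \<in> fst ` M" using M3[OF G'(1,2)] by simp
  then obtain p where "p \<in> M" "x = fst p" by (rule imageE)
  then show ?thesis by (intro exI[of _ "snd p"]) simp
 qed
 then have "\<exists>l. \<forall>x. (x, l x) \<in> M" by (intro choice allI)
 then obtain l where "\<forall>x. (x, l x) \<in> M" by (rule exE)
 then have l: "(x, l x) \<in> M" for x by (rule spec)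
 show ?thesis
 proof
  show "l (x + y) = l x + l y" for x y
   using uni[OF l rat_relation_add[OF M(1) l l]] by simp
  show "l e = q e" if e: "e \<in> E" for e
  proof -
   let ?c = "\<lambda>x. if x = e then 1 else 0 :: int"
   have "(\<Sum>x\<in>E. ?c x \<cdot> x, \<Sum>x\<in>E. of_int (?c x) * q x) \<in> G0" by (rule mem)
   moreover have "(\<Sum>x\<in>E. ?c x \<cdot> x) = (\<Sum>x\<in>E. if x = e then x else 0)"
    "(\<Sum>x\<in>E. of_int (?c x) * q x) = (\<Sum>x\<in>E. if x = e then q x else 0)"
    by (intro sum.cong; simp)+
   ultimately have "(e, q e) \<in> G0" using e assms(1) by simp
   then show ?thesis using uni[OF l] M(2) by blast
  qed
 qed
qed

lemma tensor_add_right: "tensor a (q + r) = tensor a q + tensor a r"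
 by transfer (simp add: tensor_cong_def tensor_relations.add_right flip: diff_diff_eq)

text \<open>The universal property of the tensor product for the bilinear map that sends
  \<open>a\<close> and \<open>q\<close> to \<open>l a * q\<close>: its extension to the free group
  vanishes on \<open>tensor_relations\<close>.\<close>

lemma tensor_lift:
 fixes l :: "'a::ab_group_add => rat"
 assumes l: "\<And>x y. l (x + y) = l x + l y"
 obtains L :: "'a tensor_rat => rat" where "\<And>s t. L (s + t) = L s + L t" "\<And>a q. L (tensor a q) = l a * q"
proof -
 define g where "g k c = of_int c * (l (fst k) * snd k)" for k :: "'a \<times> rat" and c :: int
 define S where "S s = (\<Sum>k\<in>Poly_Mapping.keys s. g k (Poly_Mapping.lookup s k))" for s
 have Sadd: "S (s + t) = S s + S t" for s t
  unfolding S_def by (rule sum_keys_add) (simp_all add: g_def algebra_simps)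
 have S0: "S 0 = 0" by (simp add: S_def)
 have Sdiff: "S (s - t) = S s - S t" for s t
  using Sadd[of "s - t" t] by simp
 have Ssym: "S (tensor_symbol a q) = l a * q" for a q
  by (simp add: S_def tensor_symbol_def g_def)
 have Srel: "s \<in> tensor_relations ==> S s = 0" for s
  by (induction rule: tensor_relations.induct) (simp_all only: S0 Sdiff Ssym l, simp_all add: algebra_simps)
 have cong: "S s = S t" if "tensor_cong s t" for s t
  using Srel[of "s - t"] that by (simp add: tensor_cong_def Sdiff)
 define L where "L t = S (rep_tensor_rat t)" for t
 have L: "L (abs_tensor_rat s) = S s" for s
  unfolding L_def by (rule cong)
   (metis Quotient_tensor_rat Quotient_rep_abs Quotient_abs_rep Quotient_rel_rep tensor_rat.abs_eq_iff)
 have aa: "\<exists>s. t = abs_tensor_rat s" for t :: "'a tensor_rat"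
  by (metis Quotient_tensor_rat Quotient_abs_rep)
 show ?thesis
 proof
  show "L (s + t) = L s + L t" for s t
  proof -
   obtain s' t' where st: "s = abs_tensor_rat s'" "t = abs_tensor_rat t'" using aa by blast
   show ?thesis unfolding st plus_tensor_rat.abs_eq L Sadd by (rule HOL.refl)
  qed
  show "L (tensor a q) = l a * q" for a q
   unfolding tensor.abs_eq L Ssym by (rule HOL.refl)
 qed
qed

section \<open>The ring \<open>Sym\<close>\<close>

text \<open>The functional ensures that \<open>0 \<noteq> 1\<close> in \<open>Sym\<close>.\<close>

class rat_group = nat_monoid + ab_group_add +
 assumes ex_functional: "\<exists>L :: 'a => rat. (\<forall>s t. L (s + t) = L s + L t) \<and> L (nat_hom 1) = 1"

lemma Sym_of_add: "Sym_of (g + h) = Sym_of g + Sym_of h"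
 by transfer (rule sym_cong.sym[OF sym_cong.symbol_add])

lemma Sym_of_0 [simp]: "Sym_of 0 = 0"
 by transfer (rule sym_cong.symbol_0)

lemma Sym_of_nat_hom_1: "Sym_of (nat_hom 1) = 1"
 by transfer (rule sym_cong.symbol_1)

text \<open>Evaluating each symbol by \<open>L\<close> respects the generating relations of
  \<open>sym_cong\<close>, so the evaluation descends to the quotient.\<close>

lemma Sym_lift:
 fixes L :: "'g::nat_monoid => rat"
 assumes add: "\<And>s t. L (s + t) = L s + L t" and one: "L (nat_hom 1) = 1"
 obtains H :: "'g Sym => rat" where "\<And>x y. H (x + y) = H x + H y" "\<And>x y. H (x * y) = H x * H y"
  "H 0 = 0" "H 1 = 1" "\<And>g. H (Sym_of g) = L g"
proof -
 define E where "E = mpoly_eval (of_nat :: nat => rat) L"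
 interpret coeff_hom "of_nat :: nat => rat" by unfold_locales auto
 have sym: "E (symbol g) = L g" for g
  unfolding E_def symbol_def by (rule eval_var)
 have E_add: "E (f + g) = E f + E g" and E_mult: "E (f * g) = E f * E g" and E_0: "E 0 = 0" and E_1: "E 1 = 1" for f g
  by (simp_all add: E_def eval_add eval_mult eval_0 eval_1)
 have L0: "L 0 = 0" using assms(1)[of 0 0] by simp
 have cong: "sym_cong f g ==> E f = E g" for f g
  by (induction rule: sym_cong.induct)
   (simp_all add: E_add E_mult E_0 E_1 sym assms assms(2)[unfolded One_nat_def] L0)
 define H where "H x = E (rep_Sym x)" for x
 have H: "H (abs_Sym f) = E f" for f
  unfolding H_def by (rule cong) (metis Quotient_Sym Quotient_abs_rep Sym.abs_eq_iff)
 have aa: "\<exists>f. x = abs_Sym f" for x :: "'g Sym"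
  by (metis Quotient_Sym Quotient_abs_rep)
 show ?thesis
 proof
  show "H (x + y) = H x + H y" "H (x * y) = H x * H y" for x y
  proof -
   obtain f g where fg: "x = abs_Sym f" "y = abs_Sym g" using aa by blast
   show "H (x + y) = H x + H y"
    unfolding fg plus_Sym.abs_eq H by (simp add: E_def eval_add)
   show "H (x * y) = H x * H y"
    unfolding fg times_Sym.abs_eq H by (simp add: E_def eval_mult)
  qed
  show "H 0 = 0" "H 1 = 1"
   unfolding zero_Sym.abs_eq one_Sym.abs_eq H by (simp_all add: E_def eval_0 eval_1)
  show "H (Sym_of g) = L g" for g
   unfolding Sym_of.abs_eq H sym by (rule HOL.refl)
 qed
qed

text \<open>Additive inverses come from the group of symbols: \<open>[- s(1)]\<close> serves as -1.
  Differences are what turns equality of two polynomial values into a vanishing statement.\<close>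

instantiation Sym :: (rat_group) comm_ring_1
begin

definition uminus_Sym :: "'a Sym => 'a Sym" where "uminus_Sym x = Sym_of (- nat_hom 1) * x"
definition minus_Sym :: "'a Sym => 'a Sym => 'a Sym" where "minus_Sym x y = x + - y"

instance
proof
 fix x y :: "'a Sym"
 show "x - y = x + - y" by (rule minus_Sym_def)
 have "Sym_of (- nat_hom 1) + 1 = (0 :: 'a Sym)"
  by (simp flip: Sym_of_nat_hom_1 Sym_of_add)
 then have "(Sym_of (- nat_hom 1) + 1) * x = 0" by simp
 then show "- x + x = 0" by (simp add: uminus_Sym_def distrib_right)
 show "(0 :: 'a Sym) \<noteq> 1"
 proof -
  obtain L :: "'a => rat" where L: "\<forall>s t. L (s + t) = L s + L t" "L (nat_hom 1) = 1"
   using ex_functional by blast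
  show ?thesis
  proof (rule Sym_lift[where L = L])
   show "L (s + t) = L s + L t" for s t using L(1) by (elim allE)
   show "L (nat_hom 1) = 1" by (rule L(2))
   fix H :: "'a Sym => rat" assume "H 0 = 0" "H 1 = 1"
   then show "(0 :: 'a Sym) \<noteq> 1" by (metis zero_neq_one)
  qed
 qed
qed

end

text \<open>Values on an independent set may be prescribed; the requirement at \<open>zone\<close>
  matches the relation that identifies the symbol of \<open>nat_hom 1\<close> with 1.\<close>

lemma tensor_functional:
 fixes E :: "'a::zgroup set"
 assumes "finite E" "indep E" "zone \<in> E" "q zone = 1"
 shows "\<exists>L :: 'a tensor_rat => rat. (\<forall>s t. L (s + t) = L s + L t) \<and> L (nat_hom 1) = 1 \<and>
  (\<forall>e\<in>E. L (tensor e 1) = q e)"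
proof -
 obtain l :: "'a => rat" where l: "\<And>x y. l (x + y) = l x + l y" "\<And>e. e \<in> E ==> l e = q e"
  using additive_extension[OF assms(1,2), of q] by blast
 obtain L :: "'a tensor_rat => rat" where L: "\<And>s t. L (s + t) = L s + L t" "\<And>a q. L (tensor a q) = l a * q"
  using tensor_lift[OF l(1)] by blast
 show ?thesis
  by (rule exI[of _ L]) (use assms in "simp add: L l nat_hom_tensor_rat_def")
qed

instance tensor_rat :: (zgroup) rat_group
proof
 have "indep {zone :: 'a}" unfolding indep_def using zone_pos[where 'a = 'a] by (auto simp: zsc_eq_0)
 from tensor_functional[OF _ this, of "\<lambda>_. 1"]
 obtain L :: "'a tensor_rat => rat" where "\<forall>s t. L (s + t) = L s + L t" "L (nat_hom 1) = 1"
  by (elim meta_impE exE conjE) simp_all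
 then show "\<exists>L :: 'a tensor_rat => rat. (\<forall>s t. L (s + t) = L s + L t) \<and> L (nat_hom 1) = 1"
  by (intro exI conjI)
qed

text \<open>Provides the homomorphisms by which polynomial expressions in \<open>Sym\<close> are
  evaluated at arbitrary values of the basis elements.\<close>

lemma Sym_functional:
 fixes E :: "'a::zgroup set"
 assumes "finite E" "indep E" "zone \<in> E" "q zone = 1"
 obtains H :: "'a tensor_rat Sym => rat" where "\<And>x y. H (x + y) = H x + H y" "\<And>x y. H (x * y) = H x * H y"
  "H 0 = 0" "H 1 = 1" "\<And>e. e \<in> E ==> H (Sym_elem e) = q e"
proof -
 obtain L :: "'a tensor_rat => rat" where L: "\<forall>s t. L (s + t) = L s + L t" "L (nat_hom 1) = 1"
  "\<forall>e\<in>E. L (tensor e 1) = q e"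
  using tensor_functional[where q = q, OF assms] by (elim exE conjE) (rule that)
 show thesis
 proof (rule Sym_lift[where L = L])
  show "L (s + t) = L s + L t" for s t using L(1) by (elim allE)
  show "L (nat_hom 1) = 1" by (rule L(2))
  fix H :: "'a tensor_rat Sym => rat"
  assume H: "\<And>x y. H (x + y) = H x + H y" "\<And>x y. H (x * y) = H x * H y" "H 0 = 0" "H 1 = 1"
   "\<And>g. H (Sym_of g) = L g"
  show thesis
  proof (rule that[of H])
   show "H (Sym_elem e) = q e" if "e \<in> E" for e
    unfolding Sym_elem_def H(5) by (rule bspec[OF L(3) \<open>e \<in> E\<close>])
  qed (rule H(1) H(2) H(3) H(4))+
 qed
qed

lemma Sym_elem_add: "Sym_elem (a + b) = Sym_elem a + Sym_elem b"
 by (simp add: Sym_elem_def tensor_add_left Sym_of_add)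

lemma Sym_elem_0 [simp]: "Sym_elem 0 = 0"
 using Sym_elem_add[of 0 0] by simp

lemma Sym_elem_minus: "Sym_elem (- a) = - Sym_elem a"
 using Sym_elem_add[of a "- a"] by (simp add: eq_neg_iff_add_eq_0 add.commute)

lemma Sym_elem_zsc: "Sym_elem (k \<cdot> a) = of_int k * Sym_elem a"
proof (induction k rule: int_induct[where k = 0])
 case (step2 i)
 have "Sym_elem ((i - 1) \<cdot> a) + Sym_elem a = Sym_elem (i \<cdot> a)"
  by (simp add: zsc_diff_left flip: Sym_elem_add)
 then have "Sym_elem ((i - 1) \<cdot> a) = of_int i * Sym_elem a - Sym_elem a"
  unfolding step2(2) by (simp add: eq_diff_eq)
 then show ?case by (simp only: of_int_diff of_int_1 left_diff_distrib mult_1)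
next
 case (step1 i)
 then show ?case
  by (simp only: zsc_add_left Sym_elem_add zsc_1_left of_int_add of_int_1 distrib_right mult_1)
next
 case base
 then show ?case by (simp only: zsc_0_left Sym_elem_0 of_int_0 mult_zero_left)
qed

lemma Sym_elem_zone [simp]: "Sym_elem (zone :: 'a::zgroup) = 1"
 using Sym_of_nat_hom_1[where 'a = "'a tensor_rat"] by (simp add: Sym_elem_def nat_hom_tensor_rat_def)

lemma Sym_elem_of_Z [simp]: "Sym_elem (of_Z c) = of_int c"
 by (subst of_Z_zsc) (simp only: Sym_elem_zsc Sym_elem_zone mult_1_right)

lemma Sym_rat_1: "Sym_rat 1 = (1 :: 'a::zgroup tensor_rat Sym)"
 using Sym_elem_zone[where 'a = 'a] by (simp add: Sym_elem_def Sym_rat_def)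

lemma Sym_rat_add: "Sym_rat (q + r) = Sym_rat q + Sym_rat r"
 by (simp add: Sym_rat_def tensor_add_right Sym_of_add)

lemma Sym_rat_0: "Sym_rat 0 = 0"
 using Sym_rat_add[of 0 0] by simp

lemma Sym_rat_int_mult: "Sym_rat (of_int k * q) = of_int k * (Sym_rat q :: 'a::zgroup tensor_rat Sym)"
proof (induction k rule: int_induct[where k = 0])
 case (step2 i)
 have "Sym_rat (of_int (i - 1) * q) + Sym_rat q = (Sym_rat (of_int i * q) :: 'a tensor_rat Sym)"
  by (simp add: algebra_simps flip: Sym_rat_add)
 then have "Sym_rat (of_int (i - 1) * q) = (Sym_rat (of_int i * q) :: 'a tensor_rat Sym) - Sym_rat q" by (simp only: eq_diff_eq)
 also have "\<dots> = of_int (i - 1) * Sym_rat q"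
  unfolding step2(2) by (simp only: of_int_diff of_int_1 left_diff_distrib mult_1)
 finally show ?case .
next
 case (step1 i)
 then show ?case by (simp only: Sym_rat_add of_int_add of_int_1 distrib_right mult_1)
qed (simp add: Sym_rat_0)

lemma Sym_rat_of_int [simp]: "Sym_rat (of_int k) = of_int k"
 using Sym_rat_int_mult[of k 1] by (simp add: Sym_rat_1)

lemma Sym_rat_inverse: "k \<noteq> 0 ==> Sym_rat (1 / of_int k) * of_int k = 1"
 using Sym_rat_int_mult[of k "1 / of_int k"] by (simp add: Sym_rat_1 mult.commute)

text \<open>Nonzero integers are invertible in \<open>Sym\<close>, the inverses being images of
  rationals. This takes the place of a domain property in arguments on zeros of polynomials.\<close>

lemma Sym_int_cancel:
 fixes u v :: "'a::zgroup tensor_rat Sym"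
 assumes "of_int k * u = of_int k * v" "k \<noteq> 0" shows "u = v"
proof -
 have "Sym_rat (1 / of_int k) * (of_int k * u) = Sym_rat (1 / of_int k) * (of_int k * v)"
  using assms(1) by simp
 then show ?thesis by (simp add: Sym_rat_inverse[OF assms(2)] flip: mult.assoc)
qed

text \<open>\<open>Sym_rat\<close> is additive by the relations of \<open>Sym\<close>, but these say
  nothing on products. Multiplicativity follows after clearing the denominator of \<open>q\<close>,
  since \<open>Sym_rat\<close> respects integer multiples.\<close>

lemma Sym_rat_mult: "Sym_rat (q * r) = Sym_rat q * (Sym_rat r :: 'a::zgroup tensor_rat Sym)"
proof -
 obtain a b where q: "q = Fract a b" "b > 0" by (rule Rat_cases)
 have bq: "of_int b * q = of_int a" using q by (simp add: Fract_of_int_quotient)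
 have "of_int b * Sym_rat (q * r) = Sym_rat ((of_int b * q) * r)"
  by (simp add: Sym_rat_int_mult mult.assoc)
 also have "\<dots> = of_int a * (Sym_rat r :: 'a tensor_rat Sym)" unfolding bq by (rule Sym_rat_int_mult)
 also have "\<dots> = Sym_rat (of_int b * q) * Sym_rat r" unfolding bq by simp
 also have "\<dots> = of_int b * (Sym_rat q * Sym_rat r)" by (simp add: Sym_rat_int_mult mult.assoc)
 finally show ?thesis by (rule Sym_int_cancel) (use q in simp)
qed

interpretation Sym_rat: coeff_hom "Sym_rat :: rat => 'a::zgroup tensor_rat Sym"
 by unfold_locales (simp_all add: Sym_rat_0 Sym_rat_1 Sym_rat_add Sym_rat_mult)

interpretation rat_id: coeff_hom "id :: rat => rat"
 by unfold_locales simp_all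

section \<open>Elementary substructures\<close>

text \<open>The Tarski-Vaught criterion for an elementary substructure, in terms of points of
  definable sets.\<close>

definition esub :: "'a::linordered_ab_group_add set => bool" where
 "esub Z \<longleftrightarrow> (\<forall>n X. definable_over Z n X --> X \<noteq> {} --> (\<exists>x\<in>X. set x \<subseteq> Z))"

lemma sat_foldr_Exists:
 "sat A v (foldr Exists xs p) \<longleftrightarrow>
  (\<exists>w. (\<forall>i. i \<notin> set xs --> w i = v i) \<and> (\<forall>i\<in>set xs. w i \<in> A) \<and> sat A w p)"
proof (induction xs arbitrary: v)
 case Nil
 have "w = v" if "\<forall>i. w i = v i" for w using that by (simp add: fun_eq_iff)
 then show ?case by auto
next
 case (Cons j xs)
 show ?case
 proof
  assume "sat A v (foldr Exists (j # xs) p)"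
  then obtain a where a: "a \<in> A" "sat A (v(j := a)) (foldr Exists xs p)" by auto
  from a(2)[unfolded Cons.IH] obtain w where
   w: "\<forall>i. i \<notin> set xs --> w i = (v(j := a)) i" "\<forall>i\<in>set xs. w i \<in> A" "sat A w p" by (elim exE conjE)
  show "\<exists>w. (\<forall>i. i \<notin> set (j # xs) --> w i = v i) \<and> (\<forall>i\<in>set (j # xs). w i \<in> A) \<and> sat A w p"
   using w a(1) by (intro exI[of _ w]) (cases "j \<in> set xs"; auto)
 next
  assume "\<exists>w. (\<forall>i. i \<notin> set (j # xs) --> w i = v i) \<and> (\<forall>i\<in>set (j # xs). w i \<in> A) \<and> sat A w p"
  then obtain w where w: "\<forall>i. i \<notin> set (j # xs) --> w i = v i" "\<forall>i\<in>set (j # xs). w i \<in> A" "sat A w p"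
   by (elim exE conjE)
  have "sat A (v(j := w j)) (foldr Exists xs p)"
   unfolding Cons.IH by (intro exI[of _ w]) (use w in auto)
  then show "sat A v (foldr Exists (j # xs) p)" using w(2) by auto
 qed
qed

text \<open>The existential closure of the defining formula is transferred down to \<open>A\<close>,
  witnesses are taken there, and the formula is transferred up again.\<close>

lemma esub_elementary:
 fixes A :: "'b::linordered_ab_group_add set" and h :: "'b => 'a::linordered_ab_group_add"
 assumes e: "elementary_embedding A UNIV h"
 shows "esub (h ` A)"
 unfolding esub_def
proof (intro allI impI)
 fix n and X :: "'a list set"
 assume "definable_over (h ` A) n X" "X \<noteq> {}"
 then obtain p b where pb: "set b \<subseteq> h ` A" "fv p \<subseteq> {..<n + length b}" "X = solutions n p b"
  unfolding definable_over_def by blast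
 obtain x where x: "length x = n" "sat UNIV (assignment (x @ b)) p"
  using \<open>X \<noteq> {}\<close> unfolding pb(3) solutions_def by auto
 obtain c where c: "set c \<subseteq> A" "b = map h c"
 proof -
  have "\<forall>a\<in>set b. \<exists>c. c \<in> A \<and> a = h c" using pb(1) by blast
  then obtain g where g: "\<forall>a\<in>set b. g a \<in> A \<and> a = h (g a)" by (rule bchoice[THEN exE])
  have "map h (map g b) = b" unfolding map_map by (rule map_idI) (use g in simp)
  then show ?thesis using that[of "map g b"] g by auto
 qed
 \<comment> \<open>The first \<open>n\<close> entries are placeholders that the quantifiers
   overwrite; 0 is taken because it belongs to \<open>A\<close>.\<close>
 define v where "v = assignment (replicate n 0 @ c)"
 have 0: "0 \<in> A" using e by (simp add: elementary_embedding_def substructure_def)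
 have vA: "v i \<in> A" for i
 proof (cases "i < n + length c")
  case True
  then have "(replicate n 0 @ c) ! i \<in> A" using c(1) 0 by (auto simp: nth_append)
  then show ?thesis using True by (simp add: v_def assignment_def)
 next
  case False
  then show ?thesis using 0 by (simp add: v_def assignment_def)
 qed
 have hv: "h (v i) = assignment (y @ b) i" if "n \<le> i" "i < n + length b" "length y = n" for i y
  using that by (simp add: v_def assignment_def c(2) nth_append)
 let ?q = "foldr Exists [0..<n] p"
 have "sat UNIV (h \<circ> v) ?q"
  unfolding sat_foldr_Exists
 proof (intro exI[of _ "\<lambda>i. if i < n then x ! i else h (v i)"] conjI allI impI ballI)
  show "sat UNIV (\<lambda>i. if i < n then x ! i else h (v i)) p"
  proof (rule iffD1[OF sat_cong x(2)])
   fix i assume "i \<in> fv p"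
   then have "i < n + length b" using pb(2) by auto
   then show "assignment (x @ b) i = (if i < n then x ! i else h (v i))"
    using hv[of i x] x(1) by (auto simp: assignment_def nth_append)
  qed
 qed auto
 then have "sat A v ?q" using e vA unfolding elementary_embedding_def by blast
 from this[unfolded sat_foldr_Exists] obtain w where
  w: "\<forall>i. i \<notin> set [0..<n] --> w i = v i" "\<forall>i\<in>set [0..<n]. w i \<in> A" "sat A w p" by (elim exE conjE)
 have "w i \<in> A" for i using w vA by (cases "i < n") auto
 then have s: "sat UNIV (h \<circ> w) p" using e w(3) unfolding elementary_embedding_def by blast
 let ?x = "map (\<lambda>i. h (w i)) [0..<n]"
 have "sat UNIV (assignment (?x @ b)) p"
 proof (rule iffD1[OF sat_cong s])
  fix i assume "i \<in> fv p"
  then have "i < n + length b" using pb(2) by auto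
  then show "(h \<circ> w) i = assignment (?x @ b) i"
   using hv[of i ?x] w(1) by (cases "i < n") (auto simp: assignment_def nth_append)
 qed
 then have "?x \<in> X" unfolding pb(3) solutions_def by simp
 moreover have "set ?x \<subseteq> h ` A" using w(2) by auto
 ultimately show "\<exists>x\<in>X. set x \<subseteq> h ` A" by blast
qed

lemma esub_std: "esub (range (of_Z :: int => 'a::zgroup))"
 using esub_elementary[OF elementary_of_Z] .

lemma esub_obtain:
 assumes "esub Z" "Def Z (\<lambda>v. P (map v [0..<n]))" "length x = n" "P x"
 obtains x' where "length x' = n" "P x'" "set x' \<subseteq> Z"
 using assms(1)[unfolded esub_def, THEN spec, THEN spec, THEN mp, THEN mp, OF definableI[OF assms(2)]] assms(3,4)
 by blast

lemma esub_shift: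
 assumes "esub Z" "x \<in> Z" shows "x + k \<cdot> (zone :: 'a::zgroup) \<in> Z"
proof -
 have "Def Z (\<lambda>v. map v [0..<1] ! 0 = x + k \<cdot> zone)"
  using Def_eq[OF Dfn_var[of Z 0] Dfn_plus[OF Dfn_const[OF assms(2)] Dfn_zsc[OF Dfn_zone]], of k] by simp
 then obtain x' where "length x' = 1" "x' ! 0 = x + k \<cdot> zone" "set x' \<subseteq> Z"
  by (rule esub_obtain[where P = "\<lambda>l. l ! 0 = x + k \<cdot> zone" and x = "[x + k \<cdot> zone]", OF assms(1)]) auto
 then show ?thesis using nth_mem[of 0 x'] by auto
qed

section \<open>Polynomial functions on definable sets\<close>

text \<open>Polynomial functions with arbitrary coefficients in the ring: the substitution of terms
  over \<open>Z\<close> introduces coefficients in \<open>Sym\<close> that need not be rational.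
  Functions are easier to substitute into than formal polynomials.\<close>

inductive PF :: "nat => ((nat => 'r::comm_ring_1) => 'r) => bool" for k where
 const: "PF k (\<lambda>v. c)"
| var: "i < k ==> PF k (\<lambda>v. v i)"
| add: "PF k f ==> PF k g ==> PF k (\<lambda>v. f v + g v)"
| mult: "PF k f ==> PF k g ==> PF k (\<lambda>v. f v * g v)"

lemma PF_sum: "(\<And>i. i \<in> I ==> PF k (f i)) ==> PF k (\<lambda>v. \<Sum>i\<in>I. f i v)"
 by (induction I rule: infinite_finite_induct) (auto intro: PF.const PF.add)

lemma PF_prod: "(\<And>i. i \<in> I ==> PF k (f i)) ==> PF k (\<lambda>v. \<Prod>i\<in>I. f i v)"
 by (induction I rule: infinite_finite_induct) (auto intro: PF.const PF.mult)

lemma PF_power: "PF k f ==> PF k (\<lambda>v. f v ^ d)"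
 by (induction d) (auto intro: PF.const PF.mult)

lemma PF_diff: "PF k f ==> PF k g ==> PF k (\<lambda>v. f v - g v)"
 using PF.add[OF _ PF.mult[OF PF.const], of k f g "- 1"] by simp

lemma PF_local: "PF k g ==> (\<And>i. i < k ==> v i = w i) ==> g v = g w"
 by (induction rule: PF.induct) auto

lemma PF_reindex: "PF k g ==> (\<And>i. i < k ==> r i < l) ==> PF l (\<lambda>v. g (\<lambda>i. v (r i)))"
 by (induction rule: PF.induct) (auto intro: PF.intros)

lemma PF_subst: "PF (Suc k) g ==> PF k h ==> PF k (\<lambda>v. g (v(k := h v)))"
proof (induction rule: PF.induct)
 case (var i)
 then show ?case by (cases "i = k") (auto intro: PF.var)
qed (auto intro: PF.intros)

text \<open>\<open>P\<close> is a function of the whole assignment, but its coefficients are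
  polynomial functions of the first \<open>k\<close> variables and hence ignore the last one. The
  bound \<open>d\<close> on the degree is uniform.\<close>

lemma PF_last:
 "PF (Suc k) g ==> \<exists>P d. (\<forall>i. PF k (\<lambda>v. coeff (P v) i)) \<and> (\<forall>v. degree (P v) \<le> d \<and> g v = poly (P v) (v k))"
proof (induction rule: PF.induct)
 case (const c)
 show ?case by (intro exI[of _ "\<lambda>v. [:c:]"] exI[of _ 0] conjI allI PF.const) simp_all
next
 case (var i)
 show ?case
 proof (cases "i = k")
  case True
  show ?thesis
   by (intro exI[of _ "\<lambda>v. [:0, 1:]"] exI[of _ 1] conjI allI PF.const) (simp_all add: True)
 next
  case False
  have "PF k (\<lambda>v. coeff [:v i:] j)" for j
   using var False by (cases j) (auto simp: coeff_pCons intro: PF.intros)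
  then show ?thesis by (intro exI[of _ "\<lambda>v. [:v i:]"] exI[of _ 0] conjI allI) simp_all
 qed
next
 case (add f g)
 from add.IH(1) obtain P d where P: "\<forall>i. PF k (\<lambda>v. coeff (P v) i)"
  "\<forall>v. degree (P v) \<le> d \<and> f v = poly (P v) (v k)" by (elim exE conjE)
 from add.IH(2) obtain Q e where Q: "\<forall>i. PF k (\<lambda>v. coeff (Q v) i)"
  "\<forall>v. degree (Q v) \<le> e \<and> g v = poly (Q v) (v k)" by (elim exE conjE)
 have "PF k (\<lambda>v. coeff (P v + Q v) i)" for i
  unfolding coeff_add by (rule PF.add[OF P(1)[rule_format] Q(1)[rule_format]])
 moreover have "degree (P v + Q v) \<le> max d e" for v
  using P(2) Q(2) by (meson degree_add_le le_max_iff_disj)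
 ultimately show ?case
  using P(2) Q(2) by (intro exI[of _ "\<lambda>v. P v + Q v"] exI[of _ "max d e"]) simp
next
 case (mult f g)
 from mult.IH(1) obtain P d where P: "\<forall>i. PF k (\<lambda>v. coeff (P v) i)"
  "\<forall>v. degree (P v) \<le> d \<and> f v = poly (P v) (v k)" by (elim exE conjE)
 from mult.IH(2) obtain Q e where Q: "\<forall>i. PF k (\<lambda>v. coeff (Q v) i)"
  "\<forall>v. degree (Q v) \<le> e \<and> g v = poly (Q v) (v k)" by (elim exE conjE)
 have "PF k (\<lambda>v. coeff (P v * Q v) i)" for i
  unfolding coeff_mult by (rule PF_sum, rule PF.mult[OF P(1)[rule_format] Q(1)[rule_format]])
 moreover have "degree (P v * Q v) \<le> d + e" for v
  using P(2) Q(2) by (meson degree_mult_le add_mono le_trans)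
 ultimately show ?case
  using P(2) Q(2) by (intro exI[of _ "\<lambda>v. P v * Q v"] exI[of _ "d + e"]) simp
qed

text \<open>Division by linear factors works over any commutative ring; that a difference of two of
  the points is not a zero divisor replaces the assumption of a domain.\<close>

lemma poly_many_zeros:
 fixes x :: "nat => 'r::comm_ring_1"
 assumes "\<And>i j a. i < j ==> j \<le> m ==> (x i - x j) * a = 0 ==> a = 0"
  and "degree P \<le> m" "\<And>i. i \<le> m ==> poly P (x i) = 0"
 shows "P = 0"
 using assms
proof (induction m arbitrary: P)
 case 0
 then obtain c where "P = [:c:]" using degree_eq_zeroE by blast
 then show ?case using 0(3)[of 0] by simp
next
 case (Suc m)
 let ?a = "x (Suc m)" let ?Q = "synthetic_div P ?a"
 have P: "P = [:- ?a, 1:] * ?Q"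
  using synthetic_div_correct'[of ?a P] Suc.prems(3)[of "Suc m"] by simp
 have "?Q = 0"
 proof (rule Suc.IH)
  show "degree ?Q \<le> m" using Suc.prems(2) by (simp add: degree_synthetic_div)
  show "poly ?Q (x i) = 0" if "i \<le> m" for i
  proof (rule Suc.prems(1)[of i "Suc m"])
   have "poly ([:- ?a, 1:] * ?Q) (x i) = 0" using Suc.prems(3)[of i] P that by simp
   then show "(x i - ?a) * poly ?Q (x i) = 0" by (simp add: algebra_simps)
  qed (use that in auto)
 qed (use Suc.prems(1) in auto)
 then show ?case using P by simp
qed

abbreviation symv :: "'a::zgroup list => nat => 'a tensor_rat Sym" where
 "symv y \<equiv> \<lambda>i. Sym_elem (y ! i)"

lemma PF_snoc:
 assumes "PF (Suc k) g" "length y = k" shows "g (symv (y @ [x])) = g ((symv y)(k := Sym_elem x))"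
 by (rule PF_local[OF assms(1)]) (use assms(2) in \<open>auto simp: nth_append\<close>)

text \<open>An element of the group over \<open>Z\<close> and \<open>y\<close> is made a function of
  \<open>y\<close> in two matching forms: a definable term \<open>T\<close> in the model and a
  polynomial function \<open>h\<close> in \<open>Sym\<close>.\<close>

lemma grp_linear_term:
 fixes y :: "'a::zgroup list"
 assumes "a \<in> grp (Z \<union> set y)"
 shows "\<exists>T h. T y = a \<and> Dfn Z (\<lambda>v. T (map v [0..<length y])) \<and> PF (length y) h \<and>
  (\<forall>y'. length y' = length y --> h (symv y') = Sym_elem (T y'))"
 using assms
proof (induction rule: grp.induct)
 case grp_zero
 show ?case
  by (rule exI[of _ "\<lambda>_. 0"], rule exI[of _ "\<lambda>_. 0"]) (auto intro: Dfn_zero PF.const)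
next
 case grp_zone
 show ?case
  by (rule exI[of _ "\<lambda>_. zone"], rule exI[of _ "\<lambda>_. 1"]) (auto intro: Dfn_zone PF.const)
next
 case (grp_base a)
 show ?case
 proof (cases "a \<in> Z")
  case True
  then show ?thesis
   by (intro exI[of _ "\<lambda>_. a"] exI[of _ "\<lambda>_. Sym_elem a"]) (auto intro: Dfn_const PF.const)
 next
  case False
  then obtain j where j: "j < length y" "a = y ! j" using grp_base by (auto simp: in_set_conv_nth)
  show ?thesis
   by (rule exI[of _ "\<lambda>y. y ! j"], rule exI[of _ "\<lambda>v. v j"]) (use j in "auto intro: Dfn_var PF.var")
 qed
next
 case (grp_add a b)
 from grp_add.IH(1) obtain T h where T: "T y = a" "Dfn Z (\<lambda>v. T (map v [0..<length y]))" "PF (length y) h"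
  "\<forall>y'. length y' = length y --> h (symv y') = Sym_elem (T y')" by (elim exE conjE)
 from grp_add.IH(2) obtain U f where U: "U y = b" "Dfn Z (\<lambda>v. U (map v [0..<length y]))" "PF (length y) f"
  "\<forall>y'. length y' = length y --> f (symv y') = Sym_elem (U y')" by (elim exE conjE)
 show ?case
  by (rule exI[of _ "\<lambda>y. T y + U y"], rule exI[of _ "\<lambda>v. h v + f v"])
   (use T U in "auto intro: Dfn_plus PF.add simp: Sym_elem_add")
next
 case (grp_minus a)
 from grp_minus.IH obtain T h where T: "T y = a" "Dfn Z (\<lambda>v. T (map v [0..<length y]))" "PF (length y) h"
  "\<forall>y'. length y' = length y --> h (symv y') = Sym_elem (T y')" by (elim exE conjE)
 have "PF (length y) (\<lambda>v. 0 - h v)" by (rule PF_diff[OF PF.const T(3)])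
 then show ?case
  by (intro exI[of _ "\<lambda>y. - T y"] exI[of _ "\<lambda>v. 0 - h v"])
   (use T in "auto intro: Dfn_minus simp: Sym_elem_minus")
qed

lemma Dfnl_snoc: "Dfn A t ==> Dfnl A n l ==> Dfnl A (Suc n) (\<lambda>v. l v @ [t v])"
 using Dfnl_append[OF _ Dfnl_Cons[OF _ Dfnl_Nil], of A n l t] by simp

text \<open>By induction on the number of variables: the last coordinate of a point is either rational over
 the parameters and the other coordinates, and can be substituted, or it can be shifted by the
 multiples of an integer within the fibre, so that the coefficients with respect to it vanish.\<close>

lemma PF_vanish:
 fixes Z :: "'a::zgroup set"
 assumes Z: "esub Z"
 shows "PF k g ==> definable_over Z k E ==> (\<And>y. y \<in> E ==> set y \<subseteq> Z ==> g (symv y) = 0) ==> y \<in> E ==>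
  g (symv y) = 0"
proof (induction k arbitrary: g E y)
 case 0
 then have "y = []" using definable_length by blast
 then show ?case using 0(3)[OF 0(4)] by simp
next
 case (Suc k)
 note g = Suc.prems(1) and E = Suc.prems(2) and van = Suc.prems(3)
 have ly: "length y = Suc k" using definable_length[OF E Suc.prems(4)] .
 define b x where "b = butlast y" and "x = last y"
 have y: "y = b @ [x]" and lb: "length b = k"
  using ly by (auto simp: b_def x_def append_butlast_last_id[of y] simp flip: length_greater_0_conv)
 have bxE: "b @ [x] \<in> E" using Suc.prems(4) y by simp
 show ?case
 proof (cases "x \<in> zhull (Z \<union> set b)")
  \<comment> \<open>Here \<open>N \<cdot> x\<close> equals a term \<open>T b\<close>. Division by
    \<open>N\<close> is possible in \<open>Sym\<close>, so the last variable can be eliminated from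
    \<open>g\<close>.\<close>
  case True
  then obtain N where N: "0 < N" "N \<cdot> x \<in> grp (Z \<union> set b)" by (auto simp: zhull_def)
  from grp_linear_term[OF N(2)] obtain T h where T: "T b = N \<cdot> x" "Dfn Z (\<lambda>v. T (map v [0..<length b]))"
   "PF (length b) h" "\<forall>y'. length y' = length b --> h (symv y') = Sym_elem (T y')" by (elim exE conjE)
  note T = T[unfolded lb]
  let ?r = "Sym_rat (1 / of_int N) :: 'a tensor_rat Sym"
  have root: "Sym_elem x' = ?r * h (symv c)" if "length c = k" "N \<cdot> x' = T c" for c x'
  proof -
   have "?r * h (symv c) = ?r * of_int N * Sym_elem x'"
    using that T(4) by (simp add: Sym_elem_zsc flip: that(2) mult.assoc)
   also have "?r * of_int N = 1" using Sym_rat_inverse[of N] N(1) by simp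
   finally show ?thesis by simp
  qed
  define g' where "g' = (\<lambda>v. g (v(k := ?r * h v)))"
  define P where "P c z \<longleftrightarrow> N \<cdot> z = T c \<and> c @ [z] \<in> E" for c z
  have g': "g' (symv c) = g (symv (c @ [z]))" if "length c = k" "P c z" for c z
   unfolding g'_def PF_snoc[OF g that(1)] root[OF that(1) conjunct1[OF that(2)[unfolded P_def]]] by (rule HOL.refl)
  have "g' (symv b) = 0"
  proof (rule Suc.IH)
   show "PF k g'" unfolding g'_def by (rule PF_subst[OF g PF.mult[OF PF.const T(3)]])
   have DP: "Def Z (\<lambda>v. P (c v) (t v))" if "Dfnl Z k c" "Dfn Z t" "Dfn Z (\<lambda>v. T (c v))" for c t
    unfolding P_def
    by (intro Def_conj Def_eq Dfn_zsc that Def_mem[OF E Dfnl_snoc[OF that(2,1)]])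
   show "definable_over Z k {c. length c = k \<and> (\<exists>z. P c z)}"
   proof (rule definableI, rule Def_ex)
    have "Dfn Z (\<lambda>w. T (map (\<lambda>j. w (Suc j)) [0..<k]))" by (rule Dfn_reindex[OF T(2)])
    moreover have "Dfnl Z k (\<lambda>w. map (\<lambda>j. w (Suc j)) [0..<k])"
     using Dfnl_reindex[OF Dfnl_vars, of Z k Suc] .
    ultimately show "Def Z (\<lambda>w. P (map (\<lambda>i. w (Suc i)) [0..<k]) (w 0))"
     by (intro DP Dfn_var)
   qed
   show "b \<in> {c. length c = k \<and> (\<exists>z. P c z)}" using lb T(1) bxE by (auto simp: P_def)
   show "g' (symv c) = 0" if c: "c \<in> {c. length c = k \<and> (\<exists>z. P c z)}" "set c \<subseteq> Z" for c
   proof -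
    obtain z where z: "length c = k" "P c z" using c(1) by blast
    have Tc: "Dfn Z (\<lambda>v. T c)"
    proof -
     have "Dfn Z (\<lambda>w. T (map (\<lambda>j. if j < k then c ! j else 0) [0..<k]))"
     proof (rule Dfn_subst[OF T(2), of "\<lambda>j v. if j < k then c ! j else 0"])
      fix j show "Dfn Z (\<lambda>v. if j < k then c ! j else 0)"
       using c(2) z(1) by (cases "j < k") (auto intro!: Dfn_const Dfn_zero)
     qed
     moreover have "map (\<lambda>j. if j < k then c ! j else 0) [0..<k] = c"
      by (rule nth_equalityI) (use z(1) in auto)
     ultimately show ?thesis by simp
    qed
    \<comment> \<open>For \<open>c\<close> with entries in \<open>Z\<close> the last coordinate can
      be found in \<open>Z\<close> too, by elementarity, and there the hypothesis on
      \<open>g\<close> applies.\<close>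
    have "Def Z (\<lambda>v. P c (map v [0..<1] ! 0))"
     using DP[OF Dfnl_const[OF c(2), unfolded z(1)] Dfn_var[of Z 0] Tc] by simp
    then obtain z' where z': "length z' = 1" "P c (z' ! 0)" "set z' \<subseteq> Z"
     by (rule esub_obtain[where P = "\<lambda>l. P c (l ! 0)" and x = "[z]", OF Z]) (use z in auto)
    have "g (symv (c @ [z' ! 0])) = 0"
     by (rule van) (use z' c(2) nth_mem[of 0 z'] in \<open>auto simp: P_def\<close>)
    then show ?thesis using g'[OF z(1) z'(2)] by simp
   qed
  qed
  then show ?thesis using g'[OF lb, of x] T(1) bxE unfolding y by (simp add: P_def)
 next
  case False
  from PF_last[OF g] obtain P d where P: "\<forall>i. PF k (\<lambda>v. coeff (P v) i)"
   "\<forall>v. degree (P v) \<le> d \<and> g v = poly (P v) (v k)" by (elim exE conjE)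
  have PE: "g (symv (c @ [z])) = poly (P (symv c)) (Sym_elem z)" if c: "length c = k" for c z
  proof -
   let ?v = "(symv c)(k := Sym_elem z)"
   have "coeff (P ?v) i = coeff (P (symv c)) i" for i
    by (rule PF_local[OF P(1)[rule_format, of i]]) simp
   then have "P ?v = P (symv c)" by (rule poly_eqI)
   moreover have "g ?v = poly (P ?v) (?v k)" using P(2) by (elim allE conjE)
   ultimately show ?thesis unfolding PF_snoc[OF g c] by (simp only: fun_upd_same)
  qed
  have "Def (Z \<union> set b) (\<lambda>v. v 0 \<in> {z. b @ [z] \<in> E})"
   using Def_mem[OF definable_mono[OF E] Dfnl_snoc[OF Dfn_var[of _ 0] Dfnl_const], of "Z \<union> set b" b] by simp
  then obtain M where M: "0 < M" "\<And>i. x + (i * M) \<cdot> zone \<in> {z. b @ [z] \<in> E}"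
   by (rule definable_translate[OF _ _ False]) (use bxE in auto)
  \<comment> \<open>Membership of \<open>d + 1\<close> shifts gives one more zero than the degree in
    the last variable. The condition is definable in \<open>c\<close> and \<open>z\<close>, so the
    coefficients can be treated by the induction hypothesis.\<close>
  define Q where "Q c z \<longleftrightarrow> (\<forall>i<Suc d. c @ [z + (int i * M) \<cdot> zone] \<in> E)" for c z
  have DQ: "Def Z (\<lambda>v. Q (c v) (t v))" if "Dfnl Z k c" "Dfn Z t" for c t
   unfolding Q_def
   by (intro Def_all_less Def_mem[OF E Dfnl_snoc[OF Dfn_plus[OF that(2) Dfn_zsc[OF Dfn_zone]] that(1)]])
  have zero: "coeff (P (symv b)) i = 0" for i
  proof (rule Suc.IH[OF P(1)[THEN spec]])
   show "definable_over Z k {c. length c = k \<and> (\<exists>z. Q c z)}"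
   proof (rule definableI, rule Def_ex)
    show "Def Z (\<lambda>w. Q (map (\<lambda>i. w (Suc i)) [0..<k]) (w 0))"
     by (rule DQ[OF Dfnl_reindex[OF Dfnl_vars, of Z k Suc] Dfn_var])
   qed
   have "Q b x" unfolding Q_def using M(2) by simp
   then show "b \<in> {c. length c = k \<and> (\<exists>z. Q c z)}" using lb by blast
   show "coeff (P (symv c)) i = 0" if c: "c \<in> {c. length c = k \<and> (\<exists>z. Q c z)}" "set c \<subseteq> Z" for c
   proof -
    obtain z where z: "length c = k" "Q c z" using c(1) by blast
    have "Def Z (\<lambda>v. Q c (map v [0..<1] ! 0))"
     using DQ[OF Dfnl_const[OF c(2), unfolded z(1)] Dfn_var[of Z 0]] by simp
    then obtain z' where z': "length z' = 1" "Q c (z' ! 0)" "set z' \<subseteq> Z"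
     by (rule esub_obtain[where P = "\<lambda>l. Q c (l ! 0)" and x = "[z]", OF Z]) (use z in auto)
    define u where "u = z' ! 0"
    have u: "u \<in> Z" "Q c u" using z' nth_mem[of 0 z'] by (auto simp: u_def)
    have "P (symv c) = 0"
    proof (rule poly_many_zeros)
     show "degree (P (symv c)) \<le> d" using P(2) by (elim allE conjE)
     let ?x = "\<lambda>i. Sym_elem (u + (int i * M) \<cdot> zone)"
     show "poly (P (symv c)) (?x i) = 0" if "i \<le> d" for i
     proof -
      have "g (symv (c @ [u + (int i * M) \<cdot> zone])) = 0"
       by (rule van) (use u that c(2) esub_shift[OF Z u(1)] in \<open>auto simp: Q_def\<close>)
      then show ?thesis using PE[OF z(1)] by simp
     qed
     show "a = 0" if "i < j" "(?x i - ?x j) * a = 0" for i j a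
     proof -
      have "of_int ((int i - int j) * M) * a = of_int ((int i - int j) * M) * 0"
       using that(2) by (simp add: Sym_elem_add Sym_elem_zsc algebra_simps)
      then show ?thesis by (rule Sym_int_cancel) (use \<open>i < j\<close> M(1) in auto)
     qed
    qed
    then show ?thesis by simp
   qed
  qed
  then have "P (symv b) = 0" by (simp add: poly_eq_iff)
  then show ?thesis using PE[OF lb, of x] unfolding y by simp
 qed
qed

section \<open>Hyper-cardinality\<close>

abbreviation std :: "'a::zgroup set" where "std \<equiv> range of_Z"
abbreviation std_tuples :: "'a::zgroup list set" where "std_tuples \<equiv> {x. set x \<subseteq> std}"

text \<open>The data of \<open>is_hypercard\<close> with the formula replaced by a family
  \<open>S\<close> defined without parameters, to which the calculus of definable sets
  applies.\<close>

definition counts :: "nat => nat => 'a::zgroup list set => 'a list set => (nat, rat) mpoly => bool" where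
 "counts k n S Y f \<longleftrightarrow> definable_over {} (k + n) S \<and> definable_over {} k Y \<and> mpoly_vars f \<subseteq> {..<k} \<and>
   (\<forall>c. length c = k \<and> map of_Z c \<in> Y --> finite ({x. map of_Z c @ x \<in> S} \<inter> std_tuples) \<and>
    of_nat (card ({x. map of_Z c @ x \<in> S} \<inter> std_tuples)) = mpoly_eval id (\<lambda>i. of_int (c ! i)) f)"

lemma solutions_uniform:
 fixes S :: "'a::zgroup list set"
 assumes S: "definable_over {} (k + n) S"
 obtains p where "fv p \<subseteq> {..<n + k}" "\<And>b. length b = k ==> solutions n p b = {x. b @ x \<in> S}"
proof -
 let ?T = "{w. length w = n + k \<and> drop n w @ take n w \<in> S}"
 have "definable_over {} (n + k) ?T"
 proof (rule definableI, rule Def_mem[OF S])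
  show "Dfnl {} (k + n) (\<lambda>v. drop n (map v [0..<n + k]) @ take n (map v [0..<n + k]))"
   by (rule Dfnl_cast[OF Dfnl_append[OF Dfnl_drop[OF Dfnl_vars] Dfnl_take[OF Dfnl_vars]]]) simp
 qed
 then obtain p where p: "fv p \<subseteq> {..<n + k}" "?T = solutions (n + k) p []"
  unfolding definable_over_def by auto
 show ?thesis
 proof (rule that[OF p(1)])
  fix b :: "'a list" assume b: "length b = k"
  have "x \<in> solutions n p b \<longleftrightarrow> length x = n \<and> x @ b \<in> solutions (n + k) p []" for x
   using b by (auto simp: solutions_def)
  then show "solutions n p b = {x. b @ x \<in> S}"
   unfolding p(2)[symmetric] using b definable_length[OF S] by fastforce
 qed
qed

lemma definable_solutions:
 assumes "fv p \<subseteq> {..<n + k}"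
 shows "definable_over {} (k + n) {w :: 'a::zgroup list. length w = k + n \<and> drop k w \<in> solutions n p (take k w)}"
proof (rule definableI)
 have S: "definable_over {} (n + k) (solutions (n + k) p ([] :: 'a list))"
  unfolding definable_over_def using assms by (intro exI[of _ p] exI[of _ "[]"]) simp
 have "Def {} (\<lambda>v :: nat => 'a. drop k (map v [0..<k + n]) @ take k (map v [0..<k + n]) \<in> solutions (n + k) p [])"
  by (rule Def_mem[OF S Dfnl_append[OF Dfnl_drop[OF Dfnl_vars] Dfnl_take[OF Dfnl_vars]]])
 moreover have "drop k w @ take k w \<in> solutions (n + k) p [] \<longleftrightarrow> drop k w \<in> solutions n p (take k w)"
  if "length w = k + n" for w :: "'a list" using that by (auto simp: solutions_def)
 ultimately show "Def {} (\<lambda>v :: nat => 'a. drop k (map v [0..<k + n]) \<in> solutions n p (take k (map v [0..<k + n])))"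
  by simp
qed

lemma is_hypercard_iff:
 fixes X :: "'a::zgroup list set"
 shows "is_hypercard n X u \<longleftrightarrow> (\<exists>k S b Y f. counts k n S Y f \<and> b \<in> Y \<and> X = {x. b @ x \<in> S} \<and>
  u = mpoly_eval Sym_rat (symv b) f)"
proof
 assume "is_hypercard n X u"
 then obtain p b Y f where h: "fv p \<subseteq> {..<n + length b}" "X = solutions n p b"
  "definable_over {} (length b) Y" "b \<in> Y" "mpoly_vars f \<subseteq> {..<length b}"
  "\<forall>c. length c = length b \<and> map of_Z c \<in> Y -->
    finite (solutions n p (map of_Z c) \<inter> (std_tuples :: 'a list set)) \<and>
    of_nat (card (solutions n p (map of_Z c) \<inter> (std_tuples :: 'a list set))) =
     mpoly_eval id (\<lambda>i. of_int (c ! i)) f"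
  "u = mpoly_eval Sym_rat (symv b) f" unfolding is_hypercard_def by (elim exE conjE)
 define k where "k = length b"
 define S where "S = {w :: 'a list. length w = k + n \<and> drop k w \<in> solutions n p (take k w)}"
 have S: "solutions n p c = {x. c @ x \<in> S}" if "length c = k" for c :: "'a list"
  using that by (auto simp: S_def) (auto simp: solutions_def)
 have "counts k n S Y f"
  unfolding counts_def
 proof (intro conjI allI impI)
  show "definable_over {} (k + n) S" unfolding S_def using definable_solutions h(1) by (simp add: k_def)
 qed (use h(3,5,6) S k_def in \<open>simp_all\<close>)
 then show "\<exists>k S b Y f. counts k n S Y f \<and> b \<in> Y \<and> X = {x. b @ x \<in> S} \<and> u = mpoly_eval Sym_rat (symv b) f"
  using h(2,4,7) S[of b] k_def by blast
next
 assume "\<exists>k S b Y f. counts k n S Y f \<and> b \<in> Y \<and> X = {x. b @ x \<in> S} \<and> u = mpoly_eval Sym_rat (symv b) f"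
 then obtain k S b Y f where h: "counts k n S Y f" "b \<in> Y" "X = {x. b @ x \<in> S}" "u = mpoly_eval Sym_rat (symv b) f"
  by (elim exE conjE)
 note c = h(1)[unfolded counts_def]
 have b: "length b = k" using definable_length[OF c[THEN conjunct2, THEN conjunct1] h(2)] .
 obtain p where p: "fv p \<subseteq> {..<n + k}" "\<And>b. length b = k ==> solutions n p b = {x. b @ x \<in> S}"
  using solutions_uniform[OF c[THEN conjunct1]] by blast
 show "is_hypercard n X u"
  unfolding is_hypercard_def b
  by (rule exI[of _ p], rule exI[of _ b], rule exI[of _ Y], rule exI[of _ f]) (use c h p b in simp)
qed

lemma PF_mpoly:
 assumes "mpoly_vars f \<subseteq> {..<k}"
 shows "PF k (\<lambda>v. mpoly_eval Sym_rat v f)"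
 unfolding mpoly_eval_def
 by (intro PF_sum PF.mult PF.const PF_prod PF_power PF.var) (use assms in "auto simp: mpoly_vars_def")

text \<open>Transports the identities between counts and polynomial values, which hold in the
  rationals, to \<open>Sym\<close>.\<close>

lemma mpoly_eval_std:
 "mpoly_eval Sym_rat (\<lambda>i. of_int (c i)) f = Sym_rat (mpoly_eval id (\<lambda>i. of_int (c i)) f)"
proof (induction f rule: poly_mapping_add_induct)
 case (single m q)
 have "monom_eval (\<lambda>i. of_int (c i) :: rat) m = of_int (monom_eval c m)"
  "monom_eval (\<lambda>i. of_int (c i) :: 'a tensor_rat Sym) m = of_int (monom_eval c m)"
  by (simp_all add: monom_eval_def of_int_prod)
 then show ?case by (simp add: mpoly_eval_single Sym_rat_0 Sym_rat_mult)
qed (simp only: Sym_rat.eval_add rat_id.eval_add Sym_rat_add)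

lemma mpoly_eval_local:
 assumes "mpoly_vars f \<subseteq> {..<k}" "\<And>i. i < k ==> v i = w i"
 shows "mpoly_eval h v f = mpoly_eval h w f"
 unfolding mpoly_eval_def
 by (intro sum.cong prod.cong arg_cong2[of _ _ _ _ "(*)"] arg_cong2[of _ _ _ _ "(^)"])
  (use assms in "auto simp: mpoly_vars_def")

lemma std_map: "set y \<subseteq> std ==> \<exists>c. y = map of_Z c"
 using ex_map_conv[of y of_Z] by (auto simp: image_iff subset_iff)

text \<open>Two presentations are compared on the set \<open>E\<close> of pairs of parameters that
  define the same fibre. At integer points of \<open>E\<close> both polynomials count the same set,
  so their difference vanishes there, and \<open>PF_vanish\<close> over the standard integers
  carries this to the given pair \<open>b @ b'\<close>.\<close>

lemma is_hypercard_unique: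
 fixes X :: "'a::zgroup list set"
 assumes "is_hypercard n X u" "is_hypercard n X u'"
 shows "u = u'"
proof -
 from assms(1)[unfolded is_hypercard_iff] obtain k S b Y f where
  h: "counts k n S Y f" "b \<in> Y" "X = {x. b @ x \<in> S}" "u = mpoly_eval Sym_rat (symv b) f" by (elim exE conjE)
 from assms(2)[unfolded is_hypercard_iff] obtain k' S' b' Y' f' where
  h': "counts k' n S' Y' f'" "b' \<in> Y'" "X = {x. b' @ x \<in> S'}" "u' = mpoly_eval Sym_rat (symv b') f'"
  by (elim exE conjE)
 note c = h(1)[unfolded counts_def] and c' = h'(1)[unfolded counts_def]
 have S: "definable_over {} (k + n) S" "definable_over {} k Y" "mpoly_vars f \<subseteq> {..<k}" using c by blast+
 have S': "definable_over {} (k' + n) S'" "definable_over {} k' Y'" "mpoly_vars f' \<subseteq> {..<k'}" using c' by blast+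
 have lb: "length b = k" "length b' = k'" using definable_length S(2) S'(2) h(2) h'(2) by blast+
 define E where "E = {w. length w = k + k' \<and> (take k w \<in> Y \<and> drop k w \<in> Y' \<and>
  (\<forall>x. length x = n --> (take k w @ x \<in> S \<longleftrightarrow> drop k w @ x \<in> S')))}"
 define g where "g = (\<lambda>v :: nat => 'a tensor_rat Sym. mpoly_eval Sym_rat v f - mpoly_eval Sym_rat (\<lambda>i. v (k + i)) f')"
 have g: "PF (k + k') g"
  unfolding g_def
  by (intro PF_diff PF_mpoly PF_reindex[OF PF_mpoly[OF S'(3)]]) (use S(3) in auto)
 have E: "definable_over {} (k + k') E"
  unfolding E_def
 proof (rule definableI, intro Def_conj Def_alll Def_iff)
  have t: "Dfnl {} k (\<lambda>v. take k (map v [0..<k + k']))"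
   by (rule Dfnl_cast[OF Dfnl_take[OF Dfnl_vars]]) simp
  have d: "Dfnl {} k' (\<lambda>v. drop k (map v [0..<k + k']))"
   by (rule Dfnl_cast[OF Dfnl_drop[OF Dfnl_vars]]) simp
  show "Def {} (\<lambda>v. take k (map v [0..<k + k']) \<in> Y)" "Def {} (\<lambda>v. drop k (map v [0..<k + k']) \<in> Y')"
   by (rule Def_mem[OF S(2) t] Def_mem[OF S'(2) d])+
  show "Def {} (\<lambda>w. take k (map (\<lambda>i. w (i + n)) [0..<k + k']) @ map w [0..<n] \<in> S)"
   by (rule Def_mem[OF S(1) Dfnl_append[OF Dfnl_reindex[OF t] Dfnl_vars]])
  show "Def {} (\<lambda>w. drop k (map (\<lambda>i. w (i + n)) [0..<k + k']) @ map w [0..<n] \<in> S')"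
   by (rule Def_mem[OF S'(1) Dfnl_append[OF Dfnl_reindex[OF d] Dfnl_vars]])
 qed
 have fib: "{x. take k w @ x \<in> S} = {x. drop k w @ x \<in> S'}" if "w \<in> E" for w
  using that definable_length[OF S(1)] definable_length[OF S'(1)] unfolding E_def by fastforce
 have "g (symv (b @ b')) = 0"
 proof (rule PF_vanish[OF esub_std g definable_mono[OF E]])
  show "b @ b' \<in> E" using lb h h' by (auto simp: E_def)
  fix w assume w: "w \<in> E" "set w \<subseteq> std"
  obtain c where cc: "w = map of_Z c" using std_map[OF w(2)] by blast
  have lw: "length c = k + k'" "take k w \<in> Y" "drop k w \<in> Y'" using w(1) by (auto simp: E_def cc)
  let ?F = "{x. take k w @ x \<in> S} \<inter> std_tuples"
  have "of_nat (card ?F) = mpoly_eval id (\<lambda>i. of_int (take k c ! i)) f"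
   using c[THEN conjunct2, THEN conjunct2, THEN conjunct2, THEN spec, of "take k c"] lw
   by (simp add: cc take_map)
  moreover have "of_nat (card ?F) = mpoly_eval id (\<lambda>i. of_int (drop k c ! i)) f'"
   unfolding fib[OF w(1)]
   using c'[THEN conjunct2, THEN conjunct2, THEN conjunct2, THEN spec, of "drop k c"] lw
   by (simp add: cc drop_map)
  ultimately have "mpoly_eval Sym_rat (\<lambda>i. of_int (take k c ! i)) f =
   (mpoly_eval Sym_rat (\<lambda>i. of_int (drop k c ! i)) f' :: 'a tensor_rat Sym)"
   unfolding mpoly_eval_std by simp
  moreover have "mpoly_eval Sym_rat (symv w) f = mpoly_eval Sym_rat (\<lambda>i. of_int (take k c ! i)) f"
   by (rule mpoly_eval_local[OF S(3)]) (use lw in "simp add: cc")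
  moreover have "mpoly_eval Sym_rat (\<lambda>i. symv w (k + i)) f' = mpoly_eval Sym_rat (\<lambda>i. of_int (drop k c ! i)) f'"
   by (rule mpoly_eval_local[OF S'(3)]) (use lw in "simp add: cc")
  ultimately show "g (symv w) = 0" by (simp add: g_def)
 qed simp
 moreover have "mpoly_eval Sym_rat (symv (b @ b')) f = u"
  unfolding h(4) by (rule mpoly_eval_local[OF S(3)]) (use lb in "simp add: nth_append")
 moreover have "mpoly_eval Sym_rat (\<lambda>i. symv (b @ b') (k + i)) f' = u'"
  unfolding h'(4) by (rule mpoly_eval_local[OF S'(3)]) (use lb in "simp add: nth_append")
 ultimately show ?thesis by (simp add: g_def)
qed

lemma hypercard_eq: "is_hypercard n X u ==> hypercard n X = u"
 unfolding hypercard_def using is_hypercard_unique by (intro the_equality)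

text \<open>The fibre is a nonempty set defined over \<open>Z\<close>, so it has a point with
  entries in \<open>Z\<close>, and \<open>z\<close> is its only point.\<close>

lemma esub_fibre_unique:
 assumes Z: "esub Z" and "definable_over Z (k + n) G" "set x \<subseteq> Z" "length x = k"
  and "x @ z \<in> G" "\<And>z'. x @ z' \<in> G ==> z' = z"
 shows "set z \<subseteq> Z"
 using Z[unfolded esub_def, THEN spec, THEN spec, THEN mp, THEN mp, OF definable_fibre[OF assms(2,4,3)]] assms(5,6)
 by blast

lemma definable_swap:
 assumes "definable_over A (n + m) G"
 shows "definable_over A (m + n) {w. length w = m + n \<and> drop m w @ take m w \<in> G}"
 by (rule definableI, rule Def_mem[OF assms Dfnl_append[OF Dfnl_drop[OF Dfnl_vars] Dfnl_take[OF Dfnl_vars]]])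

text \<open>A bijection defined over the standard integers carries integer points to integer points
  in both directions, since image and preimage are unique points of fibres.\<close>

lemma dsum_std_count:
 fixes X :: "'a::zgroup list set"
 assumes "dsum std n X I m B"
 shows "finite (X \<inter> std_tuples) \<longleftrightarrow> finite (Sigma I (\<lambda>i. B i \<inter> std_tuples))"
  "card (X \<inter> std_tuples) = card (Sigma I (\<lambda>i. B i \<inter> std_tuples))"
proof -
 obtain h G where "dvia std n X I m B h G" using dsum_dvia[OF assms] .
 note D = dviaD[OF this]
 have hI: "h x \<in> Sigma I B" if "x \<in> X" for x using D(4) that by (rule bij_betw_apply)
 have eq: "snd (h x) \<in> std_tuples \<longleftrightarrow> x \<in> std_tuples" if x: "x \<in> X" for x
 proof -
  obtain i z where iz: "h x = (i, z)" "i \<in> I" "z \<in> B i" using hI[OF x] by blast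
  have lx: "length x = n" "length z = m i" using D(2)[OF x] D(3)[OF iz(2,3)] .
  have xG: "x @ z \<in> G i" using D(6)[OF iz(2) lx] x iz(1) by simp
  have "set z \<subseteq> std" if s: "set x \<subseteq> std"
  proof (rule esub_fibre_unique[OF esub_std D(5)[OF iz(2)] s lx(1) xG])
   fix z' assume z': "x @ z' \<in> G i"
   then have "length z' = m i" using definable_length[OF D(5)[OF iz(2)] z'] lx by simp
   then show "z' = z" using D(6)[OF iz(2) lx(1), of z'] z' iz(1) by simp
  qed
  moreover have "set x \<subseteq> std" if s: "set z \<subseteq> std"
  proof (rule esub_fibre_unique[OF esub_std definable_swap[OF D(5)[OF iz(2)]] s lx(2)])
   show "z @ x \<in> {w. length w = m i + n \<and> drop (m i) w @ take (m i) w \<in> G i}" using xG lx by simp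
   fix x' assume x': "z @ x' \<in> {w. length w = m i + n \<and> drop (m i) w @ take (m i) w \<in> G i}"
   then have x'': "length x' = n" "x' @ z \<in> G i" using lx by auto
   then have "x' \<in> X" "h x' = (i, z)" using D(6)[OF iz(2) x''(1) lx(2)] by simp_all
   then show "x' = x" using D(4) x iz(1) by (metis bij_betw_inv_into_left)
  qed
  ultimately show ?thesis using iz(1) by auto
 qed
 have "h ` (X \<inter> std_tuples) = Sigma I (\<lambda>i. B i \<inter> std_tuples)"
 proof (intro set_eqI iffI)
  fix p assume "p \<in> h ` (X \<inter> std_tuples)"
  then obtain x where "x \<in> X" "x \<in> std_tuples" "p = h x" by blast
  then show "p \<in> Sigma I (\<lambda>i. B i \<inter> std_tuples)" using hI[of x] eq[of x] by auto
 next
  fix p assume p: "p \<in> Sigma I (\<lambda>i. B i \<inter> std_tuples)"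
  then have "p \<in> h ` X" using D(4) by (auto simp: bij_betw_def)
  then obtain x where "x \<in> X" "p = h x" by blast
  then show "p \<in> h ` (X \<inter> std_tuples)" using eq[of x] p by auto
 qed
 then have b: "bij_betw h (X \<inter> std_tuples) (Sigma I (\<lambda>i. B i \<inter> std_tuples))"
  using D(4) by (auto simp: bij_betw_def intro: inj_on_subset)
 show "finite (X \<inter> std_tuples) \<longleftrightarrow> finite (Sigma I (\<lambda>i. B i \<inter> std_tuples))" using bij_betw_finite[OF b] .
 show "card (X \<inter> std_tuples) = card (Sigma I (\<lambda>i. B i \<inter> std_tuples))" using bij_betw_same_card[OF b] .
qed

text \<open>The same graphs decompose the nearby members of a family, in particular those at integer
 parameters.\<close>

lemma dsum_spread:
 fixes S :: "'a::zgroup list set"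
 assumes S: "definable_over C (k + n) S" and T: "\<And>i. i \<in> I ==> definable_over C (k + m i) (T i)"
  and c: "length c = k" and d: "dsum (C \<union> set c) n {x. c @ x \<in> S} I m (\<lambda>i. {z. c @ z \<in> T i})"
 shows "\<exists>W. definable_over C k W \<and> c \<in> W \<and> (\<forall>y A. y \<in> W --> C \<union> set y \<subseteq> A -->
  dsum A n {x. y @ x \<in> S} I m (\<lambda>i. {z. y @ z \<in> T i}))"
proof -
 have "\<exists>W G. definable_over C k W \<and> c \<in> W \<and> (\<forall>i\<in>I. definable_over C (k + (n + m i)) (G i)) \<and>
  (\<forall>y\<in>W. is_graph n {x. y @ x \<in> S} I m (\<lambda>i. {z. y @ z \<in> T i}) (\<lambda>i. {w. y @ w \<in> G i}))"
  by (rule dsum_uniform_ex[OF S T c d])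
 then obtain W G where W: "definable_over C k W" "c \<in> W" "\<forall>i\<in>I. definable_over C (k + (n + m i)) (G i)"
  "\<forall>y\<in>W. is_graph n {x. y @ x \<in> S} I m (\<lambda>i. {z. y @ z \<in> T i}) (\<lambda>i. {w. y @ w \<in> G i})" by (elim exE conjE)
 show ?thesis
 proof (intro exI[of _ W] conjI W(1,2) allI impI)
  fix y A assume y: "y \<in> W" and A: "C \<union> set y \<subseteq> A"
  have ly: "length y = k" by (rule definable_length[OF W(1) y])
  show "dsum A n {x. y @ x \<in> S} I m (\<lambda>i. {z. y @ z \<in> T i})"
   unfolding dsum_def
  proof (intro conjI ballI exI[of _ "\<lambda>i. {w. y @ w \<in> G i}"])
   show "finite I" using d by (simp add: dsum_def)
   show "length x = n" if "x \<in> {x. y @ x \<in> S}" for x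
    using definable_length[OF S, of "y @ x"] that ly by simp
   show "length z = m i" if "i \<in> I" "z \<in> {z. y @ z \<in> T i}" for i z
    using definable_length[OF T[OF that(1)], of "y @ z"] that(2) ly by simp
   show "definable_over A (n + m i) {w. y @ w \<in> G i}" if "i \<in> I" for i
    using definable_fibre[OF definable_mono[OF bspec[OF W(3) that]] ly, of A] A by simp
   show "is_graph n {x. y @ x \<in> S} I m (\<lambda>i. {z. y @ z \<in> T i}) (\<lambda>i. {w. y @ w \<in> G i})"
    using bspec[OF W(4) y] .
  qed
 qed
qed

section \<open>Reduction to finitely many parameters\<close>

lemma definable_params: "definable_over A n X ==> \<exists>a. set a \<subseteq> A \<and> definable_over (set a) n X"
 unfolding definable_over_def by blast

lemma definable_params_ball:
 assumes "finite I" "\<And>i. i \<in> I ==> definable_over A (m i) (B i)"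
 shows "\<exists>a. set a \<subseteq> A \<and> (\<forall>i\<in>I. definable_over (set a) (m i) (B i))"
proof -
 have "\<forall>i\<in>I. \<exists>a. set a \<subseteq> A \<and> definable_over (set a) (m i) (B i)" using definable_params assms(2) by blast
 then obtain f where f: "\<forall>i\<in>I. set (f i) \<subseteq> A \<and> definable_over (set (f i)) (m i) (B i)"
  by (rule bchoice[THEN exE])
 have "finite (\<Union>i\<in>I. set (f i))" using assms(1) by simp
 from finite_list[OF this] obtain a where a: "set a = (\<Union>i\<in>I. set (f i))" by (rule exE)
 have "definable_over (set a) (m i) (B i)" if "i \<in> I" for i
  by (rule definable_mono[of "set (f i)"]) (use f that a in auto)
 moreover have "set a \<subseteq> A" using a f by auto
 ultimately show ?thesis by blast
qed

text \<open>The finitely many graphs use finitely many parameters; once these are listed, they can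
  be varied together with those of the set.\<close>

lemma dsum_params:
 assumes d: "dsum A n X I m B" and X: "definable_over A n' X'"
 shows "\<exists>a. set a \<subseteq> A \<and> definable_over (set a) n' X' \<and> dsum (set a) n X I m B"
proof -
 obtain G where G: "\<forall>i\<in>I. definable_over A (n + m i) (G i)" "is_graph n X I m B G" "finite I"
  using d unfolding dsum_def by (elim exE conjE)
 have "\<exists>a. set a \<subseteq> A \<and> (\<forall>i\<in>I. definable_over (set a) (n + m i) (G i))"
  by (rule definable_params_ball[OF G(3)]) (use G(1) in blast)
 then obtain a where a: "set a \<subseteq> A" "\<forall>i\<in>I. definable_over (set a) (n + m i) (G i)" by (elim exE conjE)
 obtain b where b: "set b \<subseteq> A" "definable_over (set b) n' X'" using definable_params[OF X] by blast
 have "dsum (set (a @ b)) n X I m B"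
  unfolding dsum_def
 proof (intro conjI exI[of _ G])
  show "\<forall>i\<in>I. definable_over (set (a @ b)) (n + m i) (G i)"
   using a(2) by (auto elim: definable_mono)
 qed (use d G(2) in \<open>auto simp: dsum_def\<close>)
 moreover have "definable_over (set (a @ b)) n' X'" by (rule definable_mono[OF b(2)]) simp
 ultimately show ?thesis using a(1) b(1) by (intro exI[of _ "a @ b"]) simp
qed

lemma countsD:
 assumes "counts k n S Y f"
 shows "definable_over {} (k + n) S" "definable_over {} k Y" "mpoly_vars f \<subseteq> {..<k}"
  "\<And>c. length c = k ==> map of_Z c \<in> Y ==> finite ({x. map of_Z c @ x \<in> S} \<inter> std_tuples)"
  "\<And>c. length c = k ==> map of_Z c \<in> Y ==>
   of_nat (card ({x. map of_Z c @ x \<in> S} \<inter> std_tuples)) = mpoly_eval id (\<lambda>i. of_int (c ! i)) f"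
 using assms unfolding counts_def by simp_all

text \<open>The parameters \<open>a\<close> of the bijection are appended to those of
  \<open>X\<close>. On the definable set of tuples where the formulas still give a bijection the
  counts of integer points agree, so the same polynomial, in more variables, serves for
  \<open>X'\<close>.\<close>

lemma is_hypercard_dbij:
 fixes X :: "'a::zgroup list set"
 assumes X': "definable_over UNIV n' X'" and d: "dbij UNIV n n' X X'" and h: "is_hypercard n X u"
 shows "is_hypercard n' X' u"
proof -
 from h[unfolded is_hypercard_iff] obtain k S b Y f where
  c: "counts k n S Y f" and b: "b \<in> Y" "X = {x. b @ x \<in> S}" and u: "u = mpoly_eval Sym_rat (symv b) f"
  by (elim exE conjE)
 note C = countsD[OF c]
 have lb: "length b = k" by (rule definable_length[OF C(2) b(1)])
 from dsum_params[OF d[unfolded dbij_def] X'] obtain a where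
  a: "definable_over (set a) n' X'" "dsum (set a) n X {()} (\<lambda>_. n') (\<lambda>_. X')" by (elim exE conjE)
 obtain T where T: "definable_over {} (length a + n') T" "X' = {z. a @ z \<in> T}"
  by (rule definable_param_out[OF a(1), of "{}" a]) simp
 let ?k = "k + length a"
 define S' where "S' = {w. length w = ?k + n \<and> take k w @ drop ?k w \<in> S}"
 define T' where "T' = {w. length w = ?k + n' \<and> drop k w \<in> T}"
 have S': "definable_over {} (?k + n) S'" unfolding S'_def
  by (rule definableI, rule Def_mem[OF C(1) Dfnl_append[OF Dfnl_take[OF Dfnl_vars] Dfnl_drop[OF Dfnl_vars]]])
 have T': "definable_over {} (?k + n') T'" unfolding T'_def
  by (rule definableI, rule Def_mem[OF T(1) Dfnl_drop[OF Dfnl_vars]])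
 have fS: "{x. y @ x \<in> S'} = {x. take k y @ x \<in> S}" if "length y = ?k" for y
  using that definable_length[OF C(1)] by (fastforce simp: S'_def)
 have fT: "{x. y @ x \<in> T'} = {x. drop k y @ x \<in> T}" if "length y = ?k" for y
  using that definable_length[OF T(1)] by (fastforce simp: T'_def)
 have D0: "dsum ({} \<union> set (b @ a)) n {x. (b @ a) @ x \<in> S'} {()} (\<lambda>_. n') (\<lambda>i. {z. (b @ a) @ z \<in> T'})"
  using dsum_mono[OF a(2), of "set (b @ a)"] fS[of "b @ a"] fT[of "b @ a"] lb b(2) T(2) by simp
 have lc: "length (b @ a) = ?k" using lb by simp
 have "\<exists>W. definable_over {} ?k W \<and> b @ a \<in> W \<and> (\<forall>y A. y \<in> W --> {} \<union> set y \<subseteq> A -->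
  dsum A n {x. y @ x \<in> S'} {()} (\<lambda>_. n') (\<lambda>i. {z. y @ z \<in> T'}))"
  by (rule dsum_spread[where C = "{}" and I = "{()}" and c = "b @ a", OF S' T' lc D0])
 then obtain W where W: "definable_over {} ?k W" "b @ a \<in> W"
  "\<forall>y A. y \<in> W --> {} \<union> set y \<subseteq> A --> dsum A n {x. y @ x \<in> S'} {()} (\<lambda>_. n') (\<lambda>i. {z. y @ z \<in> T'})"
  by (elim exE conjE)
 define Y' where "Y' = {w. length w = ?k \<and> w \<in> W \<and> take k w \<in> Y}"
 have Y': "definable_over {} ?k Y'" unfolding Y'_def
  by (rule definableI, rule Def_conj, rule Def_mem[OF W(1) Dfnl_vars],
    rule Def_mem[OF C(2) Dfnl_take[OF Dfnl_vars]])
 have "counts ?k n' T' Y' f"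
  unfolding counts_def
 proof (intro conjI allI impI T' Y')
  show "mpoly_vars f \<subseteq> {..<?k}" using C(3) by auto
  fix c assume cY: "length c = ?k \<and> map of_Z c \<in> Y'"
  let ?y = "map of_Z c :: 'a list"
  have y: "?y \<in> W" "map of_Z (take k c) \<in> Y" "length (take k c) = k"
   using cY by (auto simp: Y'_def take_map)
  have ly: "length ?y = ?k" using cY by simp
  have D: "dsum std n {x. ?y @ x \<in> S'} {()} (\<lambda>_. n') (\<lambda>i. {z. ?y @ z \<in> T'})"
   by (rule W(3)[rule_format, OF y(1)]) auto
  have e: "{x. ?y @ x \<in> S'} = {x. map of_Z (take k c) @ x \<in> S}" using fS[OF ly] by (simp add: take_map)
  let ?B = "{z. ?y @ z \<in> T'} \<inter> std_tuples"
  have Sig: "Sigma {()} (\<lambda>_. ?B) = Pair () ` ?B" by auto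
  have "finite (Pair () ` ?B)" using dsum_std_count(1)[OF D] C(4)[OF y(3,2)] unfolding e Sig by blast
  then show "finite ?B" by (rule finite_imageD) (simp add: inj_on_def)
  have "card (Pair () ` ?B) = card ?B" by (rule card_image) (simp add: inj_on_def)
  then have "of_nat (card ?B) = mpoly_eval id (\<lambda>i. of_int (take k c ! i)) f"
   using dsum_std_count(2)[OF D] C(5)[OF y(3,2)] unfolding e Sig by simp
  also have "\<dots> = mpoly_eval id (\<lambda>i. of_int (c ! i)) f" by (rule mpoly_eval_local[OF C(3)]) simp
  finally show "of_nat (card ?B) = mpoly_eval id (\<lambda>i. of_int (c ! i)) f" .
 qed
 moreover have "b @ a \<in> Y'" using W(2) b(1) lb by (simp add: Y'_def)
 moreover have "X' = {x. (b @ a) @ x \<in> T'}" using fT[of "b @ a"] lb T(2) by simp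
 moreover have "u = mpoly_eval Sym_rat (symv (b @ a)) f"
  unfolding u by (rule mpoly_eval_local[OF C(3)]) (use lb in "simp add: nth_append")
 ultimately show ?thesis unfolding is_hypercard_iff by blast
qed

section \<open>Hyper-cardinality of sums of boxes\<close>

text \<open>The binomial coefficient of the variable \<open>j\<close> over \<open>d\<close> as a
  rational polynomial, a falling factorial divided by the factorial of \<open>d\<close>;
  \<open>sbinom\<close> is its counterpart in \<open>Sym\<close>.\<close>

definition bpoly :: "nat => nat => (nat, rat) mpoly" where
 "bpoly j d = Poly_Mapping.single 0 (1 / of_int (fact d)) *
   (\<Prod>t<d. Poly_Mapping.single (Poly_Mapping.single j 1) 1 + Poly_Mapping.single 0 (of_int (- int t)))"

definition sbinom :: "'a::zgroup tensor_rat Sym => nat => 'a tensor_rat Sym" where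
 "sbinom u d = Sym_rat (1 / of_int (fact d)) * (\<Prod>t<d. u + of_int (- int t))"

text \<open>The hyper-cardinality of a set in normal form, as shown in
  \<open>is_hypercard_dsum\<close>.\<close>

definition bsum :: "'i set => ('i => nat list) => 'a::zgroup list => 'a tensor_rat Sym" where
 "bsum I \<delta> es = (\<Sum>i\<in>I. \<Prod>j<length es. sbinom (Sym_elem (es ! j)) (\<delta> i ! j))"

lemma bpoly_eval_Sym: "mpoly_eval Sym_rat v (bpoly j d) = sbinom (v j) d"
 by (simp only: bpoly_def sbinom_def Sym_rat.eval_mult Sym_rat.eval_const Sym_rat.eval_prod
   Sym_rat.eval_add Sym_rat.eval_var Sym_rat_of_int)

lemma bpoly_eval_rat:
 assumes "v j = of_nat q" shows "mpoly_eval id v (bpoly j d) = of_nat (q choose d)"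
proof -
 have "mpoly_eval id v (bpoly j d) = (1 / of_int (fact d)) * (\<Prod>t<d. of_nat q + of_int (- int t))"
  by (simp only: bpoly_def rat_id.eval_mult rat_id.eval_const rat_id.eval_prod
   rat_id.eval_add rat_id.eval_var assms id_apply)
 also have "\<dots> = of_nat q gchoose d"
  by (simp add: gbinomial_prod_rev atLeast0LessThan)
 finally show ?thesis by (simp add: binomial_gbinomial)
qed

lemma mpoly_vars_single: "mpoly_vars (Poly_Mapping.single m c) \<subseteq> Poly_Mapping.keys m"
 by (auto simp: mpoly_vars_def)

lemma mpoly_vars_sum:
 fixes f :: "'i => ('v, 'c::comm_semiring_1) mpoly"
 shows "(\<And>i. i \<in> I ==> mpoly_vars (f i) \<subseteq> V) ==> mpoly_vars (\<Sum>i\<in>I. f i) \<subseteq> V"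
proof (induction I rule: infinite_finite_induct)
 case (insert x F)
 then show ?case using mpoly_vars_add[of "f x" "sum f F"] by (auto 4 3)
qed (auto simp: mpoly_vars_def)

lemma mpoly_vars_prod:
 fixes f :: "'i => ('v, 'c::comm_semiring_1) mpoly"
 assumes "\<And>i. i \<in> I ==> mpoly_vars (f i) \<subseteq> V" shows "mpoly_vars (\<Prod>i\<in>I. f i) \<subseteq> V"
proof -
 have 1: "mpoly_vars (1 :: ('v, 'c) mpoly) \<subseteq> V"
  using mpoly_vars_single[of "0 :: 'v \<Rightarrow>\<^sub>0 nat" "1 :: 'c"] by simp
 show ?thesis
  using assms
 proof (induction I rule: infinite_finite_induct)
  case (insert x F)
  then show ?case using mpoly_vars_mult[of "f x" "prod f F"] by (auto 4 3)
 qed (use 1 in auto)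
qed

lemma bpoly_vars: "mpoly_vars (bpoly j d) \<subseteq> {j}"
proof -
 have s: "mpoly_vars (Poly_Mapping.single m c) \<subseteq> {j}" if "Poly_Mapping.keys m \<subseteq> {j}" for m :: "nat \<Rightarrow>\<^sub>0 nat" and c :: rat
  by (rule order_trans[OF mpoly_vars_single that])
 show ?thesis
  unfolding bpoly_def
  by (rule order_trans[OF mpoly_vars_mult Un_least[OF s mpoly_vars_prod[OF order_trans[OF mpoly_vars_add
    Un_least[OF s s]]]]]) simp_all
qed

section \<open>Counting the integer points of boxes\<close>

lemma of_Z_less_iff: "of_Z i < (of_Z j :: 'a::zgroup) \<longleftrightarrow> i < j"
 using sat_of_Z[where 'a = 'a and v = "\<lambda>n. if n = 0 then i else j" and p = "Less (Var 0) (Var 1)"] by simp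

lemma of_Z_0: "of_Z 0 = (0 :: 'a::zgroup)"
 using of_Z_add[of 0 0, where 'a = 'a] by simp

text \<open>Integer chains are the increasing enumerations of the \<open>d\<close>-element subsets
  of \<open>{0..<c}\<close>.\<close>

lemma chain_int_card: "card (chain d (c :: int)) = nat c choose d" "finite (chain d c)"
proof -
 have "bij_betw set (chain d c) {B. B \<subseteq> {0..<c} \<and> card B = d}"
 proof (rule bij_betw_byWitness[where f' = sorted_list_of_set])
  show "set ` chain d c \<subseteq> {B. B \<subseteq> {0..<c} \<and> card B = d}"
   by (auto simp: chain_def strict_sorted_iff distinct_card)
  show "sorted_list_of_set ` {B. B \<subseteq> {0..<c} \<and> card B = d} \<subseteq> chain d c"
  proof clarify
   fix B assume B: "B \<subseteq> {0..<c}"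
   then have "finite B" using finite_subset[OF _ finite_atLeastLessThan_int] by blast
   then show "sorted_list_of_set B \<in> chain (card B) c" using B by (auto simp: chain_def)
  qed
  show "\<forall>z\<in>chain d c. sorted_list_of_set (set z) = z"
   by (auto simp: chain_def intro: strict_sorted_equal)
  show "\<forall>B\<in>{B. B \<subseteq> {0..<c} \<and> card B = d}. set (sorted_list_of_set B) = B"
   using finite_subset[OF _ finite_atLeastLessThan_int, of _ 0 c] by simp
 qed
 then show "card (chain d c) = nat c choose d" "finite (chain d c)"
  using n_subsets[of "{0..<c}" d] by (simp_all add: bij_betw_same_card bij_betw_finite)
qed

lemma chain_std: "chain d (of_Z c) \<inter> std_tuples = map (of_Z :: int => 'a::zgroup) ` chain d c"
proof -
 have "map (of_Z :: int => 'a) z \<in> chain d (of_Z c) \<longleftrightarrow> z \<in> chain d c" for z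
  unfolding chain_def of_Z_0[symmetric]
  by (auto simp: sorted_wrt_map of_Z_less_iff simp flip: not_less)
 then have *: "map of_Z z \<in> chain d (of_Z c :: 'a) \<longleftrightarrow> z \<in> chain d c" for z .
 show ?thesis
 proof (intro set_eqI iffI)
  fix x :: "'a list" assume x: "x \<in> chain d (of_Z c) \<inter> std_tuples"
  then obtain z where "x = map of_Z z" using std_map by blast
  then show "x \<in> map of_Z ` chain d c" using x *[of z] by simp
 next
  fix x :: "'a list" assume "x \<in> map of_Z ` chain d c"
  then obtain z where "x = map of_Z z" "z \<in> chain d c" by blast
  then show "x \<in> chain d (of_Z c) \<inter> std_tuples" using *[of z] by auto
 qed
qed

lemma box_std:
 "box (map (\<lambda>(d, c). (d, of_Z c)) \<beta>) \<inter> std_tuples = map (of_Z :: int => 'a::zgroup) ` box \<beta>"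
proof (induction \<beta>)
 case Nil
 then show ?case by simp
next
 case (Cons p \<beta>)
 obtain d c where p: "p = (d, c)" by force
 let ?b = "map (\<lambda>(d, c). (d, of_Z c :: 'a)) \<beta>"
 have "box (map (\<lambda>(d, c). (d, of_Z c :: 'a)) (p # \<beta>)) \<inter> std_tuples =
  {z @ w | z w. z \<in> chain d (of_Z c) \<inter> std_tuples \<and> w \<in> box ?b \<inter> std_tuples}"
  unfolding p by (auto; blast)
 also have "\<dots> = {map of_Z z @ map of_Z w | z w. z \<in> chain d c \<and> w \<in> box \<beta>}"
  unfolding Cons.IH chain_std by blast
 also have "\<dots> = map of_Z ` box (p # \<beta>)"
  unfolding p box.simps fst_conv snd_conv map_append[symmetric] by blast
 finally show ?case .
qed

lemma box_int_card:
 "card (box \<beta>) = (\<Prod>p\<leftarrow>\<beta>. nat (snd p :: int) choose fst p)" "finite (box \<beta>)"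
proof (induction \<beta>)
 case (Cons p \<beta>)
 have e: "box (p # \<beta>) = (\<lambda>(z, w). z @ w) ` (chain (fst p) (snd p) \<times> box \<beta>)" by auto
 have "inj_on (\<lambda>(z, w). z @ w) (chain (fst p) (snd p) \<times> box \<beta>)"
  by (auto simp: inj_on_def chain_def)
 then have "card (box (p # \<beta>)) = card (chain (fst p) (snd p)) * card (box \<beta>)"
  unfolding e by (simp only: card_image card_cartesian_product)
 then show "card (box (p # \<beta>)) = (\<Prod>p\<leftarrow>p # \<beta>. nat (snd p) choose fst p)"
  using Cons.IH(1) by (simp add: chain_int_card(1))
 show "finite (box (p # \<beta>))" unfolding e using Cons.IH(2) chain_int_card(2) by blast
qed simp_all

text \<open>The sides are varied along with the parameters: the tuples \<open>y\<close> carry the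
  sides in front, so that the same lengths \<open>\<delta>\<close> describe decompositions with
  other sides.\<close>

lemma dsum_box_spread:
 fixes S :: "'a::zgroup list set"
 assumes S: "definable_over C (k + n) S" and a: "length a = k"
  and l: "\<And>i. i \<in> I ==> length (\<delta> i) = length es"
  and d: "dsum (C \<union> set (es @ a)) n {x. a @ x \<in> S} I (\<lambda>i. bdim (zip (\<delta> i) es)) (\<lambda>i. box (zip (\<delta> i) es))"
 shows "\<exists>W. definable_over C (length es + k) W \<and> es @ a \<in> W \<and>
  (\<forall>y A. y \<in> W --> C \<union> set y \<subseteq> A --> dsum A n {x. drop (length es) y @ x \<in> S} I
   (\<lambda>i. bdim (zip (\<delta> i) (take (length es) y))) (\<lambda>i. box (zip (\<delta> i) (take (length es) y))))"
proof -
 define r where "r = length es"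
 let ?k = "r + k"
 have bd: "bdim (zip (\<delta> i) e) = sum_list (\<delta> i)" if "i \<in> I" "length e = r" for i and e :: "'a list"
  using l[OF that(1)] that(2) by (simp add: bdim_def r_def)
 define S' where "S' = {w. length w = ?k + n \<and> drop r w \<in> S}"
 define T where "T i = {w :: 'a list. length w = ?k + sum_list (\<delta> i) \<and> drop ?k w \<in> box (zip (\<delta> i) (take r w))}" for i
 have S': "definable_over C (?k + n) S'" unfolding S'_def
  by (rule definableI, rule Def_mem[OF S Dfnl_drop[OF Dfnl_vars]])
 have T: "definable_over C (?k + sum_list (\<delta> i)) (T i)" if i: "i \<in> I" for i
  unfolding T_def
 proof (rule definableI)
  let ?l = "\<lambda>v :: nat => 'a. map v [0..<?k + sum_list (\<delta> i)]"
  let ?\<beta> = "map (\<lambda>j. (\<delta> i ! j, \<lambda>v :: nat => 'a. v j)) [0..<r]"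
  have z: "map (\<lambda>(d, t). (d, t v)) ?\<beta> = zip (\<delta> i) (take r (?l v))" for v
   by (rule nth_equalityI) (use l[OF i] in "auto simp: r_def")
  have b: "bdim ?\<beta> = sum_list (\<delta> i)"
  proof -
   have "map fst ?\<beta> = \<delta> i" by (rule nth_equalityI) (use l[OF i] in "auto simp: r_def")
   then show ?thesis by (simp only: bdim_def)
  qed
  have "Def C (\<lambda>v. drop ?k (?l v) \<in> box (map (\<lambda>(d, t). (d, t v)) ?\<beta>))"
  proof (rule Def_box)
   show "Dfnl C (bdim ?\<beta>) (\<lambda>v. drop ?k (?l v))"
    unfolding b by (rule Dfnl_cast[OF Dfnl_drop[OF Dfnl_vars]]) simp
  qed (auto intro: Dfn_var)
  then show "Def C (\<lambda>v. drop ?k (?l v) \<in> box (zip (\<delta> i) (take r (?l v))))" unfolding z .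
 qed
 have fS: "{x. y @ x \<in> S'} = {x. drop r y @ x \<in> S}" if "length y = ?k" for y
  using that definable_length[OF S] by (fastforce simp: S'_def)
 have fT: "{z. y @ z \<in> T i} = box (zip (\<delta> i) (take r y))" if "length y = ?k" "i \<in> I" for y i
  using that box_length[of _ "zip (\<delta> i) (take r y)"] bd[OF that(2), of "take r y"] by (auto simp: T_def)
 have lc: "length (es @ a) = ?k" using a by (simp add: r_def)
 have D0: "dsum (C \<union> set (es @ a)) n {x. (es @ a) @ x \<in> S'} I (\<lambda>i. sum_list (\<delta> i)) (\<lambda>i. {z. (es @ a) @ z \<in> T i})"
 proof (rule dsum_cong)
  show "dsum (C \<union> set (es @ a)) n {x. (es @ a) @ x \<in> S'} I (\<lambda>i. bdim (zip (\<delta> i) es)) (\<lambda>i. box (zip (\<delta> i) es))"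
   using d fS[OF lc] by (simp add: r_def)
 qed (use fT[OF lc] bd[of _ es] r_def in auto)
 have "\<exists>W. definable_over C ?k W \<and> es @ a \<in> W \<and> (\<forall>y A. y \<in> W --> C \<union> set y \<subseteq> A -->
  dsum A n {x. y @ x \<in> S'} I (\<lambda>i. sum_list (\<delta> i)) (\<lambda>i. {z. y @ z \<in> T i}))"
  by (rule dsum_spread[where C = C and c = "es @ a", OF S' T lc D0])
 then obtain W where W: "definable_over C ?k W" "es @ a \<in> W"
  "\<forall>y A. y \<in> W --> C \<union> set y \<subseteq> A --> dsum A n {x. y @ x \<in> S'} I (\<lambda>i. sum_list (\<delta> i)) (\<lambda>i. {z. y @ z \<in> T i})"
  by (elim exE conjE)
 show ?thesis
  unfolding r_def[symmetric]
 proof (intro exI[of _ W] conjI W(1,2) allI impI)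
  fix y A assume y: "y \<in> W" "C \<union> set y \<subseteq> A"
  have ly: "length y = ?k" by (rule definable_length[OF W(1) y(1)])
  have "dsum A n {x. y @ x \<in> S'} I (\<lambda>i. bdim (zip (\<delta> i) (take r y))) (\<lambda>i. box (zip (\<delta> i) (take r y)))"
   by (rule dsum_cong[OF W(3)[rule_format, OF y]]) (use bd[of _ "take r y"] fT[OF ly] ly in auto)
  then show "dsum A n {x. drop r y @ x \<in> S} I (\<lambda>i. bdim (zip (\<delta> i) (take r y))) (\<lambda>i. box (zip (\<delta> i) (take r y)))"
   unfolding fS[OF ly] .
 qed
qed

text \<open>At integer sides and parameters in \<open>W\<close> the decomposition persists, and its
  boxes are counted by products of binomial coefficients. Their sum is a polynomial in the sides, so
  the tuple \<open>es @ a\<close> is a presentation as the definition of hyper-cardinality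
  requires.\<close>

lemma is_hypercard_dsum:
 fixes X :: "'a::zgroup list set"
 assumes X: "definable_over UNIV n X"
  and d: "dsum UNIV n X I (\<lambda>i. bdim (zip (\<delta> i) es)) (\<lambda>i. box (zip (\<delta> i) es))"
  and l: "\<And>i. i \<in> I ==> length (\<delta> i) = length es" and pos: "\<And>e. e \<in> set es ==> 0 \<le> e"
 shows "is_hypercard n X (bsum I \<delta> es)"
proof -
 define r where "r = length es"
 from dsum_params[OF d X] obtain a where
  a: "definable_over (set a) n X" "dsum (set a) n X I (\<lambda>i. bdim (zip (\<delta> i) es)) (\<lambda>i. box (zip (\<delta> i) es))"
  by (elim exE conjE)
 have fin: "finite I" using d by (simp add: dsum_def)
 obtain S where S: "definable_over {} (length a + n) S" "X = {x. a @ x \<in> S}"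
  by (rule definable_param_out[OF a(1), of "{}" a]) simp
 let ?k = "r + length a"
 define S' where "S' = {w. length w = ?k + n \<and> drop r w \<in> S}"
 have S': "definable_over {} (?k + n) S'" unfolding S'_def
  by (rule definableI, rule Def_mem[OF S(1) Dfnl_drop[OF Dfnl_vars]])
 have fS: "{x. y @ x \<in> S'} = {x. drop r y @ x \<in> S}" if "length y = ?k" for y
  using that definable_length[OF S(1)] by (fastforce simp: S'_def)
 have "dsum ({} \<union> set (es @ a)) n {x. a @ x \<in> S} I (\<lambda>i. bdim (zip (\<delta> i) es)) (\<lambda>i. box (zip (\<delta> i) es))"
  using dsum_mono[OF a(2), of "set (es @ a)"] S(2) by simp
 then have "\<exists>W. definable_over {} ?k W \<and> es @ a \<in> W \<and> (\<forall>y A. y \<in> W --> {} \<union> set y \<subseteq> A -->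
  dsum A n {x. drop r y @ x \<in> S} I (\<lambda>i. bdim (zip (\<delta> i) (take r y))) (\<lambda>i. box (zip (\<delta> i) (take r y))))"
  unfolding r_def by (intro dsum_box_spread[OF S(1) HOL.refl l])
 then obtain W where W: "definable_over {} ?k W" "es @ a \<in> W"
  "\<forall>y A. y \<in> W --> {} \<union> set y \<subseteq> A --> dsum A n {x. drop r y @ x \<in> S} I
   (\<lambda>i. bdim (zip (\<delta> i) (take r y))) (\<lambda>i. box (zip (\<delta> i) (take r y)))"
  by (elim exE conjE)
 \<comment> \<open>Nonnegative sides are imposed because only there do the binomial polynomials
   count the chains.\<close>
 define Y where "Y = {w. length w = ?k \<and> w \<in> W \<and> (\<forall>j<r. 0 \<le> w ! j)}"
 have Y: "definable_over {} ?k Y" unfolding Y_def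
 proof (rule definableI, rule Def_conj, rule Def_mem[OF W(1) Dfnl_vars], rule Def_all_less)
  fix j assume "j < r"
  then show "Def {} (\<lambda>v. 0 \<le> map v [0..<?k] ! j)" using Def_le[OF Dfn_zero Dfn_var[of "{}" j]] by simp
 qed
 define f where "f = (\<Sum>i\<in>I. \<Prod>j<r. bpoly j (\<delta> i ! j))"
 have vf: "mpoly_vars f \<subseteq> {..<?k}" unfolding f_def
  by (rule mpoly_vars_sum, rule mpoly_vars_prod, rule order_trans[OF bpoly_vars]) simp
 have "counts ?k n S' Y f"
  unfolding counts_def
 proof (intro conjI allI impI S' Y vf)
  fix c assume cY: "length c = ?k \<and> map of_Z c \<in> Y"
  let ?y = "map of_Z c :: 'a list"
  have ly: "length ?y = ?k" and yW: "?y \<in> W" using cY by (auto simp: Y_def)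
  have c0: "0 \<le> c ! j" if "j < r" for j
  proof -
   have "0 \<le> (of_Z (c ! j) :: 'a)" using cY that by (auto simp: Y_def)
   then show ?thesis unfolding of_Z_0[symmetric] using of_Z_less_iff[where 'a = 'a] by (simp flip: not_less)
  qed
  have D: "dsum std n {x. ?y @ x \<in> S'} I (\<lambda>i. bdim (zip (\<delta> i) (take r ?y))) (\<lambda>i. box (zip (\<delta> i) (take r ?y)))"
   unfolding fS[OF ly] by (rule W(3)[rule_format, OF yW]) auto
  let ?b = "\<lambda>i. zip (\<delta> i) (take r c)"
  have B: "box (zip (\<delta> i) (take r ?y)) \<inter> std_tuples = map of_Z ` box (?b i)" if "i \<in> I" for i
   by (simp add: take_map zip_map2 box_std)
  have inj: "inj_on (map (of_Z :: int => 'a)) Z" for Z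
   by (rule inj_on_subset[OF inj_mapI]) (auto intro!: linorder_injI simp: of_Z_less_iff less_imp_neq)
  have cB: "card (box (zip (\<delta> i) (take r ?y)) \<inter> std_tuples) = (\<Prod>j<r. nat (c ! j) choose (\<delta> i ! j))" if "i \<in> I" for i
  proof -
   have "card (box (zip (\<delta> i) (take r ?y)) \<inter> std_tuples) = (\<Prod>p\<leftarrow>?b i. nat (snd p) choose fst p)"
    unfolding B[OF that] card_image[OF inj] box_int_card(1) by (rule HOL.refl)
   also have "\<dots> = (\<Prod>j<r. nat (c ! j) choose (\<delta> i ! j))"
    unfolding prod.list_conv_set_nth using l[OF that] cY
    by (intro prod.cong) (auto simp: r_def)
   finally show ?thesis .
  qed
  have fB: "finite (box (zip (\<delta> i) (take r ?y)) \<inter> std_tuples)" if "i \<in> I" for i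
   unfolding B[OF that] using box_int_card(2) by blast
  show "finite ({x. ?y @ x \<in> S'} \<inter> std_tuples)"
   unfolding dsum_std_count(1)[OF D] using fin fB by (intro finite_SigmaI)
  have "mpoly_eval id (\<lambda>i. of_int (c ! i)) f = (\<Sum>i\<in>I. \<Prod>j<r. of_nat (nat (c ! j) choose (\<delta> i ! j)))"
   unfolding f_def rat_id.eval_sum rat_id.eval_prod
   by (intro sum.cong prod.cong HOL.refl bpoly_eval_rat) (use c0 in simp)
  also have "\<dots> = of_nat (card ({x. ?y @ x \<in> S'} \<inter> std_tuples))"
   unfolding dsum_std_count(2)[OF D] using fin fB cB by (simp add: card_SigmaI)
  finally show "of_nat (card ({x. ?y @ x \<in> S'} \<inter> std_tuples)) = mpoly_eval id (\<lambda>i. of_int (c ! i)) f" by simp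
 qed
 moreover have "es @ a \<in> Y" using W(2) pos by (auto simp: Y_def r_def nth_append)
 moreover have "X = {x. (es @ a) @ x \<in> S'}" using fS[of "es @ a"] S(2) by (simp add: r_def)
 moreover have "bsum I \<delta> es = mpoly_eval Sym_rat (symv (es @ a)) f"
  unfolding f_def bsum_def Sym_rat.eval_sum Sym_rat.eval_prod bpoly_eval_Sym r_def
  by (intro sum.cong prod.cong HOL.refl) (simp add: nth_append)
 ultimately show ?thesis unfolding is_hypercard_iff by blast
qed

section \<open>Saturation\<close>

text \<open>Without a finite subcover the conditions that a point lies in \<open>Y\<close> and in no
  \<open>W\<close> would be finitely satisfiable. A realization would lie in \<open>Y\<close> and
  outside the whole cover.\<close>

lemma saturated_compact:
 fixes A :: "'a::linordered_ab_group_add set" and \<kappa> :: "'k rel"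
 assumes \<kappa>: "Card_order \<kappa>" "saturated TYPE('a) (cardSuc \<kappa>)" and A: "|A| \<le>o \<kappa>"
 shows "compact_over A"
 unfolding compact_over_def
proof (intro allI impI)
 fix k and Y :: "'a list set" and Ws
 assume Y: "definable_over A k Y" and W: "\<forall>W\<in>Ws. definable_over A k W" and cov: "Y \<subseteq> \<Union>Ws"
 let ?co = "\<lambda>W :: 'a list set. {x. length x = k \<and> x \<notin> W}"
 \<comment> \<open>All formulas over \<open>A\<close> that define \<open>Y\<close> or the complement
   of a member are taken at once, which avoids choosing one for each set.\<close>
 define q where "q = {(p, c). set c \<subseteq> A \<and> fv p \<subseteq> {..<k + length c} \<and>
  (solutions k p c = Y \<or> (\<exists>W\<in>Ws. solutions k p c = ?co W))}"
 have AS: "|A| <o cardSuc \<kappa>" using A cardSuc_greater[OF \<kappa>(1)] by (rule ordLeq_ordLess_trans)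
 have co2: "?co (?co W) = W" if "W \<in> Ws" for W using W that definable_length by blast
 have qD: "\<exists>p c. (p, c) \<in> q \<and> solutions k p c = D"
  if D: "definable_over A k D" and D': "D = Y \<or> (\<exists>W\<in>Ws. D = ?co W)" for D
 proof -
  obtain p c where pc: "set c \<subseteq> A" "fv p \<subseteq> {..<k + length c}" "D = solutions k p c"
   using D unfolding definable_over_def by blast
  have "(p, c) \<in> q" unfolding q_def using pc(1,2) D' unfolding pc(3) by blast
  then show ?thesis using pc(3) by blast
 qed
 show "\<exists>W0\<subseteq>Ws. finite W0 \<and> Y \<subseteq> \<Union>W0"
 proof (rule ccontr)
  assume no: "\<not> (\<exists>W0\<subseteq>Ws. finite W0 \<and> Y \<subseteq> \<Union>W0)"
  have "\<exists>x. length x = k \<and> (\<forall>(p, c)\<in>q. x \<in> solutions k p c)"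
  proof (rule \<kappa>(2)[unfolded saturated_def, rule_format, OF AS])
   show "case x of (p, c) => set c \<subseteq> A \<and> fv p \<subseteq> {..<k + length c}" if "x \<in> q" for x
    using that unfolding q_def by blast
   fix q0 assume q0: "q0 \<subseteq> q" "finite q0"
   \<comment> \<open>The members whose complements are mentioned in the finite part
     \<open>q0\<close>.\<close>
   define W0 where "W0 = Ws \<inter> (\<lambda>pc. ?co (solutions k (fst pc) (snd pc))) ` q0"
   have "finite W0" unfolding W0_def using q0(2) by blast
   then have "\<not> Y \<subseteq> \<Union>W0" using no unfolding W0_def by blast
   then obtain x where x: "x \<in> Y" "x \<notin> \<Union>W0" by blast
   have lx: "length x = k" using definable_length[OF Y x(1)] .
   have "x \<in> solutions k p c" if pc: "(p, c) \<in> q0" for p c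
   proof -
    have "(p, c) \<in> q" using q0(1) pc by blast
    then consider "solutions k p c = Y" | W where "W \<in> Ws" "solutions k p c = ?co W"
     unfolding q_def by blast
    then show ?thesis
    proof cases
     case 2
     have "W = ?co (solutions k p c)" unfolding 2(2) using co2[OF 2(1)] by simp
     then have "W \<in> W0" unfolding W0_def using 2(1) pc by force
     then show ?thesis unfolding 2(2) using x(2) lx by blast
    qed (use x(1) in simp)
   qed
   then show "\<exists>x. length x = k \<and> (\<forall>(p, c)\<in>q0. x \<in> solutions k p c)" using lx by blast
  qed
  then obtain x where x: "length x = k" "\<forall>(p, c)\<in>q. x \<in> solutions k p c" by (elim exE conjE)
  have mem: "x \<in> D" if "definable_over A k D" "D = Y \<or> (\<exists>W\<in>Ws. D = ?co W)" for D
   using qD[OF that] x(2) by blast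
  have "x \<in> Y" by (rule mem[OF Y]) simp
  then obtain W where W1: "W \<in> Ws" "x \<in> W" using cov by blast
  have "definable_over A k (?co W)"
   by (rule definableI, rule Def_not, rule Def_mem[OF bspec[OF W W1(1)] Dfnl_vars])
  then have "x \<in> ?co W" by (rule mem) (use W1(1) in blast)
  then show False using W1(2) by blast
 qed
qed

lemma definable_bijection_iff:
 fixes X :: "'a::zgroup list set"
 assumes X: "definable_over UNIV n X" and X': "definable_over UNIV n' X'"
 shows "definable_bijection_exists n n' X X' \<longleftrightarrow> dbij UNIV n n' X X'"
proof
 assume "definable_bijection_exists n n' X X'"
 then obtain f where f: "bij_betw f X X'" "definable_over UNIV (n + n') {x @ f x | x. x \<in> X}"
  unfolding definable_bijection_exists_def by blast
 show "dbij UNIV n n' X X'"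
  unfolding dbij_def
 proof (rule dsumI[where h = "\<lambda>x. ((), f x)" and G = "\<lambda>_. {x @ f x | x. x \<in> X}"])
  show "bij_betw (\<lambda>x. ((), f x)) X (Sigma {()} (\<lambda>_. X'))"
   using f(1) by (auto simp: bij_betw_def inj_on_def)
  show "x @ z \<in> {x @ f x | x. x \<in> X} \<longleftrightarrow> x \<in> X \<and> ((), f x) = (i, z)"
   if "length x = n" for i x z
  proof
   assume "x @ z \<in> {x @ f x | x. x \<in> X}"
   then obtain x' where x': "x' \<in> X" "x @ z = x' @ f x'" by blast
   have "length x = length x'" using definable_length[OF X x'(1)] that by simp
   then have "x = x'" "z = f x'" using x'(2) by simp_all
   then show "x \<in> X \<and> ((), f x) = (i, z)" using x'(1) by simp
  next
   assume "x \<in> X \<and> ((), f x) = (i, z)"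
   then have "x \<in> X" "z = f x" by simp_all
   then show "x @ z \<in> {x @ f x | x. x \<in> X}" by blast
  qed
 qed (use f(2) definable_length[OF X] definable_length[OF X'] in auto)
next
 assume "dbij UNIV n n' X X'"
 then obtain h G where "dvia UNIV n X {()} (\<lambda>_. n') (\<lambda>_. X') h G" unfolding dbij_def by (rule dsum_dvia)
 note D = dviaD[OF this]
 have bij: "bij_betw (\<lambda>x. snd (h x)) X X'"
  using bij_betw_trans[OF D(4), of snd X'] by (simp add: bij_betw_def inj_on_def comp_def image_iff)
 have "w \<in> G () \<longleftrightarrow> w \<in> {x @ snd (h x) | x. x \<in> X}" for w
 proof
  assume w: "w \<in> G ()"
  have l: "length w = n + n'" using definable_length[OF D(5) w] by simp
  have "take n w \<in> X \<and> h (take n w) = ((), drop n w)"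
   using D(6)[of "()" "take n w" "drop n w"] w l by simp
  then show "w \<in> {x @ snd (h x) | x. x \<in> X}" by (intro CollectI exI[of _ "take n w"]) simp
 next
  assume "w \<in> {x @ snd (h x) | x. x \<in> X}"
  then obtain x where x: "x \<in> X" "w = x @ snd (h x)" by blast
  have "snd (h x) \<in> X'" using bij x(1) by (rule bij_betw_apply)
  then show "w \<in> G ()"
   using D(6)[of "()" x "snd (h x)"] D(2)[OF x(1)] definable_length[OF X'] x by (simp add: prod_eq_iff)
 qed
 then have "G () = {x @ snd (h x) | x. x \<in> X}" by blast
 then show "definable_bijection_exists n n' X X'"
  unfolding definable_bijection_exists_def using bij D(5)[of "()"] by (intro exI[of _ "\<lambda>x. snd (h x)"]) simp
qed

text \<open>By \<open>is_hypercard_dbij\<close> in both directions the predicates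
  \<open>is_hypercard\<close> of the two sets coincide, and hence the values of the description
  operator.\<close>

lemma hypercard_dbij:
 fixes X :: "'a::zgroup list set"
 assumes X: "definable_over UNIV n X" "definable_over UNIV n' X'" and d: "dbij UNIV n n' X X'"
 shows "hypercard n X = hypercard n' X'"
proof -
 have d': "dbij UNIV n' n X' X" by (rule dsum_dbij[OF dsum_self[OF X(2)] d[unfolded dbij_def]])
 have "is_hypercard n X u \<longleftrightarrow> is_hypercard n' X' u" for u
  using is_hypercard_dbij[OF X(2) d] is_hypercard_dbij[OF X(1) d'] by blast
 then have "is_hypercard n X = is_hypercard n' X'" by (rule ext)
 then show ?thesis unfolding hypercard_def by simp
qed

section \<open>Comparing sums of products of binomial coefficients\<close>

text \<open>Evaluating at the multi-index \<open>d\<close> itself, only multi-indices below \<open>d\<close> contribute, so that the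
 multiplicities agree by induction on the size of \<open>d\<close>.\<close>

lemma binomial_sums_eq:
 fixes \<delta> \<delta>' :: "'i => nat list"
 assumes fin: "finite I" "finite I'"
  and l: "\<And>i. i \<in> I ==> length (\<delta> i) = r" "\<And>i. i \<in> I' ==> length (\<delta>' i) = r"
  and eq: "\<And>q. length q = r ==>
   (\<Sum>i\<in>I. \<Prod>j<r. q ! j choose \<delta> i ! j) = (\<Sum>i\<in>I'. \<Prod>j<r. q ! j choose \<delta>' i ! j)"
 shows "length d = r ==> card {i \<in> I. \<delta> i = d} = card {i \<in> I'. \<delta>' i = d}"
proof (induction d rule: measure_induct_rule[where f = sum_list])
 case (less d)
 define P where "P e = (\<Prod>j<r. d ! j choose e ! j)" for e
 define D where "D = insert d (\<delta> ` I \<union> \<delta>' ` I')"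
 have D: "finite D" "\<And>e. e \<in> D ==> length e = r" "d \<in> D" using fin l less.prems by (auto simp: D_def)
 have grp: "(\<Sum>i\<in>J. P (f i)) = (\<Sum>e\<in>D. card {i \<in> J. f i = e} * P e)"
  if "finite J" "f ` J \<subseteq> D" for J and f :: "'i => nat list"
 proof -
  have "(\<Sum>i\<in>J. P (f i)) = (\<Sum>e\<in>D. \<Sum>i\<in>{i \<in> J. f i = e}. P (f i))"
   by (rule sum.group[symmetric, OF that(1) D(1) that(2)])
  also have "\<dots> = (\<Sum>e\<in>D. card {i \<in> J. f i = e} * P e)" by (intro sum.cong) simp_all
  finally show ?thesis .
 qed
 have small: "card {i \<in> I. \<delta> i = e} * P e = card {i \<in> I'. \<delta>' i = e} * P e" if e: "e \<in> D - {d}" for e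
 proof (cases "P e = 0")
  case False
  have le: "length e = r" using e D(2) by blast
  have "e ! j \<le> d ! j" if "j < r" for j
  proof (rule ccontr)
   assume "\<not> e ! j \<le> d ! j"
   then have "d ! j choose e ! j = 0" by (simp add: binomial_eq_0)
   then show False using False that unfolding P_def by auto
  qed
  moreover obtain j where "j < r" "e ! j \<noteq> d ! j"
   using e le less.prems by (metis DiffD2 insertI1 nth_equalityI)
  ultimately have "(\<Sum>j<r. e ! j) < (\<Sum>j<r. d ! j)"
   by (intro sum_strict_mono_ex1) (auto intro: le_neq_implies_less)
  then have "sum_list e < sum_list d"
   using le less.prems by (simp add: sum_list_sum_nth atLeast0LessThan)
  then show ?thesis using less.IH[OF _ le] by simp
 qed simp
 have ss: "(\<Sum>e\<in>D - {d}. card {i \<in> I. \<delta> i = e} * P e) = (\<Sum>e\<in>D - {d}. card {i \<in> I'. \<delta>' i = e} * P e)"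
  by (rule sum.cong[OF HOL.refl small])
 have gI: "(\<Sum>i\<in>I. P (\<delta> i)) = (\<Sum>e\<in>D. card {i \<in> I. \<delta> i = e} * P e)"
  by (rule grp[OF fin(1)]) (auto simp: D_def)
 have gI': "(\<Sum>i\<in>I'. P (\<delta>' i)) = (\<Sum>e\<in>D. card {i \<in> I'. \<delta>' i = e} * P e)"
  by (rule grp[OF fin(2)]) (auto simp: D_def)
 have "(\<Sum>e\<in>D. card {i \<in> I. \<delta> i = e} * P e) = (\<Sum>e\<in>D. card {i \<in> I'. \<delta>' i = e} * P e)"
  using eq[OF less.prems] unfolding P_def[symmetric] gI gI' .
 then have "card {i \<in> I. \<delta> i = d} * P d = card {i \<in> I'. \<delta>' i = d} * P d"
  using ss unfolding sum.remove[OF D(1,3)] by simp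
 then show ?case by (simp add: P_def)
qed

text \<open>Bijections between the sets of indices with equal label are chosen and put
  together.\<close>

lemma bij_of_fibre_cards:
 assumes fin: "finite I" "finite I'" and c: "\<And>d. card {i \<in> I. \<delta> i = d} = card {i \<in> I'. \<delta>' i = d}"
 shows "\<exists>\<phi>. bij_betw \<phi> I I' \<and> (\<forall>i\<in>I. \<delta>' (\<phi> i) = \<delta> i)"
proof -
 have "\<exists>f. bij_betw f {i \<in> I. \<delta> i = d} {i \<in> I'. \<delta>' i = d}" for d
  using c[of d] fin by (intro finite_same_card_bij) auto
 then have "\<forall>d. \<exists>f. bij_betw f {i \<in> I. \<delta> i = d} {i \<in> I'. \<delta>' i = d}" by blast
 from choice[OF this] obtain f where f0: "\<forall>d. bij_betw (f d) {i \<in> I. \<delta> i = d} {i \<in> I'. \<delta>' i = d}" by (rule exE)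
 then have f: "bij_betw (f d) {i \<in> I. \<delta> i = d} {i \<in> I'. \<delta>' i = d}" for d by (rule spec)
 define \<phi> where "\<phi> i = f (\<delta> i) i" for i
 have \<phi>: "\<phi> i \<in> I'" "\<delta>' (\<phi> i) = \<delta> i" if "i \<in> I" for i
  using bij_betw_apply[OF f, of i "\<delta> i"] that by (auto simp: \<phi>_def)
 have "inj_on \<phi> I"
 proof (rule inj_onI)
  fix i j assume ij: "i \<in> I" "j \<in> I" "\<phi> i = \<phi> j"
  then have "\<delta> i = \<delta> j" using \<phi>(2)[OF ij(1)] \<phi>(2)[OF ij(2)] by simp
  then show "i = j"
   using inj_onD[OF bij_betw_imp_inj_on[OF f[of "\<delta> i"]], of i j] ij by (simp add: \<phi>_def)
 qed
 moreover have "i \<in> \<phi> ` I" if i: "i \<in> I'" for i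
 proof -
  have "i \<in> f (\<delta>' i) ` {j \<in> I. \<delta> j = \<delta>' i}" using bij_betw_imp_surj_on[OF f[of "\<delta>' i"]] i by blast
  then obtain j where "j \<in> I" "\<delta> j = \<delta>' i" "i = f (\<delta>' i) j" by blast
  then show ?thesis by (auto simp: \<phi>_def intro!: image_eqI[of _ _ j])
 qed
 ultimately have "bij_betw \<phi> I I'" using \<phi>(1) by (auto simp: bij_betw_def)
 then show ?thesis using \<phi>(2) by (intro exI[of _ \<phi>] conjI ballI)
qed

text \<open>\<open>H\<close> is not assumed to be linear over the rationals; it maps the inverse of
  the factorial to the inverse because it preserves products, integers and 1.\<close>

lemma hom_sbinom:
 fixes H :: "'a::zgroup tensor_rat Sym => rat"
 assumes add: "\<And>x y. H (x + y) = H x + H y" and mult: "\<And>x y. H (x * y) = H x * H y"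
  and 0: "H 0 = 0" and 1: "H 1 = 1" and u: "H u = of_nat q"
 shows "H (sbinom u d) = of_nat (q choose d)"
proof -
 have nat: "H (of_nat n) = of_nat n" for n by (induction n) (simp_all add: add 0 1)
 have int: "H (of_int k) = of_int k" for k
 proof (cases k rule: int_cases2)
  case (nonpos n)
  have "H (of_int k + of_nat n) = 0" using nonpos by (simp add: 0)
  then show ?thesis unfolding add nat using nonpos by simp
 qed (simp add: nat)
 have prod: "H (\<Prod>t\<in>T. f t) = (\<Prod>t\<in>T. H (f t))" for T and f :: "nat => _"
  by (induction T rule: infinite_finite_induct) (simp_all add: mult 1)
 have "H (Sym_rat (1 / of_int (fact d)) * of_int (fact d)) = 1"
  by (subst Sym_rat_inverse) (simp_all only: 1 fact_nonzero not_False_eq_True)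
 then have "H (Sym_rat (1 / of_int (fact d))) = 1 / of_int (fact d)"
  unfolding mult int by (simp add: eq_divide_eq)
 then have "H (sbinom u d) = (1 / of_int (fact d)) * (\<Prod>t<d. of_nat q + of_int (- int t))"
  unfolding sbinom_def by (simp only: mult prod add int u)
 also have "\<dots> = of_nat q gchoose d" by (simp add: gbinomial_prod_rev atLeast0LessThan)
 finally show ?thesis by (simp add: binomial_gbinomial)
qed

text \<open>Independence together with \<open>zone\<close> yields a homomorphism to the rationals
  with any prescribed natural values on \<open>es\<close>. The one equation in \<open>Sym\<close>
  thus becomes an identity of binomial sums at every tuple \<open>q\<close> of naturals, to which
  \<open>binomial_sums_eq\<close> applies.\<close>

lemma bsum_eq_bij:
 fixes es :: "'a::zgroup list" and I I' :: "'i set"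
 assumes ind: "indep (set (zone # es))" "distinct (zone # es)" and fin: "finite I" "finite I'"
  and l: "\<And>i. i \<in> I ==> length (\<delta> i) = length es" "\<And>i. i \<in> I' ==> length (\<delta>' i) = length es"
  and eq: "bsum I \<delta> es = bsum I' \<delta>' es"
 shows "\<exists>\<phi>. bij_betw \<phi> I I' \<and> (\<forall>i\<in>I. \<delta>' (\<phi> i) = \<delta> i)"
proof -
 let ?r = "length es"
 have ev: "(\<Sum>i\<in>I. \<Prod>j<?r. q ! j choose \<delta> i ! j) = (\<Sum>i\<in>I'. \<Prod>j<?r. q ! j choose \<delta>' i ! j)"
  if q: "length q = ?r" for q
 proof -
  \<comment> \<open>The prescribed values as a function; the default 1 is the value at
    \<open>zone\<close>, which does not occur in \<open>es\<close>.\<close>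
  define qf where "qf e = (case map_of (zip es q) e of None => 1 :: rat | Some n => of_nat n)" for e
  have "map_of (zip es q) zone = None" using ind(2) q by (simp add: map_of_zip_is_None)
  then have q1: "qf zone = 1" by (simp add: qf_def)
  have q2: "qf (es ! j) = of_nat (q ! j)" if "j < ?r" for j
   using map_of_zip_nth[of es q j] ind(2) q that by (simp add: qf_def)
  show ?thesis
  proof (rule Sym_functional[of "set (zone # es)" qf, OF _ ind(1) _ q1])
   fix H :: "'a tensor_rat Sym => rat"
   assume H: "\<And>x y. H (x + y) = H x + H y" "\<And>x y. H (x * y) = H x * H y" "H 0 = 0" "H 1 = 1"
    "\<And>e. e \<in> set (zone # es) ==> H (Sym_elem e) = qf e"
   have sum: "H (\<Sum>i\<in>J. f i) = (\<Sum>i\<in>J. H (f i))" for J :: "'i set" and f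
    by (induction J rule: infinite_finite_induct) (simp_all add: H(1,3))
   have prod: "H (\<Prod>t\<in>T. f t) = (\<Prod>t\<in>T. H (f t))" for T and f :: "nat => _"
    by (induction T rule: infinite_finite_induct) (simp_all add: H(2,4))
   have sb: "H (sbinom (Sym_elem (es ! j)) d) = of_nat (q ! j choose d)" if "j < ?r" for j d
    by (rule hom_sbinom[of H, OF H(1) H(2) H(3) H(4)]) (use H(5)[of "es ! j"] q2[OF that] that in simp)
   have "of_nat (\<Sum>i\<in>I. \<Prod>j<?r. q ! j choose \<delta> i ! j) = H (bsum I \<delta> es)"
    unfolding bsum_def sum prod of_nat_sum of_nat_prod by (intro sum.cong prod.cong HOL.refl) (simp add: sb)
   also have "\<dots> = of_nat (\<Sum>i\<in>I'. \<Prod>j<?r. q ! j choose \<delta>' i ! j)"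
    unfolding eq unfolding bsum_def sum prod of_nat_sum of_nat_prod by (intro sum.cong prod.cong HOL.refl) (simp add: sb)
   finally show ?thesis by (simp only: of_nat_eq_iff)
  qed simp_all
 qed
 have "card {i \<in> I. \<delta> i = d} = card {i \<in> I'. \<delta>' i = d}" for d
 proof (cases "length d = ?r")
  case False
  then have "{i \<in> I. \<delta> i = d} = {}" "{i \<in> I'. \<delta>' i = d} = {}" using l by auto
  then show ?thesis by (simp only:)
 qed (rule binomial_sums_eq[OF fin l ev])
 then show ?thesis by (rule bij_of_fibre_cards[OF fin])
qed

section \<open>Families of bounded sets\<close>

lemma PF_bsum: "PF (length es + k) (\<lambda>v. \<Sum>i\<in>I. \<Prod>j<length es. sbinom (v j) (\<delta> i ! j))"
 unfolding sbinom_def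
 by (rule PF_sum, rule PF_prod, rule PF.mult[OF PF.const], rule PF_prod, rule PF.add[OF PF.var PF.const]) simp

text \<open>Equality of hyper-cardinalities is given at points over \<open>Z\<close> only, whereas
  \<open>b\<close> is arbitrary and the normal form at \<open>b\<close> has sides \<open>es\<close>
  that may lie outside \<open>Z\<close>. The tuple \<open>es @ b\<close> belongs to a
  \<open>Z\<close>-definable set \<open>E\<close> on which both decompositions persist. At its
  points over \<open>Z\<close> the two binomial sums agree, so they agree at \<open>es @ b\<close>
  by \<open>PF_vanish\<close>; then multiplicities agree by independence, and the bijection so
  obtained spreads to a definable set around \<open>b\<close>.\<close>

lemma local_bijection:
 fixes Z :: "'a::zgroup set"
 assumes compact: "\<And>A :: 'a set. finite A ==> compact_over A" and Z: "esub Z" and Y: "definable_over Z k Y"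
  and F: "definable_over Z (k + n) F" "definable_over Z (k + n') F'"
  and bd: "\<And>y. y \<in> Y ==> bounded_tuples {x. y @ x \<in> F}" "\<And>y. y \<in> Y ==> bounded_tuples {x. y @ x \<in> F'}"
  and eq: "\<And>y. y \<in> Y ==> set y \<subseteq> Z ==> hypercard n {x. y @ x \<in> F} = hypercard n' {x. y @ x \<in> F'}"
  and b: "b \<in> Y"
 shows "\<exists>W G. definable_over Z k W \<and> b \<in> W \<and> definable_over Z (k + (n + n')) G \<and>
  (\<forall>y\<in>W. is_graph n {x. y @ x \<in> F} {()} (\<lambda>_. n') (\<lambda>_. {z. y @ z \<in> F'}) (\<lambda>_. {w. y @ w \<in> G}))"
proof -
 let ?X = "\<lambda>y. {x. y @ x \<in> F}" and ?X' = "\<lambda>y. {x. y @ x \<in> F'}"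
 have lb: "length b = k" by (rule definable_length[OF Y b])
 have dX: "definable_over A n (?X y)" "definable_over A n' (?X' y)" if "length y = k" "Z \<union> set y \<subseteq> A" for y A
  using definable_fibre[OF definable_mono[OF F(1)] that(1), of A]
   definable_fibre[OF definable_mono[OF F(2)] that(1), of A] that(2) by auto
 obtain a1 a2 where a: "set a1 \<subseteq> Z \<union> set b" "definable_over (set a1) n (?X b)"
  "set a2 \<subseteq> Z \<union> set b" "definable_over (set a2) n' (?X' b)"
  using definable_params[OF dX(1)[OF lb order_refl]] definable_params[OF dX(2)[OF lb order_refl]] by (elim exE conjE)
 \<comment> \<open>Finitely many parameters that define both fibres; \<open>bounded_boxy\<close>
   works over finite sets.\<close>
 define A where "A = set a1 \<union> set a2"
 have A: "finite A" "A \<subseteq> Z \<union> set b" using a by (auto simp: A_def)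
 have bx: "boxy A n (?X b)"
  by (rule bounded_boxy[OF compact A(1) definable_mono[OF a(2)] bd(1)[OF b]]) (simp_all add: A_def)
 have bx': "boxy A n' (?X' b)"
  by (rule bounded_boxy[OF compact A(1) definable_mono[OF a(4)] bd(2)[OF b]]) (simp_all add: A_def)
 obtain es where es: "pbasis A (set (zone # es))" "distinct (zone # es)" "nform A es n (?X b)" "nform A es n' (?X' b)"
  by (rule common_normal_form[OF bx bx'])
 have pos: "0 \<le> e" if "e \<in> set es" for e
  using es(1) that unfolding pbasis_def by (simp add: less_imp_le)
 have ind: "indep (set (zone # es))" using es(1) unfolding pbasis_def by (elim conjE)
 let ?m = "\<lambda>\<delta> es i. bdim (zip (\<delta> i) es)" and ?B = "\<lambda>\<delta> es i. box (zip (\<delta> i) (es :: 'a list)) :: 'a list set"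
 from es(3)[unfolded nform_def] obtain I :: "nat set" and \<delta> where
  I: "\<forall>i\<in>I. length (\<delta> i) = length es" "dsum A n (?X b) I (?m \<delta> es) (?B \<delta> es)" by (elim exE conjE)
 from es(4)[unfolded nform_def] obtain I' :: "nat set" and \<delta>' where
  I': "\<forall>i\<in>I'. length (\<delta>' i) = length es" "dsum A n' (?X' b) I' (?m \<delta>' es) (?B \<delta>' es)" by (elim exE conjE)
 have fin: "finite I" "finite I'" using I(2) I'(2) by (simp_all add: dsum_def)
 let ?r = "length es"
 have sub: "A \<subseteq> Z \<union> set (es @ b)" using A(2) by auto
 have "\<exists>W. definable_over Z (?r + k) W \<and> es @ b \<in> W \<and> (\<forall>y A. y \<in> W --> Z \<union> set y \<subseteq> A -->
  dsum A n (?X (drop ?r y)) I (?m \<delta> (take ?r y)) (?B \<delta> (take ?r y)))"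
  by (rule dsum_box_spread[OF F(1) lb I(1)[rule_format] dsum_mono[OF I(2) sub]])
 then obtain W where
  W: "definable_over Z (?r + k) W" "es @ b \<in> W"
  "\<forall>y A. y \<in> W --> Z \<union> set y \<subseteq> A --> dsum A n (?X (drop ?r y)) I (?m \<delta> (take ?r y)) (?B \<delta> (take ?r y))"
  by (elim exE conjE)
 have "\<exists>W. definable_over Z (?r + k) W \<and> es @ b \<in> W \<and> (\<forall>y A. y \<in> W --> Z \<union> set y \<subseteq> A -->
  dsum A n' (?X' (drop ?r y)) I' (?m \<delta>' (take ?r y)) (?B \<delta>' (take ?r y)))"
  by (rule dsum_box_spread[OF F(2) lb I'(1)[rule_format] dsum_mono[OF I'(2) sub]])
 then obtain W' where
  W': "definable_over Z (?r + k) W'" "es @ b \<in> W'"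
  "\<forall>y A. y \<in> W' --> Z \<union> set y \<subseteq> A --> dsum A n' (?X' (drop ?r y)) I' (?m \<delta>' (take ?r y)) (?B \<delta>' (take ?r y))"
  by (elim exE conjE)
 \<comment> \<open>The signs of the sides are part of the condition, as
   \<open>is_hypercard_dsum\<close> assumes nonnegative sides.\<close>
 define E where "E = {w. length w = ?r + k \<and> (w \<in> W \<and> w \<in> W' \<and> drop ?r w \<in> Y \<and> (\<forall>j<?r. 0 \<le> w ! j))}"
 have E: "definable_over Z (?r + k) E" unfolding E_def
 proof (rule definableI, intro Def_conj Def_all_less)
  show "Def Z (\<lambda>v. map v [0..<?r + k] \<in> W)" by (rule Def_mem[OF W(1) Dfnl_vars])
  show "Def Z (\<lambda>v. map v [0..<?r + k] \<in> W')" by (rule Def_mem[OF W'(1) Dfnl_vars])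
  show "Def Z (\<lambda>v. drop ?r (map v [0..<?r + k]) \<in> Y)" by (rule Def_mem[OF Y Dfnl_drop[OF Dfnl_vars]])
  show "Def Z (\<lambda>v. 0 \<le> map v [0..<?r + k] ! j)" if "j < ?r" for j
   using Def_le[OF Dfn_zero Dfn_var[of Z j]] that by simp
 qed
 let ?p = "\<lambda>v. \<Sum>i\<in>I. \<Prod>j<?r. sbinom (v j) (\<delta> i ! j)" and ?p' = "\<lambda>v. \<Sum>i\<in>I'. \<Prod>j<?r. sbinom (v j) (\<delta>' i ! j)"
 have "?p (symv (es @ b)) - ?p' (symv (es @ b)) = 0"
 proof (rule PF_vanish[OF Z PF_diff[OF PF_bsum PF_bsum] E])
  show "es @ b \<in> E" using W(2) W'(2) b lb pos by (auto simp: E_def nth_append)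
  fix w assume w: "w \<in> E" "set w \<subseteq> Z"
  let ?y = "drop ?r w" and ?e = "take ?r w"
  have wD: "length w = ?r + k" "w \<in> W" "w \<in> W'" "?y \<in> Y" "\<forall>j<?r. 0 \<le> w ! j" using w(1) by (simp_all add: E_def)
  have le: "length ?e = ?r" "length ?y = k" using wD(1) by simp_all
  have pe: "0 \<le> e" if "e \<in> set ?e" for e
   using that wD(5) le(1) by (auto simp: in_set_conv_nth)
  have sv: "bsum J d ?e = (\<Sum>i\<in>J. \<Prod>j<?r. sbinom (symv w j) (d i ! j))" for J :: "nat set" and d
   unfolding bsum_def le(1) by (intro sum.cong prod.cong HOL.refl) simp
  have "is_hypercard n (?X ?y) (bsum I \<delta> ?e)"
   by (rule is_hypercard_dsum[OF dX(1)[OF le(2) subset_UNIV] W(3)[rule_format, OF wD(2) subset_UNIV]])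
    (use I(1) le(1) pe in auto)
  moreover have "is_hypercard n' (?X' ?y) (bsum I' \<delta>' ?e)"
   by (rule is_hypercard_dsum[OF dX(2)[OF le(2) subset_UNIV] W'(3)[rule_format, OF wD(3) subset_UNIV]])
    (use I'(1) le(1) pe in auto)
  moreover have "hypercard n (?X ?y) = hypercard n' (?X' ?y)"
   by (rule eq[OF wD(4)]) (use w(2) in \<open>auto dest: in_set_dropD\<close>)
  ultimately have "bsum I \<delta> ?e = bsum I' \<delta>' ?e" by (simp only: hypercard_eq)
  then show "?p (symv w) - ?p' (symv w) = 0" unfolding sv by simp
 qed
 moreover have "bsum J d es = (\<Sum>i\<in>J. \<Prod>j<?r. sbinom (symv (es @ b) j) (d i ! j))" for J :: "nat set" and d
  unfolding bsum_def by (intro sum.cong prod.cong HOL.refl) (simp add: nth_append)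
 ultimately have bs: "bsum I \<delta> es = bsum I' \<delta>' es" by simp
 have "\<exists>\<phi>. bij_betw \<phi> I I' \<and> (\<forall>i\<in>I. \<delta>' (\<phi> i) = \<delta> i)"
  by (rule bsum_eq_bij[OF ind es(2) fin I(1)[rule_format] I'(1)[rule_format] bs])
 then obtain \<phi> where \<phi>: "bij_betw \<phi> I I'" "\<forall>i\<in>I. \<delta>' (\<phi> i) = \<delta> i" by (elim exE conjE)
 \<comment> \<open>Reindexing by \<open>\<phi>\<close> gives both fibres the same pieces. The
   bijection is defined over \<open>A\<close>, hence over \<open>Z\<close> and \<open>b\<close>; the
   sides \<open>es\<close> no longer occur among its parameters.\<close>
 have "dsum A n' (?X' b) I (?m \<delta> es) (?B \<delta> es)"
  by (rule dsum_cong[OF dsum_reindex[OF I'(2) \<phi>(1)]]) (simp_all add: \<phi>(2))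
 from dsum_dbij[OF I(2) this]
 have "dsum (Z \<union> set b) n (?X b) {()} (\<lambda>_. n') (\<lambda>_. ?X' b)" unfolding dbij_def by (rule dsum_mono[OF _ A(2)])
 from dsum_uniform_ex[where T = "\<lambda>_. F'" and m = "\<lambda>_. n'", OF F(1) F(2) lb this]
 obtain W G where WG: "definable_over Z k W" "b \<in> W" "\<forall>i\<in>{()}. definable_over Z (k + (n + n')) (G i)"
  "\<forall>y\<in>W. is_graph n (?X y) {()} (\<lambda>_. n') (\<lambda>_. ?X' y) (\<lambda>i. {w. y @ w \<in> G i})" by (elim exE conjE)
 have "(\<lambda>i :: unit. {w. y @ w \<in> G i}) = (\<lambda>_. {w. y @ w \<in> G ()})" for y by (rule ext) simp
 then show ?thesis using WG by (intro exI[of _ W] exI[of _ "G ()"]) simp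
qed

text \<open>Where the covering sets overlap, the graph that belongs to the set added last is
  used.\<close>

lemma glue_graphs:
 fixes Z :: "'a::zgroup set"
 assumes "finite Ws"
  and "\<And>W. W \<in> Ws ==> definable_over Z k W \<and> (\<exists>G. definable_over Z (k + m) G \<and> (\<forall>y\<in>W. P y {w. y @ w \<in> G}))"
 shows "\<exists>G. definable_over Z (k + m) G \<and> (\<forall>y\<in>\<Union>Ws. P y {w. y @ w \<in> G})"
 using assms
proof (induction Ws rule: finite_induct)
 case empty
 have "definable_over Z (k + m) {w. length w = k + m \<and> False}" by (rule definableI[OF Def_const])
 then show ?case by blast
next
 case (insert W Ws)
 obtain G where G: "definable_over Z (k + m) G" "\<forall>y\<in>\<Union>Ws. P y {w. y @ w \<in> G}"
  using insert.IH insert.prems by auto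
 obtain H where W: "definable_over Z k W" and H: "definable_over Z (k + m) H" "\<forall>y\<in>W. P y {w. y @ w \<in> H}"
  using insert.prems[of W] by auto
 let ?K = "{w. length w = k + m \<and> (if take k w \<in> W then w \<in> H else w \<in> G)}"
 have "definable_over Z (k + m) ?K"
 proof (rule definableI)
  have t: "Def Z (\<lambda>v. take k (map v [0..<k + m]) \<in> W)" by (rule Def_mem[OF W Dfnl_take[OF Dfnl_vars]])
  have "Def Z (\<lambda>v. (take k (map v [0..<k + m]) \<in> W \<and> map v [0..<k + m] \<in> H) \<or>
   (take k (map v [0..<k + m]) \<notin> W \<and> map v [0..<k + m] \<in> G))"
   by (intro Def_disj Def_conj Def_not t Def_mem[OF H(1) Dfnl_vars] Def_mem[OF G(1) Dfnl_vars])
  then show "Def Z (\<lambda>v. if take k (map v [0..<k + m]) \<in> W then map v [0..<k + m] \<in> H else map v [0..<k + m] \<in> G)"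
   by (rule iffD1[OF Def_cong, rotated]) auto
 qed
 moreover have "P y {w. y @ w \<in> ?K}" if y: "y \<in> W \<or> y \<in> \<Union>Ws" "length y = k" for y
 proof -
  have lenH: "length w = m" if "y @ w \<in> H" for w using definable_length[OF H(1) that] y(2) by simp
  have lenG: "length w = m" if "y @ w \<in> G" for w using definable_length[OF G(1) that] y(2) by simp
  show ?thesis
 proof (cases "y \<in> W")
  case True
  have "{w. y @ w \<in> ?K} = {w. y @ w \<in> H}" using True y(2) lenH by auto
  then show ?thesis using H(2) True by simp
 next
  case False
  have "{w. y @ w \<in> ?K} = {w. y @ w \<in> G}" using False y(2) lenG by auto
  then show ?thesis using G(2) False y(1) by auto
 qed
 qed
 moreover have "length y = k" if yV: "y \<in> \<Union>(insert W Ws)" for y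
 proof -
  obtain V where V: "V \<in> insert W Ws" "y \<in> V" using yV by (rule UnionE)
  show ?thesis by (rule definable_length[OF conjunct1[OF insert.prems[OF V(1)]] V(2)])
 qed
 ultimately have "\<forall>y\<in>\<Union>(insert W Ws). P y {w. y @ w \<in> ?K}" by simp
 with \<open>definable_over Z (k + m) ?K\<close> show ?case by (intro exI[of _ ?K] conjI)
qed

text \<open>The functions are read off fibre by fibre. The graph is cut down to \<open>Y\<close>,
  since a glued graph may have points over other parameters.\<close>

lemma family_of_graph:
 fixes Z :: "'a::zgroup set"
 assumes Y: "definable_over Z k Y" and G: "definable_over Z (k + (n + n')) G"
  and X: "\<And>y x. y \<in> Y ==> x \<in> X y ==> length x = n" "\<And>y x. y \<in> Y ==> x \<in> X' y ==> length x = n'"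
  and g: "\<And>y. y \<in> Y ==> is_graph n (X y) {()} (\<lambda>_. n') (\<lambda>_. X' y) (\<lambda>_. {w. y @ w \<in> G})"
 shows "definable_bijection_family_exists k n n' Y X X'"
proof -
 have "\<forall>y\<in>Y. \<exists>f. bij_betw f (X y) (X' y) \<and> (\<forall>x z. length x = n --> length z = n' -->
  (y @ x @ z \<in> G \<longleftrightarrow> x \<in> X y \<and> f x = z))"
 proof
  fix y assume y: "y \<in> Y"
  show "\<exists>f. bij_betw f (X y) (X' y) \<and> (\<forall>x z. length x = n --> length z = n' -->
   (y @ x @ z \<in> G \<longleftrightarrow> x \<in> X y \<and> f x = z))"
  proof (rule is_graph_bij[OF X(1)[OF y] X(2)[OF y] g[OF y]])
  fix h assume h: "bij_betw h (X y) (Sigma {()} (\<lambda>_. X' y))"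
   "\<And>i x z. i \<in> {()} ==> length x = n ==> length z = n' ==> x @ z \<in> {w. y @ w \<in> G} \<longleftrightarrow> x \<in> X y \<and> h x = (i, z)"
  have "bij_betw (\<lambda>x. snd (h x)) (X y) (X' y)"
   using bij_betw_trans[OF h(1), of snd "X' y"] by (simp add: bij_betw_def inj_on_def comp_def image_iff)
  moreover have "y @ x @ z \<in> G \<longleftrightarrow> x \<in> X y \<and> snd (h x) = z" if "length x = n" "length z = n'" for x z
   using h(2)[of "()" x z] that by (simp add: prod_eq_iff)
  ultimately show "\<exists>f. bij_betw f (X y) (X' y) \<and> (\<forall>x z. length x = n --> length z = n' -->
   (y @ x @ z \<in> G \<longleftrightarrow> x \<in> X y \<and> f x = z))" by (intro exI[of _ "\<lambda>x. snd (h x)"]) simp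
  qed
 qed
 from bchoice[OF this] obtain f where f: "\<forall>y\<in>Y. bij_betw (f y) (X y) (X' y) \<and> (\<forall>x z. length x = n -->
  length z = n' --> (y @ x @ z \<in> G \<longleftrightarrow> x \<in> X y \<and> f y x = z))" by (rule exE)
 have fX: "f y x \<in> X' y" if "y \<in> Y" "x \<in> X y" for y x
  using f that by (blast intro: bij_betw_apply)
 let ?L = "{w. length w = k + (n + n') \<and> (take k w \<in> Y \<and> w \<in> G)}"
 have "definable_over Z (k + (n + n')) ?L"
  by (rule definableI, rule Def_conj, rule Def_mem[OF Y Dfnl_take[OF Dfnl_vars]], rule Def_mem[OF G Dfnl_vars])
 moreover have "?L = {y @ x @ f y x | y x. y \<in> Y \<and> x \<in> X y}"
 proof (intro set_eqI iffI)
  fix w assume w: "w \<in> ?L"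
  define y x z where "y = take k w" and "x = take n (drop k w)" and "z = drop n (drop k w)"
  have e: "w = y @ x @ z" by (simp only: y_def x_def z_def append_take_drop_id)
  have l: "length x = n" "length z = n'" "y \<in> Y" using w by (simp_all add: y_def x_def z_def)
  have "y @ x @ z \<in> G" using w e by simp
  then have "x \<in> X y \<and> f y x = z" using f l by blast
  then show "w \<in> {y @ x @ f y x | y x. y \<in> Y \<and> x \<in> X y}" using e l(3) by blast
 next
  fix w assume "w \<in> {y @ x @ f y x | y x. y \<in> Y \<and> x \<in> X y}"
  then obtain y x where w: "w = y @ x @ f y x" "y \<in> Y" "x \<in> X y" by blast
  have l: "length y = k" "length x = n" "length (f y x) = n'"
   using definable_length[OF Y w(2)] X(1)[OF w(2,3)] X(2)[OF w(2) fX[OF w(2,3)]] by simp_all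
  have "w \<in> G" unfolding w(1) using f w(2,3) l by blast
  then show "w \<in> ?L" using w l by simp
 qed
 ultimately have "definable_over UNIV (k + n + n') {y @ x @ f y x | y x. y \<in> Y \<and> x \<in> X y}"
  using definable_mono[of Z "k + (n + n')" ?L UNIV] by (simp add: add.assoc)
 then show ?thesis unfolding definable_bijection_family_exists_def using f by blast
qed

text \<open>The implications are (2) to (5) by \<open>local_bijection\<close>, compactness over
  \<open>Z\<close> and gluing; (5) to (3) by taking fibres; (1) to (2) and (3) to (4) since
  definable bijections preserve hyper-cardinality; (3) to (1) and (4) to (2) by restriction to the
  points over \<open>Z\<close>.\<close>

theorem theorem5p9:
  fixes Z :: "'a::zgroup set"
    and \<kappa> :: "'k rel"
    and k n n' :: nat
    and Y :: "'a list set"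
    and X X' :: "'a list \<Rightarrow> 'a list set"
  assumes "elementary_embedding (UNIV :: int set) Z of_Z"
    and "elementary_embedding Z (UNIV :: 'a set) id"
    and "Card_order \<kappa>"
    and "|Z| \<le>o \<kappa>"
    and "saturated TYPE('a) (cardSuc \<kappa>)"
    and "definable_over Z k Y"
    and "definable_family_over Z k n Y X"
    and "definable_family_over Z k n' Y X'"
    and "\<And>b. b \<in> Y \<Longrightarrow> bounded_tuples (X b)"
    and "\<And>b. b \<in> Y \<Longrightarrow> bounded_tuples (X' b)"
  shows "let
      c1 = (\<forall>b\<in>Y. set b \<subseteq> Z \<longrightarrow> definable_bijection_exists n n' (X b) (X' b));
      c2 = (\<forall>b\<in>Y. set b \<subseteq> Z \<longrightarrow> hypercard n (X b) = hypercard n' (X' b));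
      c3 = (\<forall>b\<in>Y. definable_bijection_exists n n' (X b) (X' b));
      c4 = (\<forall>b\<in>Y. hypercard n (X b) = hypercard n' (X' b));
      c5 = definable_bijection_family_exists k n n' Y X X'
    in (c1 \<longleftrightarrow> c2) \<and> (c2 \<longleftrightarrow> c3) \<and> (c3 \<longleftrightarrow> c4) \<and> (c4 \<longleftrightarrow> c5)"
proof -
 note Y = assms(6)
 have Z: "esub Z" using esub_elementary[OF assms(2)] by simp
 \<comment> \<open>\<open>Z\<close> contains the integers and is infinite, so the cardinal bound on
   \<open>Z\<close> covers every finite set of parameters, and saturation gives compactness over
   it.\<close>
 have "inj (of_Z :: int => 'a)" by (rule linorder_injI) (simp add: of_Z_less_iff less_imp_neq)
 then have "infinite (range (of_Z :: int => 'a))" using finite_imageD infinite_UNIV_int by blast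
 moreover have "range of_Z \<subseteq> Z" using assms(1) unfolding elementary_embedding_def by (elim conjE)
 ultimately have infZ: "infinite Z" using finite_subset by blast
 have compact: "compact_over A" if "finite A" for A :: "'a set"
  by (rule saturated_compact[OF assms(3,5) ordLeq_transitive[OF ordLess_imp_ordLeq[OF
    finite_ordLess_infinite] assms(4)]]) (use that infZ in "simp_all add: card_of_well_order_on Field_card_of")
 have compactZ: "compact_over Z" by (rule saturated_compact[OF assms(3,5,4)])
 define F where "F = {y @ x | y x. y \<in> Y \<and> x \<in> X y}"
 define F' where "F' = {y @ x | y x. y \<in> Y \<and> x \<in> X' y}"
 have F: "definable_over Z (k + n) F" "definable_over Z (k + n') F'"
  using assms(7,8) unfolding definable_family_over_def F_def F'_def by blast+
 have lX: "length x = n" if "y \<in> Y" "x \<in> X y" for y x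
  using assms(7) that unfolding definable_family_over_def by blast
 have lX': "length x = n'" if "y \<in> Y" "x \<in> X' y" for y x
  using assms(8) that unfolding definable_family_over_def by blast
 have ly: "length y = k" if "y \<in> Y" for y by (rule definable_length[OF Y that])
 have fib: "{x. y @ x \<in> F} = X y" "{x. y @ x \<in> F'} = X' y" if "y \<in> Y" for y
  using that ly by (auto simp: F_def F'_def)
 have dX: "definable_over UNIV n (X y)" "definable_over UNIV n' (X' y)" if "y \<in> Y" for y
  using definable_fibre[OF definable_mono[OF F(1) subset_UNIV] ly[OF that] subset_UNIV]
   definable_fibre[OF definable_mono[OF F(2) subset_UNIV] ly[OF that] subset_UNIV]
  unfolding fib[OF that] by auto
 have hyp: "hypercard n (X b) = hypercard n' (X' b)"
  if "b \<in> Y" "definable_bijection_exists n n' (X b) (X' b)" for b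
  using hypercard_dbij[OF dX[OF that(1)]] definable_bijection_iff[OF dX[OF that(1)]] that(2) by blast
 have c53: "\<forall>b\<in>Y. definable_bijection_exists n n' (X b) (X' b)"
  if c5: "definable_bijection_family_exists k n n' Y X X'"
 proof
  fix b assume b: "b \<in> Y"
  obtain f where f: "\<forall>y\<in>Y. bij_betw (f y) (X y) (X' y)"
   "definable_over UNIV (k + n + n') {y @ x @ f y x | y x. y \<in> Y \<and> x \<in> X y}"
   using c5 unfolding definable_bijection_family_exists_def by (elim exE conjE)
  have "definable_over UNIV (n + n') {w. b @ w \<in> {y @ x @ f y x | y x. y \<in> Y \<and> x \<in> X y}}"
   by (rule definable_fibre[OF f(2)[unfolded add.assoc] ly[OF b] subset_UNIV])
  moreover have "{w. b @ w \<in> {y @ x @ f y x | y x. y \<in> Y \<and> x \<in> X y}} = {x @ f b x | x. x \<in> X b}"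
  proof (intro set_eqI iffI)
   fix w assume "w \<in> {w. b @ w \<in> {y @ x @ f y x | y x. y \<in> Y \<and> x \<in> X y}}"
   then obtain y x where yx: "b @ w = y @ x @ f y x" "y \<in> Y" "x \<in> X y" by blast
   have "length b = length y" using ly[OF b] ly[OF yx(2)] by simp
   then have "b = y" "w = x @ f y x" using yx(1) by simp_all
   then show "w \<in> {x @ f b x | x. x \<in> X b}" using yx(3) by blast
  next
   fix w assume "w \<in> {x @ f b x | x. x \<in> X b}"
   then show "w \<in> {w. b @ w \<in> {y @ x @ f y x | y x. y \<in> Y \<and> x \<in> X y}}" using b by blast
  qed
  ultimately show "definable_bijection_exists n n' (X b) (X' b)"
   unfolding definable_bijection_exists_def using bspec[OF f(1) b] by (intro exI[of _ "f b"]) simp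
 qed
 have c25: "definable_bijection_family_exists k n n' Y X X'"
  if c2: "\<forall>b\<in>Y. set b \<subseteq> Z --> hypercard n (X b) = hypercard n' (X' b)"
 proof -
  let ?P = "\<lambda>y K. is_graph n {x. y @ x \<in> F} {()} (\<lambda>_. n') (\<lambda>_. {z. y @ z \<in> F'}) (\<lambda>_. K)"
  let ?W = "{W. definable_over Z k W \<and> (\<exists>G. definable_over Z (k + (n + n')) G \<and> (\<forall>y\<in>W. ?P y {w. y @ w \<in> G}))}"
  have cov: "Y \<subseteq> \<Union>?W"
  proof
   fix b assume b: "b \<in> Y"
   have "\<exists>W G. definable_over Z k W \<and> b \<in> W \<and> definable_over Z (k + (n + n')) G \<and> (\<forall>y\<in>W. ?P y {w. y @ w \<in> G})"
    by (rule local_bijection[OF compact Z Y F _ _ _ b]) (use fib assms(9,10) c2 in auto)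
   then obtain W G where W: "definable_over Z k W" "b \<in> W" "definable_over Z (k + (n + n')) G"
    "\<forall>y\<in>W. ?P y {w. y @ w \<in> G}" by (elim exE conjE)
   have "W \<in> ?W" using W(1,3,4) by (intro CollectI conjI exI[of _ G])
   then show "b \<in> \<Union>?W" using W(2) by (rule UnionI)
  qed
  have defs: "definable_over Z k W" if "W \<in> ?W" for W using that by (elim CollectE conjE)
  obtain Ws where Ws: "Ws \<subseteq> ?W" "finite Ws" "Y \<subseteq> \<Union>Ws"
   by (rule compact_overD[OF compactZ Y defs cov])
  have "\<exists>G. definable_over Z (k + (n + n')) G \<and> (\<forall>y\<in>\<Union>Ws. ?P y {w. y @ w \<in> G})"
  proof (rule glue_graphs[where P = ?P, OF Ws(2)])
   fix W assume "W \<in> Ws"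
   from subsetD[OF Ws(1) this] show "definable_over Z k W \<and>
    (\<exists>G. definable_over Z (k + (n + n')) G \<and> (\<forall>y\<in>W. ?P y {w. y @ w \<in> G}))" by (rule CollectD)
  qed
  then obtain G where G: "definable_over Z (k + (n + n')) G" "\<forall>y\<in>\<Union>Ws. ?P y {w. y @ w \<in> G}" by (elim exE conjE)
  show ?thesis
  proof (rule family_of_graph[OF Y G(1) lX lX'])
   show "is_graph n (X y) {()} (\<lambda>_. n') (\<lambda>_. X' y) (\<lambda>_. {w. y @ w \<in> G})" if y: "y \<in> Y" for y
    using bspec[OF G(2) subsetD[OF Ws(3) y]] unfolding fib[OF y] .
  qed
 qed
 show ?thesis
  unfolding Let_def using hyp c53 c25 by blast
qed

end
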